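(* Let $(X,\nu)$ be a standard Borel space with a continuous finite measure $\nu$, and let $\eta$ be a (homogeneous) Lévy process on $(X,\nu)$ with Lévy measure $\Pi$. Then the Hilbert factorization over $(X,\nu)$ determined by $\eta$ in $L^2(\eta)$ is a homogeneous Fock factorization (up to isomorphism of Hilbert factorizations), and its dimension is equal to the number of points in $\operatorname{supp}\Pi$.
   Context: Lévy process (process with independent values) on $(X,\nu)$: a generalized random process $a\mapsto\langle a,\cdot\rangle$ on the space of bounded measurable functions on $X$ (mod 0 classes) such that $\langle a_1,\cdot\rangle,\langle a_2,\cdot\rangle$ are independent whenever $a_1a_2=0$ a.e. It is homogeneous if it is invariant under measure-preserving transformations of $(X,\nu)$. A homogeneous one has $\mathbb E e^{i\langle a,\cdot\rangle}=\exp\int_X\log\phi(a(x))\,d\nu(x)$ with $\log\phi(y)=icy-\frac{\sigma^2y^2}2+\int_{\mathbb R}\big(e^{ity}-1-\frac{ity}{1+t^2}\big)d\Pi(t)$, where $c\in\mathbb R$ (drift), $\sigma^2\ge0$ (Gaussian variance), and the Lévy (Lévy–Khintchin) measure $\Pi$ is a Borel measure on $\mathbb R$ with $\Pi(\{0\})=0$ and $\int_{\mathbb R}\frac{t^2}{1+t^2}d\Pi(t)<\infty$. Convention for the Gaussian case: there $\Pi$ is thought of as concentrated at the point $0$ (so that its support is one point). Hilbert factorization over $(X,\nu)$: a map $\xi$ from the Boolean algebra of mod 0 classes of measurable subsets of $X$ to von Neumann algebras on a Hilbert space $\mathcal H$ such that each $\xi(A)$ is a type I factor, $\xi(A_1\cap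 A_2)=\xi(A_1)\cap\xi(A_2)$, $\xi(A_1\cup A_2)=(\xi(A_1)\cup\xi(A_2))''$, $\xi(X\setminus A)=\xi(A)'$, $\xi(\emptyset)=\mathbb C\cdot\mathrm{Id}$, $\xi(X)=\mathcal B(\mathcal H)$. Two Hilbert factorizations $(\mathcal H_1,\xi_1)$, $(\mathcal H_2,\xi_2)$ over Boolean algebras $\mathcal A_1,\mathcal A_2$ are isomorphic if there are an isomorphism $S:\mathcal A_1\to\mathcal A_2$ and a surjective linear isometry $T:\mathcal H_1\to\mathcal H_2$ with $T\xi_1(A)T^{-1}=\xi_2(SA)$ for all $A$. The factorization determined by $\eta$: $\mathcal H=L^2(\eta)$ (the square integrable functionals of $\eta$), $\xi_\eta(A)=\mathcal B(H_A)\otimes1_{H_{X\setminus A}}$, where $H_A$ is the set of square integrable functionals depending only on the restriction of $\eta$ to $A$, and $1_H$ is the algebra of scalar operators on $H$. Homogeneous Fock factorization of dimension $n\in\{1,2,\dots,\infty\}$: $\mathcal H=\mathrm{EXP}\,L^2((X,\nu);H)$, where $H$ is a Hilbert space of dimension $n$, $L^2((X,\nu);H)$ is the space of square integrable $H$-valued functions on $(X,\nu)$, $\mathrm{EXP}\,K=\bigoplus_{m\ge0}S^mK$ is the boson (symmetric) Fock space over the Hilbert space $K$, and $\xi(A)=\mathcal B(H_A)\otimes1_{H_{X\setminus A}}$ with $H_A=\mathrm{EXP}\,L^2((A,\nu|_A);H)$.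
   Formalization: A nonzero Gaussian component counts as the point 0 of the support also when Π is nonzero (for variance 1 and Π=δ₁ the dimension is 2, not 1), and dimension 0 is allowed, for the deterministic process with zero variance and Π=0. *)

theory Defs
  imports "HOL-Probability.Probability"
begin

section \<open>Complex Hilbert spaces with explicit carrier\<close>

record 'v hilbert =
  hcarrier :: "'v set"
  hzero :: 'v
  hadd :: "'v \<Rightarrow> 'v \<Rightarrow> 'v"
  hscale :: "complex \<Rightarrow> 'v \<Rightarrow> 'v"
  hinner :: "'v \<Rightarrow> 'v \<Rightarrow> complex"

definition hnorm :: "'v hilbert \<Rightarrow> 'v \<Rightarrow> real" where
  "hnorm H x = sqrt (Re (hinner H x x))"

definition hdist :: "'v hilbert \<Rightarrow> 'v \<Rightarrow> 'v \<Rightarrow> real" where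
  "hdist H x y = hnorm H (hadd H x (hscale H (-1) y))"

text \<open>Inner products are linear in the second argument.\<close>

locale complex_hilbert_space =
  fixes H :: "'v hilbert"
  assumes zero_closed: "hzero H \<in> hcarrier H"
    and add_closed: "\<lbrakk>x \<in> hcarrier H; y \<in> hcarrier H\<rbrakk> \<Longrightarrow> hadd H x y \<in> hcarrier H"
    and scale_closed: "x \<in> hcarrier H \<Longrightarrow> hscale H c x \<in> hcarrier H"
    and add_assoc: "\<lbrakk>x \<in> hcarrier H; y \<in> hcarrier H; z \<in> hcarrier H\<rbrakk> \<Longrightarrow>
          hadd H (hadd H x y) z = hadd H x (hadd H y z)"
    and add_commute: "\<lbrakk>x \<in> hcarrier H; y \<in> hcarrier H\<rbrakk> \<Longrightarrow> hadd H x y = hadd H y x"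
    and add_zero: "x \<in> hcarrier H \<Longrightarrow> hadd H (hzero H) x = x"
    and add_inverse: "x \<in> hcarrier H \<Longrightarrow> hadd H x (hscale H (-1) x) = hzero H"
    and scale_one: "x \<in> hcarrier H \<Longrightarrow> hscale H 1 x = x"
    and scale_scale: "x \<in> hcarrier H \<Longrightarrow> hscale H c (hscale H d x) = hscale H (c * d) x"
    and scale_add_right: "\<lbrakk>x \<in> hcarrier H; y \<in> hcarrier H\<rbrakk> \<Longrightarrow>
          hscale H c (hadd H x y) = hadd H (hscale H c x) (hscale H c y)"
    and scale_add_left: "x \<in> hcarrier H \<Longrightarrow>
          hscale H (c + d) x = hadd H (hscale H c x) (hscale H d x)"
    and inner_add: "\<lbrakk>x \<in> hcarrier H; y \<in> hcarrier H; z \<in> hcarrier H\<rbrakk> \<Longrightarrow>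
          hinner H x (hadd H y z) = hinner H x y + hinner H x z"
    and inner_scale: "\<lbrakk>x \<in> hcarrier H; y \<in> hcarrier H\<rbrakk> \<Longrightarrow>
          hinner H x (hscale H c y) = c * hinner H x y"
    and inner_commute: "\<lbrakk>x \<in> hcarrier H; y \<in> hcarrier H\<rbrakk> \<Longrightarrow> hinner H y x = cnj (hinner H x y)"
    and inner_nonneg: "x \<in> hcarrier H \<Longrightarrow> 0 \<le> Re (hinner H x x)"
    and inner_definite: "\<lbrakk>x \<in> hcarrier H; hinner H x x = 0\<rbrakk> \<Longrightarrow> x = hzero H"
    and complete: "\<lbrakk>\<And>n::nat. u n \<in> hcarrier H;
            \<And>e. 0 < e \<Longrightarrow> \<exists>N. \<forall>m\<ge>N. \<forall>n\<ge>N. hdist H (u m) (u n) < e\<rbrakk> \<Longrightarrow>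
          \<exists>x\<in>hcarrier H. (\<lambda>n. hdist H (u n) x) \<longlonglongrightarrow> 0"

definition complex_as_hilbert :: "complex hilbert" where
  "complex_as_hilbert =
     \<lparr>hcarrier = UNIV, hzero = 0, hadd = (+), hscale = (*), hinner = (\<lambda>z w. cnj z * w)\<rparr>"

definition orthonormal_basis :: "'v hilbert \<Rightarrow> 'v set \<Rightarrow> bool" where
  "orthonormal_basis H B \<longleftrightarrow>
     B \<subseteq> hcarrier H \<and>
     (\<forall>b\<in>B. \<forall>b'\<in>B. hinner H b b' = (if b = b' then 1 else 0)) \<and>
     (\<forall>x\<in>hcarrier H. (\<forall>b\<in>B. hinner H b x = 0) \<longrightarrow> x = hzero H)"

definition num_points :: "'a set \<Rightarrow> enat" where
  "num_points S = (if finite S then enat (card S) else \<infinity>)"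

text \<open>Hilbert dimension; \<open>\<infinity>\<close> stands for countably infinite.\<close>

definition hilbert_dim :: "'v hilbert \<Rightarrow> enat \<Rightarrow> bool" where
  "hilbert_dim H n \<longleftrightarrow> (\<exists>B. orthonormal_basis H B \<and> countable B \<and> num_points B = n)"

definition hilbert_iso :: "'v hilbert \<Rightarrow> 'w hilbert \<Rightarrow> ('v \<Rightarrow> 'w) \<Rightarrow> bool" where
  "hilbert_iso H K T \<longleftrightarrow>
     T ` hcarrier H = hcarrier K \<and>
     (\<forall>x\<in>hcarrier H. \<forall>y\<in>hcarrier H. T (hadd H x y) = hadd K (T x) (T y)) \<and>
     (\<forall>c. \<forall>x\<in>hcarrier H. T (hscale H c x) = hscale K c (T x)) \<and>
     (\<forall>x\<in>hcarrier H. hnorm K (T x) = hnorm H x)"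


section \<open>Von Neumann algebras\<close>

text \<open>Operators are extensional functions on the carrier, so that sets of operators can be
  compared by equality.\<close>

definition bounded_ops :: "'v hilbert \<Rightarrow> ('v \<Rightarrow> 'v) set" where
  "bounded_ops H = {T \<in> hcarrier H \<rightarrow>\<^sub>E hcarrier H.
     (\<forall>x\<in>hcarrier H. \<forall>y\<in>hcarrier H. T (hadd H x y) = hadd H (T x) (T y)) \<and>
     (\<forall>c. \<forall>x\<in>hcarrier H. T (hscale H c x) = hscale H c (T x)) \<and>
     (\<exists>C. \<forall>x\<in>hcarrier H. hnorm H (T x) \<le> C * hnorm H x)}"

definition scalar_ops :: "'v hilbert \<Rightarrow> ('v \<Rightarrow> 'v) set" where
  "scalar_ops H = range (\<lambda>c. \<lambda>x\<in>hcarrier H. hscale H c x)"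

definition is_adjoint :: "'v hilbert \<Rightarrow> ('v \<Rightarrow> 'v) \<Rightarrow> ('v \<Rightarrow> 'v) \<Rightarrow> bool" where
  "is_adjoint H T T' \<longleftrightarrow>
     (\<forall>x\<in>hcarrier H. \<forall>y\<in>hcarrier H. hinner H (T x) y = hinner H x (T' y))"

definition commutant :: "'v hilbert \<Rightarrow> ('v \<Rightarrow> 'v) set \<Rightarrow> ('v \<Rightarrow> 'v) set" where
  "commutant H \<M> = {T \<in> bounded_ops H. \<forall>S\<in>\<M>. \<forall>x\<in>hcarrier H. T (S x) = S (T x)}"

definition von_neumann_algebra :: "'v hilbert \<Rightarrow> ('v \<Rightarrow> 'v) set \<Rightarrow> bool" where
  "von_neumann_algebra H \<M> \<longleftrightarrow>
     \<M> \<subseteq> bounded_ops H \<and>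
     (\<forall>T\<in>\<M>. \<exists>T'\<in>\<M>. is_adjoint H T T') \<and>
     commutant H (commutant H \<M>) = \<M>"

definition factor :: "'v hilbert \<Rightarrow> ('v \<Rightarrow> 'v) set \<Rightarrow> bool" where
  "factor H \<M> \<longleftrightarrow> von_neumann_algebra H \<M> \<and> \<M> \<inter> commutant H \<M> = scalar_ops H"

definition projection_op :: "'v hilbert \<Rightarrow> ('v \<Rightarrow> 'v) \<Rightarrow> bool" where
  "projection_op H p \<longleftrightarrow>
     p \<in> bounded_ops H \<and> is_adjoint H p p \<and> (\<forall>x\<in>hcarrier H. p (p x) = p x)"

text \<open>A projection \<open>p\<close> in \<open>\<M>\<close> is abelian if the algebra \<open>p\<M>p\<close> is commutative.\<close>

definition abelian_projection :: "'v hilbert \<Rightarrow> ('v \<Rightarrow> 'v) set \<Rightarrow> ('v \<Rightarrow> 'v) \<Rightarrow> bool" where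
  "abelian_projection H \<M> p \<longleftrightarrow>
     p \<in> \<M> \<and> projection_op H p \<and>
     (\<forall>S\<in>\<M>. \<forall>T\<in>\<M>. \<forall>x\<in>hcarrier H. p (S (p (T (p x)))) = p (T (p (S (p x)))))"

definition type_I_factor :: "'v hilbert \<Rightarrow> ('v \<Rightarrow> 'v) set \<Rightarrow> bool" where
  "type_I_factor H \<M> \<longleftrightarrow>
     factor H \<M> \<and>
     (\<exists>p. abelian_projection H \<M> p \<and> (\<exists>x\<in>hcarrier H. p x \<noteq> hzero H))"

text \<open>For an isometric bilinear map \<open>\<tau> : H\<^sub>1 \<times> H\<^sub>2 \<rightarrow> H\<close> with total range, that is, for an
  identification \<open>H = H\<^sub>1 \<otimes> H\<^sub>2\<close> with \<open>\<tau> x y = x \<otimes> y\<close>, this is the algebra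
  \<open>\<B>(H\<^sub>1) \<otimes> 1\<close> of all operators \<open>S \<otimes> 1\<close>.\<close>

definition amplification ::
    "'v hilbert \<Rightarrow> 'a hilbert \<Rightarrow> 'b hilbert \<Rightarrow> ('a \<Rightarrow> 'b \<Rightarrow> 'v) \<Rightarrow> ('v \<Rightarrow> 'v) set" where
  "amplification H H\<^sub>1 H\<^sub>2 \<tau> = {T \<in> bounded_ops H.
     \<exists>S\<in>bounded_ops H\<^sub>1. \<forall>x\<in>hcarrier H\<^sub>1. \<forall>y\<in>hcarrier H\<^sub>2. T (\<tau> x y) = \<tau> (S x) y}"


section \<open>Hilbert factorizations\<close>

definition mod0 :: "'x measure \<Rightarrow> ('x set \<times> 'x set) set" where
  "mod0 M = {(A, B). A \<in> sets M \<and> B \<in> sets M \<and> emeasure M (sym_diff A B) = 0}"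

definition mod0_class :: "'x measure \<Rightarrow> 'x set \<Rightarrow> 'x set set" where
  "mod0_class M A = mod0 M `` {A}"

text \<open>A map on the Boolean algebra of mod 0 classes is given by a map on measurable sets that
  is constant on these classes.\<close>

definition hilbert_factorization ::
    "'x measure \<Rightarrow> 'v hilbert \<Rightarrow> ('x set \<Rightarrow> ('v \<Rightarrow> 'v) set) \<Rightarrow> bool" where
  "hilbert_factorization M H \<xi> \<longleftrightarrow>
     complex_hilbert_space H \<and>
     (\<forall>(A, B)\<in>mod0 M. \<xi> A = \<xi> B) \<and>
     (\<forall>A\<in>sets M. type_I_factor H (\<xi> A)) \<and>
     (\<forall>A\<in>sets M. \<forall>B\<in>sets M. \<xi> (A \<inter> B) = \<xi> A \<inter> \<xi> B) \<and>
     (\<forall>A\<in>sets M. \<forall>B\<in>sets M. \<xi> (A \<union> B) = commutant H (commutant H (\<xi> A \<union> \<xi> B))) \<and>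
     (\<forall>A\<in>sets M. \<xi> (space M - A) = commutant H (\<xi> A)) \<and>
     \<xi> {} = scalar_ops H \<and>
     \<xi> (space M) = bounded_ops H"

text \<open>Joins are preserved since meets and complements are.\<close>

definition measure_algebra_iso ::
    "'x measure \<Rightarrow> 'y measure \<Rightarrow> ('x set set \<Rightarrow> 'y set set) \<Rightarrow> bool" where
  "measure_algebra_iso M N S \<longleftrightarrow>
     bij_betw S (sets M // mod0 M) (sets N // mod0 N) \<and>
     (\<forall>A\<in>sets M. \<forall>B\<in>sets M. \<forall>A'\<in>S (mod0_class M A). \<forall>B'\<in>S (mod0_class M B).
        S (mod0_class M (A \<inter> B)) = mod0_class N (A' \<inter> B')) \<and>
     (\<forall>A\<in>sets M. \<forall>A'\<in>S (mod0_class M A).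
        S (mod0_class M (space M - A)) = mod0_class N (space N - A'))"

definition conjugate_op :: "'v hilbert \<Rightarrow> 'w hilbert \<Rightarrow> ('v \<Rightarrow> 'w) \<Rightarrow> ('v \<Rightarrow> 'v) \<Rightarrow> 'w \<Rightarrow> 'w" where
  "conjugate_op H K T X = (\<lambda>y\<in>hcarrier K. T (X (inv_into (hcarrier H) T y)))"

definition isomorphic_factorizations ::
    "'x measure \<Rightarrow> 'v hilbert \<Rightarrow> ('x set \<Rightarrow> ('v \<Rightarrow> 'v) set) \<Rightarrow>
     'y measure \<Rightarrow> 'w hilbert \<Rightarrow> ('y set \<Rightarrow> ('w \<Rightarrow> 'w) set) \<Rightarrow> bool" where
  "isomorphic_factorizations M H\<^sub>1 \<xi>\<^sub>1 N H\<^sub>2 \<xi>\<^sub>2 \<longleftrightarrow>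
     (\<exists>S T. measure_algebra_iso M N S \<and> hilbert_iso H\<^sub>1 H\<^sub>2 T \<and>
        (\<forall>A\<in>sets M. \<forall>B\<in>S (mod0_class M A). conjugate_op H\<^sub>1 H\<^sub>2 T ` \<xi>\<^sub>1 A = \<xi>\<^sub>2 B))"


section \<open>Square integrable functions with values in a Hilbert space\<close>

text \<open>Measurability is weak measurability, which for separable \<open>H\<close> is the same as strong
  measurability. The elements of \<open>L2 M H\<close> are classes of almost everywhere equal functions.\<close>

definition L2_functions :: "'x measure \<Rightarrow> 'v hilbert \<Rightarrow> ('x \<Rightarrow> 'v) set" where
  "L2_functions M H = {f.
     (\<forall>x\<in>space M. f x \<in> hcarrier H) \<and>
     (\<forall>h\<in>hcarrier H. (\<lambda>x. hinner H h (f x)) \<in> borel_measurable M) \<and>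
     integrable M (\<lambda>x. (hnorm H (f x))\<^sup>2)}"

definition L2_class :: "'x measure \<Rightarrow> 'v hilbert \<Rightarrow> ('x \<Rightarrow> 'v) \<Rightarrow> ('x \<Rightarrow> 'v) set" where
  "L2_class M H f = {g \<in> L2_functions M H. AE x in M. f x = g x}"

definition rep :: "('x \<Rightarrow> 'v) set \<Rightarrow> 'x \<Rightarrow> 'v" where
  "rep u = (SOME f. f \<in> u)"

definition L2 :: "'x measure \<Rightarrow> 'v hilbert \<Rightarrow> ('x \<Rightarrow> 'v) set hilbert" where
  "L2 M H =
     \<lparr>hcarrier = L2_class M H ` L2_functions M H,
      hzero = L2_class M H (\<lambda>x. hzero H),
      hadd = (\<lambda>u v. L2_class M H (\<lambda>x. hadd H (rep u x) (rep v x))),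
      hscale = (\<lambda>c u. L2_class M H (\<lambda>x. hscale H c (rep u x))),
      hinner = (\<lambda>u v. \<integral>x. hinner H (rep u x) (rep v x) \<partial>M)\<rparr>"


section \<open>Boson Fock spaces and homogeneous Fock factorizations\<close>

text \<open>The Hilbert tensor power \<open>K\<^sup>\<otimes>\<^sup>m\<close> is realized as the space of Hilbert--Schmidt
  conjugate-multilinear functionals on \<open>K\<^sup>m\<close>: the tensor \<open>h\<^sub>1 \<otimes> \<dots> \<otimes> h\<^sub>m\<close> is the functional
  \<open>(k\<^sub>1, \<dots>, k\<^sub>m) \<mapsto> \<Prod>i. \<langle>k\<^sub>i, h\<^sub>i\<rangle>\<close>, and the inner product is the sum of \<open>cnj (\<Phi> l) * \<Psi> l\<close> over
  all \<open>m\<close>-tuples \<open>l\<close> of elements of an orthonormal basis. It does not depend on the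
  choice of the basis. Elements of \<open>S\<^sup>mK\<close> are the symmetric functionals. An element of the
  orthogonal sum over \<open>m\<close> is a single function on lists, the restriction of which to lists of
  length \<open>m\<close> is its component in \<open>S\<^sup>mK\<close>.\<close>

definition some_onb :: "'k hilbert \<Rightarrow> 'k set" where
  "some_onb K = (SOME B. orthonormal_basis K B)"

definition fock_vectors :: "'k hilbert \<Rightarrow> ('k list \<Rightarrow> complex) set" where
  "fock_vectors K = {\<Phi>.
     (\<forall>l. l \<notin> lists (hcarrier K) \<longrightarrow> \<Phi> l = 0) \<and>
     (\<forall>l\<in>lists (hcarrier K). \<forall>l'\<in>lists (hcarrier K). \<forall>x\<in>hcarrier K. \<forall>y\<in>hcarrier K.
        \<Phi> (l @ hadd K x y # l') = \<Phi> (l @ x # l') + \<Phi> (l @ y # l')) \<and>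
     (\<forall>l\<in>lists (hcarrier K). \<forall>l'\<in>lists (hcarrier K). \<forall>x\<in>hcarrier K. \<forall>c.
        \<Phi> (l @ hscale K c x # l') = cnj c * \<Phi> (l @ x # l')) \<and>
     (\<forall>m. \<exists>C. \<forall>l\<in>lists (hcarrier K). length l = m \<longrightarrow>
        cmod (\<Phi> l) \<le> C * prod_list (map (hnorm K) l)) \<and>
     (\<forall>l\<in>lists (hcarrier K). \<forall>l'\<in>lists (hcarrier K). mset l = mset l' \<longrightarrow> \<Phi> l = \<Phi> l') \<and>
     (\<lambda>l. (cmod (\<Phi> l))\<^sup>2) summable_on lists (some_onb K)}"

definition fock_space :: "'k hilbert \<Rightarrow> ('k list \<Rightarrow> complex) hilbert" where
  "fock_space K =
     \<lparr>hcarrier = fock_vectors K,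
      hzero = (\<lambda>l. 0),
      hadd = (\<lambda>\<Phi> \<Psi> l. \<Phi> l + \<Psi> l),
      hscale = (\<lambda>c \<Phi> l. c * \<Phi> l),
      hinner = (\<lambda>\<Phi> \<Psi>. \<Sum>\<^sub>\<infinity>l\<in>lists (some_onb K). cnj (\<Phi> l) * \<Psi> l)\<rparr>"

definition homogeneous_fock_space ::
    "'x measure \<Rightarrow> 'h hilbert \<Rightarrow> (('x \<Rightarrow> 'h) set list \<Rightarrow> complex) hilbert" where
  "homogeneous_fock_space M H = fock_space (L2 M H)"

definition L2_restrict :: "'x measure \<Rightarrow> 'h hilbert \<Rightarrow> 'x set \<Rightarrow> ('x \<Rightarrow> 'h) set \<Rightarrow> ('x \<Rightarrow> 'h) set" where
  "L2_restrict M H A u = L2_class (restrict_space M A) H (rep u)"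

text \<open>The canonical identification of \<open>EXP (K\<^sub>A \<oplus> K\<^sub>B)\<close> with \<open>EXP K\<^sub>A \<otimes> EXP K\<^sub>B\<close>, where
  \<open>K\<^sub>A = L\<^sup>2(A; H)\<close> and \<open>B\<close> is the complement of \<open>A\<close>: up to the normalization, the product of
  tensors of degrees \<open>p\<close> and \<open>q\<close> is their symmetrized tensor product. The normalization is the
  isometric one; for the exponential vectors \<open>exp h = (\<Oplus>m. h\<^sup>\<otimes>\<^sup>m / sqrt (m!))\<close> it gives
  \<open>exp h \<otimes> exp k \<mapsto> exp (h + k)\<close>.\<close>

definition fock_tensor ::
    "'x measure \<Rightarrow> 'h hilbert \<Rightarrow> 'x set \<Rightarrow> (('x \<Rightarrow> 'h) set list \<Rightarrow> complex) \<Rightarrow>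
     (('x \<Rightarrow> 'h) set list \<Rightarrow> complex) \<Rightarrow> ('x \<Rightarrow> 'h) set list \<Rightarrow> complex" where
  "fock_tensor M H A \<Phi> \<Psi> l =
     (if l \<in> lists (hcarrier (L2 M H)) then
        (\<Sum>J\<in>Pow {..<length l}.
           of_real (sqrt (fact (card J) * fact (length l - card J) / fact (length l))) *
           \<Phi> (map (L2_restrict M H A) (nths l J)) *
           \<Psi> (map (L2_restrict M H (space M - A)) (nths l ({..<length l} - J))))
      else 0)"

definition homogeneous_fock_factorization ::
    "'x measure \<Rightarrow> 'h hilbert \<Rightarrow> 'x set \<Rightarrow>
     ((('x \<Rightarrow> 'h) set list \<Rightarrow> complex) \<Rightarrow> (('x \<Rightarrow> 'h) set list \<Rightarrow> complex)) set" where
  "homogeneous_fock_factorization M H A =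
     amplification (homogeneous_fock_space M H)
       (homogeneous_fock_space (restrict_space M A) H)
       (homogeneous_fock_space (restrict_space M (space M - A)) H)
       (fock_tensor M H A)"

text \<open>Being isomorphic to a homogeneous Fock factorization of dimension \<open>n\<close>. The type of \<open>H\<close> is
  no restriction, as every separable Hilbert space has an isometric copy with elements of type
  \<^typ>\<open>nat \<Rightarrow> complex\<close>. Dimension \<open>0\<close> is admitted; it is the trivial factorization of a
  one-dimensional space.\<close>

definition is_homogeneous_fock_of_dim ::
    "'x measure \<Rightarrow> 'v hilbert \<Rightarrow> ('x set \<Rightarrow> ('v \<Rightarrow> 'v) set) \<Rightarrow> enat \<Rightarrow> bool" where
  "is_homogeneous_fock_of_dim M \<H> \<xi> n \<longleftrightarrow>
     (\<exists>H :: (nat \<Rightarrow> complex) hilbert. complex_hilbert_space H \<and> hilbert_dim H n \<and>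
        isomorphic_factorizations M \<H> \<xi>
          M (homogeneous_fock_space M H) (homogeneous_fock_factorization M H))"


section \<open>Levy processes\<close>

definition standard_borel_space :: "'x measure \<Rightarrow> bool" where
  "standard_borel_space M \<longleftrightarrow>
     (\<exists>X. topspace X = space M \<and> completely_metrizable_space X \<and> second_countable X \<and>
        sets M = sigma_sets (space M) {U. openin X U})"

definition bounded_measurable :: "'x measure \<Rightarrow> ('x \<Rightarrow> real) set" where
  "bounded_measurable M = {a \<in> borel_measurable M. \<exists>C. \<forall>x\<in>space M. \<bar>a x\<bar> \<le> C}"

text \<open>The random variable \<open>\<langle>a, \<cdot>\<rangle>\<close> is \<open>\<eta> a\<close>.\<close>

definition generalized_random_process ::
    "'x measure \<Rightarrow> 'w measure \<Rightarrow> (('x \<Rightarrow> real) \<Rightarrow> 'w \<Rightarrow> real) \<Rightarrow> bool" where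
  "generalized_random_process M P \<eta> \<longleftrightarrow>
     prob_space P \<and>
     (\<forall>a\<in>bounded_measurable M. \<eta> a \<in> borel_measurable P) \<and>
     (\<forall>a\<in>bounded_measurable M. \<forall>b\<in>bounded_measurable M.
        (AE x in M. a x = b x) \<longrightarrow> (AE \<omega> in P. \<eta> a \<omega> = \<eta> b \<omega>)) \<and>
     (\<forall>a\<in>bounded_measurable M. \<forall>b\<in>bounded_measurable M. \<forall>r s.
        AE \<omega> in P. \<eta> (\<lambda>x. r * a x + s * b x) \<omega> = r * \<eta> a \<omega> + s * \<eta> b \<omega>)"

definition levy_process ::
    "'x measure \<Rightarrow> 'w measure \<Rightarrow> (('x \<Rightarrow> real) \<Rightarrow> 'w \<Rightarrow> real) \<Rightarrow> bool" where
  "levy_process M P \<eta> \<longleftrightarrow>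
     generalized_random_process M P \<eta> \<and>
     (\<forall>a\<in>bounded_measurable M. \<forall>b\<in>bounded_measurable M.
        (AE x in M. a x * b x = 0) \<longrightarrow> prob_space.indep_var P borel (\<eta> a) borel (\<eta> b))"

definition measure_preserving_automorphism :: "'x measure \<Rightarrow> ('x \<Rightarrow> 'x) \<Rightarrow> bool" where
  "measure_preserving_automorphism M T \<longleftrightarrow>
     T \<in> measurable M M \<and> bij_betw T (space M) (space M) \<and>
     inv_into (space M) T \<in> measurable M M \<and> distr M M T = M"

definition homogeneous_process ::
    "'x measure \<Rightarrow> 'w measure \<Rightarrow> (('x \<Rightarrow> real) \<Rightarrow> 'w \<Rightarrow> real) \<Rightarrow> bool" where
  "homogeneous_process M P \<eta> \<longleftrightarrow>
     (\<forall>T J. measure_preserving_automorphism M T \<longrightarrow> finite J \<longrightarrow> J \<subseteq> bounded_measurable M \<longrightarrow>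
        distr P (\<Pi>\<^sub>M a\<in>J. borel) (\<lambda>\<omega>. \<lambda>a\<in>J. \<eta> (a \<circ> T) \<omega>) =
        distr P (\<Pi>\<^sub>M a\<in>J. borel) (\<lambda>\<omega>. \<lambda>a\<in>J. \<eta> a \<omega>))"

definition levy_measure :: "real measure \<Rightarrow> bool" where
  "levy_measure \<Lambda> \<longleftrightarrow>
     sets \<Lambda> = sets borel \<and> emeasure \<Lambda> {0} = 0 \<and> integrable \<Lambda> (\<lambda>t. t\<^sup>2 / (1 + t\<^sup>2))"

definition log_phi :: "real \<Rightarrow> real \<Rightarrow> real measure \<Rightarrow> real \<Rightarrow> complex" where
  "log_phi c \<sigma> \<Lambda> y =
     \<i> * of_real (c * y) - of_real (\<sigma>\<^sup>2 * y\<^sup>2 / 2) +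
     (\<integral>t. exp (\<i> * of_real (t * y)) - 1 - \<i> * of_real (t * y / (1 + t\<^sup>2)) \<partial>\<Lambda>)"

text \<open>The process has drift \<open>c\<close>, Gaussian variance \<open>\<sigma>\<^sup>2\<close> and Levy measure \<open>\<Lambda>\<close>.\<close>

definition levy_characteristics ::
    "'x measure \<Rightarrow> 'w measure \<Rightarrow> (('x \<Rightarrow> real) \<Rightarrow> 'w \<Rightarrow> real) \<Rightarrow>
     real \<Rightarrow> real \<Rightarrow> real measure \<Rightarrow> bool" where
  "levy_characteristics M P \<eta> c \<sigma> \<Lambda> \<longleftrightarrow>
     levy_measure \<Lambda> \<and>
     (\<forall>a\<in>bounded_measurable M.
        (\<integral>\<omega>. exp (\<i> * of_real (\<eta> a \<omega>)) \<partial>P) = exp (\<integral>x. log_phi c \<sigma> \<Lambda> (a x) \<partial>M))"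

definition measure_support :: "real measure \<Rightarrow> real set" where
  "measure_support \<Lambda> = {t. \<forall>U. open U \<and> t \<in> U \<longrightarrow> emeasure \<Lambda> U > 0}"

text \<open>A nonzero Gaussian part is regarded as mass of the Levy measure at the point \<open>0\<close>.\<close>

definition levy_support :: "real \<Rightarrow> real measure \<Rightarrow> real set" where
  "levy_support \<sigma> \<Lambda> = measure_support \<Lambda> \<union> (if \<sigma> = 0 then {} else {0})"


section \<open>The factorization determined by a process\<close>

definition process_algebra ::
    "'x measure \<Rightarrow> 'w measure \<Rightarrow> (('x \<Rightarrow> real) \<Rightarrow> 'w \<Rightarrow> real) \<Rightarrow> 'x set \<Rightarrow> 'w measure" where
  "process_algebra M P \<eta> A =
     sigma (space P) {\<eta> a -` E \<inter> space P | a E.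
       a \<in> bounded_measurable M \<and> (\<forall>x\<in>space M - A. a x = 0) \<and> E \<in> sets borel}"

definition process_space ::
    "'x measure \<Rightarrow> 'w measure \<Rightarrow> (('x \<Rightarrow> real) \<Rightarrow> 'w \<Rightarrow> real) \<Rightarrow> 'w measure" where
  "process_space M P \<eta> = restr_to_subalg P (process_algebra M P \<eta> (space M))"

definition L2_process ::
    "'x measure \<Rightarrow> 'w measure \<Rightarrow> (('x \<Rightarrow> real) \<Rightarrow> 'w \<Rightarrow> real) \<Rightarrow> ('w \<Rightarrow> complex) set hilbert" where
  "L2_process M P \<eta> = L2 (process_space M P \<eta>) complex_as_hilbert"

definition L2_process_on ::
    "'x measure \<Rightarrow> 'w measure \<Rightarrow> (('x \<Rightarrow> real) \<Rightarrow> 'w \<Rightarrow> real) \<Rightarrow> 'x set \<Rightarrow>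
     ('w \<Rightarrow> complex) set hilbert" where
  "L2_process_on M P \<eta> A = (L2_process M P \<eta>)
     \<lparr>hcarrier := {u \<in> hcarrier (L2_process M P \<eta>).
        \<exists>f\<in>u. f \<in> borel_measurable (process_algebra M P \<eta> A)}\<rparr>"

text \<open>\<open>L\<^sup>2(\<eta>)\<close> is the tensor product of the spaces of functionals depending on the restrictions to
  \<open>A\<close> and to its complement, where \<open>f \<otimes> g\<close> is the product of the independent variables \<open>f\<close> and \<open>g\<close>.\<close>

definition process_factorization ::
    "'x measure \<Rightarrow> 'w measure \<Rightarrow> (('x \<Rightarrow> real) \<Rightarrow> 'w \<Rightarrow> real) \<Rightarrow> 'x set \<Rightarrow>
     (('w \<Rightarrow> complex) set \<Rightarrow> ('w \<Rightarrow> complex) set) set" where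
  "process_factorization M P \<eta> A =
     amplification (L2_process M P \<eta>) (L2_process_on M P \<eta> A) (L2_process_on M P \<eta> (space M - A))
       (\<lambda>u v. L2_class (process_space M P \<eta>) complex_as_hilbert (\<lambda>\<omega>. rep u \<omega> * rep v \<omega>))"

end

theory Submission
  imports Defs
begin

text \<open>Both factorizations are governed by exponential vectors indexed by bounded measurable \<open>a\<close>: the
  functionals \<open>e\<^sub>a = exp (i \<langle>a, \<cdot>\<rangle>)\<close> in \<open>L\<^sup>2(\<eta>)\<close> and the vectors \<open>exp (k \<circ> a)\<close> of a Fock space over
  \<open>L\<^sup>2(\<nu>; H)\<close>. Here \<open>H\<close> is a copy of \<open>L\<^sup>2(\<mu>)\<close>, where \<open>\<mu>\<close> is \<open>t\<^sup>2 / (1 + t\<^sup>2) d\<Lambda>\<close> with an additional mass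
  \<open>\<sigma>\<^sup>2\<close> at \<open>0\<close>, and the vectors \<open>k y\<close> of \<open>H\<close> satisfy
  \<open>log \<phi> (b - a) = log \<phi> b + cnj (log \<phi> a) + \<langle>k a, k b\<rangle>\<close>. Hence the Gram matrix of the \<open>e\<^sub>a\<close> is that of the
  vectors \<open>E e\<^sub>a \<cdot> exp (k \<circ> a)\<close>, and, both families being total, there is a unitary operator between the two
  spaces. It respects the factorizations since \<open>T \<in> \<xi>(A)\<close> can be read off from the matrix elements of \<open>T\<close>
  between exponential vectors. The dimension of \<open>L\<^sup>2(\<mu>)\<close> is the number of points of the support of \<open>\<mu>\<close>. That
  the vectors \<open>exp (k \<circ> a)\<close> are total is where the absence of atoms of \<open>\<nu>\<close> enters.\<close>

section \<open>Hilbert spaces with explicit carrier\<close>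

text \<open>The two tensor structures share no formula: one multiplies random variables, the other
  symmetrizes functionals. The algebras are therefore rewritten as \<open>exp_alg\<close>, a
  condition on matrix elements in which a sum of functions with disjoint supports stands for a
  tensor product. Totality is the hard point on the Fock side: the functions
  \<open>k \<circ> a\<close> are not closed under linear combinations, so density of their span in
  \<open>L2 M H\<close> says nothing about the span of their exponentials. What helps is that on a
  small piece an affine combination of exponentials agrees to first order with the exponential of
  that combination; since \<open>k 0 = 0\<close>, the value \<open>y = 0\<close> can absorb the
  missing weight of an arbitrary combination. On pieces of measure below \<delta> the errors of
  order \<open>s^2\<close> add up to a constant times \<delta>, and this fails at an atom, which
  cannot be cut into small pieces. The scalars \<open>E e_a\<close> drop out of the algebras because
  they are multiplicative over disjoint supports.\<close>

abbreviation hsub :: "'v hilbert \<Rightarrow> 'v \<Rightarrow> 'v \<Rightarrow> 'v" where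
  "hsub H x y \<equiv> hadd H x (hscale H (-1) y)"

definition total_in :: "'v hilbert \<Rightarrow> 'v set \<Rightarrow> bool" where
  "total_in H E \<longleftrightarrow> E \<subseteq> hcarrier H \<and>
     (\<forall>x\<in>hcarrier H. (\<forall>e\<in>E. hinner H e x = 0) \<longrightarrow> x = hzero H)"

definition hsubspace :: "'v hilbert \<Rightarrow> 'v set \<Rightarrow> bool" where
  "hsubspace H S \<longleftrightarrow> S \<subseteq> hcarrier H \<and> hzero H \<in> S \<and>
     (\<forall>x\<in>S. \<forall>y\<in>S. hadd H x y \<in> S) \<and> (\<forall>c. \<forall>x\<in>S. hscale H c x \<in> S)"

text \<open>One scaled generator is added at a time, so that inductions have a single step with an
  explicit new vector. Closure under sums is recovered in \<open>hspan_subspace\<close>.\<close>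

inductive_set hspan :: "'v hilbert \<Rightarrow> 'v set \<Rightarrow> 'v set" for H E where
  zero: "hzero H \<in> hspan H E"
| step: "x \<in> hspan H E \<Longrightarrow> e \<in> E \<Longrightarrow> hadd H x (hscale H c e) \<in> hspan H E"

abbreviation hconv :: "'v hilbert \<Rightarrow> (nat \<Rightarrow> 'v) \<Rightarrow> 'v \<Rightarrow> bool" where
  "hconv H u x \<equiv> (\<lambda>n. hdist H (u n) x) \<longlonglongrightarrow> 0"

text \<open>The sum is pinned down weakly; the finite induction showing that it exists is in
  \<open>hsum_exists\<close>.\<close>

definition hsum :: "'v hilbert \<Rightarrow> ('i \<Rightarrow> 'v) \<Rightarrow> 'i set \<Rightarrow> 'v" where
  "hsum H f G = (THE s. s \<in> hcarrier H \<and>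
     (\<forall>z\<in>hcarrier H. hinner H z s = (\<Sum>g\<in>G. hinner H z (f g))))"

text \<open>Unlike the members of \<open>bounded_ops\<close>, these maps need not be extensional and
  may go between different spaces, so they compose freely. Applying \<open>restrict\<close> at the
  end turns them into operators.\<close>

definition bounded_lin :: "'v hilbert \<Rightarrow> 'w hilbert \<Rightarrow> ('v \<Rightarrow> 'w) \<Rightarrow> bool" where
  "bounded_lin H K T \<longleftrightarrow>
     (\<forall>x\<in>hcarrier H. T x \<in> hcarrier K) \<and>
     (\<forall>x\<in>hcarrier H. \<forall>y\<in>hcarrier H. T (hadd H x y) = hadd K (T x) (T y)) \<and>
     (\<forall>c. \<forall>x\<in>hcarrier H. T (hscale H c x) = hscale K c (T x)) \<and>
     (\<exists>C. \<forall>x\<in>hcarrier H. hnorm K (T x) \<le> C * hnorm H x)"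

lemma bounded_ops_iff:
  "T \<in> bounded_ops H \<longleftrightarrow> T \<in> extensional (hcarrier H) \<and> bounded_lin H H T"
  by (auto simp: bounded_ops_def bounded_lin_def PiE_def)

section \<open>Elementary geometry of inner product spaces\<close>

context complex_hilbert_space
begin

abbreviation "V \<equiv> hcarrier H"
abbreviation "ip \<equiv> hinner H"
abbreviation "nm \<equiv> hnorm H"

lemmas closed = zero_closed add_closed scale_closed

lemma inner_add_left:
  "\<lbrakk>x \<in> V; y \<in> V; z \<in> V\<rbrakk> \<Longrightarrow>
     ip (hadd H x y) z = ip x z + ip y z"
  using inner_commute[of z "hadd H x y"] inner_add[of z x y] inner_commute[of z x] inner_commute[of z y]
  by (simp add: closed)

lemma inner_scale_left:
  "\<lbrakk>x \<in> V; y \<in> V\<rbrakk> \<Longrightarrow> ip (hscale H c x) y = cnj c * ip x y"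
  using inner_commute[of y "hscale H c x"] inner_scale[of y x c] inner_commute[of y x] by (simp add: closed)

lemma inner_zero_right: "x \<in> V \<Longrightarrow> ip x (hzero H) = 0"
  using inner_add[of x "hzero H" "hzero H"] add_zero[of "hzero H"] by (simp add: closed)

lemma inner_zero_left: "x \<in> V \<Longrightarrow> ip (hzero H) x = 0"
  using inner_commute[of x "hzero H"] inner_zero_right by (simp add: closed)

lemmas inner_simps = inner_add inner_scale inner_add_left inner_scale_left
  inner_zero_left inner_zero_right closed

text \<open>Testing with \<open>z = x - y\<close> gives a vector of square length \<open>0\<close>.
  From here on identities between vectors are checked after pairing with a third one, where
  \<open>inner_simps\<close> turns them into complex arithmetic.\<close>

lemma weak_eqI:
  assumes "x \<in> V" "y \<in> V"
    and "\<And>z. z \<in> V \<Longrightarrow> ip z x = ip z y"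
  shows "x = y"
proof -
  have "ip (hsub H x y) (hsub H x y) = 0"
    using assms(1,2) assms(3)[of "hsub H x y"] inner_add[of "hsub H x y" x "hscale H (-1) y"]
      inner_scale[of "hsub H x y" y "-1"] by (simp add: closed)
  then have "hsub H x y = hzero H" using inner_definite assms by (simp add: closed)
  then have "hadd H x (hadd H y (hscale H (-1) y)) = y"
    using assms add_assoc[of x "hscale H (-1) y" y] add_zero[of y] add_commute[of y "hscale H (-1) y"] by (simp add: closed)
  then show ?thesis using add_inverse[of y] add_zero[of x] add_commute[of x "hzero H"] assms by (simp add: closed)
qed

lemma hnorm_sq: "x \<in> V \<Longrightarrow> (nm x)^2 = Re (ip x x)" by (simp add: hnorm_def inner_nonneg)

lemma inner_self: "x \<in> V \<Longrightarrow> ip x x = of_real ((nm x)^2)" using inner_commute[of x x] by (simp add: hnorm_sq complex_eq_iff)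

lemma hnorm_nonneg: "x \<in> V \<Longrightarrow> 0 \<le> nm x" by (simp add: hnorm_def inner_nonneg)

lemma hnorm_eq_0: "x \<in> V \<Longrightarrow> nm x = 0 \<longleftrightarrow> x = hzero H" using inner_self[of x] inner_definite[of x] inner_zero_right[of x]
  by (auto simp: hnorm_def closed inner_zero_right)

lemma hnorm_scale: "x \<in> V \<Longrightarrow> nm (hscale H c x) = cmod c * nm x"
proof -
  assume x: "x \<in> V"
  have "ip (hscale H c x) (hscale H c x) = of_real ((cmod c)^2 * (nm x)^2)"
    using x by (simp add: inner_simps inner_self[of x] complex_norm_square[symmetric] mult.assoc[symmetric])
  then have "(nm (hscale H c x))^2 = (cmod c * nm x)^2"
    using x by (simp add: hnorm_sq[of "hscale H c x"] closed power_mult_distrib)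
  then show ?thesis using x by (simp add: power2_eq_iff_nonneg hnorm_nonneg closed)
qed

lemma hnorm_sub_sq:
  assumes "x \<in> V" "y \<in> V"
  shows "(nm (hsub H x y))^2 = (nm x)^2 - 2 * Re (ip x y) + (nm y)^2"
  using assms inner_commute[of x y] by (simp add: hnorm_sq inner_simps)

lemma hnorm_add_sq:
  assumes "x \<in> V" "y \<in> V"
  shows "(nm (hadd H x y))^2 = (nm x)^2 + 2 * Re (ip x y) + (nm y)^2"
  using assms inner_commute[of x y] by (simp add: hnorm_sq inner_simps)

text \<open>The exact drop of the square length when the component along \<open>y\<close> is
  removed. Its nonnegativity is the Cauchy-Schwarz inequality, and the size of the drop gives the
  orthogonality in \<open>exists_projection\<close>.\<close>

lemma hnorm_sub_projection:
  assumes x: "x \<in> V" and y: "y \<in> V" and n: "y \<noteq> hzero H"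
  shows "(nm (hsub H x (hscale H (ip y x / of_real ((nm y)^2)) y)))^2
    = (nm x)^2 - (cmod (ip y x))^2 / (nm y)^2"
proof -
  have p: "nm y \<noteq> 0" using hnorm_eq_0[OF y] n by simp
  define c where "c = ip y x / of_real ((nm y)^2)"
  have "ip x (hscale H c y) = of_real ((cmod (ip y x))^2 / (nm y)^2)"
    using x y inner_commute[of y x] by (simp add: inner_scale c_def flip: complex_norm_square)
  moreover have "(nm (hscale H c y))^2 = (cmod (ip y x))^2 / (nm y)^2"
    using y p by (simp add: hnorm_scale c_def norm_divide norm_power power2_eq_square norm_mult)
  ultimately show ?thesis using hnorm_sub_sq[of x "hscale H c y"] x y by (simp add: closed c_def)
qed

lemma cauchy_schwarz:
  assumes x: "x \<in> V" and y: "y \<in> V"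
  shows "cmod (ip x y) \<le> nm x * nm y"
proof (cases "x = hzero H")
  case True
  then show ?thesis using y hnorm_nonneg[OF x] hnorm_nonneg[OF y] by (simp add: inner_zero_left)
next
  case False
  then have p: "nm x > 0" using hnorm_eq_0[OF x] hnorm_nonneg[OF x] by simp
  have "0 \<le> (nm y)^2 - (cmod (ip x y))^2 / (nm x)^2" using hnorm_sub_projection[OF y x False] by (metis zero_le_power2)
  then have "(cmod (ip x y))^2 \<le> (nm x * nm y)^2" using p by (simp add: field_simps power_mult_distrib)
  then show ?thesis by (rule power2_le_imp_le) (use x y in \<open>simp add: hnorm_nonneg\<close>)
qed

lemma hnorm_triangle:
  assumes x: "x \<in> V" and y: "y \<in> V"
  shows "nm (hadd H x y) \<le> nm x + nm y"
proof (rule power2_le_imp_le)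
  have "Re (ip x y) \<le> nm x * nm y" using cauchy_schwarz[OF x y] complex_Re_le_cmod order_trans by blast
  then show "(nm (hadd H x y))^2 \<le> (nm x + nm y)^2" by (simp add: hnorm_add_sq[OF x y] power2_sum)
qed (use x y in \<open>simp add: hnorm_nonneg\<close>)

lemma hdist_sq:
  "\<lbrakk>x \<in> V; y \<in> V\<rbrakk> \<Longrightarrow>
     (hdist H x y)^2 = (nm x)^2 - 2 * Re (ip x y) + (nm y)^2" by (simp add: hdist_def hnorm_sub_sq)

lemma hdist_nonneg: "\<lbrakk>x \<in> V; y \<in> V\<rbrakk> \<Longrightarrow> 0 \<le> hdist H x y" by (simp add: hdist_def hnorm_nonneg closed)

lemma hdist_commute:
  assumes "x \<in> V" "y \<in> V"
  shows "hdist H x y = hdist H y x"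
proof -
  have "(hdist H x y)^2 = (hdist H y x)^2" using assms inner_commute[of x y] by (simp add: hdist_sq)
  then show ?thesis using assms by (simp add: power2_eq_iff_nonneg hdist_nonneg)
qed

lemma hdist_triangle:
  assumes x: "x \<in> V" and y: "y \<in> V" and z: "z \<in> V"
  shows "hdist H x z \<le> hdist H x y + hdist H y z"
proof -
  have "hsub H x z = hadd H (hsub H x y) (hsub H y z)" by (rule weak_eqI) (use assms in \<open>simp_all add: inner_simps\<close>)
  then show ?thesis using hnorm_triangle[of "hsub H x y" "hsub H y z"] assms by (simp add: hdist_def closed)
qed

lemma hdist_zero: "x \<in> V \<Longrightarrow> hdist H x x = 0" by (simp add: hdist_def add_inverse hnorm_eq_0 closed)

lemma hnorm_diff_le:
  assumes x: "x \<in> V" and y: "y \<in> V"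
  shows "\<bar>nm x - nm y\<bar> \<le> hdist H x y"
proof -
  have *: "nm x = nm (hadd H (hsub H x y) y)" if "x \<in> V" "y \<in> V" for x y
    by (rule arg_cong[of _ _ "nm"], rule weak_eqI) (use that in \<open>simp_all add: inner_simps\<close>)
  show ?thesis using *[OF x y] *[OF y x] hnorm_triangle[of "hsub H x y" y] hnorm_triangle[of "hsub H y x" x]
      hdist_commute[OF x y] x y by (simp add: hdist_def closed)
qed

lemma hnorm_tendsto:
  assumes "\<And>n. u n \<in> V" "x \<in> V" "hconv H u x"
  shows "(\<lambda>n. nm (u n)) \<longlonglongrightarrow> nm x"
proof -
  have "(\<lambda>n. nm (u n) - nm x) \<longlonglongrightarrow> 0" by (rule Lim_null_comparison[OF _ assms(3)]) (use hnorm_diff_le assms in auto)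
  then show ?thesis by (simp add: LIM_zero_iff)
qed

lemma inner_diff_le:
  assumes "x \<in> V" "x' \<in> V" "y \<in> V" "y' \<in> V"
  shows "cmod (ip x y - ip x' y') \<le> hdist H x x' * nm y + nm x' * hdist H y y'"
proof -
  have "ip x y - ip x' y' = ip (hsub H x x') y + ip x' (hsub H y y')" using assms by (simp add: inner_simps)
  also have "cmod \<dots> \<le> nm (hsub H x x') * nm y + nm x' * nm (hsub H y y')"
    using assms by (intro order_trans[OF norm_triangle_ineq] add_mono cauchy_schwarz) (simp_all add: closed)
  finally show ?thesis by (simp add: hdist_def)
qed

lemma inner_tendsto:
  assumes "\<And>n. u n \<in> V" "x \<in> V" "hconv H u x"
    and "\<And>n. v n \<in> V" "y \<in> V" "hconv H v y"
  shows "(\<lambda>n. ip (u n) (v n)) \<longlonglongrightarrow> ip x y"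
proof -
  have "(\<lambda>n. ip (u n) (v n) - ip x y) \<longlonglongrightarrow> 0"
  proof (rule Lim_null_comparison)
    show "\<forall>\<^sub>F n in sequentially. cmod (ip (u n) (v n) - ip x y)
        \<le> hdist H (u n) x * nm (v n) + nm x * hdist H (v n) y"
      using inner_diff_le assms by (intro always_eventually allI) auto
    show "(\<lambda>n. hdist H (u n) x * nm (v n) + nm x * hdist H (v n) y) \<longlonglongrightarrow> 0"
      using tendsto_add[OF tendsto_mult[OF assms(3) hnorm_tendsto[OF assms(4,5,6)]]
          tendsto_mult[OF tendsto_const[of "nm x"] assms(6)]] by simp
  qed
  then show ?thesis by (simp add: LIM_zero_iff)
qed

lemma inner_tendsto_right:
  assumes "z \<in> V" "\<And>n. v n \<in> V" "y \<in> V" "hconv H v y"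
  shows "(\<lambda>n. ip z (v n)) \<longlonglongrightarrow> ip z y" using inner_tendsto[of "\<lambda>_. z" z v y] assms by (simp add: hdist_zero)

lemma hconv_imp_Cauchy:
  assumes "\<And>n. u n \<in> V" "x \<in> V" "hconv H u x" "0 < e"
  shows "\<exists>N. \<forall>m\<ge>N. \<forall>n\<ge>N. hdist H (u m) (u n) < e"
proof -
  have "\<forall>\<^sub>F n in sequentially. hdist H (u n) x < e / 2" using assms(3,4) by (auto dest!: order_tendstoD(2)[of _ _ _ "e / 2"])
  then obtain N where N: "\<And>n. n \<ge> N \<Longrightarrow> hdist H (u n) x < e / 2" by (auto simp: eventually_sequentially)
  have "hdist H (u m) (u n) < e" if "m \<ge> N" "n \<ge> N" for m n
    using hdist_triangle[of "u m" x "u n"] hdist_commute[of x "u n"] N[of m] N[of n] that assms(1,2) by simp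
  then show ?thesis by blast
qed

text \<open>In the expansion of the square of the distance the norms and the cross terms converge
  separately, and their limits cancel.\<close>

lemma hconvI_weak:
  assumes "\<And>n. u n \<in> V" "x \<in> V"
    and "(\<lambda>n. Re (ip (u n) (u n))) \<longlonglongrightarrow> Re (ip x x)"
    and "(\<lambda>n. Re (ip (u n) x)) \<longlonglongrightarrow> Re (ip x x)"
  shows "hconv H u x"
proof -
  have "(\<lambda>n. (hdist H (u n) x)^2) \<longlonglongrightarrow> Re (ip x x) - 2 * Re (ip x x) + Re (ip x x)"
    using assms(1,2) unfolding hdist_sq[OF assms(1,2)] hnorm_sq[OF assms(1)] hnorm_sq[OF assms(2)]
    by (intro tendsto_intros assms(3,4))
  then have "(\<lambda>n. sqrt ((hdist H (u n) x)^2)) \<longlonglongrightarrow> sqrt 0" by (intro tendsto_real_sqrt) simp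
  then show ?thesis using assms(1,2) by (simp add: hdist_nonneg)
qed

section \<open>Total families, projections and the Riesz representation\<close>

lemma total_eqI:
  assumes "total_in H E" "x \<in> V" "y \<in> V" "\<And>e. e \<in> E \<Longrightarrow> ip e x = ip e y"
  shows "x = y"
proof -
  have "hsub H x y = hzero H" using assms by (auto simp: total_in_def subset_iff inner_simps)
  then have "ip z x = ip z y" if "z \<in> V" for z
    using that assms(2,3) inner_zero_right[of z] inner_add[of z x "hscale H (-1) y"]
      inner_scale[of z y "-1"] by (simp add: closed)
  then show ?thesis using assms by (intro weak_eqI)
qed

lemma hspan_closed:
  assumes "E \<subseteq> V" "x \<in> hspan H E"
  shows "x \<in> V" using assms(2) by induction (use assms(1) in \<open>auto simp: closed\<close>)

lemma hspan_base: "E \<subseteq> V \<Longrightarrow> e \<in> E \<Longrightarrow> e \<in> hspan H E"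
  using hspan.step[OF hspan.zero, of e E H 1] add_zero[of e] scale_one[of e] by auto

lemma hspan_subspace:
  assumes E: "E \<subseteq> V"
  shows "hsubspace H (hspan H E)"
proof -
  have add: "hadd H x y \<in> hspan H E" if "x \<in> hspan H E" "y \<in> hspan H E" for x y using that(2)
  proof induction
    case zero
    then show ?case using that(1) hspan_closed[OF E that(1)] add_commute[of x "hzero H"] add_zero[of x] by (simp add: closed)
  next
    case (step y e c)
    then show ?case using add_assoc[of x y "hscale H c e"] hspan.step[OF step(3), of e c]
        hspan_closed[OF E that(1)] hspan_closed[OF E step(1)] E by (auto simp: closed)
  qed
  have scale: "hscale H c x \<in> hspan H E" if "x \<in> hspan H E" for x c using that
  proof induction
    case zero
    have "hscale H c (hzero H) = hzero H" by (rule weak_eqI) (simp_all add: inner_simps)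
    then show ?case by (simp add: hspan.zero)
  next
    case (step y e d)
    then show ?case using scale_add_right[of y "hscale H d e" c] scale_scale[of e c d] hspan.step[OF step(3), of e "c * d"]
        hspan_closed[OF E step(1)] E by (auto simp: closed)
  qed
  show ?thesis unfolding hsubspace_def using add scale hspan_closed[OF E] by (auto intro: hspan.zero)
qed

text \<open>\<open>S\<close> need not be closed, so the foot \<open>p\<close> of the perpendicular
  is delivered as the limit of a sequence in \<open>S\<close>. It is a minimizing sequence for the
  distance to \<open>x\<close>, and minimality forces the residual to be orthogonal to
  \<open>S\<close>.\<close>

lemma exists_projection:
  assumes S: "hsubspace H S" and x: "x \<in> V"
  obtains p u where "p \<in> V" "\<And>n::nat. u n \<in> S" "hconv H u p"
    "\<And>s. s \<in> S \<Longrightarrow> ip s (hsub H x p) = 0"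
proof -
  have SC: "s \<in> V" if "s \<in> S" for s using S that by (auto simp: hsubspace_def)
  define d where "d = Inf ((\<lambda>s. (hdist H x s)^2) ` S)"
  have d_le: "d \<le> (hdist H x s)^2" if "s \<in> S" for s
    unfolding d_def by (rule cInf_lower) (use that in \<open>auto intro!: bdd_belowI[of _ 0]\<close>)
  have "\<exists>s\<in>S. (hdist H x s)^2 < d + e" if "e > 0" for e
  proof -
    have "Inf ((\<lambda>s. (hdist H x s)^2) ` S) < d + e" using that by (simp add: d_def)
    moreover have "(\<lambda>s. (hdist H x s)^2) ` S \<noteq> {}" using S by (auto simp: hsubspace_def)
    ultimately show ?thesis by (subst (asm) cInf_less_iff) (auto intro!: bdd_belowI[of _ 0])
  qed
  then have "\<forall>n::nat. \<exists>s\<in>S. (hdist H x s)^2 < d + 1 / Suc n"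
    by (metis of_nat_0_less_iff zero_less_Suc zero_less_divide_1_iff)
  then obtain u where u: "\<And>n::nat. u n \<in> S" "\<And>n. (hdist H x (u n))^2 < d + 1 / Suc n" by metis
  have uC: "u n \<in> V" for n using SC u(1) by blast
  \<comment> \<open>Parallelogram law: the midpoint \<open>h\<close> lies in \<open>S\<close>, so
    its square distance to \<open>x\<close> is at least \<open>d\<close>, which bounds the mutual
    distance of \<open>u m\<close> and \<open>u n\<close> by their excess over
    \<open>d\<close>.\<close>
  have par: "(hdist H (u m) (u n))^2 \<le> 2 / Suc m + 2 / Suc n" for m n
  proof -
    define h where "h = hscale H (1/2) (hadd H (u m) (u n))"
    have h: "h \<in> S" using S u(1) by (auto simp: h_def hsubspace_def)
    have sc: "ip a h = (ip a (u m) + ip a (u n)) / 2"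
         "ip h a = (ip (u m) a + ip (u n) a) / 2" if "a \<in> V" for a using that uC by (simp_all add: h_def inner_simps)
    have "(hdist H (u m) (u n))^2 = 2 * (hdist H x (u m))^2 + 2 * (hdist H x (u n))^2 - 4 * (hdist H x h)^2"
      using uC x SC[OF h] inner_commute[of x "u n"] inner_commute[of x "u m"] inner_commute[of "u m" "u n"]
      by (simp add: hdist_sq hnorm_sq sc field_simps)
    then show ?thesis using u(2)[of m] u(2)[of n] d_le[OF h] by linarith
  qed
  have "\<exists>p\<in>V. hconv H u p"
  proof (rule complete)
    fix e :: real assume e: "0 < e"
    \<comment> \<open>For \<open>m\<close> and \<open>n\<close> beyond \<open>N\<close> the bound
      \<open>par\<close> is at most \<open>4 / Suc N\<close>.\<close>
    obtain N :: nat where N: "N > 4 / e^2" using reals_Archimedean2 by blast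
    have "hdist H (u m) (u n) < e" if "m \<ge> N" "n \<ge> N" for m n
    proof -
      have "4 / e^2 < real (Suc N)" using N by simp
      then have "4 < real (Suc N) * e^2" using e by (simp add: divide_less_eq)
      then have *: "4 / Suc N < e^2" by (simp add: divide_less_eq mult.commute)
      have "2 / real (Suc m) \<le> 2 / Suc N" "2 / real (Suc n) \<le> 2 / Suc N" using that by (simp_all add: frac_le)
      then have "(hdist H (u m) (u n))^2 < e^2" using par[of m n] * by simp
      then show ?thesis using e by (simp add: power2_less_imp_less)
    qed
    then show "\<exists>N. \<forall>m\<ge>N. \<forall>n\<ge>N. hdist H (u m) (u n) < e" by blast
  qed (rule uC)
  then obtain p where p: "p \<in> V" "hconv H u p" by blast
  have dist_lim: "(\<lambda>n. (nm (hsub H y (u n)))^2) \<longlonglongrightarrow> (nm (hsub H y p))^2" if "y \<in> V" for y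
    using that uC p unfolding hnorm_sub_sq[OF that uC] hnorm_sub_sq[OF that p(1)]
    by (intro tendsto_intros inner_tendsto_right hnorm_tendsto) auto
  have dp: "(nm (hsub H x p))^2 \<le> d"
  proof (rule LIMSEQ_le[OF dist_lim[OF x], of "\<lambda>n. d + 1 / Suc n"])
    show "(\<lambda>n. d + 1 / real (Suc n)) \<longlonglongrightarrow> d"
      using tendsto_add[OF tendsto_const LIMSEQ_inverse_real_of_nat, of d] by (simp add: inverse_eq_divide)
    show "\<exists>N. \<forall>n\<ge>N. (nm (hsub H x (u n)))^2 \<le> d + 1 / real (Suc n)" using u(2) by (auto simp: hdist_def intro!: less_imp_le)
  qed
  have orth: "ip s (hsub H x p) = 0" if s: "s \<in> S" for s
  proof (cases "s = hzero H")
    case True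
    then show ?thesis using x p by (simp add: inner_simps)
  next
    case False
    \<comment> \<open>The best coefficient along \<open>s\<close>. Moving from \<open>p\<close> by
      \<open>c\<close> times \<open>s\<close> stays in the closure of \<open>S\<close>, and by
      \<open>hnorm_sub_projection\<close> it would go below the infimum \<open>d\<close> unless the
      pairing is \<open>0\<close>.\<close>
    define c where "c = ip s (hsub H x p) / of_real ((nm s)^2)"
    have "d \<le> (nm (hsub H (hsub H x (hscale H c s)) p))^2"
    proof (rule LIMSEQ_le_const[OF dist_lim])
      show "hsub H x (hscale H c s) \<in> V" using x SC[OF s] by (simp add: closed)
      have "hsub H (hsub H x (hscale H c s)) (u n) = hsub H x (hadd H (u n) (hscale H c s))" for n
        by (rule weak_eqI) (use x SC[OF s] uC in \<open>simp_all add: inner_simps\<close>)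
      moreover have "hadd H (u n) (hscale H c s) \<in> S" for n using S s u(1) by (auto simp: hsubspace_def)
      ultimately show "\<exists>N. \<forall>n\<ge>N. d \<le> (nm (hsub H (hsub H x (hscale H c s)) (u n)))^2" using d_le by (auto simp: hdist_def)
    qed
    also have "hsub H (hsub H x (hscale H c s)) p = hsub H (hsub H x p) (hscale H c s)"
      by (rule weak_eqI) (use x SC[OF s] p in \<open>simp_all add: inner_simps\<close>)
    also have "(nm (hsub H (hsub H x p) (hscale H c s)))^2 =
        (nm (hsub H x p))^2 - (cmod (ip s (hsub H x p)))^2 / (nm s)^2"
      unfolding c_def by (rule hnorm_sub_projection) (use x p SC[OF s] False in \<open>auto simp: closed\<close>)
    finally have "(cmod (ip s (hsub H x p)))^2 / (nm s)^2 \<le> 0" using dp by simp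
    moreover have "nm s \<noteq> 0" using hnorm_eq_0[OF SC[OF s]] False by simp
    ultimately show ?thesis by (simp add: divide_le_0_iff)
  qed
  show ?thesis using that[OF p(1) u(1) p(2) orth] by blast
qed

lemma total_subspace_dense:
  assumes S: "hsubspace H S" and t: "total_in H S" and x: "x \<in> V"
  obtains u where "\<And>n::nat. u n \<in> S" "hconv H u x"
proof -
  obtain p u where p: "p \<in> V" "\<And>n::nat. u n \<in> S" "hconv H u p"
    "\<And>s. s \<in> S \<Longrightarrow> ip s (hsub H x p) = 0" using exists_projection[OF S x] by metis
  have "x = p"
  proof (rule total_eqI[OF t x p(1)])
    fix s assume "s \<in> S"
    then show "ip s x = ip s p" using p(4)[of s] S x p(1) by (auto simp: hsubspace_def subset_iff inner_simps)
  qed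
  then show ?thesis using that p(2,3) by blast
qed

lemma hspan_total:
  assumes "total_in H E"
  shows "total_in H (hspan H E)" using assms hspan_base[of E] hspan_closed[of E] by (auto simp: total_in_def)

lemma total_dense:
  assumes t: "total_in H E" and x: "x \<in> V"
  obtains u where "\<And>n::nat. u n \<in> hspan H E" "\<And>n. u n \<in> V" "hconv H u x"
proof -
  have E: "E \<subseteq> V" using t by (simp add: total_in_def)
  obtain u where u: "\<And>n::nat. u n \<in> hspan H E" "hconv H u x"
    using total_subspace_dense[OF hspan_subspace[OF E] hspan_total[OF t] x] by blast
  then show ?thesis using that[of u] hspan_closed[OF E] by blast
qed

text \<open>The residual \<open>w\<close> of a vector outside the kernel is orthogonal to the
  kernel, and \<open>x - (f x / f w) w\<close> always lies in the kernel. Boundedness enters in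
  \<open>f p = 0\<close>, because \<open>p\<close> is merely a limit of kernel vectors.\<close>

lemma riesz:
  assumes cl: "\<And>x y. \<lbrakk>x \<in> V; y \<in> V\<rbrakk> \<Longrightarrow> f (hadd H x y) = f x + f y"
    and sc: "\<And>c x. x \<in> V \<Longrightarrow> f (hscale H c x) = c * f x"
    and bd: "\<And>x. x \<in> V \<Longrightarrow> cmod (f x) \<le> C * nm x"
  obtains w where "w \<in> V" "\<And>x. x \<in> V \<Longrightarrow> f x = ip w x"
proof (cases "\<forall>x\<in>V. f x = 0")
  case True
  then show ?thesis using that[of "hzero H"] by (simp add: inner_simps)
next
  case False
  then obtain x0 where x0: "x0 \<in> V" "f x0 \<noteq> 0" by blast
  have f0: "f (hzero H) = 0" using cl[of "hzero H" "hzero H"] add_zero[of "hzero H"] by (simp add: closed)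
  define S where "S = {x \<in> V. f x = 0}"
  have S: "hsubspace H S" using cl sc f0 by (auto simp: hsubspace_def S_def closed)
  obtain p u where p: "p \<in> V" "\<And>n::nat. u n \<in> S" "hconv H u p"
    "\<And>s. s \<in> S \<Longrightarrow> ip s (hsub H x0 p) = 0" using exists_projection[OF S x0(1)] by metis
  have "f p = 0"
  proof -
    have "(\<lambda>n. f (hsub H (u n) p)) \<longlonglongrightarrow> 0"
    proof (rule Lim_null_comparison)
      show "\<forall>\<^sub>F n in sequentially. cmod (f (hsub H (u n) p)) \<le> C * hdist H (u n) p"
        using bd p(1,2) by (intro always_eventually allI) (simp add: hdist_def closed S_def)
      show "(\<lambda>n. C * hdist H (u n) p) \<longlonglongrightarrow> 0" using tendsto_mult[OF tendsto_const p(3), of C] by simp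
    qed
    moreover have "f (hsub H (u n) p) = - f p" for n using p(1,2) cl sc by (simp add: S_def closed)
    ultimately show ?thesis by (simp add: LIMSEQ_const_iff)
  qed
  define w where "w = hsub H x0 p"
  have w: "w \<in> V" using x0 p(1) by (simp add: w_def closed)
  have fw: "f w = f x0" using x0 p(1) cl sc \<open>f p = 0\<close> by (simp add: w_def closed)
  have wn: "ip w w \<noteq> 0" using inner_definite[OF w] fw x0(2) f0 by auto
  have main: "f x = ip (hscale H (cnj (f w / ip w w)) w) x" if x: "x \<in> V" for x
  proof -
    have "hsub H x (hscale H (f x / f w) w) \<in> S" using x w cl sc fw x0(2) by (simp add: S_def closed)
    then have "ip (hsub H x (hscale H (f x / f w) w)) w = 0" using p(4) by (simp add: w_def)
    then have "ip w (hsub H x (hscale H (f x / f w) w)) = 0"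
      using inner_commute[of "hsub H x (hscale H (f x / f w) w)" w] x w by (simp add: closed)
    then have "ip w x = f x / f w * ip w w" using x w by (simp add: inner_simps)
    then show ?thesis using x w wn fw x0(2) by (simp add: inner_simps field_simps)
  qed
  show ?thesis by (rule that[OF _ main]) (simp add: w scale_closed)
qed

lemma hsum_exists:
  assumes "finite G" "\<And>g. g \<in> G \<Longrightarrow> f g \<in> V"
  shows "\<exists>s\<in>V. \<forall>z\<in>V. ip z s = (\<Sum>g\<in>G. ip z (f g))" using assms
proof (induction G)
  case empty
  then show ?case by (auto intro!: bexI[of _ "hzero H"] simp: inner_simps)
next
  case (insert a G)
  then obtain s where "s \<in> V" "\<forall>z\<in>V. ip z s = (\<Sum>g\<in>G. ip z (f g))" by auto
  then show ?case using insert by (auto intro!: bexI[of _ "hadd H (f a) s"] simp: inner_simps)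
qed

lemma
  assumes "finite G" "\<forall>g\<in>G. f g \<in> V"
  shows hsum_closed: "hsum H f G \<in> V"
    and inner_hsum: "z \<in> V \<Longrightarrow> ip z (hsum H f G) = (\<Sum>g\<in>G. ip z (f g))"
proof -
  obtain s where s: "s \<in> V" "\<forall>z\<in>V. ip z s = (\<Sum>g\<in>G. ip z (f g))" using hsum_exists[of G f] assms by blast
  then have "\<exists>!s. s \<in> V \<and> (\<forall>z\<in>V. ip z s = (\<Sum>g\<in>G. ip z (f g)))" by (intro ex1I[of _ s]) (auto intro!: weak_eqI)
  from theI'[OF this] show "hsum H f G \<in> V"
    and "z \<in> V \<Longrightarrow> ip z (hsum H f G) = (\<Sum>g\<in>G. ip z (f g))" unfolding hsum_def by blast+
qed

lemma inner_hsum_left: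
  assumes "finite G" "\<forall>g\<in>G. f g \<in> V" "z \<in> V"
  shows "ip (hsum H f G) z = (\<Sum>g\<in>G. ip (f g) z)"
proof -
  have "ip (hsum H f G) z = cnj (\<Sum>g\<in>G. ip z (f g))"
    using inner_commute[of z "hsum H f G"] hsum_closed[OF assms(1,2)] inner_hsum[OF assms(1,2,3)] assms(3) by simp
  also have "\<dots> = (\<Sum>g\<in>G. ip (f g) z)" unfolding cnj_sum by (intro sum.cong refl) (use assms inner_commute[of z] in auto)
  finally show ?thesis .
qed

lemma hsum_empty: "hsum H f {} = hzero H" by (rule weak_eqI) (simp_all add: hsum_closed inner_hsum inner_simps)

lemma hsum_insert:
  assumes "finite G" "a \<notin> G" "\<forall>g\<in>insert a G. f g \<in> V"
  shows "hsum H f (insert a G) = hadd H (f a) (hsum H f G)"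
  by (rule weak_eqI) (use assms in \<open>simp_all add: hsum_closed inner_hsum inner_simps\<close>)

lemma hsum_in_subspace:
  assumes "hsubspace H S" "finite G" "\<And>g. g \<in> G \<Longrightarrow> f g \<in> S"
  shows "hsum H f G \<in> S" using assms(2,3)
proof (induction G)
  case empty
  then show ?case using assms(1) by (simp add: hsum_empty hsubspace_def)
next
  case (insert a G)
  have "f g \<in> V" if "g \<in> insert a G" for g using assms(1) insert(4)[OF that] by (auto simp: hsubspace_def)
  then show ?case using insert assms(1) by (simp add: hsum_insert hsubspace_def)
qed

text \<open>The terms are numbered instead of being indexed by elements of \<open>E\<close>, so a
  generator may occur several times and no coefficients have to be merged.\<close>

lemma hspan_finite:
  assumes E: "E \<subseteq> V" and x: "x \<in> hspan H E"
  obtains n :: nat and c e where "\<And>i. i < n \<Longrightarrow> e i \<in> E"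
    "x = hsum H (\<lambda>i. hscale H (c i) (e i)) {..<n}"
proof -
  have "\<exists>(n::nat) c e. (\<forall>i<n. e i \<in> E) \<and> x = hsum H (\<lambda>i. hscale H (c i) (e i)) {..<n}" using x
  proof induction
    case zero
    then show ?case by (intro exI[of _ 0]) (simp add: hsum_empty)
  next
    case (step x a d)
    then obtain n :: nat and c e where *: "\<forall>i<n. e i \<in> E" "x = hsum H (\<lambda>i. hscale H (c i) (e i)) {..<n}" by blast
    have "hadd H x (hscale H d a) = hsum H (\<lambda>i. hscale H ((c(n := d)) i) ((e(n := a)) i)) {..<Suc n}"
    proof (rule weak_eqI)
      have eH: "e i \<in> V" if "i < n" for i using * E that by blast
      have aH: "a \<in> V" using step(2) E by blast
      have 1: "hsum H (\<lambda>i. hscale H (c i) (e i)) {..<n} \<in> V" by (rule hsum_closed) (auto simp: eH closed)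
      show "hadd H x (hscale H d a) \<in> V" using 1 aH *(2) by (simp add: closed)
      show 2: "hsum H (\<lambda>i. hscale H ((c(n := d)) i) ((e(n := a)) i)) {..<Suc n} \<in> V"
        by (rule hsum_closed) (auto simp: eH aH closed less_Suc_eq)
      fix z assume z: "z \<in> V"
      have "ip z (hsum H (\<lambda>i. hscale H ((c(n := d)) i) ((e(n := a)) i)) {..<Suc n}) =
          (\<Sum>i<Suc n. ip z (hscale H ((c(n := d)) i) ((e(n := a)) i)))"
        by (rule inner_hsum) (auto simp: eH aH closed less_Suc_eq z)
      moreover have "ip z (hsum H (\<lambda>i. hscale H (c i) (e i)) {..<n}) = (\<Sum>i<n. ip z (hscale H (c i) (e i)))"
        by (rule inner_hsum) (auto simp: eH closed z)
      ultimately show "ip z (hadd H x (hscale H d a)) =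
          ip z (hsum H (\<lambda>i. hscale H ((c(n := d)) i) ((e(n := a)) i)) {..<Suc n})"
        using 1 z aH *(2) by (simp add: inner_simps)
    qed
    then show ?case using * step(2) by (intro exI[of _ "Suc n"] exI[of _ "c(n := d)"] exI[of _ "e(n := a)"]) auto
  qed
  then show ?thesis using that by blast
qed

section \<open>Orthonormal bases: existence, expansion, Parseval and Bessel\<close>

definition orthonormal :: "'v set \<Rightarrow> bool" where
  "orthonormal B \<longleftrightarrow> B \<subseteq> V \<and> (\<forall>b\<in>B. \<forall>b'\<in>B. ip b b' = (if b = b' then 1 else 0))"

text \<open>A maximal orthonormal set exists by Zorn's lemma. A nonzero vector orthogonal to it
  could be normalized and added.\<close>

lemma orthonormal_basis_exists: "\<exists>B. orthonormal_basis H B"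
proof -
  have "\<exists>M\<in>Collect orthonormal. \<forall>X\<in>Collect orthonormal. M \<subseteq> X \<longrightarrow> X = M"
  proof (rule subset_Zorn_nonempty)
    show "Collect orthonormal \<noteq> {}" by (auto simp: orthonormal_def intro!: exI[of _ "{}"])
  next
    fix C assume "C \<noteq> {}" and C: "subset.chain (Collect orthonormal) C"
    have "ip b b' = (if b = b' then 1 else 0)" if bb: "b \<in> \<Union>C" "b' \<in> \<Union>C" for b b'
    proof -
      obtain X X' where X: "X \<in> C" "X' \<in> C" "b \<in> X" "b' \<in> X'" using bb by blast
      then have "X \<subseteq> X' \<or> X' \<subseteq> X" using C by (auto simp: subset.chain_def)
      moreover have "orthonormal X" "orthonormal X'" using X C by (auto simp: subset.chain_def)
      ultimately show ?thesis using X unfolding orthonormal_def by blast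
    qed
    then show "\<Union>C \<in> Collect orthonormal" using C by (fastforce simp: subset.chain_def orthonormal_def)
  qed
  then obtain B where B: "orthonormal B" "\<And>X. orthonormal X \<Longrightarrow> B \<subseteq> X \<Longrightarrow> X = B" by auto
  have "x = hzero H" if x: "x \<in> V" "\<forall>b\<in>B. ip b x = 0" for x
  proof (rule ccontr)
    assume n: "x \<noteq> hzero H"
    define y where "y = hscale H (1 / of_real (nm x)) x"
    have nx: "nm x \<noteq> 0" using hnorm_eq_0[OF x(1)] n by simp
    have y: "y \<in> V" using x by (simp add: y_def closed)
    have yy: "ip y y = 1" using x nx by (simp add: y_def inner_simps inner_self[OF x(1)] power2_eq_square)
    have yb: "ip b y = 0" "ip y b = 0" if "b \<in> B" for b
    proof -
      have bH: "b \<in> V" using B(1) that by (auto simp: orthonormal_def)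
      show "ip b y = 0" using x bH that by (simp add: y_def inner_simps)
      then show "ip y b = 0" using inner_commute[OF bH y] by simp
    qed
    have "orthonormal (insert y B)" using B(1) y yy yb unfolding orthonormal_def by (auto simp del: One_nat_def)
    then have "y \<in> B" using B(2)[of "insert y B"] by auto
    then show False using yb yy by auto
  qed
  then show ?thesis using B(1) unfolding orthonormal_basis_def orthonormal_def by (intro exI[of _ B] conjI ballI impI) blast+
qed

lemma onb_projection_orthogonal:
  assumes B: "orthonormal_basis H B" and G: "finite G" "G \<subseteq> B" and x: "x \<in> V" and b: "b \<in> G"
  shows "ip b (hsub H x (hsum H (\<lambda>b. hscale H (ip b x) b) G)) = 0"
proof -
  have GH: "g \<in> V" if "g \<in> G" for g using B G that by (auto simp: orthonormal_basis_def)
  have "ip b (hsum H (\<lambda>b. hscale H (ip b x) b) G) = (\<Sum>g\<in>G. ip g x * (if b = g then 1 else 0))"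
    using G GH b B by (simp add: inner_hsum inner_simps) (auto intro!: sum.cong simp: orthonormal_basis_def subset_iff inner_simps)
  also have "\<dots> = ip b x" using G b by (simp add: if_distrib cong: if_cong)
  finally show ?thesis using GH x b G by (simp add: inner_simps hsum_closed)
qed

lemma onb_total: "orthonormal_basis H B \<Longrightarrow> total_in H B" by (auto simp: orthonormal_basis_def total_in_def)

text \<open>Take \<open>G\<close> to support a vector \<open>u n\<close> of the span that is close
  to \<open>x\<close>. For every larger \<open>G'\<close> the residual \<open>y\<close> is
  orthogonal to \<open>u n\<close> and to the partial sum, so its square length is the pairing of
  \<open>x - u n\<close> with \<open>y\<close>, and \<open>y\<close> is no longer than
  \<open>x - u n\<close>. The form for all larger finite sets is the one that \<open>has_sum\<close>
  asks for.\<close>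

lemma onb_expansion:
  assumes B: "orthonormal_basis H B" and x: "x \<in> V" and e: "0 < \<epsilon>"
  obtains G where "finite G" "G \<subseteq> B"
    "\<And>G'. \<lbrakk>finite G'; G \<subseteq> G'; G' \<subseteq> B\<rbrakk> \<Longrightarrow>
       hdist H x (hsum H (\<lambda>b. hscale H (ip b x) b) G') < \<epsilon>"
proof -
  have BH: "B \<subseteq> V" using B by (simp add: orthonormal_basis_def)
  obtain u where u: "\<And>n::nat. u n \<in> hspan H B" "\<And>n. u n \<in> V" "hconv H u x" using total_dense[OF onb_total[OF B] x] by blast
  obtain n where n: "hdist H (u n) x < \<epsilon>" using order_tendstoD(2)[OF u(3) e] by (auto simp: eventually_sequentially)
  have "\<exists>G. finite G \<and> G \<subseteq> B \<and> (\<forall>z\<in>V. (\<forall>b\<in>G. ip b z = 0) \<longrightarrow> ip (u n) z = 0)" using u(1)[of n]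
  proof induction
    case zero
    then show ?case by (auto intro!: exI[of _ "{}"] simp: inner_simps)
  next
    case (step s b c)
    then obtain G where "finite G" "G \<subseteq> B" "\<forall>z\<in>V. (\<forall>b\<in>G. ip b z = 0) \<longrightarrow> ip s z = 0" by blast
    then show ?case using step(1,2) BH hspan_closed[OF BH step(1)]
      by (intro exI[of _ "insert b G"]) (auto simp: inner_simps subset_iff)
  qed
  then obtain G where G: "finite G" "G \<subseteq> B"
    "\<And>z. z\<in>V \<Longrightarrow> (\<forall>b\<in>G. ip b z = 0) \<Longrightarrow> ip (u n) z = 0" by blast
  show ?thesis
  proof (rule that[OF G(1,2)])
    fix G' assume G': "finite G'" "G \<subseteq> G'" "G' \<subseteq> B"
    have GH: "g \<in> V" if "g \<in> G'" for g using BH G' that by auto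
    define p where "p = hsum H (\<lambda>b. hscale H (ip b x) b) G'"
    define y where "y = hsub H x p"
    have p: "p \<in> V" unfolding p_def using G' GH by (simp add: hsum_closed closed)
    have y: "y \<in> V" using x p by (simp add: y_def closed)
    have orth: "ip b y = 0" if "b \<in> G'" for b unfolding y_def p_def by (rule onb_projection_orthogonal[OF B G'(1,3) x that])
    have un: "ip (u n) y = 0" using G(3)[OF y] orth G'(2) by blast
    have "ip p y = 0" unfolding p_def using G' GH orth y by (subst inner_hsum_left) (auto simp: inner_simps)
    then have "ip y y = ip (hsub H x (u n)) y"
      using un x p u(2) y by (simp add: inner_simps) (simp add: y_def inner_simps x p y)
    then have "(nm y)^2 = cmod (ip (hsub H x (u n)) y)"
      using inner_self[OF y] by (metis abs_of_nonneg norm_of_real zero_le_power2)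
    also have "\<dots> \<le> hdist H x (u n) * nm y" unfolding hdist_def by (rule cauchy_schwarz) (use x u(2) y in \<open>auto simp: closed\<close>)
    finally have "nm y * nm y \<le> hdist H x (u n) * nm y" by (simp add: power2_eq_square)
    then have "nm y \<le> hdist H x (u n)" using hnorm_nonneg[OF y] hdist_nonneg[OF x u(2)]
      by (cases "nm y = 0") (simp_all add: mult_le_cancel_right)
    then show "hdist H x (hsum H (\<lambda>b. hscale H (ip b x) b) G') < \<epsilon>"
      using n hdist_commute[OF x u(2)[of n]] by (simp add: hdist_def y_def p_def)
  qed
qed

lemma parseval:
  assumes B: "orthonormal_basis H B" and x: "x \<in> V" and y: "y \<in> V"
  shows "((\<lambda>b. ip x b * ip b y) has_sum ip x y) B" unfolding has_sum_def tendsto_iff eventually_finite_subsets_at_top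
proof (intro allI impI)
  fix \<epsilon> :: real assume e: "0 < \<epsilon>"
  \<comment> \<open>The added \<open>1\<close> keeps the quotient defined when \<open>y\<close> is
    zero and makes \<open>\<delta> * nm y\<close> strictly smaller than \<epsilon>.\<close>
  define \<delta> where "\<delta> = \<epsilon> / (nm y + 1)"
  have ny: "nm y \<ge> 0" using hnorm_nonneg[OF y] .
  have \<delta>: "\<delta> > 0" using e ny by (simp add: \<delta>_def)
  obtain G where G: "finite G" "G \<subseteq> B"
    "\<And>G'. \<lbrakk>finite G'; G \<subseteq> G'; G' \<subseteq> B\<rbrakk> \<Longrightarrow> hdist H x (hsum H (\<lambda>b. hscale H (ip b x) b) G') < \<delta>"
    using onb_expansion[OF B x \<delta>] by metis
  have "dist (\<Sum>b\<in>Y. ip x b * ip b y) (ip x y) < \<epsilon>" if Y: "finite Y" "G \<subseteq> Y" "Y \<subseteq> B" for Y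
  proof -
    have YH: "g \<in> V" if "g \<in> Y" for g using B Y that by (auto simp: orthonormal_basis_def)
    define p where "p = hsum H (\<lambda>b. hscale H (ip b x) b) Y"
    have p: "p \<in> V" unfolding p_def using Y YH by (simp add: hsum_closed closed)
    have "ip p y = (\<Sum>b\<in>Y. cnj (ip b x) * ip b y)"
      unfolding p_def using Y YH y by (subst inner_hsum_left) (auto simp: inner_simps)
    also have "\<dots> = (\<Sum>b\<in>Y. ip x b * ip b y)" by (intro sum.cong refl) (use inner_commute[OF YH x] in simp)
    finally have "dist (\<Sum>b\<in>Y. ip x b * ip b y) (ip x y) = cmod (ip (hsub H x p) y)"
      using x y p by (simp add: dist_norm inner_simps norm_minus_commute)
    also have "\<dots> \<le> hdist H x p * nm y" unfolding hdist_def by (rule cauchy_schwarz) (use x p y in \<open>auto simp: closed\<close>)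
    also have "\<dots> \<le> \<delta> * nm y" using G(3)[OF Y] ny by (intro mult_right_mono) (auto simp: p_def)
    also have "\<dots> < \<epsilon>" using e ny by (simp add: \<delta>_def field_simps)
    finally show ?thesis .
  qed
  then show "\<exists>X. finite X \<and> X \<subseteq> B \<and> (\<forall>Y. finite Y \<and> X \<subseteq> Y \<and> Y \<subseteq> B \<longrightarrow>
      dist (\<Sum>b\<in>Y. ip x b * ip b y) (ip x y) < \<epsilon>)" using G(1,2) by blast
qed

lemma parseval_norm:
  assumes B: "orthonormal_basis H B" and x: "x \<in> V"
  shows "((\<lambda>b. (cmod (ip b x))^2) has_sum (nm x)^2) B"
proof -
  have "((\<lambda>b. Re (ip x b * ip b x)) has_sum Re (ip x x)) B" by (rule has_sum_Re[OF parseval[OF B x x]])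
  moreover have "Re (ip x b * ip b x) = (cmod (ip b x))^2" if "b \<in> B" for b
  proof -
    have "b \<in> V" using B that by (auto simp: orthonormal_basis_def)
    then have "ip x b * ip b x = of_real ((cmod (ip b x))^2)"
      using inner_commute[of b x] x unfolding complex_norm_square by simp
    then show ?thesis by simp
  qed
  ultimately show ?thesis unfolding hnorm_sq[OF x] using has_sum_cong[of B] by (metis (no_types, lifting))
qed

lemma bessel:
  assumes B: "orthonormal B" and G: "finite G" "G \<subseteq> B" and x: "x \<in> V"
  shows "(\<Sum>b\<in>G. (cmod (ip b x))^2) \<le> (nm x)^2"
proof -
  have GH: "g \<in> V" if "g \<in> G" for g using B G that by (auto simp: orthonormal_def)
  define p where "p = hsum H (\<lambda>b. hscale H (ip b x) b) G"
  have p: "p \<in> V" unfolding p_def using G GH by (simp add: hsum_closed closed)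
  have bp: "ip b p = ip b x" if b: "b \<in> G" for b
  proof -
    have "ip b p = (\<Sum>g\<in>G. ip g x * (if b = g then 1 else 0))" using G GH b B unfolding p_def
      by (simp add: inner_hsum inner_simps) (auto intro!: sum.cong simp: orthonormal_def subset_iff inner_simps)
    also have "\<dots> = ip b x" using G b by (simp add: if_distrib cong: if_cong)
    finally show ?thesis .
  qed
  have 1: "ip p z = (\<Sum>b\<in>G. cnj (ip b x) * ip b z)" if "z \<in> V" for z
    unfolding p_def using G GH that by (subst inner_hsum_left) (auto simp: inner_simps)
  have 2: "ip p p = ip p x" using 1[OF p] 1[OF x] bp by simp
  have 3: "ip p x = of_real (\<Sum>b\<in>G. (cmod (ip b x))^2)"
    unfolding 1[OF x] of_real_sum complex_norm_square by (simp add: mult.commute)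
  have "0 \<le> (nm (hsub H x p))^2" by simp
  also have "\<dots> = (nm x)^2 - 2 * Re (ip x p) + (nm p)^2" by (rule hnorm_sub_sq[OF x p])
  also have "\<dots> = (nm x)^2 - (\<Sum>b\<in>G. (cmod (ip b x))^2)" using inner_commute[OF p x] 2 3 p by (simp add: hnorm_sq)
  finally show ?thesis by simp
qed

text \<open>By Bessel's inequality a fixed \<open>d\<close> has a square coefficient above
  \<open>1 / Suc n\<close> at only finitely many members of \<open>B\<close>, and by totality every
  member of \<open>B\<close> has a nonzero coefficient with some \<open>d\<close> in the countable
  set.\<close>

lemma orthonormal_countable:
  assumes B: "orthonormal B" and D: "countable D" "total_in H D"
  shows "countable B"
proof -
  have BH: "b \<in> V" if "b \<in> B" for b using B that by (auto simp: orthonormal_def)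
  have DH: "d \<in> V" if "d \<in> D" for d using D that by (auto simp: total_in_def)
  have "finite {b\<in>B. (cmod (ip b d))^2 > 1 / real (Suc n)}" if d: "d \<in> D" for d n
  proof (rule ccontr)
    assume inf: "infinite {b\<in>B. (cmod (ip b d))^2 > 1 / real (Suc n)}"
    obtain m :: nat where m: "m > (nm d)^2 * real (Suc n)" using reals_Archimedean2 by blast
    obtain F where F: "F \<subseteq> {b\<in>B. (cmod (ip b d))^2 > 1 / real (Suc n)}" "finite F" "card F = m"
      using infinite_arbitrarily_large[OF inf] by metis
    have "real m * (1 / real (Suc n)) \<le> (\<Sum>b\<in>F. (cmod (ip b d))^2)"
      using F sum_bounded_below[of F "1 / real (Suc n)" "\<lambda>b. (cmod (ip b d))^2"] by (force intro: less_imp_le)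
    also have "\<dots> \<le> (nm d)^2" using bessel[OF B F(2) _ DH[OF d]] F(1) by auto
    finally show False using m by (simp add: field_simps)
  qed
  then have "countable (\<Union>d\<in>D. \<Union>n. {b\<in>B. (cmod (ip b d))^2 > 1 / real (Suc n)})"
    using D(1) by (intro countable_UN countable_finite[of "{b \<in> B. _ b}"] countableI_type) blast+
  moreover have "B \<subseteq> (\<Union>d\<in>D. \<Union>n. {b\<in>B. (cmod (ip b d))^2 > 1 / real (Suc n)})"
  proof
    fix b assume b: "b \<in> B"
    have "b \<noteq> hzero H" using B b inner_zero_right[OF closed(1)] by (force simp: orthonormal_def)
    then obtain d where d: "d \<in> D" "ip d b \<noteq> 0" using D(2) BH[OF b] by (auto simp: total_in_def)
    then have "(cmod (ip b d))^2 > 0" using inner_commute[OF DH BH, of d b] b by auto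
    then obtain n where "1 / real (Suc n) < (cmod (ip b d))^2" by (metis nat_approx_posE)
    then show "b \<in> (\<Union>d\<in>D. \<Union>n. {b\<in>B. (cmod (ip b d))^2 > 1 / real (Suc n)})" using b d by blast
  qed
  ultimately show ?thesis by (rule countable_subset[rotated])
qed

end

subsection \<open>Adjoints and unitary operators\<close>

text \<open>Riesz representation of the functional
  \<open>x \<mapsto> \<langle>y, T x\<rangle>\<close> produces \<open>T' y\<close>. The bound for
  \<open>T'\<close> results from inserting \<open>x = T' y\<close>. The adjoint serves below to
  build slice maps and to transfer equations from total families.\<close>

lemma adjoint_exists:
  assumes K: "complex_hilbert_space K" and H: "complex_hilbert_space H" and T: "bounded_lin K H T"
  obtains T' where "bounded_lin H K T'"
    "\<And>x y. \<lbrakk>x \<in> hcarrier K; y \<in> hcarrier H\<rbrakk> \<Longrightarrow> hinner H (T x) y = hinner K x (T' y)"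
    "\<And>x y. \<lbrakk>x \<in> hcarrier K; y \<in> hcarrier H\<rbrakk> \<Longrightarrow> hinner H y (T x) = hinner K (T' y) x"
proof -
  interpret K: complex_hilbert_space K by fact
  interpret H: complex_hilbert_space H by fact
  have Tc: "T x \<in> hcarrier H" if "x \<in> hcarrier K" for x using T that by (simp add: bounded_lin_def)
  obtain C0 where C0: "\<And>x. x \<in> hcarrier K \<Longrightarrow> hnorm H (T x) \<le> C0 * hnorm K x" using T unfolding bounded_lin_def by blast
  \<comment> \<open>In a trivial space the given bound may be negative, which the later
    multiplications do not tolerate.\<close>
  define C where "C = max C0 0"
  have C: "hnorm H (T x) \<le> C * hnorm K x" "C \<ge> 0" if "x \<in> hcarrier K" for x
    using C0[OF that] K.hnorm_nonneg[OF that] mult_right_mono[of C0 C "hnorm K x"] by (auto simp: C_def)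
  have "\<exists>w\<in>hcarrier K. \<forall>x\<in>hcarrier K. hinner H y (T x) = hinner K w x" if y: "y \<in> hcarrier H" for y
  proof -
    have "cmod (hinner H y (T x)) \<le> (hnorm H y * C) * hnorm K x" if "x \<in> hcarrier K" for x
      using H.cauchy_schwarz[OF y Tc[OF that]] mult_left_mono[OF C(1)[OF that] H.hnorm_nonneg[OF y]] by simp
    then obtain w where "w \<in> hcarrier K" "\<And>x. x \<in> hcarrier K \<Longrightarrow> hinner H y (T x) = hinner K w x"
      using K.riesz[of "\<lambda>x. hinner H y (T x)" "hnorm H y * C" thesis] T y Tc by (auto simp: bounded_lin_def H.inner_simps)
    then show ?thesis by blast
  qed
  then obtain T' where T': "\<And>y. y \<in> hcarrier H \<Longrightarrow> T' y \<in> hcarrier K"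
    "\<And>x y. \<lbrakk>x \<in> hcarrier K; y \<in> hcarrier H\<rbrakk> \<Longrightarrow> hinner H y (T x) = hinner K (T' y) x" by metis
  have T'': "hinner H (T x) y = hinner K x (T' y)" if "x \<in> hcarrier K" "y \<in> hcarrier H" for x y
    using that T' Tc H.inner_commute[of y "T x"] K.inner_commute[of "T' y" x] by simp
  have "hnorm K (T' y) \<le> C * hnorm H y" if y: "y \<in> hcarrier H" for y
  proof (cases "hnorm K (T' y) = 0")
    case True
    then show ?thesis using C(2)[OF T'(1)[OF y]] H.hnorm_nonneg[OF y] by simp
  next
    case False
    have "hnorm K (T' y) * hnorm K (T' y) = cmod (hinner H (T (T' y)) y)"
      using T''[OF T'(1)[OF y] y] K.inner_self[OF T'(1)[OF y]] by (simp add: power2_eq_square norm_mult)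
    also have "\<dots> \<le> (C * hnorm K (T' y)) * hnorm H y"
      by (intro order_trans[OF H.cauchy_schwarz] mult_right_mono C(1)) (use T' Tc y in \<open>auto simp: H.hnorm_nonneg\<close>)
    finally have "hnorm K (T' y) * hnorm K (T' y) \<le> (C * hnorm H y) * hnorm K (T' y)" by (simp add: ac_simps)
    moreover have "hnorm K (T' y) > 0" using False K.hnorm_nonneg[OF T'(1)[OF y]] by simp
    ultimately show ?thesis by (simp only: mult_le_cancel_right_pos)
  qed
  then have "bounded_lin H K T'" unfolding bounded_lin_def using T' T'' by (intro conjI ballI allI K.weak_eqI exI[of _ C])
      (simp_all add: K.inner_simps H.inner_simps T''[symmetric] Tc)
  then show ?thesis using that T'(2) T'' by blast
qed

text \<open>The adjoints agree, because \<open>T' y\<close> and \<open>S' y\<close> have the same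
  pairings with \<open>E\<close>. Passing to adjoints replaces an approximation of \<open>x\<close>
  by combinations of \<open>E\<close>.\<close>

lemma bounded_lin_eqI:
  assumes K: "complex_hilbert_space K" and H: "complex_hilbert_space H"
    and T: "bounded_lin K H T" and S: "bounded_lin K H S"
    and E: "total_in K E" and eq: "\<And>x. x \<in> E \<Longrightarrow> T x = S x" and x: "x \<in> hcarrier K"
  shows "T x = S x"
proof -
  interpret K: complex_hilbert_space K by fact
  interpret H: complex_hilbert_space H by fact
  obtain T' where T': "bounded_lin H K T'"
    "\<And>x y. \<lbrakk>x \<in> hcarrier K; y \<in> hcarrier H\<rbrakk> \<Longrightarrow> hinner H (T x) y = hinner K x (T' y)"
    "\<And>x y. \<lbrakk>x \<in> hcarrier K; y \<in> hcarrier H\<rbrakk> \<Longrightarrow> hinner H y (T x) = hinner K (T' y) x" using adjoint_exists[OF K H T] by metis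
  obtain S' where S': "bounded_lin H K S'"
    "\<And>x y. \<lbrakk>x \<in> hcarrier K; y \<in> hcarrier H\<rbrakk> \<Longrightarrow> hinner H (S x) y = hinner K x (S' y)"
    "\<And>x y. \<lbrakk>x \<in> hcarrier K; y \<in> hcarrier H\<rbrakk> \<Longrightarrow> hinner H y (S x) = hinner K (S' y) x" using adjoint_exists[OF K H S] by metis
  have EK: "E \<subseteq> hcarrier K" using E by (simp add: total_in_def)
  have "T' y = S' y" if "y \<in> hcarrier H" for y by (rule K.total_eqI[OF E])
      (use that T' S' eq EK in \<open>auto simp: bounded_lin_def subset_iff simp flip: T'(2) S'(2)\<close>)
  then show ?thesis using T S x T' S' by (intro H.weak_eqI) (auto simp: bounded_lin_def)
qed

lemma bounded_op_eqI:
  assumes H: "complex_hilbert_space H" and T: "T \<in> bounded_ops H" and S: "S \<in> bounded_ops H"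
    and E: "total_in H E" and eq: "\<And>x. x \<in> E \<Longrightarrow> T x = S x"
  shows "T = S"
proof (rule extensionalityI[of _ "hcarrier H"])
  fix x assume "x \<in> hcarrier H"
  then show "T x = S x" using bounded_lin_eqI[OF H H _ _ E, of T S x] eq T S by (simp add: bounded_ops_iff)
qed (use T S in \<open>auto simp: bounded_ops_iff\<close>)

lemma bounded_lin_compose:
  assumes "complex_hilbert_space K" "bounded_lin H K S" "bounded_lin K M T"
  shows "bounded_lin H M (\<lambda>x. T (S x))"
proof -
  interpret complex_hilbert_space K by fact
  obtain C where C: "\<And>x. x \<in> hcarrier H \<Longrightarrow> hnorm K (S x) \<le> C * hnorm H x" using assms(2) unfolding bounded_lin_def by blast
  obtain D where D: "\<And>x. x \<in> hcarrier K \<Longrightarrow> hnorm M (T x) \<le> D * hnorm K x" using assms(3) unfolding bounded_lin_def by blast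
  have "hnorm M (T (S x)) \<le> (\<bar>D\<bar> * C) * hnorm H x" if x: "x \<in> hcarrier H" for x
  proof -
    have Sx: "S x \<in> hcarrier K" using assms(2) x by (simp add: bounded_lin_def)
    have "D * hnorm K (S x) \<le> \<bar>D\<bar> * hnorm K (S x)" using hnorm_nonneg[OF Sx] by (intro mult_right_mono) auto
    also have "\<dots> \<le> \<bar>D\<bar> * (C * hnorm H x)" by (intro mult_left_mono C x) auto
    finally show ?thesis using D[OF Sx] by simp
  qed
  moreover have "\<forall>x\<in>hcarrier H. S x \<in> hcarrier K" using assms(2) by (simp add: bounded_lin_def)
  ultimately show ?thesis using assms(2,3) unfolding bounded_lin_def by auto
qed

text \<open>Pairs formed by the same linear combination in both spaces. It is a relation because
  different combinations may represent one vector; that the second component is determined by the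
  first follows from the Gram matrices.\<close>

inductive_set pspan :: "'v hilbert \<Rightarrow> 'w hilbert \<Rightarrow> ('i \<Rightarrow> 'v) \<Rightarrow> ('i \<Rightarrow> 'w) \<Rightarrow> 'i set \<Rightarrow> ('v \<times> 'w) set" for H K e f D where
  zero: "(hzero H, hzero K) \<in> pspan H K e f D"
| step: "(x, y) \<in> pspan H K e f D \<Longrightarrow> a \<in> D \<Longrightarrow>
    (hadd H x (hscale H c (e a)), hadd K y (hscale K c (f a))) \<in> pspan H K e f D"

lemma hspan_pspan:
  assumes "x \<in> hspan H (e ` D)"
  obtains y where "(x, y) \<in> pspan H K e f D"
proof -
  have "\<exists>y. (x, y) \<in> pspan H K e f D" using assms by induction (auto intro: pspan.intros)
  then show ?thesis using that by blast
qed

locale equal_gram =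
  H: complex_hilbert_space H + K: complex_hilbert_space K for H :: "'v hilbert" and K :: "'w hilbert" +
  fixes D :: "'i set" and e :: "'i \<Rightarrow> 'v" and f :: "'i \<Rightarrow> 'w"
  assumes e_total: "total_in H (e ` D)" and f_total: "total_in K (f ` D)"
    and gram: "\<And>a b. \<lbrakk>a \<in> D; b \<in> D\<rbrakk> \<Longrightarrow> hinner H (e a) (e b) = hinner K (f a) (f b)"
begin

lemma e_closed: "a \<in> D \<Longrightarrow> e a \<in> H.V" and f_closed: "a \<in> D \<Longrightarrow> f a \<in> K.V" using e_total f_total by (auto simp: total_in_def)

lemma pspan_closed: "(x, y) \<in> pspan H K e f D \<Longrightarrow> x \<in> H.V \<and> y \<in> K.V"
  by (induction rule: pspan.induct) (auto simp: H.closed K.closed e_closed f_closed)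

lemma pspan_inner_base:
  assumes "a \<in> D" "(x, y) \<in> pspan H K e f D"
  shows "H.ip (e a) x = K.ip (f a) y" using assms(2) by (induction rule: pspan.induct)
    (use assms(1) pspan_closed in \<open>auto simp: H.inner_simps K.inner_simps e_closed f_closed gram\<close>)

lemma pspan_inner:
  assumes "(x, y) \<in> pspan H K e f D" "(x', y') \<in> pspan H K e f D"
  shows "H.ip x x' = K.ip y y'" using assms(1)
proof (induction rule: pspan.induct)
  case zero
  then show ?case using pspan_closed[OF assms(2)] by (simp add: H.inner_simps K.inner_simps)
next
  case (step x y a c)
  then show ?case using pspan_closed[OF assms(2)] pspan_closed[OF step(1)] pspan_inner_base[OF step(2) assms(2)]
    by (simp add: H.inner_simps K.inner_simps e_closed f_closed)
qed

text \<open>The graph of the unitary operator, described by pairings with the two families.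
  Linearity of the operator can be read off from this description without any limit.\<close>

definition rel :: "'v \<Rightarrow> 'w \<Rightarrow> bool" where
  "rel x y \<longleftrightarrow> x \<in> H.V \<and> y \<in> K.V \<and> (\<forall>a\<in>D. H.ip (e a) x = K.ip (f a) y)"

lemma rel_unique: "rel x y \<Longrightarrow> rel x y' \<Longrightarrow> y = y'" by (rule K.total_eqI[OF f_total]) (auto simp: rel_def)

text \<open>Approximate \<open>x\<close> by combinations \<open>u n\<close> and form the same
  combinations \<open>v n\<close> in the other space. Equal Gram matrices make the mutual distances
  equal, so \<open>v\<close> is Cauchy, and its limit is the partner of \<open>x\<close>.\<close>

lemma rel_exists:
  assumes x: "x \<in> H.V"
  shows "\<exists>y. rel x y \<and> K.nm y = H.nm x"
proof -
  obtain u where u: "\<And>n::nat. u n \<in> hspan H (e ` D)" "\<And>n. u n \<in> H.V" "hconv H u x" using H.total_dense[OF e_total x] by blast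
  have "\<forall>n. \<exists>y. (u n, y) \<in> pspan H K e f D" using u(1) hspan_pspan by metis
  then obtain v where v: "\<And>n. (u n, v n) \<in> pspan H K e f D" by metis
  have vK: "v n \<in> K.V" for n using pspan_closed[OF v] by simp
  have "hdist K (v m) (v n) = hdist H (u m) (u n)" for m n
  proof -
    have "(hdist K (v m) (v n))^2 = (hdist H (u m) (u n))^2"
      using vK u(2) by (simp add: H.hdist_sq K.hdist_sq H.hnorm_sq K.hnorm_sq pspan_inner[OF v v])
    then show ?thesis using vK u(2) by (simp add: power2_eq_iff_nonneg H.hdist_nonneg K.hdist_nonneg)
  qed
  then have "\<exists>y\<in>K.V. hconv K v y" using H.hconv_imp_Cauchy[OF u(2) x u(3)] by (intro K.complete vK) auto
  then obtain y where y: "y \<in> K.V" "hconv K v y" by blast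
  have "H.ip (e a) x = K.ip (f a) y" if a: "a \<in> D" for a using H.inner_tendsto_right[OF e_closed[OF a] u(2) x u(3)]
      K.inner_tendsto_right[OF f_closed[OF a] vK y] pspan_inner_base[OF a v] by (simp add: LIMSEQ_unique)
  moreover have "K.nm y = H.nm x"
  proof (rule LIMSEQ_unique[OF K.hnorm_tendsto[OF vK y]])
    show "(\<lambda>n. K.nm (v n)) \<longlonglongrightarrow> H.nm x" using H.hnorm_tendsto[OF u(2) x u(3)] by (simp add: hnorm_def pspan_inner[OF v v])
  qed
  ultimately show ?thesis using x y(1) by (auto simp: rel_def)
qed

lemma rel_surj:
  assumes y: "y \<in> K.V"
  shows "\<exists>x. rel x y"
proof -
  interpret flip: equal_gram K H D f e by unfold_locales (simp_all add: e_total f_total gram)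
  show ?thesis using flip.rel_exists[OF y] by (auto simp: rel_def flip.rel_def)
qed

lemma unitary_exists:
  obtains T where "hilbert_iso H K T" "\<And>a. a \<in> D \<Longrightarrow> T (e a) = f a"
proof -
  define T where "T x = (THE y. rel x y)" for x
  have Teq: "T x = y" if "rel x y" for x y unfolding T_def using that rel_unique by (intro the_equality) auto
  have T: "rel x (T x)" "K.nm (T x) = H.nm x" if "x \<in> H.V" for x using rel_exists[OF that] Teq by auto
  have "hilbert_iso H K T" unfolding hilbert_iso_def
  proof (intro conjI ballI allI)
    show "T ` H.V = K.V"
    proof (intro set_eqI iffI)
      fix y assume "y \<in> K.V"
      then obtain x where "rel x y" using rel_surj by blast
      then show "y \<in> T ` H.V" using Teq[of x y] by (auto simp: rel_def)
    qed (use T(1) in \<open>auto simp: rel_def\<close>)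
    show "T (hadd H x y) = hadd K (T x) (T y)" if "x \<in> H.V" "y \<in> H.V" for x y using T(1)[OF that(1)] T(1)[OF that(2)]
      by (intro Teq) (auto simp: rel_def H.inner_simps K.inner_simps e_closed f_closed)
    show "T (hscale H c x) = hscale K c (T x)" if "x \<in> H.V" for x c using T(1)[OF that]
      by (intro Teq) (auto simp: rel_def H.inner_simps K.inner_simps e_closed f_closed)
  qed (use T in auto)
  moreover have "T (e a) = f a" if "a \<in> D" for a using that by (intro Teq) (auto simp: rel_def e_closed f_closed gram)
  ultimately show ?thesis using that by blast
qed

end

text \<open>Polarization: \<open>hilbert_iso\<close> postulates only that norms are preserved. The
  norm of a sum determines the real part, and replacing \<open>x\<close> by \<open>\<i> x\<close>
  determines the imaginary part.\<close>

lemma hilbert_iso_inner: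
  assumes H: "complex_hilbert_space H" and K: "complex_hilbert_space K" and T: "hilbert_iso H K T"
    and x: "x \<in> hcarrier H" and y: "y \<in> hcarrier H"
  shows "hinner K (T x) (T y) = hinner H x y"
proof -
  interpret K: complex_hilbert_space K by fact
  interpret H: complex_hilbert_space H by fact
  have Tc: "T x \<in> hcarrier K" if "x \<in> hcarrier H" for x using T that by (auto simp: hilbert_iso_def)
  have Re: "Re (hinner K (T x) (T y)) = Re (hinner H x y)" if "x \<in> hcarrier H" "y \<in> hcarrier H" for x y
  proof -
    have "T (hadd H x y) = hadd K (T x) (T y)" "hnorm K (T (hadd H x y)) = hnorm H (hadd H x y)"
      using T that H.add_closed[OF that] unfolding hilbert_iso_def by blast+
    then have "hnorm K (hadd K (T x) (T y)) = hnorm H (hadd H x y)" by simp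
    moreover have "hnorm K (T x) = hnorm H x" "hnorm K (T y) = hnorm H y" using T that by (auto simp: hilbert_iso_def)
    ultimately show ?thesis using K.hnorm_add_sq[OF Tc[OF that(1)] Tc[OF that(2)]] H.hnorm_add_sq[OF that] by simp
  qed
  have "T (hscale H \<i> x) = hscale K \<i> (T x)" using T x by (simp add: hilbert_iso_def)
  then have "Im (hinner K (T x) (T y)) = Im (hinner H x y)"
    using Re[of "hscale H \<i> x" y] x y Tc by (simp add: H.inner_simps K.inner_simps)
  then show ?thesis using Re[OF x y] by (simp add: complex_eq_iff)
qed

lemma hilbert_iso_inj:
  assumes H: "complex_hilbert_space H" and K: "complex_hilbert_space K" and T: "hilbert_iso H K T"
  shows "inj_on T (hcarrier H)"
proof (rule inj_onI)
  interpret H: complex_hilbert_space H by fact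
  fix x y assume xy: "x \<in> hcarrier H" "y \<in> hcarrier H" "T x = T y"
  show "x = y" by (rule H.weak_eqI) (use xy hilbert_iso_inner[OF H K T] in metis)+
qed

section \<open>Tensor decompositions\<close>

text \<open>An identification of \<open>H\<close> with the Hilbert tensor product, given by
  elementary tensors alone. Bilinearity is not assumed but follows from the inner products and
  totality. The unit vectors exclude zero factors and serve to read off the operator on one
  leg.\<close>

locale tensor_decomposition =
  H: complex_hilbert_space H + H1: complex_hilbert_space H1 + H2: complex_hilbert_space H2
  for H :: "'v hilbert" and H1 :: "'a hilbert" and H2 :: "'b hilbert" +
  fixes \<tau> :: "'a \<Rightarrow> 'b \<Rightarrow> 'v"
  assumes tau_closed: "\<lbrakk>x \<in> hcarrier H1; y \<in> hcarrier H2\<rbrakk> \<Longrightarrow> \<tau> x y \<in> hcarrier H"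
    and inner_tau: "\<lbrakk>x \<in> hcarrier H1; y \<in> hcarrier H2; x' \<in> hcarrier H1; y' \<in> hcarrier H2\<rbrakk> \<Longrightarrow>
      hinner H (\<tau> x y) (\<tau> x' y') = hinner H1 x x' * hinner H2 y y'"
    and tau_total: "\<lbrakk>z \<in> hcarrier H; \<And>x y. \<lbrakk>x \<in> hcarrier H1; y \<in> hcarrier H2\<rbrakk> \<Longrightarrow> hinner H (\<tau> x y) z = 0\<rbrakk>
      \<Longrightarrow> z = hzero H"
    and unit1: "\<exists>x\<in>hcarrier H1. hinner H1 x x = 1"
    and unit2: "\<exists>y\<in>hcarrier H2. hinner H2 y y = 1"
begin

lemma flip: "tensor_decomposition H H2 H1 (\<lambda>y x. \<tau> x y)"
  by unfold_locales (auto simp: tau_closed inner_tau unit1 unit2 intro: tau_total)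

lemma total: "total_in H {\<tau> x y | x y. x \<in> H1.V \<and> y \<in> H2.V}" using tau_total by (auto simp: total_in_def tau_closed)

lemma tau_eqI:
  assumes "z \<in> H.V" "z' \<in> H.V"
    "\<And>x y. \<lbrakk>x \<in> H1.V; y \<in> H2.V\<rbrakk> \<Longrightarrow> H.ip (\<tau> x y) z = H.ip (\<tau> x y) z'"
  shows "z = z'" by (rule H.total_eqI[OF total]) (use assms in auto)

lemma hnorm_tau:
  assumes x: "x \<in> H1.V" and y: "y \<in> H2.V"
  shows "H.nm (\<tau> x y) = H1.nm x * H2.nm y"
proof -
  have "complex_of_real ((H.nm (\<tau> x y))^2) = of_real ((H1.nm x)^2) * of_real ((H2.nm y)^2)" using inner_tau[OF x y x y]
    unfolding H1.inner_self[OF x] H2.inner_self[OF y] H.inner_self[OF tau_closed[OF x y]] .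
  then have "(H.nm (\<tau> x y))^2 = (H1.nm x * H2.nm y)^2"
    unfolding of_real_mult[symmetric] of_real_eq_iff by (simp add: power_mult_distrib)
  then show ?thesis using x y by (simp add: power2_eq_iff_nonneg H.hnorm_nonneg H1.hnorm_nonneg H2.hnorm_nonneg tau_closed)
qed

text \<open>Both sides of each linearity equation have the same pairings with all elementary
  tensors, and these are total.\<close>

lemma bounded_lin_left: "y \<in> H2.V \<Longrightarrow> bounded_lin H1 H (\<lambda>x. \<tau> x y)" unfolding bounded_lin_def
  by (intro conjI ballI allI tau_eqI exI[of _ "H2.nm y"])
    (simp_all add: tau_closed H.inner_simps H1.inner_simps inner_tau hnorm_tau algebra_simps)

lemma bounded_lin_right: "x \<in> H1.V \<Longrightarrow> bounded_lin H2 H (\<tau> x)" unfolding bounded_lin_def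
  by (intro conjI ballI allI tau_eqI exI[of _ "H1.nm x"])
    (simp_all add: tau_closed H.inner_simps H2.inner_simps inner_tau hnorm_tau algebra_simps)

lemma tau_scale:
  assumes "x \<in> H1.V" "y \<in> H2.V"
  shows "\<tau> (hscale H1 c x) y = hscale H c (\<tau> x y)" "\<tau> x (hscale H2 c y) = hscale H c (\<tau> x y)"
  using bounded_lin_left[OF assms(2)] bounded_lin_right[OF assms(1)] assms by (auto simp: bounded_lin_def)

lemma amplificationI:
  assumes "bounded_lin H H T" "bounded_lin H1 H1 S"
    "\<And>x y. \<lbrakk>x \<in> H1.V; y \<in> H2.V\<rbrakk> \<Longrightarrow> T (\<tau> x y) = \<tau> (S x) y"
  shows "restrict T (H.V) \<in> amplification H H1 H2 \<tau>"
proof -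
  have "restrict T (H.V) \<in> bounded_ops H" using assms(1) by (auto simp: bounded_ops_iff bounded_lin_def H.closed)
  moreover have "restrict S (H1.V) \<in> bounded_ops H1" using assms(2) by (auto simp: bounded_ops_iff bounded_lin_def H1.closed)
  ultimately show ?thesis using assms(3) by (auto simp: amplification_def tau_closed intro!: bexI[of _ "restrict S (H1.V)"])
qed

lemma amplificationE:
  assumes "T \<in> amplification H H1 H2 \<tau>"
  obtains S where "bounded_lin H H T" "T \<in> bounded_ops H" "bounded_lin H1 H1 S"
    "\<And>x y. \<lbrakk>x \<in> H1.V; y \<in> H2.V\<rbrakk> \<Longrightarrow> T (\<tau> x y) = \<tau> (S x) y" using assms by (auto simp: amplification_def bounded_ops_iff)

text \<open>\<open>W\<close> is the slice map that pairs the first leg with \<open>x'\<close>,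
  namely the adjoint of \<open>y \<mapsto> \<tau> x' y\<close>. Composed with
  \<open>\<tau> x\<close> it gives the amplification of the rank one operator taking
  \<open>x'\<close> to a multiple of \<open>x\<close>.\<close>

lemma rank_one:
  assumes x: "x \<in> H1.V" and x': "x' \<in> H1.V"
  obtains W where "bounded_lin H H2 W"
    "(\<lambda>z\<in>H.V. \<tau> x (W z)) \<in> amplification H H1 H2 \<tau>"
    "\<And>x1 y. \<lbrakk>x1 \<in> H1.V; y \<in> H2.V\<rbrakk> \<Longrightarrow> W (\<tau> x1 y) = hscale H2 (H1.ip x' x1) y"
proof -
  obtain W where W: "bounded_lin H H2 W"
    "\<And>y z. \<lbrakk>y \<in> H2.V; z \<in> H.V\<rbrakk> \<Longrightarrow> H.ip (\<tau> x' y) z = H2.ip y (W z)"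
    using adjoint_exists[OF H2.complex_hilbert_space_axioms H.complex_hilbert_space_axioms bounded_lin_right[OF x']] by metis
  have Wt: "W (\<tau> x1 y) = hscale H2 (H1.ip x' x1) y" if "x1 \<in> H1.V" "y \<in> H2.V" for x1 y by (rule H2.weak_eqI)
      (use that x' W in \<open>auto simp: bounded_lin_def tau_closed H2.inner_simps inner_tau simp flip: W(2)\<close>)
  have "bounded_lin H1 H1 (\<lambda>x1. hscale H1 (H1.ip x' x1) x)" unfolding bounded_lin_def
  proof (intro conjI ballI allI exI[of _ "H1.nm x' * H1.nm x"])
    fix x1 assume x1: "x1 \<in> H1.V"
    show "H1.nm (hscale H1 (H1.ip x' x1) x) \<le> H1.nm x' * H1.nm x * H1.nm x1"
      using mult_right_mono[OF H1.cauchy_schwarz[OF x' x1] H1.hnorm_nonneg[OF x]] x by (simp add: H1.hnorm_scale ac_simps)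
  qed (use x x' in \<open>simp_all add: H1.inner_simps H1.scale_add_left H1.scale_scale\<close>)
  then have "(\<lambda>z\<in>H.V. \<tau> x (W z)) \<in> amplification H H1 H2 \<tau>"
    by (intro amplificationI[OF bounded_lin_compose[OF H2.complex_hilbert_space_axioms W(1) bounded_lin_right[OF x]]])
      (auto simp: Wt tau_scale(2)[OF x] intro!: tau_scale(1)[OF x, symmetric])
  then show ?thesis using that W(1) Wt by blast
qed

text \<open>The commutant of \<open>B(H1) \<otimes> 1\<close> is \<open>1 \<otimes> B(H2)\<close>.
  For an \<open>R\<close> in the commutant, the amplified rank one operator carrying the unit vector
  \<open>u\<close> to \<open>x\<close> maps \<open>u \<otimes> y\<close> to
  \<open>x \<otimes> y\<close>; commuting it past \<open>R\<close> shows that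
  \<open>R (x \<otimes> y)\<close> is \<open>x \<otimes> S y\<close>, where \<open>S\<close> is the
  slice of \<open>R\<close> at \<open>u\<close> and does not depend on \<open>x\<close>.\<close>

lemma commutant_amplification:
  "commutant H (amplification H H1 H2 \<tau>) = amplification H H2 H1 (\<lambda>y x. \<tau> x y)"
proof (intro set_eqI iffI)
  interpret F: tensor_decomposition H H2 H1 "\<lambda>y x. \<tau> x y" by (rule flip)
  fix R
  {
    assume R: "R \<in> amplification H H2 H1 (\<lambda>y x. \<tau> x y)"
    obtain S' where S': "bounded_lin H H R" "R \<in> bounded_ops H" "bounded_lin H2 H2 S'"
        "\<And>x y. \<lbrakk>x \<in> H1.V; y \<in> H2.V\<rbrakk> \<Longrightarrow> R (\<tau> x y) = \<tau> x (S' y)" using F.amplificationE[OF R] by metis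
    have "R (T z) = T (R z)" if T: "T \<in> amplification H H1 H2 \<tau>" and z: "z \<in> H.V" for T z
    proof -
      obtain S where S: "bounded_lin H H T" "bounded_lin H1 H1 S"
        "\<And>x y. \<lbrakk>x \<in> H1.V; y \<in> H2.V\<rbrakk> \<Longrightarrow> T (\<tau> x y) = \<tau> (S x) y" using amplificationE[OF T] by metis
      show ?thesis
      proof (rule bounded_lin_eqI[OF H.complex_hilbert_space_axioms H.complex_hilbert_space_axioms
            bounded_lin_compose[OF H.complex_hilbert_space_axioms S(1) S'(1)]
            bounded_lin_compose[OF H.complex_hilbert_space_axioms S'(1) S(1)] total _ z])
        fix w assume "w \<in> {\<tau> x y |x y. x \<in> H1.V \<and> y \<in> H2.V}"
        then show "R (T w) = T (R w)" using S S' by (auto simp: bounded_lin_def)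
      qed
    qed
    then show "R \<in> commutant H (amplification H H1 H2 \<tau>)" using S'(2) by (auto simp: commutant_def)
  }
  {
    assume R: "R \<in> commutant H (amplification H H1 H2 \<tau>)"
    then have Rb: "R \<in> bounded_ops H" "bounded_lin H H R"
      and Rc: "\<And>T z. T \<in> amplification H H1 H2 \<tau> \<Longrightarrow> z \<in> H.V \<Longrightarrow> R (T z) = T (R z)" by (auto simp: commutant_def bounded_ops_iff)
    obtain u where u: "u \<in> H1.V" "H1.ip u u = 1" using unit1 by blast
    obtain W where W: "bounded_lin H H2 W"
      "\<And>y z. \<lbrakk>y \<in> H2.V; z \<in> H.V\<rbrakk> \<Longrightarrow> H.ip (\<tau> u y) z = H2.ip y (W z)"
      using adjoint_exists[OF H2.complex_hilbert_space_axioms H.complex_hilbert_space_axioms bounded_lin_right[OF u(1)]]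
      by metis
    define S where "S = (\<lambda>y. W (R (\<tau> u y)))"
    have S: "bounded_lin H2 H2 S" unfolding S_def by (rule bounded_lin_compose[OF H.complex_hilbert_space_axioms _ W(1)],
          rule bounded_lin_compose[OF H.complex_hilbert_space_axioms bounded_lin_right[OF u(1)] Rb(2)])
    have "R (\<tau> x y) = \<tau> x (S y)" if x: "x \<in> H1.V" and y: "y \<in> H2.V" for x y
    proof -
      obtain W' where W': "bounded_lin H H2 W'"
        "(\<lambda>z\<in>H.V. \<tau> x (W' z)) \<in> amplification H H1 H2 \<tau>"
        "\<And>x1 y. \<lbrakk>x1 \<in> H1.V; y \<in> H2.V\<rbrakk> \<Longrightarrow> W' (\<tau> x1 y) = hscale H2 (H1.ip u x1) y" using rank_one[OF x u(1)] by metis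
      \<comment> \<open>\<open>rank_one\<close> supplies its own slice map for each
        \<open>x\<close>; it has to be the slice map \<open>W\<close> at \<open>u\<close>, so that
        \<open>S\<close> is the same for all \<open>x\<close>.\<close>
      have WW: "W' z = W z" if z: "z \<in> H.V" for z
      proof (rule bounded_lin_eqI[OF H.complex_hilbert_space_axioms H2.complex_hilbert_space_axioms W'(1) W(1) total _ z])
        fix w assume "w \<in> {\<tau> x y |x y. x \<in> H1.V \<and> y \<in> H2.V}"
        then obtain x1 y1 where xy: "w = \<tau> x1 y1" "x1 \<in> H1.V" "y1 \<in> H2.V" by blast
        have "H2.ip y' (W w) = H2.ip y' (W' w)" if "y' \<in> H2.V" for y'
          using that xy u W'(3) by (simp add: W(2)[symmetric] tau_closed inner_tau H2.inner_simps)
        then show "W' w = W w" using W(1) W'(1) xy by (intro H2.weak_eqI) (auto simp: bounded_lin_def tau_closed)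
      qed
      have Rt: "R (\<tau> u y) \<in> H.V" using Rb(2) u y by (simp add: bounded_lin_def tau_closed)
      have "(\<lambda>z\<in>H.V. \<tau> x (W' z)) (\<tau> u y) = \<tau> x y" using W'(3)[OF u(1) y] u y by (simp add: tau_closed H2.scale_one)
      then have "R (\<tau> x y) = (\<lambda>z\<in>H.V. \<tau> x (W' z)) (R (\<tau> u y))" using Rc[OF W'(2) tau_closed[OF u(1) y]] by simp
      also have "\<dots> = \<tau> x (S y)" using Rt by (simp add: WW S_def)
      finally show ?thesis .
    qed
    then have "restrict R (H.V) \<in> amplification H H2 H1 (\<lambda>y x. \<tau> x y)" by (intro F.amplificationI[OF Rb(2) S]) auto
    moreover have "restrict R (H.V) = R" using Rb(1) by (auto simp: bounded_ops_iff extensional_restrict)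
    ultimately show "R \<in> amplification H H2 H1 (\<lambda>y x. \<tau> x y)" by simp
  }
qed

lemma scalar_in_amplification: "scalar_ops H \<subseteq> amplification H H1 H2 \<tau>"
proof
  fix T assume "T \<in> scalar_ops H"
  then obtain c where T: "T = (\<lambda>x\<in>H.V. hscale H c x)" by (auto simp: scalar_ops_def)
  have "bounded_lin K K (hscale K c)" if "complex_hilbert_space K" for K :: "'k hilbert"
  proof -
    interpret complex_hilbert_space K by fact
    show ?thesis
      by (auto simp: bounded_lin_def closed scale_add_right scale_scale hnorm_scale mult.commute intro!: exI[of _ "cmod c"])
  qed
  note * = this[OF H.complex_hilbert_space_axioms]
  have **: "bounded_lin H1 H1 (hscale H1 c)"
    by (auto simp: bounded_lin_def H1.closed H1.scale_add_right H1.scale_scale H1.hnorm_scale mult.commute intro!: exI[of _ "cmod c"])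
  show "T \<in> amplification H H1 H2 \<tau>" unfolding T by (rule amplificationI[OF * **]) (simp add: tau_scale)
qed

text \<open>An operator that is both \<open>S \<otimes> 1\<close> and \<open>1 \<otimes> R\<close>
  is a scalar: pairing the second leg with a unit vector \<open>v\<close> shows that
  \<open>S\<close> multiplies by \<open>\<langle>v, R v\<rangle>\<close>.\<close>

lemma amplification_Int_commutant:
  "amplification H H1 H2 \<tau> \<inter> commutant H (amplification H H1 H2 \<tau>) = scalar_ops H"
proof
  interpret F: tensor_decomposition H H2 H1 "\<lambda>y x. \<tau> x y" by (rule flip)
  show "scalar_ops H \<subseteq> amplification H H1 H2 \<tau> \<inter> commutant H (amplification H H1 H2 \<tau>)"
    using scalar_in_amplification F.scalar_in_amplification by (simp add: commutant_amplification)
  show "amplification H H1 H2 \<tau> \<inter> commutant H (amplification H H1 H2 \<tau>) \<subseteq> scalar_ops H"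
  proof
    fix T assume "T \<in> amplification H H1 H2 \<tau> \<inter> commutant H (amplification H H1 H2 \<tau>)"
    then have T: "T \<in> amplification H H1 H2 \<tau>" "T \<in> amplification H H2 H1 (\<lambda>y x. \<tau> x y)"
      by (simp_all add: commutant_amplification)
    obtain S where S: "bounded_lin H H T" "bounded_lin H1 H1 S" "T \<in> bounded_ops H"
      "\<And>x y. \<lbrakk>x \<in> H1.V; y \<in> H2.V\<rbrakk> \<Longrightarrow> T (\<tau> x y) = \<tau> (S x) y" using amplificationE[OF T(1)] by metis
    obtain R where R: "bounded_lin H2 H2 R"
      "\<And>x y. \<lbrakk>x \<in> H1.V; y \<in> H2.V\<rbrakk> \<Longrightarrow> T (\<tau> x y) = \<tau> x (R y)" using F.amplificationE[OF T(2)] by metis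
    obtain v where v: "v \<in> H2.V" "H2.ip v v = 1" using unit2 by blast
    define c where "c = H2.ip v (R v)"
    have Rv: "R v \<in> H2.V" using R(1) v by (simp add: bounded_lin_def)
    have Sx: "S x \<in> H1.V" if "x \<in> H1.V" for x using S(2) that by (simp add: bounded_lin_def)
    have "S x = hscale H1 c x" if x: "x \<in> H1.V" for x
    proof (rule H1.weak_eqI[OF Sx[OF x] H1.scale_closed[OF x]])
      fix z assume z: "z \<in> H1.V"
      have "H.ip (\<tau> z v) (\<tau> (S x) v) = H.ip (\<tau> z v) (\<tau> x (R v))" using S(4)[OF x v(1)] R(2)[OF x v(1)] by simp
      then show "H1.ip z (S x) = H1.ip z (hscale H1 c x)"
        using x z v Rv Sx by (simp add: inner_tau H1.inner_simps c_def mult.commute)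
    qed
    then have "T w = hscale H c w" if "w \<in> {\<tau> x y |x y. x \<in> H1.V \<and> y \<in> H2.V}" for w using that S(4) by (auto simp: tau_scale)
    moreover have "(\<lambda>x\<in>H.V. hscale H c x) \<in> bounded_ops H"
      using scalar_in_amplification by (auto simp: scalar_ops_def amplification_def)
    ultimately have "T = (\<lambda>x\<in>H.V. hscale H c x)"
      using S(3) by (intro bounded_op_eqI[OF H.complex_hilbert_space_axioms _ _ total]) (auto simp: tau_closed)
    then show "T \<in> scalar_ops H" by (auto simp: scalar_ops_def)
  qed
qed

lemma amplification_adjoint:
  assumes T: "T \<in> amplification H H1 H2 \<tau>"
  shows "\<exists>T'\<in>amplification H H1 H2 \<tau>. is_adjoint H T T'"
proof -
  obtain S where S: "bounded_lin H H T" "bounded_lin H1 H1 S" "T \<in> bounded_ops H"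
    "\<And>x y. \<lbrakk>x \<in> H1.V; y \<in> H2.V\<rbrakk> \<Longrightarrow> T (\<tau> x y) = \<tau> (S x) y" using amplificationE[OF T] by metis
  have Sx: "S x \<in> H1.V" if "x \<in> H1.V" for x using S(2) that by (simp add: bounded_lin_def)
  obtain S' where S': "bounded_lin H1 H1 S'"
    "\<And>x y. \<lbrakk>x \<in> H1.V; y \<in> H1.V\<rbrakk> \<Longrightarrow> H1.ip (S x) y = H1.ip x (S' y)"
    using adjoint_exists[OF H1.complex_hilbert_space_axioms H1.complex_hilbert_space_axioms S(2)] by metis
  have S'x: "S' x \<in> H1.V" if "x \<in> H1.V" for x using S'(1) that by (simp add: bounded_lin_def)
  obtain T' where T': "bounded_lin H H T'"
    "\<And>x y. \<lbrakk>x \<in> H.V; y \<in> H.V\<rbrakk> \<Longrightarrow> H.ip (T x) y = H.ip x (T' y)"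
    using adjoint_exists[OF H.complex_hilbert_space_axioms H.complex_hilbert_space_axioms S(1)] by metis
  have T'x: "T' x \<in> H.V" if "x \<in> H.V" for x using T'(1) that by (simp add: bounded_lin_def)
  have "T' (\<tau> x y) = \<tau> (S' x) y" if "x \<in> H1.V" "y \<in> H2.V" for x y
    by (rule tau_eqI) (use that T'x S'x Sx S'(2) S(4) in \<open>simp_all add: tau_closed inner_tau flip: T'(2)\<close>)
  then have "restrict T' (H.V) \<in> amplification H H1 H2 \<tau>" by (rule amplificationI[OF T'(1) S'(1)])
  moreover have "is_adjoint H T (restrict T' (H.V))" using T'(2) by (simp add: is_adjoint_def)
  ultimately show ?thesis by blast
qed

text \<open>The projection is that onto a unit vector \<open>u\<close> in the first leg, tensored
  with the identity. Compressing \<open>S \<otimes> 1\<close> by it gives the multiple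
  \<open>\<langle>u, S u\<rangle>\<close> of the projection, so all compressions commute.\<close>

lemma amplification_abelian_projection:
  "\<exists>p. abelian_projection H (amplification H H1 H2 \<tau>) p \<and> (\<exists>x\<in>H.V. p x \<noteq> hzero H)"
proof -
  obtain u where u: "u \<in> H1.V" "H1.ip u u = 1" using unit1 by blast
  obtain v where v: "v \<in> H2.V" "H2.ip v v = 1" using unit2 by blast
  obtain W where W: "bounded_lin H H2 W"
    "(\<lambda>z\<in>H.V. \<tau> u (W z)) \<in> amplification H H1 H2 \<tau>"
    "\<And>x1 y. \<lbrakk>x1 \<in> H1.V; y \<in> H2.V\<rbrakk> \<Longrightarrow> W (\<tau> x1 y) = hscale H2 (H1.ip u x1) y" using rank_one[OF u(1) u(1)] by metis
  define p where "p = (\<lambda>z\<in>H.V. \<tau> u (W z))"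
  have Wc: "W z \<in> H2.V" if "z \<in> H.V" for z using W(1) that by (simp add: bounded_lin_def)
  have pb: "p \<in> bounded_ops H" "bounded_lin H H p" using W(2) by (auto simp: amplification_def p_def bounded_ops_iff)
  have px: "p z = \<tau> u (W z)" if "z \<in> H.V" for z using that by (simp add: p_def)
  have Wu: "W (\<tau> u y) = y" if "y \<in> H2.V" for y using W(3)[OF u(1) that] u(2) that by (simp add: H2.scale_one)
  obtain p' where p': "bounded_lin H H p'"
    "\<And>x y. \<lbrakk>x \<in> H.V; y \<in> H.V\<rbrakk> \<Longrightarrow> H.ip (p x) y = H.ip x (p' y)"
    using adjoint_exists[OF H.complex_hilbert_space_axioms H.complex_hilbert_space_axioms pb(2)] by metis
  have pt: "p (\<tau> x y) = hscale H (H1.ip u x) (\<tau> u y)" if "x \<in> H1.V" "y \<in> H2.V" for x y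
    using that u by (simp add: px tau_closed W(3) tau_scale)
  have "p' w = p w" if "w \<in> {\<tau> x y |x y. x \<in> H1.V \<and> y \<in> H2.V}" for w
  proof -
    obtain x y where xy: "w = \<tau> x y" "x \<in> H1.V" "y \<in> H2.V" using \<open>w \<in> _\<close> by blast
    have "p' w \<in> H.V" "p w \<in> H.V" using p'(1) pb(2) xy by (auto simp: bounded_lin_def tau_closed)
    then show ?thesis
    proof (rule tau_eqI)
      fix x' y' assume "x' \<in> H1.V" "y' \<in> H2.V"
      then show "H.ip (\<tau> x' y') (p' w) = H.ip (\<tau> x' y') (p w)" using xy u H1.inner_commute[of u x']
        by (simp add: p'(2)[symmetric] tau_closed pt H.inner_simps inner_tau)
    qed
  qed
  then have "p' z = p z" if "z \<in> H.V" for z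
    by (rule bounded_lin_eqI[OF H.complex_hilbert_space_axioms H.complex_hilbert_space_axioms p'(1) pb(2) total _ that])
  then have adj: "is_adjoint H p p" using p'(2) by (simp add: is_adjoint_def)
  have proj: "projection_op H p" using pb(1) adj Wc u by (auto simp: projection_op_def px tau_closed Wu)
  have key: "\<exists>s. \<forall>z\<in>H.V. p (S (p z)) = hscale H s (p z)" if S: "S \<in> amplification H H1 H2 \<tau>" for S
  proof -
    obtain S1 where S1: "bounded_lin H1 H1 S1"
      "\<And>x y. \<lbrakk>x \<in> H1.V; y \<in> H2.V\<rbrakk> \<Longrightarrow> S (\<tau> x y) = \<tau> (S1 x) y" using amplificationE[OF S] by metis
    have "S1 u \<in> H1.V" using S1(1) u(1) by (simp add: bounded_lin_def)
    then show ?thesis using S1(2) u Wc by (intro exI[of _ "H1.ip u (S1 u)"]) (auto simp: px tau_closed W(3) tau_scale)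
  qed
  have "p (S (p (T (p x)))) = p (T (p (S (p x))))"
    if S: "S \<in> amplification H H1 H2 \<tau>" and T: "T \<in> amplification H H1 H2 \<tau>" and x: "x \<in> H.V" for S T x
  proof -
    obtain s where s: "\<And>z. z \<in> H.V \<Longrightarrow> p (S (p z)) = hscale H s (p z)" using key[OF S] by blast
    obtain t where t: "\<And>z. z \<in> H.V \<Longrightarrow> p (T (p z)) = hscale H t (p z)" using key[OF T] by blast
    have cl: "p z \<in> H.V" "S z \<in> H.V" "T z \<in> H.V" if "z \<in> H.V" for z
      using pb S T that by (auto simp: amplification_def bounded_ops_iff bounded_lin_def)
    have "p (S (p (T (p x)))) = hscale H s (hscale H t (p x))" using s[of "T (p x)"] x by (simp only: t[OF x] cl)
    also have "\<dots> = hscale H t (hscale H s (p x))" using x by (simp add: cl H.scale_scale mult.commute)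
    also have "\<dots> = p (T (p (S (p x))))" using t[of "S (p x)"] x by (simp only: s[OF x] cl)
    finally show ?thesis .
  qed
  then have "abelian_projection H (amplification H H1 H2 \<tau>) p" using W(2) proj by (auto simp: abelian_projection_def p_def)
  moreover have "p (\<tau> u v) \<noteq> hzero H"
    using inner_tau[OF u(1) v(1) u(1) v(1)] u v H.inner_zero_left[OF tau_closed[OF u(1) v(1)]]
    by (auto simp: px tau_closed Wu)
  ultimately show ?thesis using tau_closed[OF u(1) v(1)] by blast
qed

lemma type_I_factor_amplification: "type_I_factor H (amplification H H1 H2 \<tau>)"
proof -
  interpret F: tensor_decomposition H H2 H1 "\<lambda>y x. \<tau> x y" by (rule flip)
  show ?thesis unfolding type_I_factor_def factor_def von_neumann_algebra_def
    using amplification_Int_commutant amplification_abelian_projection amplification_adjoint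
      commutant_amplification F.commutant_amplification by (auto simp: amplification_def)
qed

text \<open>For fixed first factor the slice of \<open>z\<close> vanishes by totality of the second
  family, and then the other slice vanishes by totality of the first.\<close>

lemma total_products:
  assumes e1: "total_in H1 (e1 ` D1)" and e2: "total_in H2 (e2 ` D2)"
  shows "total_in H {\<tau> (e1 a) (e2 b) | a b. a \<in> D1 \<and> b \<in> D2}" unfolding total_in_def
proof (intro conjI ballI impI)
  have c: "\<And>a. a \<in> D1 \<Longrightarrow> e1 a \<in> H1.V" "\<And>b. b \<in> D2 \<Longrightarrow> e2 b \<in> H2.V" using e1 e2 by (auto simp: total_in_def)
  then show "{\<tau> (e1 a) (e2 b) | a b. a \<in> D1 \<and> b \<in> D2} \<subseteq> H.V" by (auto simp: tau_closed)
  fix z assume z: "z \<in> H.V" and orth: "\<forall>e\<in>{\<tau> (e1 a) (e2 b) | a b. a \<in> D1 \<and> b \<in> D2}. H.ip e z = 0"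
  have orth': "H.ip (\<tau> (e1 a) (e2 b)) z = 0" if "a \<in> D1" "b \<in> D2" for a b using orth that by blast
  have 1: "H.ip (\<tau> (e1 a) y) z = 0" if a: "a \<in> D1" and y: "y \<in> H2.V" for a y
  proof -
    obtain W where W: "bounded_lin H H2 W"
      "\<And>y z. \<lbrakk>y \<in> H2.V; z \<in> H.V\<rbrakk> \<Longrightarrow> H.ip (\<tau> (e1 a) y) z = H2.ip y (W z)"
      using adjoint_exists[OF H2.complex_hilbert_space_axioms H.complex_hilbert_space_axioms bounded_lin_right[OF c(1)[OF a]]]
      by metis
    have "W z = hzero H2" by (rule H2.total_eqI[OF e2])
        (use W(1) z orth' a c(2) in \<open>auto simp: bounded_lin_def H2.inner_simps simp flip: W(2)\<close>)
    then show ?thesis using W(2)[OF y z] y by (simp add: H2.inner_simps)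
  qed
  show "z = hzero H"
  proof (rule tau_total[OF z])
    fix x y assume x: "x \<in> H1.V" and y: "y \<in> H2.V"
    obtain W where W: "bounded_lin H H1 W"
      "\<And>x z. \<lbrakk>x \<in> H1.V; z \<in> H.V\<rbrakk> \<Longrightarrow> H.ip (\<tau> x y) z = H1.ip x (W z)"
      using adjoint_exists[OF H1.complex_hilbert_space_axioms H.complex_hilbert_space_axioms bounded_lin_left[OF y]] by metis
    have "W z = hzero H1" by (rule H1.total_eqI[OF e1])
        (use W(1) z 1 y c(1) in \<open>auto simp: bounded_lin_def H1.inner_simps simp flip: W(2)\<close>)
    then show "H.ip (\<tau> x y) z = 0" using W(2)[OF x z] x by (simp add: H1.inner_simps)
  qed
qed

text \<open>Membership in \<open>B(H1) \<otimes> 1\<close> is visible in matrix elements between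
  products of two total families: the second legs contribute their bare inner product. Conversely
  \<open>S\<close> is the slice of \<open>T\<close> at the unit vector \<open>e2 o2\<close>; the
  equation \<open>T = S \<otimes> 1\<close> holds on the products and extends by continuity first in
  the one argument and then in the other.\<close>

lemma amplification_iff:
  assumes e1: "total_in H1 (e1 ` D1)" and e2: "total_in H2 (e2 ` D2)"
    and o: "o2 \<in> D2" "H2.ip (e2 o2) (e2 o2) = 1"
  shows "T \<in> amplification H H1 H2 \<tau> \<longleftrightarrow> T \<in> bounded_ops H \<and>
    (\<forall>a\<in>D1. \<forall>a'\<in>D1. \<forall>b\<in>D2. \<forall>b'\<in>D2.
       H.ip (\<tau> (e1 a') (e2 b')) (T (\<tau> (e1 a) (e2 b))) =
       H.ip (\<tau> (e1 a') (e2 o2)) (T (\<tau> (e1 a) (e2 o2))) * H2.ip (e2 b') (e2 b))"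
    (is "?L \<longleftrightarrow> ?R")
proof
  have c: "\<And>a. a \<in> D1 \<Longrightarrow> e1 a \<in> H1.V" "\<And>b. b \<in> D2 \<Longrightarrow> e2 b \<in> H2.V" using e1 e2 by (auto simp: total_in_def)
  {
    assume ?L
    then obtain S where S: "T \<in> bounded_ops H" "bounded_lin H1 H1 S"
      "\<And>x y. \<lbrakk>x \<in> H1.V; y \<in> H2.V\<rbrakk> \<Longrightarrow> T (\<tau> x y) = \<tau> (S x) y" by (metis amplificationE)
    moreover have "S (e1 a) \<in> H1.V" if "a \<in> D1" for a using S(2) c that by (simp add: bounded_lin_def)
    ultimately show ?R using c o by (auto simp: inner_tau)
  }
  {
    assume R: ?R
    then have T: "T \<in> bounded_ops H" "bounded_lin H H T" by (auto simp: bounded_ops_iff)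
    note V = bounded_lin_left[OF c(2)[OF o(1)]]
    obtain V' where V': "bounded_lin H H1 V'"
      "\<And>x z. \<lbrakk>x \<in> H1.V; z \<in> H.V\<rbrakk> \<Longrightarrow> H.ip (\<tau> x (e2 o2)) z = H1.ip x (V' z)"
      using adjoint_exists[OF H1.complex_hilbert_space_axioms H.complex_hilbert_space_axioms V] by metis
    define S where "S = (\<lambda>x. V' (T (\<tau> x (e2 o2))))"
    have S: "bounded_lin H1 H1 S" unfolding S_def by (rule bounded_lin_compose[OF H.complex_hilbert_space_axioms _ V'(1)],
          rule bounded_lin_compose[OF H.complex_hilbert_space_axioms V T(2)])
    have Sx: "S x \<in> H1.V" if "x \<in> H1.V" for x using S that by (simp add: bounded_lin_def)
    have Tx: "T x \<in> H.V" if "x \<in> H.V" for x using T(2) that by (simp add: bounded_lin_def)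
    have 1: "T (\<tau> (e1 a) (e2 b)) = \<tau> (S (e1 a)) (e2 b)" if "a \<in> D1" "b \<in> D2" for a b
    proof (rule H.total_eqI[OF total_products[OF e1 e2]])
      fix w assume "w \<in> {\<tau> (e1 a) (e2 b) |a b. a \<in> D1 \<and> b \<in> D2}"
      then obtain a' b' where w: "w = \<tau> (e1 a') (e2 b')" "a' \<in> D1" "b' \<in> D2" by blast
      have "H.ip w (T (\<tau> (e1 a) (e2 b))) =
          H.ip (\<tau> (e1 a') (e2 o2)) (T (\<tau> (e1 a) (e2 o2))) * H2.ip (e2 b') (e2 b)" using R w that by blast
      then show "H.ip w (T (\<tau> (e1 a) (e2 b))) = H.ip w (\<tau> (S (e1 a)) (e2 b))"
        using w that c Sx Tx o by (simp add: inner_tau V'(2) tau_closed S_def)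
    qed (use that c Sx Tx in \<open>auto simp: tau_closed\<close>)
    have 2: "T (\<tau> x (e2 b)) = \<tau> (S x) (e2 b)" if x: "x \<in> H1.V" and b: "b \<in> D2" for x b
      by (rule bounded_lin_eqI[OF H1.complex_hilbert_space_axioms H.complex_hilbert_space_axioms
            bounded_lin_compose[OF H.complex_hilbert_space_axioms bounded_lin_left[OF c(2)[OF b]] T(2)]
            bounded_lin_compose[OF H1.complex_hilbert_space_axioms S bounded_lin_left[OF c(2)[OF b]]] e1 _ x])
        (use 1 b in auto)
    have 3: "T (\<tau> x y) = \<tau> (S x) y" if x: "x \<in> H1.V" and y: "y \<in> H2.V" for x y
      by (rule bounded_lin_eqI[OF H2.complex_hilbert_space_axioms H.complex_hilbert_space_axioms
            bounded_lin_compose[OF H.complex_hilbert_space_axioms bounded_lin_right[OF x] T(2)]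
            bounded_lin_right[OF Sx[OF x]] e2 _ y])
        (use 2 x in auto)
    have "restrict T (H.V) \<in> amplification H H1 H2 \<tau>" by (rule amplificationI[OF T(2) S 3])
    moreover have "restrict T (H.V) = T" using T(1) by (auto simp: bounded_ops_iff extensional_restrict)
    ultimately show ?L by simp
  }
qed

end

section \<open>Factorizations generated by multiplicative families\<close>

definition bm_on :: "'x measure \<Rightarrow> 'x set \<Rightarrow> ('x \<Rightarrow> real) set" where
  "bm_on M A = {a \<in> bounded_measurable M. \<forall>x\<in>space M - A. a x = 0}"

lemma bm_add:
  assumes "a \<in> bounded_measurable M" "b \<in> bounded_measurable M"
  shows "(\<lambda>x. r * a x + s * b x) \<in> bounded_measurable M"
proof -
  obtain C D where C: "\<forall>x\<in>space M. \<bar>a x\<bar> \<le> C" and D: "\<forall>x\<in>space M. \<bar>b x\<bar> \<le> D"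
    using assms by (auto simp: bounded_measurable_def)
  have "\<bar>r * a x + s * b x\<bar> \<le> \<bar>r\<bar> * C + \<bar>s\<bar> * D" if "x \<in> space M" for x
  proof -
    have "\<bar>r * a x + s * b x\<bar> \<le> \<bar>r\<bar> * \<bar>a x\<bar> + \<bar>s\<bar> * \<bar>b x\<bar>" by (metis abs_mult abs_triangle_ineq)
    also have "\<dots> \<le> \<bar>r\<bar> * C + \<bar>s\<bar> * D" using C D that by (intro add_mono mult_left_mono) auto
    finally show ?thesis .
  qed
  then show ?thesis using assms by (auto simp: bounded_measurable_def)
qed

lemma bm_plus:
  "\<lbrakk>a \<in> bounded_measurable M; b \<in> bounded_measurable M\<rbrakk> \<Longrightarrow> (\<lambda>x. a x + b x) \<in> bounded_measurable M"
  using bm_add[of a M b 1 1] by simp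

lemma bm_const: "(\<lambda>x. c) \<in> bounded_measurable M" by (auto simp: bounded_measurable_def)

lemma bm_If:
  assumes "A \<in> sets M" "a \<in> bounded_measurable M"
  shows "(\<lambda>x. if x \<in> A then a x else 0) \<in> bounded_measurable M"
    "(\<lambda>x. if x \<in> A then 0 else a x) \<in> bounded_measurable M"
proof -
  obtain C where "\<forall>x\<in>space M. \<bar>a x\<bar> \<le> C" using assms by (auto simp: bounded_measurable_def)
  then have "\<forall>x\<in>space M. \<bar>if x \<in> A then a x else 0\<bar> \<le> \<bar>C\<bar>" "\<forall>x\<in>space M. \<bar>if x \<in> A then 0 else a x\<bar> \<le> \<bar>C\<bar>" by auto
  moreover have "{x\<in>space M. x \<in> A} \<in> sets M" using assms(1) by (simp add: Collect_conj_eq)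
  ultimately show "(\<lambda>x. if x \<in> A then a x else 0) \<in> bounded_measurable M"
    "(\<lambda>x. if x \<in> A then 0 else a x) \<in> bounded_measurable M"
    using assms unfolding bounded_measurable_def by (auto intro!: measurable_If exI[of _ "\<bar>C\<bar>"])
qed

text \<open>The criterion of \<open>amplification_iff\<close> with \<open>e (a + b)\<close> in the
  place of \<open>e a \<otimes> e b\<close> and with \<open>e 0\<close> as the unit vector. No
  tensor product occurs in it any more, so it can be compared across different realizations.\<close>

definition exp_alg :: "'x measure \<Rightarrow> 'v hilbert \<Rightarrow> (('x \<Rightarrow> real) \<Rightarrow> 'v) \<Rightarrow> 'x set \<Rightarrow> ('v \<Rightarrow> 'v) set" where
  "exp_alg M H e A = {T \<in> bounded_ops H.
     \<forall>a\<in>bm_on M A. \<forall>a'\<in>bm_on M A. \<forall>b\<in>bm_on M (space M - A). \<forall>b'\<in>bm_on M (space M - A).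
       hinner H (e (\<lambda>x. a' x + b' x)) (T (e (\<lambda>x. a x + b x))) = hinner H (e a') (T (e a)) * hinner H (e b') (e b)}"

locale exp_system = complex_hilbert_space H for H :: "'v hilbert" +
  fixes M :: "'x measure" and e :: "('x \<Rightarrow> real) \<Rightarrow> 'v"
  assumes e_total: "total_in H (e ` bounded_measurable M)"
    and e_AE: "\<lbrakk>a \<in> bounded_measurable M; b \<in> bounded_measurable M; AE x in M. a x = b x\<rbrakk> \<Longrightarrow> e a = e b"
    and e_mult: "\<lbrakk>A \<in> sets M; a \<in> bm_on M A; a' \<in> bm_on M A; b \<in> bm_on M (space M - A); b' \<in> bm_on M (space M - A)\<rbrakk> \<Longrightarrow>
      hinner H (e (\<lambda>x. a' x + b' x)) (e (\<lambda>x. a x + b x)) = hinner H (e a') (e a) * hinner H (e b') (e b)"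
    and e_unit: "hinner H (e (\<lambda>x. 0)) (e (\<lambda>x. 0)) = 1"
begin

lemma e_closed: "a \<in> bounded_measurable M \<Longrightarrow> e a \<in> V" using e_total by (auto simp: total_in_def)

lemma exp_algD:
  "\<lbrakk>T \<in> exp_alg M H e A; a \<in> bm_on M A; a' \<in> bm_on M A; b \<in> bm_on M (space M - A); b' \<in> bm_on M (space M - A)\<rbrakk> \<Longrightarrow>
    ip (e (\<lambda>x. a' x + b' x)) (T (e (\<lambda>x. a x + b x))) = ip (e a') (T (e a)) * ip (e b') (e b)" by (simp add: exp_alg_def)

lemma bm_on_split:
  assumes "A \<in> sets M" "B \<in> sets M" "a \<in> bm_on M A"
  shows "(\<lambda>x. if x \<in> B then a x else 0) \<in> bm_on M (A \<inter> B)"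
    "(\<lambda>x. if x \<in> B then 0 else a x) \<in> bm_on M (A - B)" using assms bm_If[of B M a] by (auto simp: bm_on_def)

lemma bm_on_mono: "A \<inter> space M \<subseteq> B \<Longrightarrow> bm_on M A \<subseteq> bm_on M B" by (auto simp: bm_on_def)

lemma bm_on_plus: "\<lbrakk>a \<in> bm_on M A; b \<in> bm_on M A\<rbrakk> \<Longrightarrow> (\<lambda>x. a x + b x) \<in> bm_on M A" by (auto simp: bm_on_def bm_plus)

text \<open>A function on \<open>B\<close> is cut into its parts \<open>p\<close> on
  \<open>A\<close> and \<open>q\<close> on \<open>B - A\<close>. Membership for \<open>A\<close>
  moves the \<open>q\<close> parts to the side on which \<open>T\<close> does not act, and there
  \<open>e_mult\<close> separates them from \<open>b\<close>.\<close>

lemma exp_alg_mono: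
  assumes "A \<in> sets M" "B \<in> sets M" "A \<subseteq> B"
  shows "exp_alg M H e A \<subseteq> exp_alg M H e B"
proof
  fix T assume T: "T \<in> exp_alg M H e A"
  have "ip (e (\<lambda>x. a' x + b' x)) (T (e (\<lambda>x. a x + b x))) = ip (e a') (T (e a)) * ip (e b') (e b)"
    if a: "a \<in> bm_on M B" and a': "a' \<in> bm_on M B" and b: "b \<in> bm_on M (space M - B)" and b': "b' \<in> bm_on M (space M - B)"
    for a a' b b'
  proof -
    define p where "p f = (\<lambda>x. if x \<in> A then f x else (0::real))" for f
    define q where "q f = (\<lambda>x. if x \<in> A then 0 else (f x::real))" for f
    have p: "p a \<in> bm_on M A" "p a' \<in> bm_on M A"
      using bm_on_split(1)[OF assms(2,1) a] bm_on_split(1)[OF assms(2,1) a'] assms(3) by (simp_all add: p_def Int_absorb1)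
    have q: "q a \<in> bm_on M (space M - A)" "q a' \<in> bm_on M (space M - A)"
      and qB: "q a \<in> bm_on M B" "q a' \<in> bm_on M B"
      using bm_on_split(2)[OF assms(2,1) a] bm_on_split(2)[OF assms(2,1) a'] bm_on_mono[of "B - A" "space M - A"]
        bm_on_mono[of "B - A" B] by (auto simp: q_def)
    have bA: "b \<in> bm_on M (space M - A)" "b' \<in> bm_on M (space M - A)"
      using b b' bm_on_mono[of "space M - B" "space M - A"] assms(3) by auto
    have split: "f = (\<lambda>x. p f x + q f x)" for f by (auto simp: p_def q_def)
    have split2: "(\<lambda>x. f x + g x) = (\<lambda>x. p f x + (q f x + g x))" for f g by (auto simp: p_def q_def)
    have "ip (e (\<lambda>x. a' x + b' x)) (T (e (\<lambda>x. a x + b x))) =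
        ip (e (p a')) (T (e (p a))) * ip (e (\<lambda>x. q a' x + b' x)) (e (\<lambda>x. q a x + b x))"
      unfolding split2[of a] split2[of a'] by (intro exp_algD[OF T] p bm_on_plus q bA)
    also have "ip (e (\<lambda>x. q a' x + b' x)) (e (\<lambda>x. q a x + b x)) = ip (e (q a')) (e (q a)) * ip (e b') (e b)"
      by (rule e_mult[OF assms(2) qB b b'])
    also have "ip (e (p a')) (T (e (p a))) * (ip (e (q a')) (e (q a)) * ip (e b') (e b)) =
        (ip (e (p a')) (T (e (p a))) * ip (e (q a')) (e (q a))) * ip (e b') (e b)" by simp
    also have "ip (e (p a')) (T (e (p a))) * ip (e (q a')) (e (q a)) = ip (e a') (T (e a))"
      using exp_algD[OF T p q] split[of a] split[of a'] by simp
    finally show ?thesis .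
  qed
  then show "T \<in> exp_alg M H e B" using T by (simp add: exp_alg_def)
qed

text \<open>A function \<open>b\<close> living off \<open>A \<inter> B\<close> is cut along
  \<open>A\<close>. The part off \<open>A\<close> is split away by membership for \<open>A\<close>,
  and the remaining part lies in \<open>A\<close> but off \<open>B\<close>, so membership for
  \<open>B\<close> splits it away. Finally \<open>e_mult\<close> reunites the two.\<close>

lemma exp_alg_Int:
  assumes A: "A \<in> sets M" and B: "B \<in> sets M"
  shows "exp_alg M H e (A \<inter> B) = exp_alg M H e A \<inter> exp_alg M H e B"
proof
  show "exp_alg M H e (A \<inter> B) \<subseteq> exp_alg M H e A \<inter> exp_alg M H e B"
    using exp_alg_mono[of "A \<inter> B" A] exp_alg_mono[of "A \<inter> B" B] assms by auto
  show "exp_alg M H e A \<inter> exp_alg M H e B \<subseteq> exp_alg M H e (A \<inter> B)"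
  proof
    fix T assume "T \<in> exp_alg M H e A \<inter> exp_alg M H e B"
    then have T: "T \<in> exp_alg M H e A" "T \<in> exp_alg M H e B" by auto
    have "ip (e (\<lambda>x. a' x + b' x)) (T (e (\<lambda>x. a x + b x))) = ip (e a') (T (e a)) * ip (e b') (e b)"
      if a: "a \<in> bm_on M (A \<inter> B)" and a': "a' \<in> bm_on M (A \<inter> B)"
        and b: "b \<in> bm_on M (space M - A \<inter> B)" and b': "b' \<in> bm_on M (space M - A \<inter> B)" for a a' b b'
    proof -
      define p where "p f = (\<lambda>x. if x \<in> A then f x else (0::real))" for f
      define q where "q f = (\<lambda>x. if x \<in> A then 0 else (f x::real))" for f
      have C: "space M - A \<inter> B \<in> sets M" using assms by auto
      have aA: "a \<in> bm_on M A" "a' \<in> bm_on M A" and aB: "a \<in> bm_on M B" "a' \<in> bm_on M B"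
        using a a' bm_on_mono[of "A \<inter> B" A] bm_on_mono[of "A \<inter> B" B] by auto
      have pA: "p b \<in> bm_on M A" "p b' \<in> bm_on M A"
        and pB: "p b \<in> bm_on M (space M - B)" "p b' \<in> bm_on M (space M - B)"
        using bm_on_split(1)[OF C A b] bm_on_split(1)[OF C A b'] bm_on_mono[of "(space M - A \<inter> B) \<inter> A" A]
          bm_on_mono[of "(space M - A \<inter> B) \<inter> A" "space M - B"] by (auto simp: p_def)
      have q: "q b \<in> bm_on M (space M - A)" "q b' \<in> bm_on M (space M - A)"
        using bm_on_split(2)[OF C A b] bm_on_split(2)[OF C A b'] bm_on_mono[of "(space M - A \<inter> B) - A" "space M - A"]
        by (auto simp: q_def)
      have split: "f = (\<lambda>x. p f x + q f x)" for f by (auto simp: p_def q_def)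
      have split2: "(\<lambda>x. g x + f x) = (\<lambda>x. (g x + p f x) + q f x)" for f g by (auto simp: p_def q_def)
      have "ip (e (\<lambda>x. a' x + b' x)) (T (e (\<lambda>x. a x + b x))) =
          ip (e (\<lambda>x. a' x + p b' x)) (T (e (\<lambda>x. a x + p b x))) * ip (e (q b')) (e (q b))"
        unfolding split2[of _ b] split2[of _ b'] by (intro exp_algD[OF T(1)] aA bm_on_plus q pA)
      also have "ip (e (\<lambda>x. a' x + p b' x)) (T (e (\<lambda>x. a x + p b x))) =
          ip (e a') (T (e a)) * ip (e (p b')) (e (p b))" by (intro exp_algD[OF T(2)] aB pB)
      also have "ip (e a') (T (e a)) * ip (e (p b')) (e (p b)) * ip (e (q b')) (e (q b)) =
          ip (e a') (T (e a)) * ip (e b') (e b)" using e_mult[OF A pA q] split[of b] split[of b'] by simp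
      finally show ?thesis .
    qed
    then show "T \<in> exp_alg M H e (A \<inter> B)" using T by (simp add: exp_alg_def)
  qed
qed

text \<open>Functions adapted to \<open>B\<close> are cut along \<open>A\<close>. This changes them
  on a null set only, which \<open>e\<close> does not notice.\<close>

lemma exp_alg_mod0:
  assumes "(A, B) \<in> mod0 M"
  shows "exp_alg M H e A = exp_alg M H e B"
proof -
  have *: "exp_alg M H e A \<subseteq> exp_alg M H e B" if AB: "(A, B) \<in> mod0 M" for A B
  proof
    fix T assume T: "T \<in> exp_alg M H e A"
    have A: "A \<in> sets M" and B: "B \<in> sets M" and z: "sym_diff A B \<in> null_sets M"
      using AB by (auto simp: mod0_def null_sets_def)
    define p where "p f = (\<lambda>x. if x \<in> A then f x else (0::real))" for f
    define q where "q f = (\<lambda>x. if x \<in> A then 0 else (f x::real))" for f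
    have ae: "AE x in M. x \<in> A \<longleftrightarrow> x \<in> B" using AE_not_in[OF z] by eventually_elim auto
    have pp: "p a \<in> bm_on M A" "AE x in M. a x = p a x" "a \<in> bounded_measurable M" "p a \<in> bounded_measurable M"
      if "a \<in> bm_on M B" for a
    proof -
      show "p a \<in> bm_on M A" using bm_on_split(1)[OF B A that] bm_on_mono[of "B \<inter> A" A] by (auto simp: p_def)
      show "AE x in M. a x = p a x" using ae AE_space by eventually_elim (use that in \<open>auto simp: p_def bm_on_def\<close>)
    qed (use that A bm_If in \<open>auto simp: bm_on_def p_def\<close>)
    have qq: "q b \<in> bm_on M (space M - A)" "AE x in M. b x = q b x" "b \<in> bounded_measurable M" "q b \<in> bounded_measurable M"
      if "b \<in> bm_on M (space M - B)" for b
    proof -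
      show "q b \<in> bm_on M (space M - A)" using that bm_If(2)[OF A] by (auto simp: q_def bm_on_def)
      show "AE x in M. b x = q b x" using ae AE_space by eventually_elim (use that in \<open>auto simp: q_def bm_on_def\<close>)
    qed (use that A bm_If in \<open>auto simp: bm_on_def q_def\<close>)
    have "ip (e (\<lambda>x. a' x + b' x)) (T (e (\<lambda>x. a x + b x))) = ip (e a') (T (e a)) * ip (e b') (e b)"
      if a: "a \<in> bm_on M B" and a': "a' \<in> bm_on M B" and b: "b \<in> bm_on M (space M - B)" and b': "b' \<in> bm_on M (space M - B)"
      for a a' b b'
    proof -
      have 1: "e (\<lambda>x. a x + b x) = e (\<lambda>x. p a x + q b x)" if "a \<in> bm_on M B" "b \<in> bm_on M (space M - B)" for a b
        by (rule e_AE) (use pp(2-4)[OF that(1)] qq(2-4)[OF that(2)] in \<open>auto intro: bm_plus\<close>)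
      have 2: "e a = e (p a)" if "a \<in> bm_on M B" for a by (rule e_AE) (use pp[OF that] in auto)
      have 3: "e b = e (q b)" if "b \<in> bm_on M (space M - B)" for b by (rule e_AE) (use qq[OF that] in auto)
      show ?thesis unfolding 1[OF a b] 1[OF a' b'] 2[OF a] 2[OF a'] 3[OF b] 3[OF b']
        by (rule exp_algD[OF T pp(1)[OF a] pp(1)[OF a'] qq(1)[OF b] qq(1)[OF b']])
    qed
    then show "T \<in> exp_alg M H e B" using T by (simp add: exp_alg_def)
  qed
  have "(B, A) \<in> mod0 M" using assms by (auto simp: mod0_def Un_commute)
  then show ?thesis using *[OF assms] * by blast
qed

text \<open>Members of \<open>bm_on M {}\<close> vanish on the space but are arbitrary outside of
  it, hence the appeal to almost everywhere equality.\<close>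

lemma e_null:
  assumes "a \<in> bm_on M {}" "b \<in> bounded_measurable M"
  shows "e a = e (\<lambda>x. 0)" "e (\<lambda>x. a x + b x) = e b" "e (\<lambda>x. b x + a x) = e b"
  using assms by (auto simp: bm_on_def bm_const bm_plus intro!: e_AE)

text \<open>With no room for \<open>a\<close>, the condition says that the matrix elements of
  \<open>T\<close> are those of the identity times the vacuum expectation \<open>c\<close>. Totality
  then gives \<open>T = c\<close>.\<close>

lemma exp_alg_empty: "exp_alg M H e {} = scalar_ops H"
proof (intro set_eqI iffI)
  fix T
  have z: "(\<lambda>x. 0) \<in> bm_on M {}" by (simp add: bm_on_def bm_const)
  have bm: "bm_on M (space M - {}) = bounded_measurable M" "bm_on M (space M) = bounded_measurable M"
    by (auto simp: bm_on_def)
  have sc: "(\<lambda>x\<in>V. hscale H c x) \<in> bounded_ops H" for c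
    by (auto simp: bounded_ops_iff bounded_lin_def closed scale_add_right scale_scale hnorm_scale mult.commute intro!: exI[of _ "cmod c"])
  {
    assume T: "T \<in> exp_alg M H e {}"
    then have Tb: "T \<in> bounded_ops H" "bounded_lin H H T" by (auto simp: exp_alg_def bounded_ops_iff)
    define c where "c = ip (e (\<lambda>x. 0)) (T (e (\<lambda>x. 0)))"
    have "T (e b) = hscale H c (e b)" if b: "b \<in> bounded_measurable M" for b
    proof (rule total_eqI[OF e_total])
      show "T (e b) \<in> V" using Tb(2) e_closed[OF b] by (simp add: bounded_lin_def)
      fix w assume "w \<in> e ` bounded_measurable M"
      then obtain b' where w: "w = e b'" "b' \<in> bounded_measurable M" by blast
      then show "ip w (T (e b)) = ip w (hscale H c (e b))"
        using exp_algD[OF T z z, of b b'] b e_closed by (simp add: bm c_def inner_simps)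
    qed (use e_closed[OF b] in \<open>simp add: closed\<close>)
    then have "T = (\<lambda>x\<in>V. hscale H c x)"
      by (intro bounded_op_eqI[OF complex_hilbert_space_axioms Tb(1) sc e_total]) (auto simp: e_closed)
    then show "T \<in> scalar_ops H" by (auto simp: scalar_ops_def)
  }
  {
    assume "T \<in> scalar_ops H"
    then obtain c where T: "T = (\<lambda>x\<in>V. hscale H c x)" by (auto simp: scalar_ops_def)
    show "T \<in> exp_alg M H e {}"
      unfolding exp_alg_def bm T using e_null sc e_unit by (auto simp: e_closed bm_const inner_simps)
  }
qed

lemma exp_alg_space: "exp_alg M H e (space M) = bounded_ops H" using e_null e_unit by (auto simp: exp_alg_def bm_on_def)

text \<open>Unions reduce to intersections by de Morgan's law: the commutant of a union of sets of
  operators is the intersection of the commutants, and commutants correspond to complements.\<close>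

theorem hilbert_factorization_exp_alg:
  assumes eq: "\<And>A. A \<in> sets M \<Longrightarrow> \<xi> A = exp_alg M H e A"
    and type_I: "\<And>A. A \<in> sets M \<Longrightarrow> type_I_factor H (\<xi> A)"
    and compl: "\<And>A. A \<in> sets M \<Longrightarrow> \<xi> (space M - A) = commutant H (\<xi> A)"
  shows "hilbert_factorization M H \<xi>"
proof -
  have comm_Un: "commutant H (X \<union> Y) = commutant H X \<inter> commutant H Y" for X Y by (auto simp: commutant_def)
  have "\<xi> (A \<union> B) = commutant H (commutant H (\<xi> A \<union> \<xi> B))" if A: "A \<in> sets M" and B: "B \<in> sets M" for A B
  proof -
    have "commutant H (\<xi> A \<union> \<xi> B) = exp_alg M H e ((space M - A) \<inter> (space M - B))"
      unfolding comm_Un compl[OF A, symmetric] compl[OF B, symmetric] using A B by (simp add: eq exp_alg_Int)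
    also have "(space M - A) \<inter> (space M - B) = space M - (A \<union> B)" by blast
    finally have "commutant H (commutant H (\<xi> A \<union> \<xi> B)) = \<xi> (space M - (space M - (A \<union> B)))"
      using A B by (simp add: eq[symmetric] compl)
    moreover have "space M - (space M - (A \<union> B)) = A \<union> B"
      using sets.sets_into_space[OF A] sets.sets_into_space[OF B] by blast
    ultimately show ?thesis by simp
  qed
  moreover have "\<forall>(A, B)\<in>mod0 M. \<xi> A = \<xi> B" using exp_alg_mod0 eq by (auto simp: mod0_def)
  ultimately show ?thesis unfolding hilbert_factorization_def
    using complex_hilbert_space_axioms eq type_I compl exp_alg_Int exp_alg_empty exp_alg_space by auto
qed

end

text \<open>The defining condition mentions only inner products and matrix elements between the
  vectors \<open>e a\<close>, and the unitary operator preserves both.\<close>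

lemma conjugate_exp_alg:
  assumes H: "complex_hilbert_space H" and K: "complex_hilbert_space K" and T: "hilbert_iso H K T"
    and e: "\<And>a. a \<in> bounded_measurable M \<Longrightarrow> e a \<in> hcarrier H"
    and f: "\<And>a. a \<in> bounded_measurable M \<Longrightarrow> T (e a) = f a"
  shows "conjugate_op H K T ` exp_alg M H e A = exp_alg M K f A"
proof -
  interpret K: complex_hilbert_space K by fact
  interpret H: complex_hilbert_space H by fact
  define T' where "T' = inv_into (hcarrier H) T"
  note inj = hilbert_iso_inj[OF H K T]
  have img: "T ` hcarrier H = hcarrier K" using T by (simp add: hilbert_iso_def)
  have Tc: "T x \<in> hcarrier K" if "x \<in> hcarrier H" for x using img that by blast
  have T'c: "T' y \<in> hcarrier H" "T (T' y) = y" if "y \<in> hcarrier K" for y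
    using that img by (auto simp: T'_def inv_into_into f_inv_into_f)
  have T'T: "T' (T x) = x" if "x \<in> hcarrier H" for x using inj that by (simp add: T'_def)
  have Tin: "hinner K (T x) (T y) = hinner H x y" if "x \<in> hcarrier H" "y \<in> hcarrier H" for x y
    by (rule hilbert_iso_inner[OF H K T that])
  have blT: "bounded_lin H K T" using T Tc by (auto simp: bounded_lin_def hilbert_iso_def intro!: exI[of _ 1])
  have blT': "bounded_lin K H T'" unfolding bounded_lin_def
  proof (intro conjI ballI allI exI[of _ 1])
    fix x y assume xy: "x \<in> hcarrier K" "y \<in> hcarrier K"
    have "T (hadd H (T' x) (T' y)) = hadd K x y" using blT T'c xy by (auto simp: bounded_lin_def)
    then show "T' (hadd K x y) = hadd H (T' x) (T' y)" using T'T[of "hadd H (T' x) (T' y)"] T'c xy by (simp add: H.closed)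
  next
    fix c x assume x: "x \<in> hcarrier K"
    have "T (hscale H c (T' x)) = hscale K c x" using blT T'c x by (auto simp: bounded_lin_def)
    then show "T' (hscale K c x) = hscale H c (T' x)" using T'T[of "hscale H c (T' x)"] T'c x by (simp add: H.closed)
  next
    fix x assume x: "x \<in> hcarrier K"
    then show "hnorm H (T' x) \<le> 1 * hnorm K x" using T T'c[OF x] by (force simp: hilbert_iso_def)
  qed (use T'c in auto)
  have bm: "(\<lambda>x. a x + b x) \<in> bounded_measurable M" "a \<in> bounded_measurable M"
    if "a \<in> bm_on M A" "b \<in> bm_on M B" for a b and A B :: "'c set" using that by (auto simp: bm_on_def bm_plus)
  show ?thesis
  proof (intro set_eqI iffI)
    fix Y assume "Y \<in> conjugate_op H K T ` exp_alg M H e A"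
    then obtain X where X: "X \<in> exp_alg M H e A" "Y = conjugate_op H K T X" by blast
    then have Xb: "bounded_lin H H X" by (simp add: exp_alg_def bounded_ops_iff)
    have Xc: "X x \<in> hcarrier H" if "x \<in> hcarrier H" for x using Xb that by (simp add: bounded_lin_def)
    have Y: "Y = (\<lambda>y\<in>hcarrier K. T (X (T' y)))" using X(2) by (simp add: conjugate_op_def T'_def)
    have "bounded_lin K K (\<lambda>y. T (X (T' y)))" by (rule bounded_lin_compose[OF H bounded_lin_compose[OF H blT' Xb] blT])
    then have Yb: "Y \<in> bounded_ops K" unfolding Y by (auto simp: bounded_ops_iff bounded_lin_def K.closed)
    have *: "hinner K (T (e a)) (Y (T (e b))) = hinner H (e a) (X (e b))"
      if "a \<in> bounded_measurable M" "b \<in> bounded_measurable M" for a b using that Tc e Xc by (simp add: Y T'T Tin)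
    show "Y \<in> exp_alg M K f A" using X(1) Yb by (auto simp: exp_alg_def * bm bm[where b="\<lambda>_. 0"] Tin e simp flip: f)
  next
    fix Y assume Y: "Y \<in> exp_alg M K f A"
    then have Yb: "bounded_lin K K Y" "Y \<in> extensional (hcarrier K)" by (auto simp: exp_alg_def bounded_ops_iff)
    have Yc: "Y x \<in> hcarrier K" if "x \<in> hcarrier K" for x using Yb that by (simp add: bounded_lin_def)
    define X where "X = (\<lambda>x\<in>hcarrier H. T' (Y (T x)))"
    have "bounded_lin H H (\<lambda>x. T' (Y (T x)))" by (rule bounded_lin_compose[OF K bounded_lin_compose[OF K blT Yb(1)] blT'])
    then have Xb: "X \<in> bounded_ops H" unfolding X_def by (auto simp: bounded_ops_iff bounded_lin_def H.closed)
    have YX: "Y = conjugate_op H K T X" by (rule extensionalityI[of _ "hcarrier K"])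
        (use Yb(2) Yc T'c Tc in \<open>auto simp: conjugate_op_def X_def simp flip: T'_def\<close>)
    have *: "hinner K (T (e a)) (Y (T (e b))) = hinner H (e a) (X (e b))"
      if "a \<in> bounded_measurable M" "b \<in> bounded_measurable M" for a b using that Tc e Yc T'c by (simp add: X_def flip: Tin)
    have "X \<in> exp_alg M H e A" using Y Xb by (auto simp: exp_alg_def * bm bm[where b="\<lambda>_. 0"] Tin e simp flip: f)
    then show "Y \<in> conjugate_op H K T ` exp_alg M H e A" using YX by blast
  qed
qed

section \<open>Square integrable functions with values in a separable Hilbert space\<close>

locale separable_hilbert = complex_hilbert_space H for H :: "'v hilbert" +
  assumes countable_onb: "\<exists>B. orthonormal_basis H B \<and> countable B"
begin

text \<open>Parseval's identity over a countable basis writes the inner product as a pointwise limit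
  of sums of products of coordinates, and these are measurable by weak measurability.\<close>

lemma borel_measurable_inner:
  assumes fc: "\<And>x. x \<in> space M \<Longrightarrow> f x \<in> V" and gc: "\<And>x. x \<in> space M \<Longrightarrow> g x \<in> V"
    and f: "\<And>h. h \<in> V \<Longrightarrow> (\<lambda>x. ip h (f x)) \<in> borel_measurable M"
    and g: "\<And>h. h \<in> V \<Longrightarrow> (\<lambda>x. ip h (g x)) \<in> borel_measurable M"
  shows "(\<lambda>x. ip (f x) (g x)) \<in> borel_measurable M"
proof -
  obtain B where B: "orthonormal_basis H B" "countable B" using countable_onb by blast
  have BH: "b \<in> V" if "b \<in> B" for b using B that by (auto simp: orthonormal_basis_def)
  \<comment> \<open>The basis may be finite; the numbers that enumerate no basis vector contribute
    zero.\<close>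
  define t where "t n x = (if n \<in> to_nat_on B ` B then ip (f x) (from_nat_into B n) * ip (from_nat_into B n) (g x) else 0)" for n x
  have sums: "(\<lambda>n. t n x) sums ip (f x) (g x)" if x: "x \<in> space M" for x
  proof (rule has_sum_imp_sums)
    have "((\<lambda>n. ip (f x) (from_nat_into B n) * ip (from_nat_into B n) (g x)) \<circ> to_nat_on B has_sum ip (f x) (g x)) B"
      using parseval[OF B(1) fc[OF x] gc[OF x]] B(2) by (simp add: o_def cong: has_sum_cong)
    then have "((\<lambda>n. ip (f x) (from_nat_into B n) * ip (from_nat_into B n) (g x)) has_sum ip (f x) (g x)) (to_nat_on B ` B)"
      using B(2) by (subst has_sum_reindex) auto
    then show "((\<lambda>n. t n x) has_sum ip (f x) (g x)) UNIV"
      by (rule has_sum_cong_neutral[THEN iffD1, rotated -1]) (auto simp: t_def)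
  qed
  have tm: "t n \<in> borel_measurable M" for n
  proof (cases "n \<in> to_nat_on B ` B")
    case True
    then have b: "from_nat_into B n \<in> V" using BH B(2) by auto
    have "(\<lambda>x. cnj (ip (from_nat_into B n) (f x)) * ip (from_nat_into B n) (g x)) \<in> borel_measurable M"
      using f[OF b] g[OF b] by (intro borel_measurable_times borel_measurable_continuous_on[of cnj]) (auto intro!: continuous_intros)
    moreover have "t n x = cnj (ip (from_nat_into B n) (f x)) * ip (from_nat_into B n) (g x)" if "x \<in> space M" for x
      using True inner_commute[OF b fc[OF that]] by (simp add: t_def)
    ultimately show ?thesis by (simp cong: measurable_cong)
  next
    case False
    then have "t n = (\<lambda>x. 0)" by (auto simp: t_def fun_eq_iff)
    then show ?thesis by simp
  qed
  show ?thesis by (rule borel_measurable_LIMSEQ_metric[of "\<lambda>N x. \<Sum>n<N. t n x"]) (use tm sums in \<open>auto simp: sums_def\<close>)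
qed

end

locale L2_space = separable_hilbert H + finite_measure M for H :: "'v hilbert" and M :: "'x measure"
begin

abbreviation "LF \<equiv> L2_functions M H"
abbreviation "cls \<equiv> L2_class M H"

lemma LF_closed: "f \<in> LF \<Longrightarrow> x \<in> space M \<Longrightarrow> f x \<in> V"
  and LF_measurable: "f \<in> LF \<Longrightarrow> h \<in> V \<Longrightarrow> (\<lambda>x. ip h (f x)) \<in> borel_measurable M"
  and LF_integrable_norm: "f \<in> LF \<Longrightarrow> integrable M (\<lambda>x. (nm (f x))^2)" by (auto simp: L2_functions_def)

lemma LF_measurable_inner: "f \<in> LF \<Longrightarrow> g \<in> LF \<Longrightarrow> (\<lambda>x. ip (f x) (g x)) \<in> borel_measurable M"
  by (rule borel_measurable_inner) (auto simp: L2_functions_def)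

lemma LF_bounded:
  assumes "\<And>x. x \<in> space M \<Longrightarrow> f x \<in> V"
    and m: "\<And>h. h \<in> V \<Longrightarrow> (\<lambda>x. ip h (f x)) \<in> borel_measurable M"
    and g: "integrable M g" "\<And>x. x \<in> space M \<Longrightarrow> (nm (f x))^2 \<le> g x"
  shows "f \<in> LF"
proof -
  have "(\<lambda>x. Re (ip (f x) (f x))) \<in> borel_measurable M" using borel_measurable_inner[OF assms(1,1) m m] by simp
  moreover have "Re (ip (f x) (f x)) = (nm (f x))^2" if "x \<in> space M" for x using assms(1)[OF that] by (simp add: hnorm_sq)
  ultimately have "(\<lambda>x. (nm (f x))^2) \<in> borel_measurable M" by (simp cong: measurable_cong)
  then have "integrable M (\<lambda>x. (nm (f x))^2)"
    by (rule Bochner_Integration.integrable_bound[OF g(1)]) (use g(2) in \<open>auto intro!: AE_I2 order_trans[OF _ abs_ge_self]\<close>)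
  then show ?thesis using assms(1) m by (simp add: L2_functions_def)
qed

lemma LF_zero: "(\<lambda>x. hzero H) \<in> LF"
  by (rule LF_bounded[where g="\<lambda>_. 0"]) (auto simp: closed inner_simps hnorm_eq_0 hnorm_eq_0[THEN iffD2])

lemma LF_add:
  assumes f: "f \<in> LF" and g: "g \<in> LF"
  shows "(\<lambda>x. hadd H (f x) (g x)) \<in> LF"
proof (rule LF_bounded)
  show "integrable M (\<lambda>x. 2 * (nm (f x))^2 + 2 * (nm (g x))^2)"
    using f g by (auto intro!: integrable_add integrable_mult_right LF_integrable_norm)
  show "(nm (hadd H (f x) (g x)))^2 \<le> 2 * (nm (f x))^2 + 2 * (nm (g x))^2" if "x \<in> space M" for x
    using hnorm_add_sq[of "f x" "g x"] hnorm_sub_sq[of "f x" "g x"] LF_closed[OF f that] LF_closed[OF g that]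
      zero_le_power2[of "nm (hsub H (f x) (g x))"] by linarith
  fix h assume h: "h \<in> V"
  have "(\<lambda>x. ip h (f x) + ip h (g x)) \<in> borel_measurable M" using LF_measurable[OF f h] LF_measurable[OF g h] by simp
  then show "(\<lambda>x. ip h (hadd H (f x) (g x))) \<in> borel_measurable M"
    by (rule measurable_cong[THEN iffD1, rotated]) (use h f g in \<open>simp add: inner_simps LF_closed\<close>)
qed (use f g in \<open>simp add: LF_closed closed\<close>)

lemma LF_scale:
  assumes f: "f \<in> LF"
  shows "(\<lambda>x. hscale H c (f x)) \<in> LF"
proof (rule LF_bounded)
  show "integrable M (\<lambda>x. (cmod c)^2 * (nm (f x))^2)" using f by (auto intro!: integrable_mult_right LF_integrable_norm)
  show "(nm (hscale H c (f x)))^2 \<le> (cmod c)^2 * (nm (f x))^2" if "x \<in> space M" for x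
    using LF_closed[OF f that] by (simp add: hnorm_scale power_mult_distrib)
  fix h assume h: "h \<in> V"
  have "(\<lambda>x. c * ip h (f x)) \<in> borel_measurable M" using LF_measurable[OF f h] by simp
  then show "(\<lambda>x. ip h (hscale H c (f x))) \<in> borel_measurable M"
    by (rule measurable_cong[THEN iffD1, rotated]) (use h f in \<open>simp add: inner_simps LF_closed\<close>)
qed (use f in \<open>simp add: LF_closed closed\<close>)

lemma LF_integrable_inner:
  assumes f: "f \<in> LF" and g: "g \<in> LF"
  shows "integrable M (\<lambda>x. ip (f x) (g x))"
proof (rule Bochner_Integration.integrable_bound)
  show "integrable M (\<lambda>x. (nm (f x))^2 + (nm (g x))^2)" using f g by (auto intro!: integrable_add LF_integrable_norm)
  show "(\<lambda>x. ip (f x) (g x)) \<in> borel_measurable M" by (rule LF_measurable_inner[OF f g])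
  show "AE x in M. norm (ip (f x) (g x)) \<le> norm ((nm (f x))^2 + (nm (g x))^2)"
  proof (rule AE_I2)
    fix x assume x: "x \<in> space M"
    have "cmod (ip (f x) (g x)) \<le> nm (f x) * nm (g x)" by (rule cauchy_schwarz) (use f g x LF_closed in auto)
    also have "\<dots> \<le> (nm (f x))^2 + (nm (g x))^2"
      using sum_squares_bound[of "nm (f x)" "nm (g x)"] hnorm_nonneg[OF LF_closed[OF f x]] hnorm_nonneg[OF LF_closed[OF g x]]
        mult_nonneg_nonneg[of "nm (f x)" "nm (g x)"] by linarith
    finally show "norm (ip (f x) (g x)) \<le> norm ((nm (f x))^2 + (nm (g x))^2)" by simp
  qed
qed

lemma rep_cls:
  assumes f: "f \<in> LF"
  shows "rep (cls f) \<in> LF" "AE x in M. f x = rep (cls f) x"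
proof -
  have "f \<in> cls f" using f by (simp add: L2_class_def)
  then have "rep (cls f) \<in> cls f" unfolding rep_def by (rule someI[of "\<lambda>g. g \<in> cls f"])
  then show "rep (cls f) \<in> LF" "AE x in M. f x = rep (cls f) x" by (simp_all add: L2_class_def)
qed

lemma cls_eqI: "AE x in M. f x = g x \<Longrightarrow> cls f = cls g" unfolding L2_class_def
proof (intro Collect_cong conj_cong refl)
  fix h assume ae: "AE x in M. f x = g x"
  show "(AE x in M. f x = h x) = (AE x in M. g x = h x)" using ae by (auto elim: eventually_elim2)
qed

lemma carrier_L2: "hcarrier (L2 M H) = cls ` LF" by (simp add: L2_def)

lemma cls_carrier: "f \<in> LF \<Longrightarrow> cls f \<in> hcarrier (L2 M H)" by (simp add: carrier_L2)

lemma rep_carrier: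
  assumes "u \<in> hcarrier (L2 M H)"
  shows "rep u \<in> LF" "cls (rep u) = u"
proof -
  obtain f where f: "f \<in> LF" "u = cls f" using assms by (auto simp: carrier_L2)
  then show "rep u \<in> LF" using rep_cls by simp
  show "cls (rep u) = u" using rep_cls(2)[OF f(1)] f by (auto intro!: cls_eqI elim: eventually_mono)
qed

lemma L2_add:
  assumes "f \<in> LF" "g \<in> LF"
  shows "hadd (L2 M H) (cls f) (cls g) = cls (\<lambda>x. hadd H (f x) (g x))"
  unfolding L2_def using rep_cls(2)[OF assms(1)] rep_cls(2)[OF assms(2)] by (auto intro!: cls_eqI elim: eventually_elim2)

lemma L2_scale:
  assumes "f \<in> LF"
  shows "hscale (L2 M H) c (cls f) = cls (\<lambda>x. hscale H c (f x))" unfolding L2_def using rep_cls(2)[OF assms]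
  by (auto intro!: cls_eqI elim: eventually_mono)

lemma L2_inner:
  assumes "f \<in> LF" "g \<in> LF"
  shows "hinner (L2 M H) (cls f) (cls g) = (\<integral>x. ip (f x) (g x) \<partial>M)"
proof -
  have "(\<integral>x. ip (rep (cls f) x) (rep (cls g) x) \<partial>M) = (\<integral>x. ip (f x) (g x) \<partial>M)"
    using rep_cls[OF assms(1)] rep_cls[OF assms(2)] assms
    by (intro integral_cong_AE LF_measurable_inner) (auto elim: eventually_elim2)
  then show ?thesis by (simp add: L2_def)
qed

lemma L2_zero: "hzero (L2 M H) = cls (\<lambda>x. hzero H)" by (simp add: L2_def)

lemma LF_sub: "f \<in> LF \<Longrightarrow> g \<in> LF \<Longrightarrow> (\<lambda>x. hsub H (f x) (g x)) \<in> LF" by (intro LF_add LF_scale)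

lemma L2_norm_sq:
  assumes f: "f \<in> LF"
  shows "(hnorm (L2 M H) (cls f))^2 = (\<integral>x. (nm (f x))^2 \<partial>M)"
    and "hinner (L2 M H) (cls f) (cls f) = of_real (\<integral>x. (nm (f x))^2 \<partial>M)"
proof -
  have "(\<integral>x. ip (f x) (f x) \<partial>M) = (\<integral>x. of_real ((nm (f x))^2) \<partial>M)"
    by (intro Bochner_Integration.integral_cong refl) (use f LF_closed inner_self in auto)
  also have "\<dots> = of_real (\<integral>x. (nm (f x))^2 \<partial>M)" by (rule integral_complex_of_real)
  finally show 1: "hinner (L2 M H) (cls f) (cls f) = of_real (\<integral>x. (nm (f x))^2 \<partial>M)" by (simp add: L2_inner[OF f f])
  then show "(hnorm (L2 M H) (cls f))^2 = (\<integral>x. (nm (f x))^2 \<partial>M)" by (simp add: hnorm_def)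
qed

lemma L2_dist_sq:
  assumes f: "f \<in> LF" and g: "g \<in> LF"
  shows "(hdist (L2 M H) (cls f) (cls g))^2 = (\<integral>x. (hdist H (f x) (g x))^2 \<partial>M)"
  unfolding hdist_def using L2_norm_sq(1)[OF LF_sub[OF f g]] f g by (simp add: L2_add L2_scale LF_scale)

lemma L2_dist_nonneg: "f \<in> LF \<Longrightarrow> g \<in> LF \<Longrightarrow> 0 \<le> hdist (L2 M H) (cls f) (cls g)"
  unfolding hdist_def using L2_norm_sq(2)[OF LF_sub[of f g]] by (simp add: L2_add L2_scale LF_scale hnorm_def)

lemma LF_integrable_dist:
  assumes f: "f \<in> LF" and g: "g \<in> LF"
  shows "integrable M (\<lambda>x. (hdist H (f x) (g x))^2)" using LF_integrable_norm[OF LF_sub[OF f g]] by (simp add: hdist_def)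

lemma dist_borel:
  assumes f: "f \<in> LF" and g: "g \<in> LF"
  shows "(\<lambda>x. hdist H (f x) (g x)) \<in> borel_measurable M"
proof -
  have "(\<lambda>x. sqrt ((hdist H (f x) (g x))^2)) \<in> borel_measurable M"
    using borel_measurable_integrable[OF LF_integrable_dist[OF f g]] by (rule measurable_compose[OF _ borel_measurable_sqrt])
  then show ?thesis by (rule measurable_cong[THEN iffD1, rotated]) (use f g in \<open>simp add: LF_closed hdist_nonneg\<close>)
qed

text \<open>The argument of Riesz and Fischer: a rapidly convergent subsequence has summable steps
  almost everywhere, hence converges pointwise in the complete space \<open>H\<close>, and Fatou's
  lemma shows that the pointwise limit is the limit in norm.\<close>

lemma L2_complete:
  assumes u: "\<And>n::nat. u n \<in> hcarrier (L2 M H)"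
    and cauchy: "\<And>e. 0 < e \<Longrightarrow> \<exists>N. \<forall>m\<ge>N. \<forall>n\<ge>N. hdist (L2 M H) (u m) (u n) < e"
  shows "\<exists>v\<in>hcarrier (L2 M H). (\<lambda>n. hdist (L2 M H) (u n) v) \<longlonglongrightarrow> 0"
proof -
  define f where "f n = rep (u n)" for n
  have f: "f n \<in> LF" "u n = cls (f n)" for n using rep_carrier[OF u[of n]] by (simp_all add: f_def)
  have fc: "f n x \<in> V" if "x \<in> space M" for n x using LF_closed[OF f(1) that] .
  have D: "(\<integral>x. (hdist H (f m x) (f n x))^2 \<partial>M) = (hdist (L2 M H) (u m) (u n))^2" for m n
    using L2_dist_sq[OF f(1) f(1)] by (simp add: f(2))
  have Dn: "0 \<le> hdist (L2 M H) (u m) (u n)" for m n using L2_dist_nonneg[OF f(1) f(1)] by (simp add: f(2))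
  have "\<exists>N. \<forall>m\<ge>N. \<forall>n\<ge>N. hdist (L2 M H) (u m) (u n) < (1/2)^j" for j :: nat by (rule cauchy) simp
  then obtain N where N: "\<And>j m n. \<lbrakk>m \<ge> N j; n \<ge> N j\<rbrakk> \<Longrightarrow> hdist (L2 M H) (u m) (u n) < (1/2)^j" by metis
  \<comment> \<open>The partial sums make the indices monotone while staying above every threshold
    \<open>N j\<close>; the summand \<open>j\<close> makes them tend to infinity.\<close>
  define k where "k j = j + (\<Sum>i\<le>j. N i)" for j
  have kN: "N j \<le> k j" for j by (simp add: k_def trans_le_add2 member_le_sum)
  have kmono: "k i \<le> k j" if "i \<le> j" for i j unfolding k_def using that by (intro add_mono sum_mono2) auto
  have kj: "j \<le> k j" for j by (simp add: k_def)
  define F where "F j = f (k j)" for j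
  have F: "F j \<in> LF" and Fc: "x \<in> space M \<Longrightarrow> F j x \<in> V" for j x using f(1) fc by (simp_all add: F_def)
  define d where "d j x = hdist H (F j x) (F (Suc j) x)" for j x
  have dm[measurable]: "d j \<in> borel_measurable M" for j unfolding d_def by (rule dist_borel[OF F F])
  have d0: "0 \<le> d j x" if "x \<in> space M" for j x using Fc[OF that] by (simp add: d_def hdist_nonneg)
  have dint: "(\<integral>\<^sup>+x. ennreal (d j x) \<partial>M) \<le> ennreal ((1/2)^j * (measure M (space M) + 1))" for j
  proof -
    \<comment> \<open>This trades the square integrals, which are at most \<open>(1/4)^j\<close>,
      for integrals of the steps themselves that are summable over \<open>j\<close>, since the
      measure is finite. It is the positivity of \<open>(2^j * d - 1)^2 + 2^j * d\<close>.\<close>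
    have le: "d j x \<le> (1/2)^j + 2^j * (d j x)^2" for x
    proof -
      have "0 \<le> (1/2)^j * ((2^j * d j x - 1)^2 + (2^j * d j x))" if "d j x \<ge> 0" using that by simp
      moreover have "(1/2)^j * ((2^j * d j x - 1)^2 + (2^j * d j x)) = (1/2)^j + 2^j * (d j x)^2 - d j x"
        by (simp add: power2_eq_square algebra_simps power_divide)
      ultimately show ?thesis by (cases "d j x \<ge> 0") (auto intro: order_trans[of _ 0])
    qed
    have int: "integrable M (\<lambda>x. (1/2)^j + 2^j * (d j x)^2)"
      using LF_integrable_dist[OF F F, of j "Suc j"] by (auto simp: d_def)
    have "(\<integral>\<^sup>+x. ennreal (d j x) \<partial>M) \<le> (\<integral>\<^sup>+x. ennreal ((1/2)^j + 2^j * (d j x)^2) \<partial>M)"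
      by (intro nn_integral_mono ennreal_leI le)
    also have "\<dots> = ennreal (\<integral>x. (1/2)^j + 2^j * (d j x)^2 \<partial>M)" by (rule nn_integral_eq_integral[OF int]) simp
    also have "(\<integral>x. (1/2)^j + 2^j * (d j x)^2 \<partial>M) = (1/2)^j * measure M (space M) + 2^j * (hdist (L2 M H) (u (k j)) (u (k (Suc j))))^2"
      using LF_integrable_dist[OF F F, of j "Suc j"] D[of "k j" "k (Suc j)"] by (simp add: d_def F_def)
    also have "\<dots> \<le> (1/2)^j * measure M (space M) + 2^j * ((1/2)^j)^2"
      using N[of j "k j" "k (Suc j)"] kN[of j] kmono[of j "Suc j"]
      by (intro add_left_mono mult_left_mono power_mono Dn less_imp_le) auto
    also have "\<dots> = (1/2)^j * (measure M (space M) + 1)"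
      by (simp add: power2_eq_square algebra_simps power_divide add_divide_distrib)
    finally show ?thesis by (simp add: ennreal_leI)
  qed
  define S where "S = {x\<in>space M. (\<Sum>j. ennreal (d j x)) < top}"
  have Sm: "S \<in> sets M" unfolding S_def by measurable
  have "(\<integral>\<^sup>+x. (\<Sum>j. ennreal (d j x)) \<partial>M) = (\<Sum>j. \<integral>\<^sup>+x. ennreal (d j x) \<partial>M)" by (rule nn_integral_suminf) measurable
  also have "\<dots> \<le> (\<Sum>j. ennreal ((1/2)^j * (measure M (space M) + 1)))" by (rule suminf_le) (use dint in auto)
  also have "\<dots> < top"
  proof -
    have "summable (\<lambda>j. (1/2::real)^j * (measure M (space M) + 1))" by (intro summable_mult2 summable_geometric) simp
    then show ?thesis by (subst suminf_ennreal_eq[OF _ summable_sums]) auto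
  qed
  finally have "AE x in M. (\<Sum>j. ennreal (d j x)) \<noteq> top"
    using nn_integral_PInf_AE[of "\<lambda>x. \<Sum>j. ennreal (d j x)" M] by (simp add: less_top)
  then have AES: "AE x in M. x \<in> S" using AE_space by eventually_elim (auto simp: S_def top.not_eq_extremum)
  have "\<exists>z\<in>V. hconv H (\<lambda>j. F j x) z" if x: "x \<in> S" for x
  proof (rule complete)
    have xs: "x \<in> space M" using x by (simp add: S_def)
    show "F n x \<in> V" for n by (rule Fc[OF xs])
    have sm: "summable (\<lambda>j. d j x)" using x d0[OF xs] by (intro summable_suminf_not_top) (auto simp: S_def)
    have tri: "hdist H (F m x) (F (m + i) x) \<le> (\<Sum>j\<in>{m..<m+i}. d j x)" for m i
    proof (induction i)
      case 0
      then show ?case by (simp add: hdist_zero Fc[OF xs])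
    next
      case (Suc i)
      then show ?case
        using hdist_triangle[OF Fc[OF xs, of m] Fc[OF xs, of "m + i"] Fc[OF xs, of "Suc (m + i)"]] by (simp add: d_def)
    qed
    fix e :: real assume "0 < e"
    then obtain N where N: "\<And>m n. m \<ge> N \<Longrightarrow> norm (\<Sum>j\<in>{m..<n}. d j x) < e" using sm unfolding summable_Cauchy by blast
    have *: "hdist H (F m x) (F n x) < e" if "m \<ge> N" "m \<le> n" for m n
      using tri[of m "n - m"] N[OF that(1), of n] that(2) by auto
    have "hdist H (F m x) (F n x) < e" if "m \<ge> N" "n \<ge> N" for m n
      using *[of m n] *[of n m] that hdist_commute[OF Fc[OF xs] Fc[OF xs], of m n] by (cases "m \<le> n") auto
    then show "\<exists>N. \<forall>m\<ge>N. \<forall>n\<ge>N. hdist H (F m x) (F n x) < e" by blast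
  qed
  then obtain G0 where G0: "\<And>x. x \<in> S \<Longrightarrow> G0 x \<in> V" "\<And>x. x \<in> S \<Longrightarrow> hconv H (\<lambda>j. F j x) (G0 x)" by metis
  define G where "G x = (if x \<in> S then G0 x else hzero H)" for x
  have Gc: "G x \<in> V" for x using G0 by (simp add: G_def closed)
  have Gm: "(\<lambda>x. ip h (G x)) \<in> borel_measurable M" if h: "h \<in> V" for h
  proof (rule borel_measurable_LIMSEQ_metric)
    have "(\<lambda>x. if x \<in> S then ip h (F j x) else 0) \<in> borel_measurable M" for j
      using LF_measurable[OF F h] Sm by (intro measurable_If_set) auto
    then show "(\<lambda>x. if x \<in> S then ip h (F j x) else 0) \<in> borel_measurable M" for j .
    fix x assume xs: "x \<in> space M"
    show "(\<lambda>j. if x \<in> S then ip h (F j x) else 0) \<longlonglongrightarrow> ip h (G x)"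
      using inner_tendsto_right[OF h Fc[OF xs] G0(1,2)] h by (simp add: G_def inner_simps)
  qed
  \<comment> \<open>Fatou's lemma along the subsequence \<open>F\<close>, for which \<open>G\<close>
    is the pointwise limit almost everywhere.\<close>
  have fatou: "(\<integral>\<^sup>+x. ennreal ((hdist H (f n x) (G x))^2) \<partial>M) \<le> ennreal (e^2)"
    if n: "\<And>m. m \<ge> n \<Longrightarrow> hdist (L2 M H) (u n) (u m) < e" for n e
  proof -
    have e: "e \<ge> 0" using n[of n] Dn[of n n] by simp
    have "(\<integral>\<^sup>+x. ennreal ((hdist H (f n x) (G x))^2) \<partial>M) = (\<integral>\<^sup>+x. liminf (\<lambda>j. ennreal ((hdist H (f n x) (F j x))^2)) \<partial>M)"
    proof (rule nn_integral_cong_AE)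
      show "AE x in M. ennreal ((hdist H (f n x) (G x))^2) = liminf (\<lambda>j. ennreal ((hdist H (f n x) (F j x))^2))" using AES
      proof eventually_elim
        fix x assume x: "x \<in> S"
        then have xs: "x \<in> space M" by (simp add: S_def)
        have "(\<lambda>j. (hdist H (f n x) (F j x))^2) \<longlonglongrightarrow> (hdist H (f n x) (G0 x))^2"
          unfolding hdist_sq[OF fc[OF xs] Fc[OF xs]] hdist_sq[OF fc[OF xs] G0(1)[OF x]]
          by (intro tendsto_intros inner_tendsto_right hnorm_tendsto fc[OF xs] Fc[OF xs] G0[OF x])
        then have "(\<lambda>j. ennreal ((hdist H (f n x) (F j x))^2)) \<longlonglongrightarrow> ennreal ((hdist H (f n x) (G x))^2)"
          using x by (intro tendsto_ennrealI) (simp add: G_def)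
        from lim_imp_Liminf[OF _ this]
        show "ennreal ((hdist H (f n x) (G x))^2) = liminf (\<lambda>j. ennreal ((hdist H (f n x) (F j x))^2))" by simp
      qed
    qed
    also have "\<dots> \<le> liminf (\<lambda>j. \<integral>\<^sup>+x. ennreal ((hdist H (f n x) (F j x))^2) \<partial>M)"
      using dist_borel[OF f(1) F] by (intro nn_integral_liminf) simp
    also have "\<dots> \<le> limsup (\<lambda>j. \<integral>\<^sup>+x. ennreal ((hdist H (f n x) (F j x))^2) \<partial>M)" by (rule Liminf_le_Limsup) simp
    also have "\<dots> \<le> ennreal (e^2)"
    proof (rule Limsup_bounded)
      show "\<forall>\<^sub>F j in sequentially. (\<integral>\<^sup>+x. ennreal ((hdist H (f n x) (F j x))^2) \<partial>M) \<le> ennreal (e^2)"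
      proof (intro eventually_sequentiallyI[of n])
        fix j assume "n \<le> j"
        then have "hdist (L2 M H) (u n) (u (k j)) < e" using n kj[of j] by simp
        then have "(hdist (L2 M H) (u n) (u (k j)))^2 \<le> e^2" using Dn by (intro power_mono) auto
        moreover have "(\<integral>\<^sup>+x. ennreal ((hdist H (f n x) (F j x))^2) \<partial>M) = ennreal (\<integral>x. (hdist H (f n x) (F j x))^2 \<partial>M)"
          by (rule nn_integral_eq_integral[OF LF_integrable_dist[OF f(1) F]]) simp
        ultimately show "(\<integral>\<^sup>+x. ennreal ((hdist H (f n x) (F j x))^2) \<partial>M) \<le> ennreal (e^2)"
          using D[of n "k j"] by (simp add: F_def ennreal_leI)
      qed
    qed
    finally show ?thesis .
  qed
  have G: "G \<in> LF"
  proof -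
    \<comment> \<open>Fatou's lemma controls the difference from one member of the sequence, so
      square integrability is first shown for that difference and then carried over to
      \<open>G\<close>.\<close>
    define fG where "fG x = hsub H (f (N 0) x) (G x)" for x
    have 1: "x \<in> space M \<Longrightarrow> fG x \<in> V" for x by (simp add: fG_def closed fc Gc)
    have 2: "(\<lambda>x. ip h (fG x)) \<in> borel_measurable M" if h: "h \<in> V" for h
    proof -
      have "(\<lambda>x. ip h (f (N 0) x) - ip h (G x)) \<in> borel_measurable M" using LF_measurable[OF f(1) h] Gm[OF h] by simp
      then show ?thesis by (rule measurable_cong[THEN iffD1, rotated]) (simp add: fG_def inner_simps h fc Gc)
    qed
    have m: "(\<lambda>x. (nm (fG x))^2) \<in> borel_measurable M"
    proof -
      have "(\<lambda>x. Re (ip (fG x) (fG x))) \<in> borel_measurable M" using borel_measurable_inner[OF 1 1 2 2] by simp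
      then show ?thesis by (rule measurable_cong[THEN iffD1, rotated]) (simp add: 1 hnorm_sq)
    qed
    have "(\<integral>\<^sup>+x. ennreal ((nm (fG x))^2) \<partial>M) \<le> ennreal (1^2)"
      using fatou[of "N 0" 1] N[of 0 "N 0"] by (simp add: hdist_def fG_def)
    then have "integrable M (\<lambda>x. (nm (fG x))^2)" using m by (intro integrableI_bounded) (auto simp: le_less_trans)
    then have fG: "fG \<in> LF" using 1 2 by (simp add: L2_functions_def)
    have "(\<lambda>x. hsub H (f (N 0) x) (fG x)) \<in> LF" by (rule LF_sub[OF f(1) fG])
    moreover have "hsub H (f (N 0) x) (fG x) = G x" if "x \<in> space M" for x
      by (rule weak_eqI) (use that Gc fc[OF that] in \<open>simp_all add: fG_def inner_simps\<close>)
    ultimately show ?thesis by (auto simp: L2_functions_def Gc Gm cong: Bochner_Integration.integrable_cong)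
  qed
  have "(\<lambda>n. hdist (L2 M H) (u n) (cls G)) \<longlonglongrightarrow> 0"
  proof (rule LIMSEQ_I)
    fix r :: real assume r: "0 < r"
    obtain N' where N': "\<And>m n. \<lbrakk>m \<ge> N'; n \<ge> N'\<rbrakk> \<Longrightarrow> hdist (L2 M H) (u m) (u n) < r/2" using cauchy[of "r/2"] r by auto
    have "norm (hdist (L2 M H) (u n) (cls G) - 0) < r" if n: "n \<ge> N'" for n
    proof -
      have "(\<integral>\<^sup>+x. ennreal ((hdist H (f n x) (G x))^2) \<partial>M) \<le> ennreal ((r/2)^2)" using N' n by (intro fatou) auto
      then have "ennreal (\<integral>x. (hdist H (f n x) (G x))^2 \<partial>M) \<le> ennreal ((r/2)^2)"
        using nn_integral_eq_integral[OF LF_integrable_dist[OF f(1) G, of n]] by simp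
      then have "(hdist (L2 M H) (u n) (cls G))^2 \<le> (r/2)^2"
        using L2_dist_sq[OF f(1)[of n] G] by (simp only: f(2) ennreal_le_iff zero_le_power2)
      then have "hdist (L2 M H) (u n) (cls G) \<le> r/2" by (rule power2_le_imp_le) (use r in simp)
      moreover have "0 \<le> hdist (L2 M H) (u n) (cls G)" using L2_dist_nonneg[OF f(1)[of n] G] by (simp only: f(2))
      ultimately show ?thesis using r by simp
    qed
    then show "\<exists>no. \<forall>n\<ge>no. norm (hdist (L2 M H) (u n) (cls G) - 0) < r" by blast
  qed
  then show ?thesis using cls_carrier[OF G] by blast
qed

lemma carrierE:
  assumes "u \<in> hcarrier (L2 M H)"
  obtains f where "f \<in> LF" "u = cls f" using assms by (auto simp: carrier_L2)

theorem hilbert_L2: "complex_hilbert_space (L2 M H)"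
proof
  note cl = LF_zero LF_add LF_scale
  note ops = L2_zero L2_add L2_scale L2_inner
  show "hzero (L2 M H) \<in> hcarrier (L2 M H)" by (simp add: ops cls_carrier cl)
  fix x assume "x \<in> hcarrier (L2 M H)"
  then obtain f where f: "f \<in> LF" "x = cls f" by (rule carrierE)
  show "hscale (L2 M H) c x \<in> hcarrier (L2 M H)" for c using f by (simp add: ops cls_carrier cl)
  show "hadd (L2 M H) (hzero (L2 M H)) x = x" using f by (auto simp: ops cl add_zero LF_closed intro!: cls_eqI)
  show "hadd (L2 M H) x (hscale (L2 M H) (- 1) x) = hzero (L2 M H)"
    using f by (auto simp: ops cl add_inverse LF_closed intro!: cls_eqI)
  show "hscale (L2 M H) 1 x = x" using f by (auto simp: ops cl scale_one LF_closed intro!: cls_eqI)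
  show "hscale (L2 M H) c (hscale (L2 M H) d x) = hscale (L2 M H) (c * d) x" for c d
    using f by (auto simp: ops cl scale_scale LF_closed intro!: cls_eqI)
  show "hscale (L2 M H) (c + d) x = hadd (L2 M H) (hscale (L2 M H) c x) (hscale (L2 M H) d x)" for c d
    using f by (auto simp: ops cl scale_add_left LF_closed intro!: cls_eqI)
  show "0 \<le> Re (hinner (L2 M H) x x)" using f by (simp add: L2_norm_sq(2))
  show "x = hzero (L2 M H)" if "hinner (L2 M H) x x = 0"
  proof -
    have "(\<integral>x. (nm (f x))^2 \<partial>M) = 0" using that f by (simp add: L2_norm_sq(2))
    then have "AE x in M. (nm (f x))^2 = 0"
      using LF_integrable_norm[OF f(1)] by (subst (asm) integral_nonneg_eq_0_iff_AE) auto
    then have "AE x in M. f x = hzero H" using AE_space by eventually_elim (simp add: hnorm_eq_0 LF_closed[OF f(1)])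
    then show ?thesis using f by (auto simp: L2_zero intro!: cls_eqI)
  qed
  fix y assume "y \<in> hcarrier (L2 M H)"
  then obtain g where g: "g \<in> LF" "y = cls g" by (rule carrierE)
  show "hadd (L2 M H) x y \<in> hcarrier (L2 M H)" using f g by (simp add: ops cls_carrier cl)
  show "hadd (L2 M H) x y = hadd (L2 M H) y x" using f g by (auto simp: ops cl add_commute LF_closed intro!: cls_eqI)
  show "hscale (L2 M H) c (hadd (L2 M H) x y) = hadd (L2 M H) (hscale (L2 M H) c x) (hscale (L2 M H) c y)" for c
    using f g by (auto simp: ops cl scale_add_right LF_closed intro!: cls_eqI)
  show "hinner (L2 M H) x (hscale (L2 M H) c y) = c * hinner (L2 M H) x y" for c
  proof -
    have "(\<integral>z. ip (f z) (hscale H c (g z)) \<partial>M) = (\<integral>z. c * ip (f z) (g z) \<partial>M)"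
      by (intro Bochner_Integration.integral_cong refl) (use f g in \<open>simp add: inner_simps LF_closed\<close>)
    then show ?thesis using f g by (simp add: ops cl)
  qed
  show "hinner (L2 M H) y x = cnj (hinner (L2 M H) x y)"
  proof -
    have "(\<integral>z. ip (g z) (f z) \<partial>M) = (\<integral>z. cnj (ip (f z) (g z)) \<partial>M)"
      by (intro Bochner_Integration.integral_cong refl inner_commute) (use f g in \<open>simp_all add: LF_closed\<close>)
    then show ?thesis using f g by (simp add: ops cl)
  qed
  fix z assume "z \<in> hcarrier (L2 M H)"
  then obtain h where h: "h \<in> LF" "z = cls h" by (rule carrierE)
  show "hadd (L2 M H) (hadd (L2 M H) x y) z = hadd (L2 M H) x (hadd (L2 M H) y z)"
    using f g h by (auto simp: ops cl add_assoc LF_closed intro!: cls_eqI)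
  show "hinner (L2 M H) x (hadd (L2 M H) y z) = hinner (L2 M H) x y + hinner (L2 M H) x z"
  proof -
    have "(\<integral>w. ip (f w) (hadd H (g w) (h w)) \<partial>M) = (\<integral>w. ip (f w) (g w) + ip (f w) (h w) \<partial>M)"
      by (intro Bochner_Integration.integral_cong refl) (use f g h in \<open>simp add: inner_simps LF_closed\<close>)
    then show ?thesis using f g h by (simp add: ops cl LF_integrable_inner)
  qed
qed (rule L2_complete)

end

lemma separable_complex: "separable_hilbert complex_as_hilbert"
proof
  let ?C = complex_as_hilbert
  show "\<exists>B. orthonormal_basis ?C B \<and> countable B"
    by (rule exI[of _ "{1}"]) (simp add: orthonormal_basis_def complex_as_hilbert_def)
  fix u :: "nat \<Rightarrow> complex"
  assume c: "\<And>e. 0 < e \<Longrightarrow> \<exists>N. \<forall>m\<ge>N. \<forall>n\<ge>N. hdist ?C (u m) (u n) < e"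
  have d: "hdist ?C x y = cmod (x - y)" for x y
  proof -
    have "cnj (x - y) * (x - y) = of_real ((cmod (x - y))^2)"
      by (simp add: complex_norm_square mult.commute del: of_real_power)
    then show ?thesis by (simp add: hdist_def hnorm_def complex_as_hilbert_def del: complex_cnj_diff)
  qed
  have "Cauchy u" using c unfolding d Cauchy_def dist_norm by blast
  then obtain x where "u \<longlonglongrightarrow> x" using Cauchy_convergent convergent_def by blast
  then have "(\<lambda>n. hdist ?C (u n) x) \<longlonglongrightarrow> 0" unfolding d by (simp add: LIM_zero_iff tendsto_norm_zero_iff)
  then show "\<exists>x\<in>hcarrier ?C. (\<lambda>n. hdist ?C (u n) x) \<longlonglongrightarrow> 0" by (auto simp: complex_as_hilbert_def)
qed (auto simp: complex_as_hilbert_def algebra_simps)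

lemma L2_functions_complex:
  "L2_functions M complex_as_hilbert = {f \<in> borel_measurable M. integrable M (\<lambda>x. (cmod (f x))^2)}"
proof -
  have n: "hnorm complex_as_hilbert x = cmod x" for x
    by (simp add: hnorm_def complex_as_hilbert_def cmod_def power2_eq_square)
  have "(\<forall>h. (\<lambda>x. cnj h * f x) \<in> borel_measurable M) \<longleftrightarrow> f \<in> borel_measurable M" for f :: "'a \<Rightarrow> complex"
  proof
    assume "\<forall>h. (\<lambda>x. cnj h * f x) \<in> borel_measurable M"
    then have "(\<lambda>x. cnj 1 * f x) \<in> borel_measurable M" by (rule spec)
    then show "f \<in> borel_measurable M" by simp
  qed simp
  then show ?thesis unfolding L2_functions_def n by (simp add: complex_as_hilbert_def)
qed

text \<open>Renames the elements along an injection. This is how the one-particle space gets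
  elements of the type \<open>nat \<Rightarrow> complex\<close>.\<close>

definition transport_hilbert :: "'v hilbert \<Rightarrow> ('v \<Rightarrow> 'w) \<Rightarrow> 'w hilbert" where
  "transport_hilbert H \<phi> = (let \<psi> = inv_into (hcarrier H) \<phi> in
     \<lparr>hcarrier = \<phi> ` hcarrier H, hzero = \<phi> (hzero H), hadd = (\<lambda>u v. \<phi> (hadd H (\<psi> u) (\<psi> v))),
      hscale = (\<lambda>c u. \<phi> (hscale H c (\<psi> u))), hinner = (\<lambda>u v. hinner H (\<psi> u) (\<psi> v))\<rparr>)"

lemma transport_hilbert:
  assumes H: "complex_hilbert_space H" and inj: "inj_on \<phi> (hcarrier H)"
  shows "complex_hilbert_space (transport_hilbert H \<phi>)"
    and "x \<in> hcarrier H \<Longrightarrow> y \<in> hcarrier H \<Longrightarrow> hinner (transport_hilbert H \<phi>) (\<phi> x) (\<phi> y) = hinner H x y"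
    and "orthonormal_basis H B \<Longrightarrow> orthonormal_basis (transport_hilbert H \<phi>) (\<phi> ` B)"
proof -
  interpret complex_hilbert_space H by fact
  let ?K = "transport_hilbert H \<phi>"
  have inv: "inv_into (hcarrier H) \<phi> (\<phi> x) = x" if "x \<in> hcarrier H" for x using inj that by simp
  have ops: "hcarrier ?K = \<phi> ` hcarrier H" "hzero ?K = \<phi> (hzero H)"
    "\<And>x y. \<lbrakk>x \<in> hcarrier H; y \<in> hcarrier H\<rbrakk> \<Longrightarrow> hadd ?K (\<phi> x) (\<phi> y) = \<phi> (hadd H x y)"
    "\<And>x c. x \<in> hcarrier H \<Longrightarrow> hscale ?K c (\<phi> x) = \<phi> (hscale H c x)"
    "\<And>x y. \<lbrakk>x \<in> hcarrier H; y \<in> hcarrier H\<rbrakk> \<Longrightarrow> hinner ?K (\<phi> x) (\<phi> y) = hinner H x y"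
    by (simp_all add: transport_hilbert_def Let_def inv)
  have dist: "hdist ?K (\<phi> x) (\<phi> y) = hdist H x y" if "x \<in> hcarrier H" "y \<in> hcarrier H" for x y
    using that by (simp add: hdist_def hnorm_def ops closed)
  show "complex_hilbert_space ?K"
  proof
    fix u :: "nat \<Rightarrow> 'b"
    assume u: "\<And>n. u n \<in> hcarrier ?K" and c: "\<And>e. 0 < e \<Longrightarrow> \<exists>N. \<forall>m\<ge>N. \<forall>n\<ge>N. hdist ?K (u m) (u n) < e"
    have "\<forall>n. \<exists>x\<in>hcarrier H. u n = \<phi> x" using u by (auto simp: ops)
    then obtain v where v: "\<And>n. v n \<in> hcarrier H" "\<And>n. u n = \<phi> (v n)" by metis
    obtain x where "x \<in> hcarrier H" "hconv H v x" using complete[of v] v c by (auto simp: dist)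
    then show "\<exists>x\<in>hcarrier ?K. (\<lambda>n. hdist ?K (u n) x) \<longlonglongrightarrow> 0" by (intro bexI[of _ "\<phi> x"]) (auto simp: v dist ops)
  next
    fix x y assume "x \<in> hcarrier ?K" "y \<in> hcarrier ?K"
    then obtain x' y' where xy: "x = \<phi> x'" "y = \<phi> y'" "x' \<in> hcarrier H" "y' \<in> hcarrier H" by (auto simp: ops)
    show "hadd ?K x y = hadd ?K y x" using add_commute[OF xy(3,4)] xy by (simp add: ops)
    show "hinner ?K y x = cnj (hinner ?K x y)" using inner_commute[OF xy(3,4)] xy by (simp add: ops)
    show "x = hzero ?K" if "hinner ?K x x = 0" using that inner_definite[OF xy(3)] xy by (simp add: ops)
  qed (auto simp: ops closed add_assoc add_zero add_inverse scale_one scale_scale scale_add_right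
      scale_add_left inner_add inner_scale inner_nonneg)
  show "x \<in> hcarrier H \<Longrightarrow> y \<in> hcarrier H \<Longrightarrow> hinner ?K (\<phi> x) (\<phi> y) = hinner H x y" by (rule ops(5))
  assume B: "orthonormal_basis H B"
  then have BH: "b \<in> hcarrier H" if "b \<in> B" for b using that by (auto simp: orthonormal_basis_def)
  show "orthonormal_basis ?K (\<phi> ` B)" unfolding orthonormal_basis_def
  proof (intro conjI ballI impI)
    show "\<phi> ` B \<subseteq> hcarrier ?K" using BH by (auto simp: ops)
    fix b b' assume "b \<in> \<phi> ` B" "b' \<in> \<phi> ` B"
    then show "hinner ?K b b' = (if b = b' then 1 else 0)"
      using B BH inj by (auto simp: ops orthonormal_basis_def inj_on_def)
  next
    fix x assume "x \<in> hcarrier ?K" "\<forall>b\<in>\<phi> ` B. hinner ?K b x = 0"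
    then show "x = hzero ?K" using B BH by (auto simp: ops orthonormal_basis_def)
  qed
qed

section \<open>Fock spaces\<close>

abbreviation "EXP \<equiv> fock_space"

lemma has_sum_lists:
  "(f has_sum s) (lists B) \<longleftrightarrow>
     ((\<lambda>(m, l). f l) has_sum s) (Sigma UNIV (\<lambda>m. {l \<in> lists B. length l = m}))"
proof -
  have "bij_betw snd (Sigma UNIV (\<lambda>m. {l \<in> lists B. length l = m})) (lists B)"
    by (rule bij_betwI[of _ _ _ "\<lambda>l. (length l, l)"]) auto
  from has_sum_reindex_bij_betw[OF this, of f s] show ?thesis by (simp add: case_prod_unfold)
qed

text \<open>Expansion of the power \<open>s ^ m\<close> of an infinite sum over words of length
  \<open>m\<close>, by splitting off the first letter. The absolute version is carried through the
  same induction because the sum over pairs of a letter and a word needs absolute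
  convergence.\<close>

lemma has_sum_prod_list:
  fixes f :: "'b \<Rightarrow> complex"
  assumes f: "(f has_sum s) B"
  shows "((\<lambda>l. prod_list (map f l)) has_sum s ^ m) {l \<in> lists B. length l = m}"
    and "((\<lambda>l. norm (prod_list (map f l))) has_sum (infsum (\<lambda>b. norm (f b)) B) ^ m) {l \<in> lists B. length l = m}"
proof -
  define L where "L m = {l \<in> lists B. length l = m}" for m :: nat
  have n: "(\<lambda>b. norm (f b)) summable_on B" using f has_sum_imp_summable summable_on_iff_abs_summable_on_complex by blast
  define t where "t = infsum (\<lambda>b. norm (f b)) B"
  have "((\<lambda>l. prod_list (map f l)) has_sum s ^ m) (L m) \<and>
    ((\<lambda>l. norm (prod_list (map f l))) has_sum t ^ m) (L m)"
  proof (induction m)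
    case 0
    have "L 0 = {[]}" by (auto simp: L_def)
    then show ?case by (simp add: has_sum_finite_iff)
  next
    case (Suc m)
    have bij: "bij_betw (\<lambda>(b, l). b # l) (B \<times> L m) (L (Suc m))"
      by (rule bij_betwI[of _ _ _ "\<lambda>l. (hd l, tl l)"]) (auto simp: L_def length_Suc_conv)
    have abs: "(\<lambda>p. norm (case p of (b, l) \<Rightarrow> f b * prod_list (map f l))) summable_on B \<times> L m"
      unfolding Infinite_Sum.abs_summable_on_Sigma_iff
    proof (intro conjI ballI)
      fix b
      show "(\<lambda>y. norm (case (b, y) of (b, l) \<Rightarrow> f b * prod_list (map f l))) summable_on L m"
        using summable_on_cmult_right[OF has_sum_imp_summable[OF Suc[THEN conjunct2]], of "norm (f b)"]
        by (simp add: norm_mult)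
    next
      have "infsum (\<lambda>y. norm (case (b, y) of (b, l) \<Rightarrow> f b * prod_list (map f l))) (L m) = norm (f b) * t ^ m" for b
        using has_sum_cmult_right[OF Suc[THEN conjunct2], of "norm (f b)"] by (simp add: norm_mult infsumI)
      then show "(\<lambda>x. norm (infsum (\<lambda>y. norm (case (x, y) of (b, l) \<Rightarrow> f b * prod_list (map f l))) (L m))) summable_on B"
        using n by (simp add: abs_mult summable_on_cmult_left)
    qed
    have "((\<lambda>(b, l). f b * prod_list (map f l)) has_sum s * s ^ m) (B \<times> L m)"
    proof (rule has_sum_SigmaI)
      show "((\<lambda>y. case (x, y) of (b, l) \<Rightarrow> f b * prod_list (map f l)) has_sum f x * s ^ m) (L m)" for x
        using has_sum_cmult_right[OF Suc[THEN conjunct1], of "f x"] by simp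
      show "((\<lambda>x. f x * s ^ m) has_sum s * s ^ m) B" by (rule has_sum_cmult_left[OF f])
      show "(\<lambda>(b, l). f b * prod_list (map f l)) summable_on B \<times> L m" by (rule abs_summable_summable[OF abs])
    qed
    moreover have "((\<lambda>(b, l). norm (f b * prod_list (map f l))) has_sum t * t ^ m) (B \<times> L m)"
    proof (rule has_sum_SigmaI)
      show "((\<lambda>y. case (x, y) of (b, l) \<Rightarrow> norm (f b * prod_list (map f l))) has_sum norm (f x) * t ^ m) (L m)" for x
        using has_sum_cmult_right[OF Suc[THEN conjunct2], of "norm (f x)"] by (simp add: norm_mult)
      show "((\<lambda>x. norm (f x) * t ^ m) has_sum t * t ^ m) B" using n by (intro has_sum_cmult_left) (simp add: t_def)
      show "(\<lambda>(b, l). norm (f b * prod_list (map f l))) summable_on B \<times> L m" using abs by (simp add: case_prod_unfold)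
    qed
    ultimately show ?case using has_sum_reindex_bij_betw[OF bij, of "\<lambda>l. prod_list (map f l)" "s * s ^ m"]
        has_sum_reindex_bij_betw[OF bij, of "\<lambda>l. norm (prod_list (map f l))" "t * t ^ m"] by (simp add: case_prod_unfold)
  qed
  then show "((\<lambda>l. prod_list (map f l)) has_sum s ^ m) {l \<in> lists B. length l = m}"
    "((\<lambda>l. norm (prod_list (map f l))) has_sum (infsum (\<lambda>b. norm (f b)) B) ^ m) {l \<in> lists B. length l = m}"
    by (simp_all add: L_def t_def)
qed

text \<open>The exponential series, each power being expanded over words of that length. Applied to
  the Parseval sum it computes the inner products of exponential vectors.\<close>

lemma has_sum_exp_lists:
  fixes f :: "'b \<Rightarrow> complex"
  assumes f: "(f has_sum s) B"
  shows "((\<lambda>l. prod_list (map f l) / fact (length l)) has_sum exp s) (lists B)" unfolding has_sum_lists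
proof (rule has_sum_SigmaI)
  define L where "L m = {l \<in> lists B. length l = m}" for m :: nat
  define t where "t = infsum (\<lambda>b. norm (f b)) B"
  have fin: "((\<lambda>l. prod_list (map f l) / fact (length l)) has_sum s ^ m / fact m) (L m)" for m
  proof -
    have "((\<lambda>l. prod_list (map f l) / fact m) has_sum s ^ m / fact m) (L m)"
      using has_sum_cmult_left[OF has_sum_prod_list(1)[OF f], where c="1 / fact m"] by (simp add: L_def)
    then show ?thesis by (rule has_sum_cong[THEN iffD1, rotated]) (simp add: L_def)
  qed
  have fin': "((\<lambda>l. norm (prod_list (map f l) / fact (length l))) has_sum t ^ m / fact m) (L m)" for m
  proof -
    have "((\<lambda>l. norm (prod_list (map f l)) / fact m) has_sum t ^ m / fact m) (L m)"
      using has_sum_cmult_left[OF has_sum_prod_list(2)[OF f], where c="1 / fact m"] by (simp add: L_def t_def)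
    then show ?thesis by (rule has_sum_cong[THEN iffD1, rotated]) (simp add: L_def norm_divide)
  qed
  have ex: "((\<lambda>n. z ^ n / fact n) has_sum exp z) UNIV" for z :: "'c::{banach,real_normed_field}"
    using exp_converges[of z] summable_norm_exp[of z]
    by (intro norm_summable_imp_has_sum) (simp_all add: scaleR_conv_of_real divide_inverse mult.commute norm_mult norm_power norm_inverse)
  show "((\<lambda>y. case (x, y) of (m, l) \<Rightarrow> prod_list (map f l) / fact (length l)) has_sum s ^ x / fact x)
      {l \<in> lists B. length l = x}" for x using fin[of x] by (simp add: L_def)
  show "((\<lambda>x. s ^ x / fact x) has_sum exp s) UNIV" by (rule ex)
  have "(\<lambda>p. norm (case p of (m, l) \<Rightarrow> prod_list (map f l) / fact (length l))) summable_on Sigma UNIV L"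
    unfolding Infinite_Sum.abs_summable_on_Sigma_iff
  proof (intro conjI ballI)
    fix m
    show "(\<lambda>y. norm (case (m, y) of (m, l) \<Rightarrow> prod_list (map f l) / fact (length l))) summable_on L m"
      using has_sum_imp_summable[OF fin'[of m]] by simp
  next
    have "infsum (\<lambda>y. norm (case (m, y) of (m, l) \<Rightarrow> prod_list (map f l) / fact (length l))) (L m) = t ^ m / fact m" for m
      using infsumI[OF fin'[of m]] by simp
    moreover have "(\<lambda>m. norm (t ^ m / fact m)) summable_on UNIV"
      using has_sum_imp_summable[OF ex[of t]] by (simp only: summable_on_iff_abs_summable_on_real[symmetric])
    ultimately show "(\<lambda>x. norm (infsum (\<lambda>y. norm (case (x, y) of (m, l) \<Rightarrow> prod_list (map f l) / fact (length l))) (L x))) summable_on UNIV"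
      by simp
  qed
  then show "(\<lambda>(m, l). prod_list (map f l) / fact (length l)) summable_on (SIGMA m:UNIV. {l \<in> lists B. length l = m})"
    by (simp add: abs_summable_summable L_def[abs_def])
qed

text \<open>Identity theorem with only real arguments in \<open>(0, 1]\<close>. If the coefficients
  before \<open>a m\<close> vanish, division by \<open>t ^ m\<close> leaves
  \<open>norm (a m) \<le> t * A\<close>, and \<open>t\<close> is arbitrarily small.\<close>

lemma power_series_zero:
  fixes a :: "nat \<Rightarrow> complex"
  assumes s: "summable (\<lambda>n. norm (a n))" and z: "\<And>t. 0 < t \<Longrightarrow> t \<le> 1 \<Longrightarrow> (\<lambda>n. a n * of_real t ^ n) sums 0"
  shows "a m = 0"
proof (induction m rule: less_induct)
  case (less m)
  define A where "A = (\<Sum>n. norm (a n))"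
  have le: "norm (a m) \<le> t * A" if t: "0 < t" "t \<le> 1" for t
  proof -
    have sm: "summable (\<lambda>i. a (i + k) * of_real t ^ i)" for k
    proof (rule summable_comparison_test'[of "\<lambda>i. norm (a (i + k))" 0])
      show "summable (\<lambda>i. norm (a (i + k)))" using s summable_iff_shift[of "\<lambda>n. norm (a n)" k] by simp
      show "norm (a (i + k) * of_real t ^ i) \<le> norm (a (i + k))" for i
        using t by (simp add: norm_mult norm_power mult_left_le power_le_one)
    qed
    have "(\<lambda>i. a (i + m) * of_real t ^ (i + m)) sums (0 - (\<Sum>i<m. a i * of_real t ^ i))"
      using z[OF t] sums_iff_shift'[of "\<lambda>i. a i * of_real t ^ i" m 0] by blast
    then have "(\<lambda>i. (a (i + m) * of_real t ^ i) * of_real t ^ m) sums 0" using less by (simp add: power_add mult.assoc)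
    then have "(\<lambda>i. a (i + m) * of_real t ^ i) sums 0"
      using t sums_mult2_iff[of "of_real t ^ m :: complex" "\<lambda>i. a (i + m) * of_real t ^ i" 0] by simp
    then have "a m + (\<Sum>i. a (Suc i + m) * of_real t ^ Suc i) = 0"
      using suminf_split_head[OF sm[of m]] by (simp add: sums_iff)
    moreover have "(\<Sum>i. a (Suc i + m) * of_real t ^ Suc i) = of_real t * (\<Sum>i. a (i + Suc m) * of_real t ^ i)"
      using suminf_mult[OF sm[of "Suc m"], of "of_real t"] by (simp add: ac_simps)
    ultimately have "a m = - (of_real t * (\<Sum>i. a (i + Suc m) * of_real t ^ i))" by (simp add: eq_neg_iff_add_eq_0)
    then have "norm (a m) = t * norm (\<Sum>i. a (i + Suc m) * of_real t ^ i)" using t by (simp add: norm_mult)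
    also have "norm (\<Sum>i. a (i + Suc m) * of_real t ^ i) \<le> (\<Sum>i. norm (a (i + Suc m)))"
    proof (rule norm_suminf_le)
      show "summable (\<lambda>i. norm (a (i + Suc m)))" using s summable_iff_shift[of "\<lambda>n. norm (a n)" "Suc m"] by simp
      show "norm (a (i + Suc m) * of_real t ^ i) \<le> norm (a (i + Suc m))" for i
        using t by (simp add: norm_mult norm_power mult_left_le power_le_one)
    qed
    also have "\<dots> \<le> A" using suminf_split_initial_segment[OF s, of "Suc m"] by (simp add: A_def sum_nonneg)
    finally show ?thesis using t by simp
  qed
  have A: "A \<ge> 0" unfolding A_def by (rule suminf_nonneg[OF s]) simp
  have "norm (a m) \<le> 0"
  proof (rule field_le_epsilon)
    fix e :: real assume e: "0 < e"
    have "norm (a m) \<le> min 1 (e / (A + 1)) * A" using e A by (intro le) auto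
    also have "\<dots> \<le> e / (A + 1) * A" using A by (intro mult_right_mono) auto
    also have "\<dots> \<le> e" using A e by (simp add: field_simps)
    finally show "norm (a m) \<le> 0 + e" by simp
  qed
  then show ?case by simp
qed

section \<open>Bounded evaluations and completeness of the Fock space\<close>

context complex_hilbert_space
begin

abbreviation "LH \<equiv> lists (V)"
abbreviation "ONB \<equiv> some_onb H"

lemma some_onb: "orthonormal_basis H ONB" unfolding some_onb_def using orthonormal_basis_exists by (rule someI_ex)

lemma some_onb_closed: "b \<in> ONB \<Longrightarrow> b \<in> V" using some_onb by (auto simp: orthonormal_basis_def)

lemma lists_onb: "l \<in> lists ONB \<Longrightarrow> l \<in> LH" using some_onb_closed by auto

definition fock_sq :: "('v list \<Rightarrow> complex) \<Rightarrow> real" where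
  "fock_sq \<Phi> = infsum (\<lambda>l. (cmod (\<Phi> l))^2) (lists ONB)"

lemma fock_vectors_iff:
  "\<Phi> \<in> fock_vectors H \<longleftrightarrow>
     (\<forall>l. l \<notin> LH \<longrightarrow> \<Phi> l = 0) \<and>
     (\<forall>l\<in>LH. \<forall>l'\<in>LH. \<forall>x\<in>V. \<forall>y\<in>V.
        \<Phi> (l @ hadd H x y # l') = \<Phi> (l @ x # l') + \<Phi> (l @ y # l')) \<and>
     (\<forall>l\<in>LH. \<forall>l'\<in>LH. \<forall>x\<in>V. \<forall>c. \<Phi> (l @ hscale H c x # l') = cnj c * \<Phi> (l @ x # l')) \<and>
     (\<forall>m. \<exists>C. \<forall>l\<in>LH. length l = m \<longrightarrow> cmod (\<Phi> l) \<le> C * prod_list (map (nm) l)) \<and>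
     (\<forall>l\<in>LH. \<forall>l'\<in>LH. mset l = mset l' \<longrightarrow> \<Phi> l = \<Phi> l') \<and>
     (\<lambda>l. (cmod (\<Phi> l))^2) summable_on lists ONB" unfolding fock_vectors_def by (rule mem_Collect_eq)

lemma fv_outside: "\<Phi> \<in> fock_vectors H \<Longrightarrow> l \<notin> LH \<Longrightarrow> \<Phi> l = 0"
  and fv_add: "\<lbrakk>\<Phi> \<in> fock_vectors H; l \<in> LH; l' \<in> LH; x \<in> V; y \<in> V\<rbrakk> \<Longrightarrow>
    \<Phi> (l @ hadd H x y # l') = \<Phi> (l @ x # l') + \<Phi> (l @ y # l')"
  and fv_scale: "\<lbrakk>\<Phi> \<in> fock_vectors H; l \<in> LH; l' \<in> LH; x \<in> V\<rbrakk> \<Longrightarrow>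
    \<Phi> (l @ hscale H c x # l') = cnj c * \<Phi> (l @ x # l')"
  and fv_bounded: "\<Phi> \<in> fock_vectors H \<Longrightarrow> \<exists>C. \<forall>l\<in>LH. length l = m \<longrightarrow> cmod (\<Phi> l) \<le> C * prod_list (map (nm) l)"
  and fv_sym: "\<lbrakk>\<Phi> \<in> fock_vectors H; l \<in> LH; l' \<in> LH; mset l = mset l'\<rbrakk> \<Longrightarrow> \<Phi> l = \<Phi> l'"
  and fv_summable: "\<Phi> \<in> fock_vectors H \<Longrightarrow> (\<lambda>l. (cmod (\<Phi> l))^2) summable_on lists ONB"
  subgoal by (drule fock_vectors_iff[THEN iffD1, THEN conjunct1]) (erule allE, erule mp)
  subgoal by (drule fock_vectors_iff[THEN iffD1, THEN conjunct2, THEN conjunct1]) (drule (1) bspec)+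
  subgoal by (drule fock_vectors_iff[THEN iffD1, THEN conjunct2, THEN conjunct2, THEN conjunct1])
      ((drule (1) bspec)+, erule spec)
  subgoal by (drule fock_vectors_iff[THEN iffD1, THEN conjunct2, THEN conjunct2, THEN conjunct2, THEN conjunct1]) (erule spec)
  subgoal by (drule fock_vectors_iff[THEN iffD1, THEN conjunct2, THEN conjunct2, THEN conjunct2, THEN conjunct2, THEN conjunct1])
      ((drule (1) bspec)+, erule (1) mp)
  subgoal by (drule fock_vectors_iff[THEN iffD1, THEN conjunct2, THEN conjunct2, THEN conjunct2, THEN conjunct2, THEN conjunct2])
  done

lemma prod_hnorm_nonneg: "l \<in> LH \<Longrightarrow> 0 \<le> prod_list (map (nm) l)" by (induction l) (auto simp: hnorm_nonneg)

lemma fv_tendsto: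
  assumes \<Phi>: "\<Phi> \<in> fock_vectors H" and l: "l \<in> LH" "l' \<in> LH"
    and u: "\<And>n. u n \<in> V" "x \<in> V" "hconv H u x"
  shows "(\<lambda>n. \<Phi> (l @ u n # l')) \<longlonglongrightarrow> \<Phi> (l @ x # l')"
proof -
  obtain C where C: "\<And>k. k \<in> LH \<Longrightarrow> length k = length l + Suc (length l') \<Longrightarrow> cmod (\<Phi> k) \<le> C * prod_list (map (nm) k)"
    using fv_bounded[OF \<Phi>, of "length l + Suc (length l')"] by blast
  define D where "D = C * (prod_list (map (nm) l) * prod_list (map (nm) l'))"
  have "(\<lambda>n. \<Phi> (l @ u n # l') - \<Phi> (l @ x # l')) \<longlonglongrightarrow> 0"
  proof (rule Lim_null_comparison)
    have "cmod (\<Phi> (l @ u n # l') - \<Phi> (l @ x # l')) \<le> D * hdist H (u n) x" for n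
    proof -
      have "\<Phi> (l @ u n # l') - \<Phi> (l @ x # l') = \<Phi> (l @ hsub H (u n) x # l')"
        using \<Phi> l u by (simp add: fv_add fv_scale closed)
      also have "cmod \<dots> \<le> C * prod_list (map (nm) (l @ hsub H (u n) x # l'))" using l u by (intro C) (auto simp: closed)
      finally show ?thesis by (simp add: D_def hdist_def ac_simps)
    qed
    then show "\<forall>\<^sub>F n in sequentially. cmod (\<Phi> (l @ u n # l') - \<Phi> (l @ x # l')) \<le> D * hdist H (u n) x" by simp
    show "(\<lambda>n. D * hdist H (u n) x) \<longlonglongrightarrow> 0" using tendsto_mult[OF tendsto_const u(3), of D] by simp
  qed
  then show ?thesis by (simp add: LIM_zero_iff)
qed

lemma fv_hzero:
  assumes "\<Phi> \<in> fock_vectors H" "l \<in> LH" "l' \<in> LH"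
  shows "\<Phi> (l @ hzero H # l') = 0" using fv_add[OF assms closed(1) closed(1)] add_zero[OF closed(1)] by simp

lemma fv_hsum:
  assumes \<Phi>: "\<Phi> \<in> fock_vectors H" and l: "l \<in> LH" "l' \<in> LH"
    and G: "finite G" "\<forall>g\<in>G. f g \<in> V"
  shows "\<Phi> (l @ hsum H (\<lambda>g. hscale H (c g) (f g)) G # l') = (\<Sum>g\<in>G. cnj (c g) * \<Phi> (l @ f g # l'))" using G
proof (induction G)
  case empty
  then show ?case by (simp add: hsum_empty fv_hzero[OF \<Phi> l])
next
  case (insert a G)
  then show ?case using fv_add[OF \<Phi> l, of "hscale H (c a) (f a)" "hsum H (\<lambda>g. hscale H (c g) (f g)) G"]
      fv_scale[OF \<Phi> l, of "f a" "c a"] by (simp add: hsum_insert hsum_closed closed)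
qed

text \<open>The arguments in \<open>l\<close> are replaced one after the other by their basis
  expansions. In each slot the Cauchy-Schwarz and Bessel inequalities cost a factor
  \<open>(nm x)^2\<close>, and the new basis letter joins the prefix. The sum over a set
  \<open>F\<close> of prefixes is what makes the induction close.\<close>

lemma fv_eval_aux:
  assumes \<Phi>: "\<Phi> \<in> fock_vectors H" and l: "l \<in> LH" and F: "finite F" "F \<subseteq> lists ONB"
  shows "(\<Sum>b\<in>F. (cmod (\<Phi> (b @ l)))^2) \<le> (prod_list (map (nm) l))^2 * fock_sq \<Phi>" using l F
proof (induction l arbitrary: F)
  case Nil
  then show ?case using finite_sum_le_infsum[OF fv_summable[OF \<Phi>], of F] by (simp add: fock_sq_def)
next
  case (Cons x l)
  then have x: "x \<in> V" and l: "l \<in> LH" by auto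
  define P where "P G = hsum H (\<lambda>b. hscale H (ip b x) b) G" for G
  have "\<exists>G. finite G \<and> G \<subseteq> ONB \<and> hdist H x (P G) < 1 / real (Suc n)" for n
  proof -
    have "0 < 1 / real (Suc n)" by simp
    from onb_expansion[OF some_onb x this] show ?thesis unfolding P_def by (metis order_refl)
  qed
  then obtain G where G: "\<And>n. finite (G n)" "\<And>n. G n \<subseteq> ONB" "\<And>n. hdist H x (P (G n)) < 1 / real (Suc n)" by metis
  have GH: "\<forall>g\<in>G n. g \<in> V" for n using G(2) some_onb_closed by blast
  have Pc: "P (G n) \<in> V" for n unfolding P_def using G(1) GH by (auto intro!: hsum_closed closed)
  have conv: "hconv H (\<lambda>n. P (G n)) x"
  proof (rule tendsto_sandwich[of "\<lambda>_. 0" _ _ "\<lambda>n. 1 / real (Suc n)"])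
    show "\<forall>\<^sub>F n in sequentially. hdist H (P (G n)) x \<le> 1 / real (Suc n)"
      using G(3) hdist_commute[OF x Pc] by (auto intro!: always_eventually less_imp_le)
    show "(\<lambda>n. 1 / real (Suc n)) \<longlonglongrightarrow> 0" using LIMSEQ_inverse_real_of_nat by (simp add: inverse_eq_divide)
  qed (simp_all add: hdist_nonneg Pc x)
  have bH: "b \<in> LH" if "b \<in> F" for b by (rule lists_onb[OF subsetD[OF Cons.prems(2) that]])
  have "(\<Sum>b\<in>F. (cmod (\<Phi> (b @ P (G n) # l)))^2) \<le> (prod_list (map (nm) (x # l)))^2 * fock_sq \<Phi>" for n
  proof -
    have "(cmod (\<Phi> (b @ P (G n) # l)))^2 \<le> (nm x)^2 * (\<Sum>c\<in>G n. (cmod (\<Phi> ((b @ [c]) @ l)))^2)" if b: "b \<in> F" for b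
    proof -
      have "\<Phi> (b @ P (G n) # l) = (\<Sum>c\<in>G n. cnj (ip c x) * \<Phi> (b @ c # l))"
        unfolding P_def by (rule fv_hsum[OF \<Phi> bH[OF b] l G(1) GH])
      then have "cmod (\<Phi> (b @ P (G n) # l)) \<le> (\<Sum>c\<in>G n. cmod (ip c x) * cmod (\<Phi> (b @ c # l)))"
        using norm_sum[of "\<lambda>c. cnj (ip c x) * \<Phi> (b @ c # l)" "G n"] by (simp add: norm_mult)
      then have "(cmod (\<Phi> (b @ P (G n) # l)))^2 \<le> (\<Sum>c\<in>G n. cmod (ip c x) * cmod (\<Phi> (b @ c # l)))^2"
        by (intro power_mono) auto
      also have "\<dots> \<le> (\<Sum>c\<in>G n. (cmod (ip c x))^2) * (\<Sum>c\<in>G n. (cmod (\<Phi> (b @ c # l)))^2)" by (rule Cauchy_Schwarz_ineq_sum)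
      also have "(\<Sum>c\<in>G n. (cmod (ip c x))^2) \<le> (nm x)^2"
        using some_onb G by (intro bessel[of ONB] x) (auto simp: orthonormal_def orthonormal_basis_def)
      finally show ?thesis by (simp add: mult_right_mono sum_nonneg)
    qed
    then have "(\<Sum>b\<in>F. (cmod (\<Phi> (b @ P (G n) # l)))^2) \<le> (\<Sum>b\<in>F. (nm x)^2 * (\<Sum>c\<in>G n. (cmod (\<Phi> ((b @ [c]) @ l)))^2))"
      by (rule sum_mono)
    also have "\<dots> = (nm x)^2 * (\<Sum>(b, c)\<in>F \<times> G n. (cmod (\<Phi> ((b @ [c]) @ l)))^2)"
      by (simp add: sum_distrib_left sum.cartesian_product case_prod_unfold)
    also have "(\<Sum>(b, c)\<in>F \<times> G n. (cmod (\<Phi> ((b @ [c]) @ l)))^2) = (\<Sum>b\<in>(\<lambda>(b, c). b @ [c]) ` (F \<times> G n). (cmod (\<Phi> (b @ l)))^2)"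
      by (subst sum.reindex) (auto simp: inj_on_def case_prod_unfold)
    also have "(nm x)^2 * \<dots> \<le> (nm x)^2 * ((prod_list (map (nm) l))^2 * fock_sq \<Phi>)"
      using Cons.prems G(1) subsetD[OF G(2)] subsetD[OF Cons.prems(2)]
      by (intro mult_left_mono Cons.IH) (auto simp: in_lists_conv_set)
    finally show ?thesis by (simp add: power_mult_distrib)
  qed
  moreover have "(\<lambda>n. \<Sum>b\<in>F. (cmod (\<Phi> (b @ P (G n) # l)))^2) \<longlonglongrightarrow> (\<Sum>b\<in>F. (cmod (\<Phi> (b @ x # l)))^2)"
    by (intro tendsto_intros fv_tendsto[OF \<Phi> bH l Pc x conv])
  ultimately show ?case by (intro LIMSEQ_le_const2) auto
qed

text \<open>Evaluation at any list, not only at lists of basis vectors, is continuous in the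
  Hilbert-Schmidt norm. This makes norm limits pointwise limits.\<close>

lemma fv_eval:
  assumes \<Phi>: "\<Phi> \<in> fock_vectors H" and l: "l \<in> LH"
  shows "cmod (\<Phi> l) \<le> prod_list (map (nm) l) * sqrt (fock_sq \<Phi>)"
proof -
  have "(cmod (\<Phi> l))^2 \<le> (prod_list (map (nm) l))^2 * fock_sq \<Phi>" using fv_eval_aux[OF \<Phi> l, of "{[]}"] by simp
  also have "\<dots> = (prod_list (map (nm) l) * sqrt (fock_sq \<Phi>))^2"
    unfolding power_mult_distrib by (simp add: fock_sq_def infsum_nonneg)
  finally show ?thesis by (rule power2_le_imp_le) (simp add: prod_hnorm_nonneg[OF l] fock_sq_def infsum_nonneg)
qed

lemma fock_sq_nonneg: "fock_sq \<Phi> \<ge> 0" unfolding fock_sq_def by (rule infsum_nonneg) simp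

lemma fv_zero: "(\<lambda>l. 0) \<in> fock_vectors H" by (auto simp: fock_vectors_def intro!: exI[of _ 0])

lemma fv_plus:
  assumes "\<Phi> \<in> fock_vectors H" "\<Psi> \<in> fock_vectors H"
  shows "(\<lambda>l. \<Phi> l + \<Psi> l) \<in> fock_vectors H"
proof -
  have "\<exists>C. \<forall>l\<in>LH. length l = m \<longrightarrow> cmod (\<Phi> l + \<Psi> l) \<le> C * prod_list (map (nm) l)" for m
  proof -
    obtain C D where "\<forall>l\<in>LH. length l = m \<longrightarrow> cmod (\<Phi> l) \<le> C * prod_list (map (nm) l)"
      "\<forall>l\<in>LH. length l = m \<longrightarrow> cmod (\<Psi> l) \<le> D * prod_list (map (nm) l)"
      using fv_bounded[OF assms(1), of m] fv_bounded[OF assms(2), of m] by blast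
    then show ?thesis by (intro exI[of _ "C + D"] ballI impI, unfold distrib_right)
        (rule norm_triangle_le, rule add_mono, auto)
  qed
  moreover have "(\<lambda>l. (cmod (\<Phi> l + \<Psi> l))^2) summable_on lists ONB"
  proof (rule summable_on_comparison_test)
    show "(\<lambda>l. 2 * (cmod (\<Phi> l))^2 + 2 * (cmod (\<Psi> l))^2) summable_on lists ONB"
      by (intro summable_on_add summable_on_cmult_right fv_summable assms)
    show "(cmod (\<Phi> l + \<Psi> l))^2 \<le> 2 * (cmod (\<Phi> l))^2 + 2 * (cmod (\<Psi> l))^2" for l
    proof -
      have "(cmod (\<Phi> l + \<Psi> l))^2 \<le> (cmod (\<Phi> l) + cmod (\<Psi> l))^2" by (intro power_mono norm_triangle_ineq) simp
      then show ?thesis using sum_squares_bound[of "cmod (\<Phi> l)" "cmod (\<Psi> l)"] by (simp add: power2_sum)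
    qed
  qed simp
  ultimately show ?thesis unfolding fock_vectors_iff
  proof (intro conjI allI ballI impI)
    show "\<Phi> l + \<Psi> l = \<Phi> l' + \<Psi> l'" if "l \<in> LH" "l' \<in> LH" "mset l = mset l'" for l l'
      using fv_sym[OF assms(1) that] fv_sym[OF assms(2) that] by simp
  qed (auto simp: fv_outside assms fv_add fv_scale distrib_left)
qed

lemma fv_mult:
  assumes "\<Phi> \<in> fock_vectors H"
  shows "(\<lambda>l. c * \<Phi> l) \<in> fock_vectors H"
proof -
  have "\<exists>C. \<forall>l\<in>LH. length l = m \<longrightarrow> cmod (c * \<Phi> l) \<le> C * prod_list (map (nm) l)" for m
  proof -
    obtain C where "\<forall>l\<in>LH. length l = m \<longrightarrow> cmod (\<Phi> l) \<le> C * prod_list (map (nm) l)" using fv_bounded[OF assms, of m] by blast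
    then show ?thesis by (intro exI[of _ "cmod c * C"]) (auto simp: norm_mult mult.assoc intro: mult_left_mono)
  qed
  moreover have "(\<lambda>l. (cmod (c * \<Phi> l))^2) summable_on lists ONB"
    using fv_summable[OF assms] by (simp add: norm_mult power_mult_distrib summable_on_cmult_right)
  ultimately show ?thesis unfolding fock_vectors_iff
  proof (intro conjI allI ballI impI)
    show "c * \<Phi> l = c * \<Phi> l'" if "l \<in> LH" "l' \<in> LH" "mset l = mset l'" for l l' using fv_sym[OF assms(1) that] by simp
  qed (auto simp: fv_outside assms fv_add fv_scale distrib_left)
qed

lemma fock_summable:
  assumes "\<Phi> \<in> fock_vectors H" "\<Psi> \<in> fock_vectors H"
  shows "(\<lambda>l. cnj (\<Phi> l) * \<Psi> l) summable_on lists ONB"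
proof (rule abs_summable_summable, rule summable_on_comparison_test)
  show "(\<lambda>l. (cmod (\<Phi> l))^2 + (cmod (\<Psi> l))^2) summable_on lists ONB" by (intro summable_on_add fv_summable assms)
  show "norm (cnj (\<Phi> l) * \<Psi> l) \<le> (cmod (\<Phi> l))^2 + (cmod (\<Psi> l))^2" for l
    using sum_squares_bound[of "cmod (\<Phi> l)" "cmod (\<Psi> l)"] mult_nonneg_nonneg[OF norm_ge_zero[of "\<Phi> l"] norm_ge_zero[of "\<Psi> l"]]
    unfolding norm_mult complex_mod_cnj by linarith
qed simp

lemma fock_inner:
  assumes "\<Phi> \<in> fock_vectors H" "\<Psi> \<in> fock_vectors H"
  shows "((\<lambda>l. cnj (\<Phi> l) * \<Psi> l) has_sum hinner (EXP H) \<Phi> \<Psi>) (lists ONB)"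
  using fock_summable[OF assms] by (simp add: fock_space_def)

lemma fock_inner_self:
  assumes "\<Phi> \<in> fock_vectors H"
  shows "hinner (EXP H) \<Phi> \<Phi> = of_real (fock_sq \<Phi>)"
proof -
  have "(\<lambda>l. cnj (\<Phi> l) * \<Phi> l) = (\<lambda>l. of_real ((cmod (\<Phi> l))^2))" by (simp only: complex_norm_square mult.commute)
  then show ?thesis using has_sum_of_real[OF has_sum_infsum[OF fv_summable[OF assms]], where 'a=complex] infsumI
    by (simp add: fock_space_def fock_sq_def del: of_real_power)
qed

lemma fock_dist:
  assumes "\<Phi> \<in> fock_vectors H" "\<Psi> \<in> fock_vectors H"
  shows "(hdist (EXP H) \<Phi> \<Psi>)^2 = fock_sq (\<lambda>l. \<Phi> l - \<Psi> l)" "hdist (EXP H) \<Phi> \<Psi> \<ge> 0"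
    "(\<lambda>l. \<Phi> l - \<Psi> l) \<in> fock_vectors H"
proof -
  have *: "(\<lambda>l. \<Phi> l - \<Psi> l) \<in> fock_vectors H" using fv_plus[OF assms(1) fv_mult[OF assms(2), of "-1"]] by simp
  have "hdist (EXP H) \<Phi> \<Psi> = sqrt (Re (hinner (EXP H) (\<lambda>l. \<Phi> l - \<Psi> l) (\<lambda>l. \<Phi> l - \<Psi> l)))"
    unfolding hdist_def hnorm_def by (simp add: fock_space_def)
  then have "hdist (EXP H) \<Phi> \<Psi> = sqrt (fock_sq (\<lambda>l. \<Phi> l - \<Psi> l))" by (simp add: fock_inner_self[OF *])
  then show "(hdist (EXP H) \<Phi> \<Psi>)^2 = fock_sq (\<lambda>l. \<Phi> l - \<Psi> l)" "hdist (EXP H) \<Phi> \<Psi> \<ge> 0" by (simp_all add: fock_sq_nonneg)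
  show "(\<lambda>l. \<Phi> l - \<Psi> l) \<in> fock_vectors H" by (rule *)
qed

lemma fock_sq_zero:
  assumes "\<Phi> \<in> fock_vectors H" "fock_sq \<Phi> = 0"
  shows "\<Phi> = (\<lambda>l. 0)"
proof
  fix l show "\<Phi> l = 0" using fv_eval[OF assms(1), of l] fv_outside[OF assms(1), of l] assms(2) by (cases "l \<in> LH") auto
qed

text \<open>By \<open>fv_eval\<close> a Cauchy sequence converges at every list, and multilinearity
  and symmetry pass to the pointwise limit. The estimate \<open>fin\<close> over finite sets of
  basis lists then yields square summability and convergence in norm.\<close>

lemma fock_complete:
  assumes u: "\<And>n::nat. u n \<in> fock_vectors H"
    and c: "\<And>e. 0 < e \<Longrightarrow> \<exists>N. \<forall>m\<ge>N. \<forall>n\<ge>N. hdist (EXP H) (u m) (u n) < e"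
  shows "\<exists>\<Phi>\<in>fock_vectors H. (\<lambda>n. hdist (EXP H) (u n) \<Phi>) \<longlonglongrightarrow> 0"
proof -
  have "Cauchy (\<lambda>n. u n l)" if l: "l \<in> LH" for l
  proof (rule CauchyI)
    fix e :: real assume e: "0 < e"
    define p where "p = prod_list (map (nm) l)"
    have p: "p \<ge> 0" unfolding p_def by (rule prod_hnorm_nonneg[OF l])
    obtain N where N: "\<And>m n. \<lbrakk>m \<ge> N; n \<ge> N\<rbrakk> \<Longrightarrow> hdist (EXP H) (u m) (u n) < e / (p + 1)" using c[of "e / (p + 1)"] e p by auto
    have "norm (u m l - u n l) < e" if "m \<ge> N" "n \<ge> N" for m n
    proof -
      have "norm (u m l - u n l) \<le> p * sqrt (fock_sq (\<lambda>l. u m l - u n l))"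
        unfolding p_def by (rule fv_eval[OF fock_dist(3)[OF u u] l])
      also have "sqrt (fock_sq (\<lambda>l. u m l - u n l)) = hdist (EXP H) (u m) (u n)"
        using fock_dist(1,2)[OF u u, of m n] by (simp add: real_sqrt_unique)
      also have "p * \<dots> \<le> p * (e / (p + 1))" using N[OF that] p by (intro mult_left_mono) auto
      also have "\<dots> < e" using e p by (simp add: field_simps)
      finally show ?thesis .
    qed
    then show "\<exists>M. \<forall>m\<ge>M. \<forall>n\<ge>M. norm (u m l - u n l) < e" by blast
  qed
  then have "\<forall>l\<in>LH. \<exists>z. (\<lambda>n. u n l) \<longlonglongrightarrow> z" using Cauchy_convergent convergent_def by blast
  then obtain \<phi> where \<phi>: "\<And>l. l \<in> LH \<Longrightarrow> (\<lambda>n. u n l) \<longlonglongrightarrow> \<phi> l" by metis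
  define \<Phi> where "\<Phi> l = (if l \<in> LH then \<phi> l else 0)" for l
  have lim: "(\<lambda>n. u n l) \<longlonglongrightarrow> \<Phi> l" for l using \<phi>[of l] fv_outside[OF u, of l] by (cases "l \<in> LH") (simp_all add: \<Phi>_def)
  have fin: "(\<Sum>l\<in>F. (cmod (\<Phi> l - u n l))^2) \<le> e^2"
    if n: "\<And>m. m \<ge> n \<Longrightarrow> hdist (EXP H) (u n) (u m) < e" and F: "finite F" "F \<subseteq> lists ONB" for n e F
  proof (rule LIMSEQ_le_const2)
    show "(\<lambda>m. \<Sum>l\<in>F. (cmod (u m l - u n l))^2) \<longlonglongrightarrow> (\<Sum>l\<in>F. (cmod (\<Phi> l - u n l))^2)" by (intro tendsto_intros lim)
    have "(\<Sum>l\<in>F. (cmod (u m l - u n l))^2) \<le> e^2" if "m \<ge> n" for m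
    proof -
      have "(\<Sum>l\<in>F. (cmod (u m l - u n l))^2) = (\<Sum>l\<in>F. (cmod (u n l - u m l))^2)" by (simp add: norm_minus_commute)
      also have "\<dots> \<le> fock_sq (\<lambda>l. u n l - u m l)"
        unfolding fock_sq_def by (intro finite_sum_le_infsum fv_summable fock_dist u F) auto
      also have "\<dots> = (hdist (EXP H) (u n) (u m))^2" by (rule fock_dist(1)[OF u u, symmetric])
      also have "\<dots> \<le> e^2" using n[OF that] fock_dist(2)[OF u u] by (intro power_mono) auto
      finally show ?thesis .
    qed
    then show "\<exists>N. \<forall>m\<ge>N. (\<Sum>l\<in>F. (cmod (u m l - u n l))^2) \<le> e^2" by blast
  qed
  obtain N where N: "\<And>m n. \<lbrakk>m \<ge> N; n \<ge> N\<rbrakk> \<Longrightarrow> hdist (EXP H) (u m) (u n) < 1" using c[of 1] by auto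
  \<comment> \<open>A common bound for the norms of the tail, from
    \<open>(a + b)^2 \<le> 2 a^2 + 2 b^2\<close> and the distance at most \<open>1\<close> to
    \<open>u N\<close>. It bounds the limit functional in all degrees at once.\<close>
  define R where "R = sqrt (2 * fock_sq (u N) + 2)"
  have sqb: "fock_sq (u n) \<le> 2 * fock_sq (u N) + 2" if n: "n \<ge> N" for n
  proof -
    have d: "(\<lambda>l. u n l - u N l) \<in> fock_vectors H" by (rule fock_dist(3)[OF u u])
    have "fock_sq (\<lambda>l. u n l - u N l) \<le> 1^2"
      unfolding fock_dist(1)[OF u u, symmetric] using N[OF n order_refl] fock_dist(2)[OF u u] by (intro power_mono) auto
    moreover have "fock_sq (u n) \<le> 2 * fock_sq (u N) + 2 * fock_sq (\<lambda>l. u n l - u N l)"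
    proof -
      have "((\<lambda>l. 2 * (cmod (u N l))^2 + 2 * (cmod (u n l - u N l))^2) has_sum
          (2 * fock_sq (u N) + 2 * fock_sq (\<lambda>l. u n l - u N l))) (lists ONB)"
        unfolding fock_sq_def by (intro has_sum_add has_sum_cmult_right has_sum_infsum fv_summable u d)
      moreover have "((\<lambda>l. (cmod (u n l))^2) has_sum fock_sq (u n)) (lists ONB)"
        unfolding fock_sq_def by (intro has_sum_infsum fv_summable u)
      moreover have "(cmod (u n l))^2 \<le> 2 * (cmod (u N l))^2 + 2 * (cmod (u n l - u N l))^2" for l
      proof -
        have "(cmod (u n l))^2 \<le> (cmod (u N l) + cmod (u n l - u N l))^2"
          using norm_triangle_ineq[of "u N l" "u n l - u N l"] by (intro power_mono) auto
        then show ?thesis using sum_squares_bound[of "cmod (u N l)" "cmod (u n l - u N l)"] by (simp add: power2_sum)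
      qed
      ultimately show ?thesis using has_sum_mono by blast
    qed
    ultimately show ?thesis by simp
  qed
  have bound: "cmod (\<Phi> l) \<le> R * prod_list (map (nm) l)" if l: "l \<in> LH" for l
  proof (rule LIMSEQ_le_const2[OF tendsto_norm[OF lim]], intro exI[of _ N] allI impI)
    fix n assume "N \<le> n"
    then have "sqrt (fock_sq (u n)) \<le> R" unfolding R_def using sqb by simp
    then show "norm (u n l) \<le> R * prod_list (map (nm) l)"
      using fv_eval[OF u l, of n] mult_left_mono[OF _ prod_hnorm_nonneg[OF l], of "sqrt (fock_sq (u n))" R]
      by (simp add: mult.commute)
  qed
  have diff: "(\<lambda>l. (cmod (\<Phi> l - u n l))^2) summable_on lists ONB" if "n \<ge> N" for n using fin[of n 1] N[OF that] that
    by (intro nonneg_bdd_above_summable_on) (auto intro!: bdd_aboveI2[where M=1])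
  have sm: "(\<lambda>l. (cmod (\<Phi> l))^2) summable_on lists ONB"
  proof (rule summable_on_comparison_test)
    show "(\<lambda>l. 2 * (cmod (u N l))^2 + 2 * (cmod (\<Phi> l - u N l))^2) summable_on lists ONB"
      by (intro summable_on_add summable_on_cmult_right fv_summable u diff order_refl)
    show "(cmod (\<Phi> l))^2 \<le> 2 * (cmod (u N l))^2 + 2 * (cmod (\<Phi> l - u N l))^2" for l
    proof -
      have "(cmod (\<Phi> l))^2 \<le> (cmod (u N l) + cmod (\<Phi> l - u N l))^2"
        using norm_triangle_ineq[of "u N l" "\<Phi> l - u N l"] by (intro power_mono) auto
      then show ?thesis using sum_squares_bound[of "cmod (u N l)" "cmod (\<Phi> l - u N l)"] by (simp add: power2_sum)
    qed
  qed simp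
  have \<Phi>: "\<Phi> \<in> fock_vectors H" unfolding fock_vectors_def
  proof (intro CollectI conjI allI ballI impI)
    show "\<Phi> l = 0" if "l \<notin> LH" for l using that by (simp add: \<Phi>_def)
    show "\<Phi> (l @ hadd H x y # l') = \<Phi> (l @ x # l') + \<Phi> (l @ y # l')" if "l \<in> LH" "l' \<in> LH" "x \<in> V" "y \<in> V" for l l' x y
      using LIMSEQ_unique[OF lim[of "l @ hadd H x y # l'"] tendsto_add[OF lim[of "l @ x # l'"] lim[of "l @ y # l'"], folded fv_add[OF u that]]]
      by simp
    show "\<Phi> (l @ hscale H c x # l') = cnj c * \<Phi> (l @ x # l')" if "l \<in> LH" "l' \<in> LH" "x \<in> V" for l l' x c
      using LIMSEQ_unique[OF lim[of "l @ hscale H c x # l'"] tendsto_mult[OF tendsto_const[of "cnj c"] lim[of "l @ x # l'"], folded fv_scale[OF u that]]]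
      by simp
    show "\<exists>C. \<forall>l\<in>LH. length l = m \<longrightarrow> cmod (\<Phi> l) \<le> C * prod_list (map (nm) l)" for m using bound by blast
    show "\<Phi> l = \<Phi> l'" if "l \<in> LH" "l' \<in> LH" "mset l = mset l'" for l l'
      using LIMSEQ_unique[OF lim[of l] lim[of l', folded fv_sym[OF u that]]] by simp
  qed (rule sm)
  have "(\<lambda>n. hdist (EXP H) (u n) \<Phi>) \<longlonglongrightarrow> 0"
  proof (rule LIMSEQ_I)
    fix r :: real assume r: "0 < r"
    obtain N' where N': "\<And>m n. \<lbrakk>m \<ge> N'; n \<ge> N'\<rbrakk> \<Longrightarrow> hdist (EXP H) (u m) (u n) < r/2" using c[of "r/2"] r by auto
    have "norm (hdist (EXP H) (u n) \<Phi> - 0) < r" if n: "n \<ge> N'" for n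
    proof -
      have "fock_sq (\<lambda>l. u n l - \<Phi> l) \<le> (r/2)^2" unfolding fock_sq_def
      proof (rule infsum_le_finite_sums)
        show "(\<lambda>l. (cmod (u n l - \<Phi> l))^2) summable_on lists ONB" by (rule fv_summable[OF fock_dist(3)[OF u \<Phi>]])
        show "(\<Sum>l\<in>F. (cmod (u n l - \<Phi> l))^2) \<le> (r/2)^2" if "finite F" "F \<subseteq> lists ONB" for F
          using fin[of n "r/2" F] N'[OF n] n that by (simp add: norm_minus_commute)
      qed
      then have "(hdist (EXP H) (u n) \<Phi>)^2 \<le> (r/2)^2" by (simp only: fock_dist(1)[OF u \<Phi>])
      then have "hdist (EXP H) (u n) \<Phi> \<le> r/2" by (rule power2_le_imp_le) (use r in simp)
      then show ?thesis using r fock_dist(2)[OF u \<Phi>, of n] by simp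
    qed
    then show "\<exists>no. \<forall>n\<ge>no. norm (hdist (EXP H) (u n) \<Phi> - 0) < r" by blast
  qed
  then show ?thesis using \<Phi> by blast
qed

theorem hilbert_fock: "complex_hilbert_space (EXP H)"
proof
  let ?F = "EXP H"
  have ops: "hcarrier ?F = fock_vectors H" "hzero ?F = (\<lambda>l. 0)" "hadd ?F = (\<lambda>\<Phi> \<Psi> l. \<Phi> l + \<Psi> l)"
    "hscale ?F = (\<lambda>c \<Phi> l. c * \<Phi> l)" by (simp_all add: fock_space_def)
  show "hzero ?F \<in> hcarrier ?F" by (simp add: ops fv_zero)
  fix x assume "x \<in> hcarrier ?F"
  then have x: "x \<in> fock_vectors H" by (simp add: ops)
  show "hscale ?F c x \<in> hcarrier ?F" for c using x by (simp add: ops fv_mult)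
  show "0 \<le> Re (hinner ?F x x)" by (simp add: fock_inner_self[OF x] fock_sq_nonneg)
  show "x = hzero ?F" if "hinner ?F x x = 0" using that fock_sq_zero[OF x] by (simp add: fock_inner_self[OF x] ops)
  fix y assume "y \<in> hcarrier ?F"
  then have y: "y \<in> fock_vectors H" by (simp add: ops)
  show "hadd ?F x y \<in> hcarrier ?F" using x y by (simp add: ops fv_plus)
  show "hinner ?F x (hscale ?F c y) = c * hinner ?F x y" for c
    using has_sum_cmult_right[OF fock_inner[OF x y], of c] fock_inner[OF x fv_mult[OF y, of c]]
    by (simp add: ops ac_simps has_sum_unique)
  show "hinner ?F y x = cnj (hinner ?F x y)"
  proof (rule has_sum_unique[OF fock_inner[OF y x]])
    have "((\<lambda>l. cnj (cnj (x l) * y l)) has_sum cnj (hinner ?F x y)) (lists ONB)"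
      using fock_inner[OF x y] by (simp only: has_sum_cnj_iff)
    then show "((\<lambda>l. cnj (y l) * x l) has_sum cnj (hinner ?F x y)) (lists ONB)" by (simp add: mult.commute)
  qed
  fix z assume "z \<in> hcarrier ?F"
  then have z: "z \<in> fock_vectors H" by (simp add: ops)
  show "hinner ?F x (hadd ?F y z) = hinner ?F x y + hinner ?F x z"
    using has_sum_add[OF fock_inner[OF x y] fock_inner[OF x z]] fock_inner[OF x fv_plus[OF y z]]
    by (simp add: ops algebra_simps has_sum_unique)
next
  show "\<exists>x\<in>hcarrier (EXP H). (\<lambda>n. hdist (EXP H) (u n) x) \<longlonglongrightarrow> 0" if "\<And>n::nat. u n \<in> hcarrier (EXP H)"
      "\<And>e. 0 < e \<Longrightarrow> \<exists>N. \<forall>m\<ge>N. \<forall>n\<ge>N. hdist (EXP H) (u m) (u n) < e" for u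
    using fock_complete[of u] that by (simp add: fock_space_def)
qed (auto simp: fock_space_def algebra_simps)

subsection \<open>Exponential vectors\<close>

text \<open>The component of degree \<open>m\<close> is the power
  \<open>h \<otimes> \<dots> \<otimes> h\<close> divided by \<open>sqrt (fact m)\<close>, which
  makes the inner products exponentials.\<close>

definition expv :: "'v \<Rightarrow> 'v list \<Rightarrow> complex" where
  "expv h l = (if l \<in> LH then prod_list (map (\<lambda>k. ip k h) l) / sqrt (fact (length l)) else 0)"

lemma expv_summand:
  assumes "h \<in> V" "k \<in> V" "l \<in> LH"
  shows "cnj (expv h l) * expv k l = prod_list (map (\<lambda>b. ip h b * ip b k) l) / fact (length l)"
proof -
  have "cnj (prod_list (map (\<lambda>k. ip k h) l)) * prod_list (map (\<lambda>b. ip b k) l) =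
      prod_list (map (\<lambda>b. ip h b * ip b k) l)" using assms(3)
  proof (induction l)
    case (Cons a l)
    then show ?case using inner_commute[of a h] assms(1) by (simp add: ac_simps)
  qed simp
  moreover have "complex_of_real (sqrt (fact (length l))) * complex_of_real (sqrt (fact (length l))) = fact (length l)"
    by (metis of_real_fact of_real_mult real_sqrt_mult_self abs_of_nonneg fact_ge_zero)
  ultimately show ?thesis using assms(3) by (simp add: expv_def)
qed

lemma expv_sum:
  assumes "h \<in> V" "k \<in> V"
  shows "((\<lambda>l. cnj (expv h l) * expv k l) has_sum exp (ip h k)) (lists ONB)"
  using has_sum_exp_lists[OF parseval[OF some_onb assms]]
  by (rule has_sum_cong[THEN iffD1, rotated]) (use assms lists_onb in \<open>simp add: expv_summand\<close>)

lemma expv_closed: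
  assumes h: "h \<in> V"
  shows "expv h \<in> fock_vectors H" unfolding fock_vectors_def
proof (intro CollectI conjI allI ballI impI)
  show "\<exists>C. \<forall>l\<in>LH. length l = m \<longrightarrow> cmod (expv h l) \<le> C * prod_list (map (nm) l)" for m
  proof (intro exI[of _ "nm h ^ m / sqrt (fact m)"] ballI impI)
    fix l assume l: "l \<in> LH" "length l = m"
    have "cmod (prod_list (map (\<lambda>k. ip k h) l)) \<le> nm h ^ length l * prod_list (map (nm) l)" using l(1)
    proof (induction l)
      case (Cons a l)
      then have a: "a \<in> V" and l: "l \<in> LH" by auto
      have "cmod (ip a h) * cmod (prod_list (map (\<lambda>k. ip k h) l)) \<le>
          (nm a * nm h) * (nm h ^ length l * prod_list (map (nm) l))"
        using Cons.IH cauchy_schwarz[OF a h] hnorm_nonneg[OF a] hnorm_nonneg[OF h] by (intro mult_mono) auto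
      then show ?case by (simp add: norm_mult ac_simps)
    qed simp
    then show "cmod (expv h l) \<le> nm h ^ m / sqrt (fact m) * prod_list (map (nm) l)"
      using l by (simp add: expv_def norm_divide divide_right_mono)
  qed
  show "expv h l = expv h l'" if "l \<in> LH" "l' \<in> LH" "mset l = mset l'" for l l'
  proof -
    have "prod_list (map (\<lambda>k. ip k h) l) = prod_list (map (\<lambda>k. ip k h) l')"
      using that(3) by (metis mset_map prod_mset_prod_list)
    then show ?thesis using that mset_eq_length[OF that(3)] by (simp add: expv_def)
  qed
  have "((\<lambda>l. Re (cnj (expv h l) * expv h l)) has_sum Re (exp (ip h h))) (lists ONB)"
    by (rule has_sum_Re[OF expv_sum[OF h h]])
  moreover have "Re (cnj z * z) = (cmod z)^2" for z by (metis Re_complex_of_real complex_norm_square mult.commute)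
  ultimately show "(\<lambda>l. (cmod (expv h l))^2) summable_on lists ONB" by (auto simp: has_sum_imp_summable)
qed (use h in \<open>auto simp: expv_def inner_simps algebra_simps add_divide_distrib\<close>)

lemma expv_inner:
  assumes "h \<in> V" "k \<in> V"
  shows "hinner (EXP H) (expv h) (expv k) = exp (ip h k)"
  using has_sum_unique[OF fock_inner[OF expv_closed[OF assms(1)] expv_closed[OF assms(2)]] expv_sum[OF assms]] .

text \<open>The inner products of exponential vectors are continuous functions of those of their
  arguments, so \<open>hconvI_weak\<close> applies.\<close>

lemma expv_tendsto:
  assumes "\<And>n. u n \<in> V" "x \<in> V" "hconv H u x"
  shows "hconv (EXP H) (\<lambda>n. expv (u n)) (expv x)"
proof -
  interpret F: complex_hilbert_space "EXP H" by (rule hilbert_fock)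
  have c: "expv y \<in> hcarrier (EXP H)" if "y \<in> V" for y using expv_closed[OF that] by (simp add: fock_space_def)
  show ?thesis
  proof (rule F.hconvI_weak)
    show "(\<lambda>n. Re (hinner (EXP H) (expv (u n)) (expv (u n)))) \<longlonglongrightarrow> Re (hinner (EXP H) (expv x) (expv x))"
      unfolding expv_inner[OF assms(1,1)] expv_inner[OF assms(2,2)] by (intro tendsto_intros inner_tendsto assms)
    show "(\<lambda>n. Re (hinner (EXP H) (expv (u n)) (expv x))) \<longlonglongrightarrow> Re (hinner (EXP H) (expv x) (expv x))"
      unfolding expv_inner[OF assms(1,2)] expv_inner[OF assms(2,2)]
      by (intro tendsto_intros inner_tendsto assms) (simp add: hdist_zero assms(2))
  qed (use c assms in auto)
qed

section \<open>Polarization and totality of the exponential vectors\<close>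

lemma fv_power_expand:
  assumes \<Phi>: "\<Phi> \<in> fock_vectors H" and G: "finite G" "G \<subseteq> V" and l: "l \<in> LH"
  shows "\<Phi> (l @ replicate m (hsum H (\<lambda>b. hscale H (c b) b) G)) =
    (\<Sum>k\<in>{k\<in>lists G. length k = m}. prod_list (map (\<lambda>b. cnj (c b)) k) * \<Phi> (l @ k))" using l
proof (induction m arbitrary: l)
  case 0
  have "{k \<in> lists G. length k = 0} = {[]}" by auto
  then show ?case by simp
next
  case (Suc m)
  define h where "h = hsum H (\<lambda>b. hscale H (c b) b) G"
  have h: "h \<in> V" unfolding h_def using G by (auto intro!: hsum_closed closed)

  have img: "{k \<in> lists G. length k = Suc m} = (\<lambda>(b, k). b # k) ` (G \<times> {k \<in> lists G. length k = m})"
    by (auto simp: length_Suc_conv image_iff)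
  have "\<Phi> (l @ replicate (Suc m) h) = (\<Sum>b\<in>G. cnj (c b) * \<Phi> (l @ b # replicate m h))" unfolding h_def replicate_Suc
    by (rule fv_hsum[OF \<Phi> Suc(2) _ G(1)]) (use G h in \<open>auto simp: h_def\<close>)
  also have "\<dots> = (\<Sum>b\<in>G. cnj (c b) * (\<Sum>k\<in>{k\<in>lists G. length k = m}. prod_list (map (\<lambda>b. cnj (c b)) k) * \<Phi> ((l @ [b]) @ k)))"
  proof (intro sum.cong refl arg_cong2[of _ _ _ _ "(*)"])
    fix b assume "b \<in> G"
    then show "\<Phi> (l @ b # replicate m h) = (\<Sum>k\<in>{k\<in>lists G. length k = m}. prod_list (map (\<lambda>b. cnj (c b)) k) * \<Phi> ((l @ [b]) @ k))"
      using Suc(1)[of "l @ [b]"] Suc(2) G by (auto simp: h_def)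
  qed
  also have "\<dots> = (\<Sum>(b, k)\<in>G \<times> {k\<in>lists G. length k = m}. prod_list (map (\<lambda>b. cnj (c b)) (b # k)) * \<Phi> (l @ b # k))"
    by (simp add: sum_distrib_left sum.cartesian_product mult.assoc)
  also have "\<dots> = (\<Sum>k\<in>{k\<in>lists G. length k = Suc m}. prod_list (map (\<lambda>b. cnj (c b)) k) * \<Phi> (l @ k))"
    unfolding img by (subst sum.reindex) (auto simp: inj_on_def case_prod_unfold)
  finally show ?case unfolding h_def .
qed

text \<open>On the line \<open>x + t y\<close> a functional of degree \<open>n\<close> is a
  polynomial in \<open>t\<close>, whose linear coefficient is by symmetry \<open>n\<close> times the
  value with a single \<open>y\<close>. The remaining arguments \<open>r\<close> allow the slots to
  be expanded one by one. For \<open>n = 0\<close> the factor \<open>of_nat n\<close> removes the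
  term with \<open>n - 1\<close>.\<close>

lemma fv_polynomial:
  assumes \<Phi>: "\<Phi> \<in> fock_vectors H" and x: "x \<in> V" and y: "y \<in> V" and r: "r \<in> LH"
  shows "\<exists>p. (\<forall>t. poly p (of_real t) = \<Phi> (replicate n (hadd H x (hscale H (of_real t) y)) @ r)) \<and>
    coeff p 0 = \<Phi> (replicate n x @ r) \<and> coeff p 1 = of_nat n * \<Phi> (y # replicate (n - 1) x @ r)" using r
proof (induction n arbitrary: r)
  case 0
  then show ?case by (intro exI[of _ "[:\<Phi> r:]"]) simp
next
  case (Suc n)
  obtain p where p: "\<forall>t. poly p (of_real t) = \<Phi> (replicate n (hadd H x (hscale H (of_real t) y)) @ x # r)"
      "coeff p 0 = \<Phi> (replicate n x @ x # r)" "coeff p 1 = of_nat n * \<Phi> (y # replicate (n - 1) x @ x # r)"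
    using Suc(1)[of "x # r"] Suc(2) x by auto
  obtain q where q: "\<forall>t. poly q (of_real t) = \<Phi> (replicate n (hadd H x (hscale H (of_real t) y)) @ y # r)"
      "coeff q 0 = \<Phi> (replicate n x @ y # r)" using Suc(1)[of "y # r"] Suc(2) y by auto
  have "poly (p + pCons 0 q) (of_real t) = \<Phi> (replicate (Suc n) (hadd H x (hscale H (of_real t) y)) @ r)" for t
  proof -
    define z where "z = hadd H x (hscale H (of_real t) y)"
    have z: "z \<in> V" using x y by (simp add: z_def closed)
    have rn: "replicate n z \<in> LH" using z by (induction n) auto
    have "replicate (Suc n) z @ r = replicate n z @ z # r" by (simp add: replicate_app_Cons_same)
    then have "\<Phi> (replicate (Suc n) z @ r) = \<Phi> (replicate n z @ z # r)" by simp
    also have "\<dots> = \<Phi> (replicate n z @ x # r) + of_real t * \<Phi> (replicate n z @ y # r)"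
      using fv_add[OF \<Phi> rn Suc(2), of x "hscale H (of_real t) y"] fv_scale[OF \<Phi> rn Suc(2) y, of "of_real t"] x y
      by (simp add: z_def closed)
    finally show ?thesis using p(1) q(1) by (simp add: z_def)
  qed
  moreover have "coeff (p + pCons 0 q) 0 = \<Phi> (replicate (Suc n) x @ r)" using p(2) by (simp add: replicate_app_Cons_same)
  moreover have "coeff (p + pCons 0 q) 1 = of_nat (Suc n) * \<Phi> (y # replicate (Suc n - 1) x @ r)"
  proof -
    have rx: "replicate k x \<in> LH" for k using x by (induction k) auto
    have "\<Phi> (replicate n x @ y # r) = \<Phi> (y # replicate n x @ r)" by (rule fv_sym[OF \<Phi>]) (use rx y Suc(2) in auto)
    moreover have "of_nat n * \<Phi> (y # replicate (n - 1) x @ x # r) = of_nat n * \<Phi> (y # replicate n x @ r)"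
    proof (cases n)
      case (Suc k)
      then show ?thesis by (simp add: replicate_app_Cons_same)
    qed simp
    ultimately show ?thesis using p(3) q(2) by (simp add: algebra_simps)
  qed
  ultimately show ?case by blast
qed

text \<open>A symmetric multilinear functional that vanishes on the diagonal vanishes altogether:
  the polynomial of \<open>fv_polynomial\<close> is zero at all real \<open>t\<close>, hence so is
  its linear coefficient. The induction inserts the letters of \<open>l\<close> one by one next to
  powers of an arbitrary \<open>x\<close>, and at the end the power is taken to be empty.\<close>

lemma fv_polarization:
  assumes \<Phi>: "\<Phi> \<in> fock_vectors H" and S: "hsubspace H S"
    and z: "\<And>x m. x \<in> S \<Longrightarrow> \<Phi> (replicate m x) = 0" and l: "l \<in> lists S"
  shows "\<Phi> l = 0"
proof -
  have SH: "x \<in> V" if "x \<in> S" for x using S that by (auto simp: hsubspace_def)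
  have "\<Phi> (replicate m x @ l) = 0" if "x \<in> S" for x m using l that
  proof (induction l arbitrary: x m)
    case Nil
    then show ?case using z by simp
  next
    case (Cons w l)
    then have w: "w \<in> S" "w \<in> V" and l: "l \<in> LH" and x: "x \<in> V" using SH by auto
    obtain p where p: "\<forall>t. poly p (of_real t) = \<Phi> (replicate (Suc m) (hadd H x (hscale H (of_real t) w)) @ l)"
      "coeff p 1 = of_nat (Suc m) * \<Phi> (w # replicate (Suc m - 1) x @ l)"
      using fv_polynomial[OF \<Phi> x w(2) l, of "Suc m"] by blast
    have S': "hadd H x (hscale H (of_real t) w) \<in> S" for t using S Cons(4) w by (auto simp: hsubspace_def)
    have "poly p (of_real t) = 0" for t using p(1) Cons.IH[OF S', of "Suc m" t] by simp
    then have "range complex_of_real \<subseteq> {z. poly p z = 0}" by auto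
    moreover have "infinite (range complex_of_real)" by (simp add: finite_image_iff inj_of_real infinite_UNIV_char_0)
    ultimately have "p = 0" using poly_roots_finite finite_subset by blast
    then have "\<Phi> (w # replicate m x @ l) = 0" using p(2) by (simp del: of_nat_Suc)
    moreover have "\<Phi> (replicate m x @ w # l) = \<Phi> (w # replicate m x @ l)"
    proof (rule fv_sym[OF \<Phi>])
      have "replicate m x \<in> LH" using x by (induction m) auto
      then show "replicate m x @ w # l \<in> LH" "w # replicate m x @ l \<in> LH" using w l by auto
    qed simp
    ultimately show ?case by simp
  qed
  from this[of "hzero H" 0] show ?thesis using S by (simp add: hsubspace_def)
qed

text \<open>Along \<open>t \<mapsto> exp (t h)\<close> with a finite combination \<open>h\<close> of
  basis vectors, the pairing with \<Phi> is a power series in \<open>t\<close> whose coefficient of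
  degree \<open>m\<close> is, up to a factor, the value of \<Phi> at \<open>m\<close> copies of
  \<open>h\<close>. If it is zero then so are all diagonal values, and polarization finishes the
  proof.\<close>

theorem expv_total: "total_in (EXP H) (expv ` V)" unfolding total_in_def
proof (intro conjI ballI impI)
  show "expv ` V \<subseteq> hcarrier (EXP H)" using expv_closed by (auto simp: fock_space_def)
  fix \<Phi> assume "\<Phi> \<in> hcarrier (EXP H)" and orth: "\<forall>e\<in>expv ` V. hinner (EXP H) e \<Phi> = 0"
  then have \<Phi>: "\<Phi> \<in> fock_vectors H" by (simp add: fock_space_def)
  have diag: "\<Phi> (replicate m (hsum H (\<lambda>b. hscale H (c b) b) G)) = 0" if G: "finite G" "G \<subseteq> ONB" for G c m
  proof -
    have GH: "G \<subseteq> V" using G some_onb_closed by blast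
    define h where "h t = hsum H (\<lambda>b. hscale H (of_real t * c b) b) G" for t :: real
    have h: "h t \<in> V" for t unfolding h_def using G GH by (auto intro!: hsum_closed closed)
    define A where "A m = {k\<in>lists G. length k = m}" for m
    have Afin: "finite (A m)" for m using finite_lists_length_eq[OF G(1)] by (simp add: lists_eq_set A_def)
    define a where "a m = (\<Sum>k\<in>A m. prod_list (map (\<lambda>b. cnj (c b)) k) * \<Phi> k) / sqrt (fact m)" for m
    have bh: "ip b (h t) = (if b \<in> G then of_real t * c b else 0)" if b: "b \<in> ONB" for b t
    proof -
      have "ip b (h t) = (\<Sum>g\<in>G. of_real t * c g * (if b = g then 1 else 0))" unfolding h_def using G GH b some_onb
        by (subst inner_hsum) (auto intro!: sum.cong closed simp: some_onb_closed inner_simps orthonormal_basis_def subset_iff)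
      also have "\<dots> = (if b \<in> G then of_real t * c b else 0)" using G by (simp add: if_distrib cong: if_cong)
      finally show ?thesis .
    qed
    have exph: "cnj (expv (h t) l) = (if l \<in> lists G then of_real t ^ length l * prod_list (map (\<lambda>b. cnj (c b)) l) / sqrt (fact (length l)) else 0)"
      if l: "l \<in> lists ONB" for l t
    proof -
      have "cnj (prod_list (map (\<lambda>k. ip k (h t)) l)) = (if l \<in> lists G then of_real t ^ length l * prod_list (map (\<lambda>b. cnj (c b)) l) else 0)"
        using l by (induction l) (auto simp: bh)
      then show ?thesis using lists_onb[OF l] by (simp add: expv_def)
    qed
    have sum0: "((\<lambda>m. a m * of_real t ^ m) has_sum 0) UNIV" for t
    proof (rule has_sum_Sigma'[where B = "\<lambda>m. {l \<in> lists ONB. length l = m}"])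
      have "((\<lambda>l. cnj (expv (h t) l) * \<Phi> l) has_sum 0) (lists ONB)"
        using fock_inner[OF expv_closed[OF h] \<Phi>, of t] orth h by simp
      then show "((\<lambda>(m, l). cnj (expv (h t) l) * \<Phi> l) has_sum 0) (SIGMA m:UNIV. {l \<in> lists ONB. length l = m})"
        by (simp only: has_sum_lists)
      fix m :: nat
      have "((\<lambda>l. cnj (expv (h t) l) * \<Phi> l) has_sum (\<Sum>l\<in>A m. cnj (expv (h t) l) * \<Phi> l)) {l \<in> lists ONB. length l = m}"
      proof (rule has_sum_finite_neutralI[OF Afin])
        show "A m \<subseteq> {l \<in> lists ONB. length l = m}" using G by (auto simp: A_def)
        show "cnj (expv (h t) l) * \<Phi> l = 0" if "l \<in> {l \<in> lists ONB. length l = m} - A m" for l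
          using that by (auto simp: A_def exph)
      qed simp
      also have "(\<Sum>l\<in>A m. cnj (expv (h t) l) * \<Phi> l) = a m * of_real t ^ m"
        unfolding a_def sum_divide_distrib sum_distrib_right
      proof (rule sum.cong[OF refl])
        fix l assume l: "l \<in> A m"
        then have "l \<in> lists ONB" using G by (auto simp: A_def)
        then show "cnj (expv (h t) l) * \<Phi> l = prod_list (map (\<lambda>b. cnj (c b)) l) * \<Phi> l / sqrt (fact m) * of_real t ^ m"
          using l by (simp add: exph A_def)
      qed
      finally show "((\<lambda>y. case (m, y) of (m, l) \<Rightarrow> cnj (expv (h t) l) * \<Phi> l) has_sum a m * of_real t ^ m) {l \<in> lists ONB. length l = m}"
        by simp
    qed
    have "a m = 0"
    proof (rule power_series_zero)
      have "(\<lambda>n. norm (a n)) summable_on UNIV"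
        using has_sum_imp_summable[OF sum0[of 1]] by (simp add: summable_on_iff_abs_summable_on_complex[symmetric])
      then show "summable (\<lambda>n. norm (a n))" by (rule summable_on_imp_summable)
      show "(\<lambda>n. a n * of_real t ^ n) sums 0" for t by (rule has_sum_imp_sums[OF sum0])
    qed
    moreover have "\<Phi> (replicate m (h 1)) = (\<Sum>k\<in>A m. prod_list (map (\<lambda>b. cnj (c b)) k) * \<Phi> k)"
      using fv_power_expand[OF \<Phi> G(1) GH, of "[]" m c] by (simp add: h_def A_def)
    ultimately have "\<Phi> (replicate m (h 1)) = 0" by (simp add: a_def)
    then show ?thesis by (simp add: h_def)
  qed
  define S where "S = hspan H ONB"
  have onbH: "ONB \<subseteq> V" using some_onb_closed by blast
  have S: "hsubspace H S" unfolding S_def by (rule hspan_subspace[OF onbH])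
  have "\<Phi> (replicate m x) = 0" if x: "x \<in> S" for x m
  proof -
    have "\<exists>G c. finite G \<and> G \<subseteq> ONB \<and> x = hsum H (\<lambda>b. hscale H (c b) b) G" using x unfolding S_def
    proof induction
      case zero
      then show ?case by (intro exI[of _ "{}"]) (simp add: hsum_empty)
    next
      case (step x e d)
      then obtain G c where G: "finite G" "G \<subseteq> ONB" "x = hsum H (\<lambda>b. hscale H (c b) b) G" by blast
      \<comment> \<open>The index set is now a set of basis vectors, so the coefficient of a
        generator that occurred before has to be added to the old one.\<close>
      define c' where "c' b = (if b \<in> G then c b else 0) + (if b = e then d else 0)" for b
      have GH: "\<forall>g\<in>G. g \<in> V" "e \<in> V" using G(2) onbH step(2) by auto
      have xH: "x \<in> V" by (rule hspan_closed[OF onbH step(1)])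
      have "hadd H x (hscale H d e) = hsum H (\<lambda>b. hscale H (c' b) b) (insert e G)"
      proof (rule weak_eqI)
        have cl: "\<forall>b\<in>insert e G. hscale H (c' b) b \<in> V" using GH by (auto simp: closed)
        show "hsum H (\<lambda>b. hscale H (c' b) b) (insert e G) \<in> V" by (rule hsum_closed[OF _ cl]) (use G in simp)
        fix z assume z: "z \<in> V"
        have "ip z (hsum H (\<lambda>b. hscale H (c' b) b) (insert e G)) = (\<Sum>b\<in>insert e G. ip z (hscale H (c' b) b))"
          by (rule inner_hsum[OF _ cl z]) (use G in simp)
        also have "\<dots> = (\<Sum>b\<in>insert e G. (if b \<in> G then c b * ip z b else 0) + (if b = e then d * ip z b else 0))"
          using GH z by (intro sum.cong refl) (auto simp: inner_simps c'_def algebra_simps)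
        also have "\<dots> = (\<Sum>b\<in>G. c b * ip z b) + d * ip z e"
          using G(1) by (simp add: sum.distrib sum.If_cases Int_insert_left insert_absorb)
        also have "(\<Sum>b\<in>G. c b * ip z b) = ip z x"
          unfolding G(3) using GH z G(1) by (subst inner_hsum) (auto simp: closed inner_simps)
        finally show "ip z (hadd H x (hscale H d e)) = ip z (hsum H (\<lambda>b. hscale H (c' b) b) (insert e G))"
          using z xH GH by (simp add: inner_simps)
      qed (use xH GH in \<open>simp add: closed\<close>)
      then show ?case using G step(2) by (intro exI[of _ "insert e G"] exI[of _ c']) auto
    qed
    then show ?thesis using diag by blast
  qed
  then have "\<Phi> l = 0" if "l \<in> lists ONB" for l
    using fv_polarization[OF \<Phi> S, of l] that hspan_base[OF onbH] by (auto simp: S_def)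
  then have "fock_sq \<Phi> = 0" unfolding fock_sq_def by (simp add: infsum_0)
  then show "\<Phi> = hzero (EXP H)" using fock_sq_zero[OF \<Phi>] by (simp add: fock_space_def)
qed

end

section \<open>Uniqueness of Fourier transforms\<close>

lemma borel_measurable_cnj [measurable (raw)]:
  "f \<in> borel_measurable N \<Longrightarrow> (\<lambda>x. cnj (f x)) \<in> borel_measurable N"
  by (intro borel_measurable_continuous_on[of cnj]) (auto intro!: continuous_intros)

text \<open>The positive and the negative part of \<open>g\<close> have the same integral, by the
  hypothesis at \<open>y = 0\<close>. Normalized to probability densities they give two laws of
  \<open>X\<close> with equal characteristic functions, so the laws agree.\<close>

lemma fourier_zero_real:
  fixes g :: "'a \<Rightarrow> real"
  assumes g: "integrable N g" and X[measurable]: "X \<in> borel_measurable N"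
    and z: "\<And>y. (\<integral>x. of_real (g x) * iexp (y * X x) \<partial>N) = 0"
    and E: "E \<in> sets borel"
  shows "(\<integral>x. indicator E (X x) * g x \<partial>N) = 0"
proof -
  have gm[measurable]: "g \<in> borel_measurable N" using g by simp
  define p where "p x = max 0 (g x)" for x
  define q where "q x = max 0 (- g x)" for x
  have pq: "g x = p x - q x" "p x \<ge> 0" "q x \<ge> 0" for x by (auto simp: p_def q_def)
  have int: "integrable N p" "integrable N q" unfolding p_def q_def using g by auto
  have pm[measurable]: "p \<in> borel_measurable N" "q \<in> borel_measurable N" using int by auto
  have intX: "integrable N (\<lambda>x. of_real (f x) * iexp (y * X x))" if "integrable N f" for f :: "'a \<Rightarrow> real" and y
  proof (rule Bochner_Integration.integrable_bound[OF that])
    have [measurable]: "f \<in> borel_measurable N" using that by simp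
    show "(\<lambda>x. of_real (f x) * iexp (y * X x)) \<in> borel_measurable N" by measurable
  qed (simp add: norm_mult)
  have eqc: "(\<integral>x. of_real (p x) * iexp (y * X x) \<partial>N) = (\<integral>x. of_real (q x) * iexp (y * X x) \<partial>N)" for y
  proof -
    have "(\<integral>x. of_real (g x) * iexp (y * X x) \<partial>N) =
      (\<integral>x. of_real (p x) * iexp (y * X x) - of_real (q x) * iexp (y * X x) \<partial>N)"
      by (simp add: pq(1) left_diff_distrib)
    also have "\<dots> =
      (\<integral>x. of_real (p x) * iexp (y * X x) \<partial>N) - (\<integral>x. of_real (q x) * iexp (y * X x) \<partial>N)"
      by (rule Bochner_Integration.integral_diff[OF intX[OF int(1)] intX[OF int(2)]])
    finally show ?thesis using z by simp
  qed
  define m where "m = (\<integral>x. p x \<partial>N)"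
  have mq: "m = (\<integral>x. q x \<partial>N)"
  proof -
    have "complex_of_real m = complex_of_real (\<integral>x. q x \<partial>N)" using eqc[of 0] by (simp add: m_def)
    then show ?thesis by (simp only: of_real_eq_iff)
  qed
  have m0: "m \<ge> 0" unfolding m_def by (rule integral_nonneg_AE) (simp add: pq)
  show ?thesis
  proof (cases "m = 0")
    case True
    then have "(\<integral>x. p x \<partial>N) = 0" "(\<integral>x. q x \<partial>N) = 0" using mq by (simp_all add: m_def)
    then have "AE x in N. p x = 0" "AE x in N. q x = 0"
      using integral_nonneg_eq_0_iff_AE[OF int(1)] integral_nonneg_eq_0_iff_AE[OF int(2)] pq by simp_all
    then have "AE x in N. indicator E (X x) * g x = 0" by eventually_elim (simp add: pq(1))
    then show ?thesis by (rule integral_eq_zero_AE)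
  next
    case False
    then have m: "m > 0" using m0 by simp
    define D where "D f = density N (\<lambda>x. ennreal (f x / m))" for f
    have Dp: "prob_space (D f)" if f: "integrable N f" "\<And>x. f x \<ge> 0" "(\<integral>x. f x \<partial>N) = m" for f
    proof (rule prob_spaceI)
      have [measurable]: "f \<in> borel_measurable N" using f by simp
      have "emeasure (D f) (space (D f)) = (\<integral>\<^sup>+x. ennreal (f x / m) \<partial>N)"
        unfolding D_def by (subst emeasure_density) (auto intro!: nn_integral_cong)
      also have "\<dots> = ennreal (\<integral>x. f x / m \<partial>N)" using f m by (intro nn_integral_eq_integral) auto
      also have "\<dots> = 1" using f m by simp
      finally show "emeasure (D f) (space (D f)) = 1" .
    qed
    have XD: "X \<in> borel_measurable (D f)" for f by (simp add: D_def)
    have ch: "char (distr (D f) borel X) y = (\<integral>x. of_real (f x) * iexp (y * X x) \<partial>N) / m"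
      if f: "integrable N f" "\<And>x. f x \<ge> 0" for f y
    proof -
      have [measurable]: "f \<in> borel_measurable N" using f by simp
      have "char (distr (D f) borel X) y = (\<integral>x. iexp (y * X x) \<partial>D f)"
        unfolding char_def by (rule integral_distr) (use XD in \<open>auto\<close>)
      also have "\<dots> = (\<integral>x. (f x / m) *\<^sub>R iexp (y * X x) \<partial>N)" unfolding D_def by (rule integral_density) (use f m in auto)
      also have "\<dots> = (\<integral>x. (of_real (f x) * iexp (y * X x)) / m \<partial>N)"
        by (intro Bochner_Integration.integral_cong refl) (simp add: scaleR_conv_of_real)
      finally show ?thesis by simp
    qed
    have "distr (D p) borel X = distr (D q) borel X"
    proof (rule Levy_uniqueness)
      show "real_distribution (distr (D p) borel X)"
        by (rule prob_space.real_distribution_distr[OF Dp XD]) (use int pq in \<open>auto simp: m_def\<close>)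
      show "real_distribution (distr (D q) borel X)"
        by (rule prob_space.real_distribution_distr[OF Dp XD]) (use int pq in \<open>auto simp: mq\<close>)
      show "char (distr (D p) borel X) = char (distr (D q) borel X)" using int pq eqc by (simp add: ch fun_eq_iff)
    qed
    then have me: "measure (distr (D p) borel X) E = measure (distr (D q) borel X) E" by simp
    have val: "measure (distr (D f) borel X) E = (\<integral>x. indicator E (X x) * f x \<partial>N) / m"
      if f: "integrable N f" "\<And>x. f x \<ge> 0" for f
    proof -
      have [measurable]: "f \<in> borel_measurable N" using f by simp
      have i: "integrable N (\<lambda>x. indicator E (X x) * f x)"
        by (rule Bochner_Integration.integrable_bound[OF f(1)]) (use E in \<open>auto split: split_indicator\<close>)
      have "emeasure (distr (D f) borel X) E = emeasure (D f) (X -` E \<inter> space N)"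
        using E XD by (subst emeasure_distr) (auto simp: D_def)
      also have "\<dots> = (\<integral>\<^sup>+x. ennreal (f x / m) * indicator (X -` E \<inter> space N) x \<partial>N)"
        unfolding D_def using E by (subst emeasure_density) auto
      also have "\<dots> = (\<integral>\<^sup>+x. ennreal (indicator E (X x) * f x / m) \<partial>N)"
        by (intro nn_integral_cong) (auto split: split_indicator)
      also have "\<dots> = ennreal ((\<integral>x. indicator E (X x) * f x \<partial>N) / m)" using i f m by (subst nn_integral_eq_integral) auto
      finally show ?thesis using f m by (simp add: measure_def integral_nonneg_AE)
    qed
    have i: "integrable N (\<lambda>x. indicator E (X x) * p x)" "integrable N (\<lambda>x. indicator E (X x) * q x)"
      by (rule Bochner_Integration.integrable_bound[OF int(1)], use E in \<open>auto split: split_indicator\<close>)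
        (rule Bochner_Integration.integrable_bound[OF int(2)], use E in \<open>auto split: split_indicator\<close>)
    have "(\<integral>x. indicator E (X x) * p x \<partial>N) = (\<integral>x. indicator E (X x) * q x \<partial>N)"
      using me val[OF int(1)] val[OF int(2)] pq m by simp
    then show ?thesis using i by (simp add: pq(1) right_diff_distrib)
  qed
qed

text \<open>The hypothesis for \<open>- y\<close> is, after conjugation, the hypothesis for
  \<open>cnj \<circ> g\<close>. Hence it holds for the real and for the imaginary part.\<close>

lemma fourier_zero:
  fixes g :: "'a \<Rightarrow> complex"
  assumes g: "integrable N g" and X[measurable]: "X \<in> borel_measurable N"
    and z: "\<And>y. (\<integral>x. g x * iexp (y * X x) \<partial>N) = 0"
    and E: "E \<in> sets borel"
  shows "(\<integral>x. indicator E (X x) *\<^sub>R g x \<partial>N) = 0"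
proof -
  have gm[measurable]: "g \<in> borel_measurable N" using g by simp
  have intX: "integrable N (\<lambda>x. f x * iexp (y * X x))" if f: "integrable N f" for f :: "'a \<Rightarrow> complex" and y
  proof (rule Bochner_Integration.integrable_bound[OF f])
    have [measurable]: "f \<in> borel_measurable N" using f by simp
    show "(\<lambda>x. f x * iexp (y * X x)) \<in> borel_measurable N" by measurable
  qed (simp add: norm_mult)
  have gc: "integrable N (\<lambda>x. cnj (g x))" using g by simp
  have zc: "(\<integral>x. cnj (g x) * iexp (y * X x) \<partial>N) = 0" for y
  proof -
    have "(\<integral>x. cnj (g x) * iexp (y * X x) \<partial>N) = (\<integral>x. cnj (g x * iexp (- y * X x)) \<partial>N)"
      by (intro Bochner_Integration.integral_cong refl) (simp add: exp_cnj)
    also have "\<dots> = cnj (\<integral>x. g x * iexp (- y * X x) \<partial>N)" by (rule Bochner_Integration.integral_cnj)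
    also have "\<dots> = 0" by (simp only: z complex_cnj_zero)
    finally show ?thesis .
  qed
  have 1: "(\<integral>x. of_real (Re (g x)) * iexp (y * X x) \<partial>N) = 0" for y
  proof -
    have "(\<integral>x. of_real (Re (g x)) * iexp (y * X x) \<partial>N) =
        (\<integral>x. (g x * iexp (y * X x) + cnj (g x) * iexp (y * X x)) / 2 \<partial>N)"
      by (intro Bochner_Integration.integral_cong refl) (simp add: complex_add_cnj flip: distrib_right)
    then show ?thesis using g gc intX z zc by simp
  qed
  have 2: "(\<integral>x. of_real (Im (g x)) * iexp (y * X x) \<partial>N) = 0" for y
  proof -
    have "(\<integral>x. of_real (Im (g x)) * iexp (y * X x) \<partial>N) =
        (\<integral>x. (g x * iexp (y * X x) - cnj (g x) * iexp (y * X x)) / (2 * \<i>) \<partial>N)"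
    proof (intro Bochner_Integration.integral_cong refl)
      fix x
      have "(g x - cnj (g x)) / (2 * \<i>) = of_real (Im (g x))" by (simp add: complex_diff_cnj complex_eq_iff)
      then show "of_real (Im (g x)) * iexp (y * X x) =
          (g x * iexp (y * X x) - cnj (g x) * iexp (y * X x)) / (2 * \<i>)"
        by (metis left_diff_distrib times_divide_eq_left)
    qed
    then show ?thesis using g gc intX z zc by simp
  qed
  have "(\<integral>x. indicator E (X x) * Re (g x) \<partial>N) = 0" by (rule fourier_zero_real[OF _ X 1 E]) (use g in simp)
  moreover have "(\<integral>x. indicator E (X x) * Im (g x) \<partial>N) = 0" by (rule fourier_zero_real[OF _ X 2 E]) (use g in simp)
  moreover have i: "integrable N (\<lambda>x. indicator E (X x) *\<^sub>R g x)"
    by (rule Bochner_Integration.integrable_bound[OF g]) (use E in \<open>auto split: split_indicator\<close>)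
  ultimately show ?thesis
    by (intro complex_eqI) (simp_all add: integral_Re[OF i, symmetric] integral_Im[OF i, symmetric] del: integral_Re integral_Im)
qed

text \<open>The sets on which \<open>f\<close> is positive and on which it is negative,
  \<open>s\<close> being the sign, have to be null sets.\<close>

lemma AE_zero_if_set_integrals_zero_real:
  fixes f :: "'a \<Rightarrow> real"
  assumes f: "integrable N f" and z: "\<And>F. F \<in> sets N \<Longrightarrow> (\<integral>x. indicator F x * f x \<partial>N) = 0"
  shows "AE x in N. f x = 0"
proof -
  have [measurable]: "f \<in> borel_measurable N" using f by simp
  have *: "AE x in N. indicator {x\<in>space N. s * f x > 0} x * (s * f x) = 0" for s :: real
  proof -
    have F: "{x\<in>space N. s * f x > 0} \<in> sets N" by measurable
    have "integrable N (\<lambda>x. indicator {x\<in>space N. s * f x > 0} x * (s * f x))"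
      using integrable_mult_indicator[OF F, of "\<lambda>x. s * f x"] f by simp
    moreover have "(\<integral>x. indicator {x\<in>space N. s * f x > 0} x * (s * f x) \<partial>N) = s * (\<integral>x. indicator {x\<in>space N. s * f x > 0} x * f x \<partial>N)"
      by (subst integral_mult_right_zero[symmetric]) (simp add: ac_simps)
    ultimately show ?thesis using z[OF F] by (subst integral_nonneg_eq_0_iff_AE[symmetric]) (auto split: split_indicator)
  qed
  show ?thesis using *[of 1] *[of "-1"] AE_space by eventually_elim (auto split: split_indicator_asm)
qed

lemma AE_zero_if_set_integrals_zero:
  fixes f :: "'a \<Rightarrow> complex"
  assumes f: "integrable N f" and z: "\<And>F. F \<in> sets N \<Longrightarrow> (\<integral>x. indicator F x *\<^sub>R f x \<partial>N) = 0"
  shows "AE x in N. f x = 0"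
proof -
  have i: "integrable N (\<lambda>x. indicator F x *\<^sub>R f x)" if "F \<in> sets N" for F
    using f that by (rule integrable_mult_indicator[rotated])
  have "AE x in N. Re (f x) = 0"
  proof (rule AE_zero_if_set_integrals_zero_real)
    fix F assume F: "F \<in> sets N"
    show "(\<integral>x. indicator F x * Re (f x) \<partial>N) = 0" using integral_Re[OF i[OF F]] z[OF F] by simp
  qed (use f in simp)
  moreover have "AE x in N. Im (f x) = 0"
  proof (rule AE_zero_if_set_integrals_zero_real)
    fix F assume F: "F \<in> sets N"
    show "(\<integral>x. indicator F x * Im (f x) \<partial>N) = 0" using integral_Im[OF i[OF F]] z[OF F] by simp
  qed (use f in simp)
  ultimately show ?thesis by eventually_elim (simp add: complex_eq_iff)
qed

section \<open>The factorization determined by a process with independent values\<close>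

locale independent_values = prob_space P for P :: "'w measure" +
  fixes M :: "'x measure" and \<eta> :: "('x \<Rightarrow> real) \<Rightarrow> 'w \<Rightarrow> real"
  assumes levy: "levy_process M P \<eta>"
begin

abbreviation "alg \<equiv> process_algebra M P \<eta>"
abbreviation "bm \<equiv> bounded_measurable M"

definition ex :: "('x \<Rightarrow> real) \<Rightarrow> 'w \<Rightarrow> complex" where
  "ex a \<omega> = iexp (\<eta> a \<omega>)"

definition cf :: "('x \<Rightarrow> real) \<Rightarrow> complex" where
  "cf a = (\<integral>\<omega>. ex a \<omega> \<partial>P)"

lemma eta_measurable: "a \<in> bm \<Longrightarrow> \<eta> a \<in> borel_measurable P"
  and eta_AE: "\<lbrakk>a \<in> bm; b \<in> bm; AE x in M. a x = b x\<rbrakk> \<Longrightarrow> AE \<omega> in P. \<eta> a \<omega> = \<eta> b \<omega>"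
  and eta_lin: "\<lbrakk>a \<in> bm; b \<in> bm\<rbrakk> \<Longrightarrow> AE \<omega> in P. \<eta> (\<lambda>x. r * a x + s * b x) \<omega> = r * \<eta> a \<omega> + s * \<eta> b \<omega>"
  and eta_indep: "\<lbrakk>a \<in> bm; b \<in> bm; AE x in M. a x * b x = 0\<rbrakk> \<Longrightarrow> indep_var borel (\<eta> a) borel (\<eta> b)"
  using levy unfolding levy_process_def generalized_random_process_def by blast+

lemma bm_on_bm: "a \<in> bm_on M A \<Longrightarrow> a \<in> bm" by (simp add: bm_on_def)

lemma bm_on_add: "\<lbrakk>a \<in> bm_on M A; b \<in> bm_on M A\<rbrakk> \<Longrightarrow> (\<lambda>x. r * a x + s * b x) \<in> bm_on M A" by (auto simp: bm_on_def bm_add)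

lemma space_alg: "space (alg A) = space P" by (simp add: process_algebra_def space_measure_of_conv)

lemma alg_gen: "{\<eta> a -` E \<inter> space P | a E. a \<in> bounded_measurable M \<and> (\<forall>x\<in>space M - A. a x = 0) \<and> E \<in> sets borel}
    = {\<eta> a -` E \<inter> space P | a E. a \<in> bm_on M A \<and> E \<in> sets borel}" by (auto simp: bm_on_def)

lemma sets_alg: "sets (alg A) = sigma_sets (space P) {\<eta> a -` E \<inter> space P | a E. a \<in> bm_on M A \<and> E \<in> sets borel}"
  unfolding process_algebra_def alg_gen by (rule sets_measure_of) auto

lemma subalg: "subalgebra P (alg A)" unfolding subalgebra_def space_alg sets_alg
  using eta_measurable bm_on_bm by (auto intro!: sets.sigma_sets_subset measurable_sets)

lemma alg_mono: "A \<inter> space M \<subseteq> B \<Longrightarrow> sets (alg A) \<subseteq> sets (alg B)"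
  unfolding sets_alg by (rule sigma_sets_mono') (auto simp: bm_on_def)

lemma alg_mono_measurable: "A \<inter> space M \<subseteq> B \<Longrightarrow> f \<in> measurable (alg A) N \<Longrightarrow> f \<in> measurable (alg B) N"
  using alg_mono[of A B] by (auto simp: measurable_def space_alg)

lemma eta_alg: "a \<in> bm_on M A \<Longrightarrow> \<eta> a \<in> borel_measurable (alg A)"
proof (rule measurableI)
  fix E :: "real set" assume "a \<in> bm_on M A" "E \<in> sets borel"
  then show "\<eta> a -` E \<inter> space (alg A) \<in> sets (alg A)" unfolding space_alg sets_alg by (intro sigma_sets.Basic) blast
qed simp

lemma ex_alg: "a \<in> bm_on M A \<Longrightarrow> ex a \<in> borel_measurable (alg A)" unfolding ex_def using eta_alg[of a A] by measurable

lemma ex_measurable: "a \<in> bm \<Longrightarrow> ex a \<in> borel_measurable P" unfolding ex_def using eta_measurable[of a] by measurable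

lemma norm_ex: "cmod (ex a \<omega>) = 1" by (simp add: ex_def)

lemma ex_AE: "\<lbrakk>a \<in> bm; b \<in> bm; AE x in M. a x = b x\<rbrakk> \<Longrightarrow> AE \<omega> in P. ex a \<omega> = ex b \<omega>"
  using eta_AE[of a b] by (auto simp: ex_def elim: eventually_mono)

lemma ex_add: "\<lbrakk>a \<in> bm; b \<in> bm\<rbrakk> \<Longrightarrow> AE \<omega> in P. ex (\<lambda>x. a x + b x) \<omega> = ex a \<omega> * ex b \<omega>"
  using eta_lin[of a b 1 1] by (auto simp: ex_def exp_add algebra_simps elim!: eventually_mono simp flip: exp_add)

lemma ex_diff: "\<lbrakk>a \<in> bm; b \<in> bm\<rbrakk> \<Longrightarrow> AE \<omega> in P. ex (\<lambda>x. a x - b x) \<omega> = ex a \<omega> * cnj (ex b \<omega>)" using eta_lin[of a b 1 "-1"]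
  by (auto simp: ex_def exp_cnj right_diff_distrib exp_diff exp_minus divide_inverse elim!: eventually_mono)

lemma ex_zero: "AE \<omega> in P. ex (\<lambda>x. 0) \<omega> = 1"
  using eta_lin[of "\<lambda>x. 0" "\<lambda>x. 0" 0 0] bm_const[of 0 M] by (auto simp: ex_def elim!: eventually_mono)

lemma integrable_ex_mult:
  assumes f: "integrable P f" and a: "a \<in> bm"
  shows "integrable P (\<lambda>\<omega>. f \<omega> * ex a \<omega>)" by (rule Bochner_Integration.integrable_bound[OF f])
    (use f ex_measurable[OF a] in \<open>auto simp: norm_mult norm_ex\<close>)

lemma integrable_ex: "a \<in> bm \<Longrightarrow> integrable P (ex a)"
  by (rule integrable_const_bound[of _ 1]) (use ex_measurable in \<open>auto simp: norm_ex\<close>)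

text \<open>Each event \<open>\<eta> b \<in> E\<close> is inserted by \<open>fourier_zero\<close>.
  The factor \<open>iexp (y * \<eta> b)\<close> that this needs turns \<open>ex a\<close> into the
  exponential of \<open>a + y * b\<close>, which is why the vanishing is kept for all
  \<open>a\<close> during the induction.\<close>

lemma cylinder_integral_zero:
  assumes f: "integrable P f" and z: "\<And>a. a \<in> bm_on M A \<Longrightarrow> (\<integral>\<omega>. f \<omega> * ex a \<omega> \<partial>P) = 0"
    and L: "\<forall>(b, E)\<in>set L. b \<in> bm_on M A \<and> E \<in> sets borel" and a: "a \<in> bm_on M A"
  shows "(\<integral>\<omega>. indicator {\<omega>\<in>space P. \<forall>(b, E)\<in>set L. \<eta> b \<omega> \<in> E} \<omega> *\<^sub>R f \<omega> * ex a \<omega> \<partial>P) = 0" using L a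
proof (induction L arbitrary: a)
  case Nil
  have "(\<integral>\<omega>. indicator (space P) \<omega> *\<^sub>R f \<omega> * ex a \<omega> \<partial>P) = (\<integral>\<omega>. f \<omega> * ex a \<omega> \<partial>P)"
    by (intro Bochner_Integration.integral_cong) auto
  then show ?case using z[OF Nil(2)] by simp
next
  case (Cons p L)
  obtain b E where p: "p = (b, E)" by (cases p)
  have b: "b \<in> bm_on M A" "E \<in> sets borel" and L: "\<forall>(b, E)\<in>set L. b \<in> bm_on M A \<and> E \<in> sets borel" using Cons(2) p by auto
  define C where "C = {\<omega>\<in>space P. \<forall>(b, E)\<in>set L. \<eta> b \<omega> \<in> E}"
  have C: "C \<in> sets P"
  proof -
    have "C = space P \<inter> (\<Inter>(b, E)\<in>set L. {\<omega>\<in>space P. \<eta> b \<omega> \<in> E})" by (auto simp: C_def)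
    also have "\<dots> \<in> sets P"
    proof (cases "L = []")
      case False
      have "{\<omega>\<in>space P. \<eta> b \<omega> \<in> E} \<in> sets P" if "(b, E) \<in> set L" for b E
        using L that measurable_sets[OF eta_measurable, of b E] bm_on_bm[of b A]
        by (auto simp: vimage_def Int_def conj_commute)
      then show ?thesis using False by (intro sets.Int sets.finite_INT) auto
    qed simp
    finally show ?thesis .
  qed
  define g where "g \<omega> = indicator C \<omega> *\<^sub>R f \<omega> * ex a \<omega>" for \<omega>
  have g: "integrable P g" unfolding g_def by (intro integrable_ex_mult integrable_mult_indicator C f bm_on_bm[OF Cons(3)])
  have zero: "(\<integral>\<omega>. g \<omega> * iexp (y * \<eta> b \<omega>) \<partial>P) = 0" for y
  proof -
    have "AE \<omega> in P. g \<omega> * iexp (y * \<eta> b \<omega>) = indicator C \<omega> *\<^sub>R f \<omega> * ex (\<lambda>x. 1 * a x + y * b x) \<omega>"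
      using eta_lin[OF bm_on_bm[OF Cons(3)] bm_on_bm[OF b(1)], of 1 y]
    proof eventually_elim
      case (elim \<omega>)
      then show ?case unfolding g_def ex_def by (simp add: distrib_left exp_add mult.assoc)
    qed
    then have "(\<integral>\<omega>. g \<omega> * iexp (y * \<eta> b \<omega>) \<partial>P) = (\<integral>\<omega>. indicator C \<omega> *\<^sub>R f \<omega> * ex (\<lambda>x. 1 * a x + y * b x) \<omega> \<partial>P)"
      using g f C ex_measurable[OF bm_add[OF bm_on_bm[OF Cons(3)] bm_on_bm[OF b(1)], of 1 y]] eta_measurable[OF bm_on_bm[OF b(1)]]
      by (intro integral_cong_AE) auto
    also have "\<dots> = 0" unfolding C_def by (rule Cons.IH[OF L bm_on_add[OF Cons(3) b(1)]])
    finally show ?thesis .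
  qed
  have "(\<integral>\<omega>. indicator E (\<eta> b \<omega>) *\<^sub>R g \<omega> \<partial>P) = 0" by (rule fourier_zero[OF g eta_measurable[OF bm_on_bm[OF b(1)]] zero b(2)])
  moreover have "(\<integral>\<omega>. indicator {\<omega>\<in>space P. \<forall>(b, E)\<in>set (p # L). \<eta> b \<omega> \<in> E} \<omega> *\<^sub>R f \<omega> * ex a \<omega> \<partial>P) =
      (\<integral>\<omega>. indicator E (\<eta> b \<omega>) *\<^sub>R g \<omega> \<partial>P)"
    by (intro Bochner_Integration.integral_cong refl) (auto simp: g_def C_def p split: split_indicator)
  ultimately show ?case by simp
qed

text \<open>Orthogonality to the exponentials over \<open>A\<close> makes the conditional
  expectation on \<open>alg A\<close> zero. The finite cylinder events form an intersection stable
  generator, and the property passes to the whole algebra by the argument of Dynkin.\<close>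

lemma alg_integral_zero:
  assumes f: "integrable P f" and z: "\<And>a. a \<in> bm_on M A \<Longrightarrow> (\<integral>\<omega>. f \<omega> * ex a \<omega> \<partial>P) = 0"
    and F: "F \<in> sets (alg A)"
  shows "(\<integral>\<omega>. indicator F \<omega> *\<^sub>R f \<omega> \<partial>P) = 0"
proof -
  define CS where "CS = {{\<omega>\<in>space P. \<forall>(b, E)\<in>set L. \<eta> b \<omega> \<in> E} | L. \<forall>(b, E)\<in>set L. b \<in> bm_on M A \<and> E \<in> sets borel}"
  have fm[measurable]: "f \<in> borel_measurable P" using f by simp
  have zero_on: "(\<lambda>x. 0) \<in> bm_on M A" by (simp add: bm_on_def bm_const)
  have base: "(\<integral>\<omega>. indicator C \<omega> *\<^sub>R f \<omega> \<partial>P) = 0" if C: "C \<in> sets P" "C \<in> CS" for C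
  proof -
    obtain L where L: "C = {\<omega>\<in>space P. \<forall>(b, E)\<in>set L. \<eta> b \<omega> \<in> E}" "\<forall>(b, E)\<in>set L. b \<in> bm_on M A \<and> E \<in> sets borel"
      using C by (auto simp: CS_def)
    have "(\<integral>\<omega>. indicator C \<omega> *\<^sub>R f \<omega> * ex (\<lambda>x. 0) \<omega> \<partial>P) = 0"
      unfolding L(1) by (rule cylinder_integral_zero[OF f z L(2) zero_on])
    moreover have "(\<integral>\<omega>. indicator C \<omega> *\<^sub>R f \<omega> * ex (\<lambda>x. 0) \<omega> \<partial>P) = (\<integral>\<omega>. indicator C \<omega> *\<^sub>R f \<omega> \<partial>P)"
      using C ex_measurable[OF bm_const, of 0] ex_zero by (intro integral_cong_AE) (auto elim!: eventually_mono)
    ultimately show ?thesis by simp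
  qed
  have CSsub: "CS \<subseteq> sets (alg A)"
  proof
    fix C assume "C \<in> CS"
    then obtain L where L: "C = {\<omega>\<in>space P. \<forall>(b, E)\<in>set L. \<eta> b \<omega> \<in> E}" "\<forall>(b, E)\<in>set L. b \<in> bm_on M A \<and> E \<in> sets borel"
      by (auto simp: CS_def)
    have e: "{\<omega>\<in>space P. \<eta> b \<omega> \<in> E} \<in> sets (alg A)" if "(b, E) \<in> set L" for b E
      using L(2) that measurable_sets[OF eta_alg, of b A E] by (auto simp: vimage_def Int_def conj_commute space_alg)
    show "C \<in> sets (alg A)"
    proof (cases "L = []")
      case True
      then show ?thesis using L(1) sets.top[of "alg A"] by (simp add: space_alg)
    next
      case False
      then have "C = (\<Inter>(b, E)\<in>set L. {\<omega>\<in>space P. \<eta> b \<omega> \<in> E})" by (cases L) (auto simp: L(1))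
      also have "\<dots> \<in> sets (alg A)" using False e by (intro sets.finite_INT) auto
      finally show ?thesis .
    qed
  qed
  have algP: "sets (alg A) \<subseteq> sets P" using subalg by (simp add: subalgebra_def)
  have CS_pow: "CS \<subseteq> Pow (space P)" by (auto simp: CS_def)
  have stable: "Int_stable CS"
  proof (rule Int_stableI)
    fix C D assume "C \<in> CS" "D \<in> CS"
    then obtain L K where "C = {\<omega>\<in>space P. \<forall>(b, E)\<in>set L. \<eta> b \<omega> \<in> E}" "\<forall>(b, E)\<in>set L. b \<in> bm_on M A \<and> E \<in> sets borel"
      "D = {\<omega>\<in>space P. \<forall>(b, E)\<in>set K. \<eta> b \<omega> \<in> E}" "\<forall>(b, E)\<in>set K. b \<in> bm_on M A \<and> E \<in> sets borel" unfolding CS_def by blast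
    then show "C \<inter> D \<in> CS" unfolding CS_def by (intro CollectI exI[of _ "L @ K"]) auto
  qed
  have "F \<in> sigma_sets (space P) CS"
  proof -
    have "sigma_sets (space P) {\<eta> a -` E \<inter> space P | a E. a \<in> bm_on M A \<and> E \<in> sets borel} \<subseteq> sigma_sets (space P) CS"
    proof (rule sigma_sets_mono')
      show "{\<eta> a -` E \<inter> space P | a E. a \<in> bm_on M A \<and> E \<in> sets borel} \<subseteq> CS"
      proof safe
        fix a and E :: "real set" assume "a \<in> bm_on M A" "E \<in> sets borel"
        then show "\<eta> a -` E \<inter> space P \<in> CS" unfolding CS_def by (intro CollectI exI[of _ "[(a, E)]"]) auto
      qed
    qed
    then show ?thesis using F by (auto simp: sets_alg)
  qed
  have sig: "sigma_sets (space P) CS \<subseteq> sets P" using CSsub algP by (intro sets.sigma_sets_subset) auto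
  have i: "integrable P (\<lambda>\<omega>. indicator G \<omega> *\<^sub>R f \<omega>)" if "G \<in> sets P" for G by (rule integrable_mult_indicator[OF that f])
  show ?thesis using stable CS_pow \<open>F \<in> sigma_sets (space P) CS\<close>
  proof (induction rule: sigma_sets_induct_disjoint)
    case (basic G)
    then show ?case using base[of G] CSsub algP by auto
  next
    case empty
    show ?case by simp
  next
    case (compl G)
    then have G: "G \<in> sets P" using sig by auto
    have "(\<integral>\<omega>. indicator (space P - G) \<omega> *\<^sub>R f \<omega> \<partial>P) = (\<integral>\<omega>. indicator (space P) \<omega> *\<^sub>R f \<omega> - indicator G \<omega> *\<^sub>R f \<omega> \<partial>P)"
      by (intro Bochner_Integration.integral_cong refl) (auto split: split_indicator)
    also have "\<dots> = (\<integral>\<omega>. indicator (space P) \<omega> *\<^sub>R f \<omega> \<partial>P) - (\<integral>\<omega>. indicator G \<omega> *\<^sub>R f \<omega> \<partial>P)"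
      by (rule Bochner_Integration.integral_diff[OF i[OF sets.top] i[OF G]])
    also have "(\<integral>\<omega>. indicator (space P) \<omega> *\<^sub>R f \<omega> \<partial>P) = 0"
    proof (rule base[OF sets.top])
      show "space P \<in> CS" unfolding CS_def by (intro CollectI exI[of _ "[]"]) auto
    qed
    finally show ?case using compl by simp
  next
    case (union G)
    then have G: "G j \<in> sets P" for j using sig by auto
    have U: "(\<Union>j. G j) \<in> sets P" using G by blast
    have "(LINT \<omega>:(\<Union>j. G j)|P. f \<omega>) = (\<Sum>j. (LINT \<omega>:(G j)|P. f \<omega>))" using union(1) i[OF U] G
      by (intro lebesgue_integral_countable_add) (auto simp: disjoint_family_on_def set_integrable_def)
    then show ?case using union(3) by (simp add: set_lebesgue_integral_def)
  qed
qed

lemma cf_mult: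
  assumes a: "a \<in> bm_on M A" and b: "b \<in> bm_on M (space M - A)"
  shows "(\<integral>\<omega>. ex a \<omega> * ex b \<omega> \<partial>P) = cf a * cf b"
proof -
  have "AE x in M. a x * b x = 0" using a b by (intro AE_I2) (auto simp: bm_on_def)
  then have "indep_var borel (\<eta> a) borel (\<eta> b)" using a b by (intro eta_indep bm_on_bm)
  then have "indep_var borel ((\<lambda>r. exp (\<i> * complex_of_real r)) \<circ> \<eta> a) borel ((\<lambda>r. exp (\<i> * complex_of_real r)) \<circ> \<eta> b)"
    by (rule indep_var_compose) simp_all
  then have "indep_var borel (ex a) borel (ex b)" by (simp add: ex_def[abs_def] o_def)
  from indep_var_lebesgue_integral[OF this integrable_ex[OF bm_on_bm[OF a]] integrable_ex[OF bm_on_bm[OF b]]]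
  show ?thesis by (simp add: cf_def)
qed

text \<open>Independence of the two algebras follows from the pairwise independence of linear functionals:
  first an event of one algebra is decoupled from the exponentials of the other, then from its events.\<close>

lemma alg_indep:
  assumes F: "F \<in> sets (alg A)" and G: "G \<in> sets (alg (space M - A))"
  shows "prob (F \<inter> G) = prob F * prob G"
proof -
  have FP: "F \<in> events" "G \<in> events" using F G subalg by (auto simp: subalgebra_def)
  have ind: "integrable P (indicat_real E)" if "E \<in> events" for E
    by (rule integrable_const_bound[of _ 1]) (use that in \<open>auto split: split_indicator\<close>)
  have 1: "(\<integral>\<omega>. indicator F \<omega> *\<^sub>R ex b \<omega> \<partial>P) = of_real (prob F) * cf b" if b: "b \<in> bm_on M (space M - A)" for b
  proof -
    have "(\<integral>\<omega>. indicator F \<omega> *\<^sub>R (ex b \<omega> - cf b) \<partial>P) = 0"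
    proof (rule alg_integral_zero[OF _ _ F])
      show "integrable P (\<lambda>\<omega>. ex b \<omega> - cf b)" using integrable_ex[OF bm_on_bm[OF b]] by simp
      fix a assume a: "a \<in> bm_on M A"
      have "(\<integral>\<omega>. (ex b \<omega> - cf b) * ex a \<omega> \<partial>P) = (\<integral>\<omega>. ex a \<omega> * ex b \<omega> - cf b * ex a \<omega> \<partial>P)"
        by (intro Bochner_Integration.integral_cong refl) (simp add: algebra_simps)
      also have "\<dots> = (\<integral>\<omega>. ex a \<omega> * ex b \<omega> \<partial>P) - (\<integral>\<omega>. cf b * ex a \<omega> \<partial>P)"
        by (intro Bochner_Integration.integral_diff integrable_ex_mult integrable_ex integrable_mult_right bm_on_bm[OF a] bm_on_bm[OF b])
      also have "\<dots> = 0" by (simp add: cf_mult[OF a b] flip: cf_def)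
      finally show "(\<integral>\<omega>. (ex b \<omega> - cf b) * ex a \<omega> \<partial>P) = 0" .
    qed
    moreover have "(\<integral>\<omega>. indicator F \<omega> *\<^sub>R (ex b \<omega> - cf b) \<partial>P) = (\<integral>\<omega>. indicator F \<omega> *\<^sub>R ex b \<omega> \<partial>P) - (\<integral>\<omega>. indicator F \<omega> *\<^sub>R cf b \<partial>P)"
      unfolding scaleR_right_diff_distrib
      by (intro Bochner_Integration.integral_diff integrable_mult_indicator FP integrable_ex bm_on_bm[OF b]) simp
    moreover have "(\<integral>\<omega>. indicator F \<omega> *\<^sub>R cf b \<partial>P) = of_real (prob F) * cf b" using FP by (simp add: scaleR_conv_of_real)
    ultimately show ?thesis by simp
  qed
  have "(\<integral>\<omega>. indicator G \<omega> *\<^sub>R (indicator F \<omega> - complex_of_real (prob F)) \<partial>P) = 0"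
  proof (rule alg_integral_zero[OF _ _ G])
    have "integrable P (indicat_real F)" by (rule ind[OF FP(1)])
    then have "integrable P (\<lambda>\<omega>. complex_of_real (indicator F \<omega> - prob F))"
      by (intro integrable_of_real Bochner_Integration.integrable_diff) simp_all
    moreover have "complex_of_real (indicator F \<omega> - prob F) = indicator F \<omega> - complex_of_real (prob F)" for \<omega>
      by (auto split: split_indicator)
    ultimately show "integrable P (\<lambda>\<omega>. indicator F \<omega> - complex_of_real (prob F))" by simp
    fix b assume b: "b \<in> bm_on M (space M - A)"
    have "(\<integral>\<omega>. (indicator F \<omega> - complex_of_real (prob F)) * ex b \<omega> \<partial>P) =
        (\<integral>\<omega>. indicator F \<omega> *\<^sub>R ex b \<omega> - complex_of_real (prob F) * ex b \<omega> \<partial>P)"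
      by (intro Bochner_Integration.integral_cong refl) (auto split: split_indicator simp: algebra_simps)
    also have "\<dots> = (\<integral>\<omega>. indicator F \<omega> *\<^sub>R ex b \<omega> \<partial>P) - (\<integral>\<omega>. complex_of_real (prob F) * ex b \<omega> \<partial>P)"
      by (intro Bochner_Integration.integral_diff integrable_mult_indicator FP integrable_ex integrable_mult_right bm_on_bm[OF b])
    also have "\<dots> = 0" by (simp add: 1[OF b] flip: cf_def)
    finally show "(\<integral>\<omega>. (indicator F \<omega> - complex_of_real (prob F)) * ex b \<omega> \<partial>P) = 0" .
  qed
  moreover have "(\<integral>\<omega>. indicator G \<omega> *\<^sub>R (indicator F \<omega> - complex_of_real (prob F)) \<partial>P) =
      (\<integral>\<omega>. complex_of_real (indicator (F \<inter> G) \<omega> - prob F * indicator G \<omega>) \<partial>P)"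
    by (intro Bochner_Integration.integral_cong refl) (auto split: split_indicator)
  moreover have "\<dots> = complex_of_real (prob (F \<inter> G) - prob F * prob G)"
    unfolding integral_complex_of_real using FP ind[OF FP(2)] ind[OF sets.Int[OF FP]] by simp
  ultimately show ?thesis by (simp only: of_real_eq_0_iff right_minus_eq)
qed

lemma alg_indep_var:
  assumes X: "X \<in> borel_measurable (alg A)" and Y: "Y \<in> borel_measurable (alg (space M - A))"
  shows "indep_var borel X borel Y" unfolding indep_var_eq
proof (intro conjI)
  show "random_variable borel X" "random_variable borel Y" using X Y measurable_from_subalg[OF subalg] by blast+
  have sub: "sigma_sets (space P) {Z -` E \<inter> space P | E. E \<in> sets borel} \<subseteq> sets (alg B)"
    if "Z \<in> borel_measurable (alg B)" for Z B
    using measurable_sets[OF that] unfolding space_alg[of B, symmetric] by (intro sets.sigma_sets_subset) auto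
  show "indep_set (sigma_sets (space P) {X -` E \<inter> space P | E. E \<in> sets borel})
      (sigma_sets (space P) {Y -` E \<inter> space P | E. E \<in> sets borel})"
  proof (rule indep_setI)
    show "sigma_sets (space P) {X -` E \<inter> space P | E. E \<in> sets borel} \<subseteq> events"
      "sigma_sets (space P) {Y -` E \<inter> space P | E. E \<in> sets borel} \<subseteq> events"
      using sub[OF X] sub[OF Y] subalg unfolding subalgebra_def by (meson order_trans)+
    show "prob (a \<inter> b) = prob a * prob b" if "a \<in> sigma_sets (space P) {X -` E \<inter> space P | E. E \<in> sets borel}"
        "b \<in> sigma_sets (space P) {Y -` E \<inter> space P | E. E \<in> sets borel}" for a b
      using alg_indep sub[OF X] sub[OF Y] that by blast
  qed
qed

section \<open>The functionals of a restriction of the process as a Hilbert space\<close>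

abbreviation "Q A \<equiv> restr_to_subalg P (alg A)"
abbreviation "CH \<equiv> complex_as_hilbert"
abbreviation "LFQ A \<equiv> L2_functions (Q A) CH"
abbreviation "L2P \<equiv> L2_process M P \<eta>"
abbreviation "cl \<equiv> L2_class (Q (space M)) CH"

definition e :: "('x \<Rightarrow> real) \<Rightarrow> ('w \<Rightarrow> complex) set" where
  "e a = cl (ex a)"

lemma L2_space_Q: "L2_space CH (Q A)"
proof -
  interpret separable_hilbert CH by (rule separable_complex)
  interpret finite_measure "Q A" by (rule finite_measure_restr_to_subalg[OF subalg]) unfold_locales
  show ?thesis by unfold_locales
qed

lemma LFQ_iff: "f \<in> LFQ A \<longleftrightarrow> f \<in> borel_measurable (alg A) \<and> integrable P (\<lambda>\<omega>. (cmod (f \<omega>))^2)"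
proof -
  have "f \<in> borel_measurable (Q A) \<longleftrightarrow> f \<in> borel_measurable (alg A)"
    using measurable_in_subalg[OF subalg] measurable_in_subalg'[OF subalg] by blast
  moreover have "integrable (Q A) (\<lambda>\<omega>. (cmod (f \<omega>))^2) \<longleftrightarrow> integrable P (\<lambda>\<omega>. (cmod (f \<omega>))^2)"
    if [measurable]: "f \<in> borel_measurable (alg A)"
  proof
    show "integrable P (\<lambda>\<omega>. (cmod (f \<omega>))^2)" if "integrable (Q A) (\<lambda>\<omega>. (cmod (f \<omega>))^2)"
      by (rule integrable_from_subalg[OF subalg that])
    show "integrable (Q A) (\<lambda>\<omega>. (cmod (f \<omega>))^2)" if "integrable P (\<lambda>\<omega>. (cmod (f \<omega>))^2)"
      by (rule integrable_in_subalg[OF subalg _ that]) measurable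
  qed
  ultimately show ?thesis by (auto simp: L2_functions_complex)
qed

lemma LFQ_mono: "A \<inter> space M \<subseteq> B \<Longrightarrow> f \<in> LFQ A \<Longrightarrow> f \<in> LFQ B" using alg_mono_measurable by (auto simp: LFQ_iff)

lemma LFQ_space: "f \<in> LFQ A \<Longrightarrow> f \<in> LFQ (space M)" by (rule LFQ_mono) auto

lemma L2P: "L2P = L2 (Q (space M)) CH" by (simp add: L2_process_def process_space_def)

lemma hilbert_L2P: "complex_hilbert_space L2P" unfolding L2P by (rule L2_space.hilbert_L2[OF L2_space_Q])

lemma AE_Q:
  assumes "f \<in> borel_measurable (alg A)" "g \<in> borel_measurable (alg A)" "AE \<omega> in P. f \<omega> = (g \<omega> :: complex)"
  shows "AE \<omega> in Q A. f \<omega> = g \<omega>" using assms by (intro AE_restr_to_subalg2[OF subalg]) auto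

lemma cl_eqI:
  assumes "f \<in> LFQ A" "g \<in> LFQ B" "AE \<omega> in P. f \<omega> = g \<omega>"
  shows "cl f = cl g" using assms LFQ_space[of f A] LFQ_space[of g B]
  by (intro L2_space.cls_eqI[OF L2_space_Q] AE_Q) (simp_all add: LFQ_iff)

lemma inner_L2:
  assumes f: "f \<in> LFQ A" and g: "g \<in> LFQ A"
  shows "hinner (L2 (Q A) CH) (L2_class (Q A) CH f) (L2_class (Q A) CH g) = (\<integral>\<omega>. cnj (f \<omega>) * g \<omega> \<partial>P)"
proof -
  have [measurable]: "f \<in> borel_measurable (alg A)" "g \<in> borel_measurable (alg A)" using f g by (simp_all add: LFQ_iff)
  have "hinner (L2 (Q A) CH) (L2_class (Q A) CH f) (L2_class (Q A) CH g) = (\<integral>\<omega>. cnj (f \<omega>) * g \<omega> \<partial>Q A)"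
    using L2_space.L2_inner[OF L2_space_Q f g] by (simp add: complex_as_hilbert_def)
  also have "\<dots> = (\<integral>\<omega>. cnj (f \<omega>) * g \<omega> \<partial>P)" by (rule integral_subalgebra2[OF subalg]) measurable
  finally show ?thesis .
qed

lemma inner_L2P: "f \<in> LFQ A \<Longrightarrow> g \<in> LFQ B \<Longrightarrow> hinner L2P (cl f) (cl g) = (\<integral>\<omega>. cnj (f \<omega>) * g \<omega> \<partial>P)"
  unfolding L2P by (rule inner_L2) (auto intro: LFQ_space)

lemma LFQ_integrable_mult:
  assumes f: "f \<in> LFQ A" and g: "g \<in> LFQ B"
  shows "integrable P (\<lambda>\<omega>. cnj (f \<omega>) * g \<omega>)"
proof (rule Bochner_Integration.integrable_bound)
  show "integrable P (\<lambda>\<omega>. (cmod (f \<omega>))^2 + (cmod (g \<omega>))^2)" using f g by (simp add: LFQ_iff)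
  have [measurable]: "f \<in> borel_measurable P" "g \<in> borel_measurable P"
    using f g measurable_from_subalg[OF subalg] by (auto simp: LFQ_iff)
  show "(\<lambda>\<omega>. cnj (f \<omega>) * g \<omega>) \<in> borel_measurable P" by measurable
  have "norm (cnj (f \<omega>) * g \<omega>) \<le> norm ((cmod (f \<omega>))^2 + (cmod (g \<omega>))^2)" for \<omega>
    using sum_squares_bound[of "cmod (f \<omega>)" "cmod (g \<omega>)"]
      mult_nonneg_nonneg[OF norm_ge_zero[of "f \<omega>"] norm_ge_zero[of "g \<omega>"]]
    unfolding norm_mult complex_mod_cnj real_norm_def by linarith
  then show "AE \<omega> in P. norm (cnj (f \<omega>) * g \<omega>) \<le> norm ((cmod (f \<omega>))^2 + (cmod (g \<omega>))^2)" by simp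
qed

lemma ex_LFQ: "a \<in> bm_on M A \<Longrightarrow> ex a \<in> LFQ A" using ex_alg[of a A] by (simp add: LFQ_iff norm_ex)

lemma bm_on_space: "bm_on M (space M) = bm" by (auto simp: bm_on_def)

lemma e_AE: "\<lbrakk>a \<in> bm; b \<in> bm; AE x in M. a x = b x\<rbrakk> \<Longrightarrow> e a = e b"
  unfolding e_def using ex_AE[of a b] ex_LFQ[of a "space M"] ex_LFQ[of b "space M"] by (intro cl_eqI) (auto simp: bm_on_space)

lemma e_inner:
  assumes a: "a \<in> bm" and b: "b \<in> bm"
  shows "hinner L2P (e a) (e b) = cf (\<lambda>x. b x - a x)"
proof -
  have "hinner L2P (e a) (e b) = (\<integral>\<omega>. cnj (ex a \<omega>) * ex b \<omega> \<partial>P)"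
    unfolding e_def by (rule inner_L2P[OF ex_LFQ[of _ "space M"] ex_LFQ[of _ "space M"]]) (use a b in \<open>auto simp: bm_on_space\<close>)
  also have "\<dots> = cf (\<lambda>x. b x - a x)" unfolding cf_def
  proof (rule integral_cong_AE)
    show "AE \<omega> in P. cnj (ex a \<omega>) * ex b \<omega> = ex (\<lambda>x. b x - a x) \<omega>" using ex_diff[OF b a] by eventually_elim simp
    show "ex (\<lambda>x. b x - a x) \<in> borel_measurable P" using bm_add[OF b a, of 1 "-1"] by (intro ex_measurable) simp
  qed (use ex_measurable[OF a] ex_measurable[OF b] in measurable)
  finally show ?thesis .
qed

lemma cf_zero: "cf (\<lambda>x. 0) = 1"
proof -
  have "cf (\<lambda>x. 0) = (\<integral>\<omega>. 1 \<partial>P)"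
    unfolding cf_def using ex_zero ex_measurable[OF bm_const, of 0] by (intro integral_cong_AE) auto
  then show ?thesis by (simp add: prob_space)
qed

lemma cf_add:
  assumes a: "a \<in> bm_on M A" and b: "b \<in> bm_on M (space M - A)"
  shows "cf (\<lambda>x. a x + b x) = cf a * cf b"
proof -
  have "cf (\<lambda>x. a x + b x) = (\<integral>\<omega>. ex a \<omega> * ex b \<omega> \<partial>P)" unfolding cf_def
  proof (rule integral_cong_AE)
    show "AE \<omega> in P. ex (\<lambda>x. a x + b x) \<omega> = ex a \<omega> * ex b \<omega>" by (rule ex_add[OF bm_on_bm[OF a] bm_on_bm[OF b]])
    show "ex (\<lambda>x. a x + b x) \<in> borel_measurable P" by (rule ex_measurable[OF bm_plus[OF bm_on_bm[OF a] bm_on_bm[OF b]]])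
  qed (use ex_measurable[OF bm_on_bm[OF a]] ex_measurable[OF bm_on_bm[OF b]] in measurable)
  then show ?thesis by (simp add: cf_mult[OF a b])
qed

abbreviation "L2on \<equiv> L2_process_on M P \<eta>"

lemma carrier_L2on: "hcarrier (L2on A) = cl ` LFQ A"
proof -
  have "{u \<in> cl ` LFQ (space M). \<exists>f\<in>u. f \<in> borel_measurable (alg A)} = cl ` LFQ A"
  proof safe
    fix g f assume g: "g \<in> LFQ (space M)" and f: "f \<in> cl g" "f \<in> borel_measurable (alg A)"
    then have "f \<in> LFQ (space M)" "AE \<omega> in Q (space M). g \<omega> = f \<omega>" by (auto simp: L2_class_def)
    moreover from this have "f \<in> LFQ A" using f(2) by (simp add: LFQ_iff)
    moreover have "cl g = cl f" by (rule L2_space.cls_eqI[OF L2_space_Q]) fact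
    ultimately show "cl g \<in> cl ` LFQ A" by blast
  next
    fix f assume f: "f \<in> LFQ A"
    then show "cl f \<in> cl ` LFQ (space M)" using LFQ_space by blast
    have "f \<in> cl f" using LFQ_space[OF f] by (simp add: L2_class_def)
    then show "\<exists>f\<in>cl f. f \<in> borel_measurable (alg A)" using f by (auto simp: LFQ_iff)
  qed
  then show ?thesis by (simp add: L2_process_on_def L2P L2_space.carrier_L2[OF L2_space_Q])
qed

lemma L2on_ops:
  "hzero (L2on A) = hzero L2P" "hadd (L2on A) = hadd L2P" "hscale (L2on A) = hscale L2P"
  "hinner (L2on A) = hinner L2P" "hdist (L2on A) = hdist L2P" "hnorm (L2on A) = hnorm L2P"
  by (simp_all add: L2_process_on_def hdist_def[abs_def] hnorm_def[abs_def])

lemma L2on_space: "L2on (space M) = L2P"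
proof -
  have "hcarrier (L2on (space M)) = hcarrier L2P"
    unfolding carrier_L2on by (simp add: L2P L2_space.carrier_L2[OF L2_space_Q])
  then show ?thesis by (simp add: L2_process_on_def)
qed

lemma L2_dist_on:
  assumes f: "f \<in> LFQ A" and g: "g \<in> LFQ A"
  shows "hdist L2P (cl f) (cl g) = hdist (L2 (Q A) CH) (L2_class (Q A) CH f) (L2_class (Q A) CH g)"
proof -
  have *: "complex_hilbert_space (L2 (Q B) CH)" for B by (rule L2_space.hilbert_L2[OF L2_space_Q])
  have c: "L2_class (Q B) CH h \<in> hcarrier (L2 (Q B) CH)" if "h \<in> LFQ B" for h B
    by (rule L2_space.cls_carrier[OF L2_space_Q that])
  have "(hdist L2P (cl f) (cl g))^2 = (hdist (L2 (Q A) CH) (L2_class (Q A) CH f) (L2_class (Q A) CH g))^2"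
    unfolding L2P using c[OF f] c[OF g] c[OF LFQ_space[OF f]] c[OF LFQ_space[OF g]] f g LFQ_space[OF f] LFQ_space[OF g]
    by (simp add: complex_hilbert_space.hdist_sq[OF *] complex_hilbert_space.hnorm_sq[OF *] inner_L2)
  then show ?thesis unfolding L2P using c[OF f] c[OF g] c[OF LFQ_space[OF f]] c[OF LFQ_space[OF g]]
    by (simp add: power2_eq_iff_nonneg complex_hilbert_space.hdist_nonneg[OF *])
qed

text \<open>The operations and their laws are those of \<open>L2P\<close>. Completeness comes from
  the space of square integrable functions over the smaller algebra, which by
  \<open>L2_dist_on\<close> is isometric to this subspace.\<close>

lemma hilbert_L2on: "complex_hilbert_space (L2on A)"
proof -
  interpret L: complex_hilbert_space L2P by (rule hilbert_L2P)
  interpret S: L2_space CH "Q (space M)" by (rule L2_space_Q)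
  interpret SA: L2_space CH "Q A" by (rule L2_space_Q)
  have sub: "u \<in> hcarrier L2P" if "u \<in> hcarrier (L2on A)" for u
    using that LFQ_space by (auto simp: carrier_L2on L2P S.carrier_L2)
  show ?thesis
  proof
    show "hzero (L2on A) \<in> hcarrier (L2on A)" unfolding carrier_L2on L2on_ops L2P S.L2_zero using SA.LF_zero by blast
    show "hadd (L2on A) x y \<in> hcarrier (L2on A)" if "x \<in> hcarrier (L2on A)" "y \<in> hcarrier (L2on A)" for x y
    proof -
      obtain f g where "f \<in> LFQ A" "g \<in> LFQ A" "x = cl f" "y = cl g" using \<open>x \<in> _\<close> \<open>y \<in> _\<close> by (auto simp: carrier_L2on)
      then show ?thesis unfolding carrier_L2on L2on_ops L2P using S.L2_add[of f g] LFQ_space SA.LF_add[of f g] by auto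
    qed
    show "hscale (L2on A) c x \<in> hcarrier (L2on A)" if "x \<in> hcarrier (L2on A)" for c x
    proof -
      obtain f where "f \<in> LFQ A" "x = cl f" using \<open>x \<in> _\<close> by (auto simp: carrier_L2on)
      then show ?thesis unfolding carrier_L2on L2on_ops L2P using S.L2_scale[of f] LFQ_space SA.LF_scale[of f] by auto
    qed
    fix u :: "nat \<Rightarrow> ('w \<Rightarrow> complex) set"
    assume u: "\<And>n. u n \<in> hcarrier (L2on A)"
      and c: "\<And>e. 0 < e \<Longrightarrow> \<exists>N. \<forall>m\<ge>N. \<forall>n\<ge>N. hdist (L2on A) (u m) (u n) < e"
    have "\<forall>n. \<exists>f. f \<in> LFQ A \<and> u n = cl f" using u by (auto simp: carrier_L2on)
    then obtain f where f: "\<And>n. f n \<in> LFQ A" "\<And>n. u n = cl (f n)" by metis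
    have D: "hdist (L2 (Q A) CH) (L2_class (Q A) CH (f m)) (L2_class (Q A) CH (f n)) = hdist (L2on A) (u m) (u n)" for m n
      unfolding L2on_ops f(2) by (rule L2_dist_on[OF f(1) f(1), symmetric])
    obtain v where v: "v \<in> hcarrier (L2 (Q A) CH)" "(\<lambda>n. hdist (L2 (Q A) CH) (L2_class (Q A) CH (f n)) v) \<longlonglongrightarrow> 0"
      using SA.L2_complete[of "\<lambda>n. L2_class (Q A) CH (f n)", OF SA.cls_carrier[OF f(1)]] c unfolding D by blast
    then obtain g where g: "g \<in> LFQ A" "v = L2_class (Q A) CH g" by (auto simp: SA.carrier_L2)
    have "hdist (L2on A) (u n) (cl g) = hdist (L2 (Q A) CH) (L2_class (Q A) CH (f n)) v" for n
      unfolding L2on_ops f(2) g(2) by (rule L2_dist_on[OF f(1) g(1)])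
    then show "\<exists>x\<in>hcarrier (L2on A). (\<lambda>n. hdist (L2on A) (u n) x) \<longlonglongrightarrow> 0"
      using v(2) g(1) by (intro bexI[of _ "cl g"]) (auto simp: carrier_L2on)
  next
    fix x y assume "x \<in> hcarrier (L2on A)" "y \<in> hcarrier (L2on A)"
    then show "hadd (L2on A) x y = hadd (L2on A) y x" "hinner (L2on A) y x = cnj (hinner (L2on A) x y)"
      using L.add_commute[of x y] L.inner_commute[of x y] sub by (simp_all add: L2on_ops)
  qed (auto simp: L2on_ops sub L.add_assoc L.add_zero L.add_inverse L.scale_one L.scale_scale L.scale_add_right
      L.scale_add_left L.inner_add L.inner_scale L.inner_nonneg L.inner_definite)
qed

text \<open>A functional that is orthogonal to all exponentials over \<open>A\<close> has zero
  integral over every event of \<open>alg A\<close>, and being measurable for \<open>alg A\<close>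
  it is zero almost everywhere.\<close>

lemma e_total_on: "total_in (L2on A) (e ` bm_on M A)" unfolding total_in_def
proof (intro conjI ballI impI)
  show "e ` bm_on M A \<subseteq> hcarrier (L2on A)" using ex_LFQ by (auto simp: e_def carrier_L2on)
  fix u assume "u \<in> hcarrier (L2on A)" and orth: "\<forall>w\<in>e ` bm_on M A. hinner (L2on A) w u = 0"
  then obtain f where f: "f \<in> LFQ A" "u = cl f" by (auto simp: carrier_L2on)
  have fm: "f \<in> borel_measurable (alg A)" using f by (simp add: LFQ_iff)
  have fP[measurable]: "f \<in> borel_measurable P" by (rule measurable_from_subalg[OF subalg fm])
  have z: "(\<lambda>x. 0) \<in> bm_on M A" by (simp add: bm_on_def bm_const)
  \<comment> \<open>Integrability of \<open>f\<close> itself: the exponential of the zero function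
    is almost everywhere \<open>1\<close>.\<close>
  have "integrable P (\<lambda>\<omega>. cnj (ex (\<lambda>x. 0) \<omega>) * f \<omega>)" by (rule LFQ_integrable_mult[OF ex_LFQ[OF z] f(1)])
  moreover have "AE \<omega> in P. cnj (ex (\<lambda>x. 0) \<omega>) * f \<omega> = f \<omega>" using ex_zero by eventually_elim simp
  ultimately have fi: "integrable P f" using integrable_cong_AE_imp[of P _ f] by simp
  have "(\<integral>\<omega>. indicator F \<omega> *\<^sub>R f \<omega> \<partial>P) = 0" if F: "F \<in> sets (alg A)" for F
  proof (rule alg_integral_zero[OF fi _ F])
    fix a assume a: "a \<in> bm_on M A"
    \<comment> \<open>The inner product conjugates its first argument, so integrals against
      \<open>ex a\<close> are pairings with the exponential of \<open>- a\<close>; the form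
      \<open>0 - a x\<close> is the one treated by \<open>ex_diff\<close>.\<close>
    define a' where "a' = (\<lambda>x. 0 - a x)"
    have a': "a' \<in> bm_on M A" using bm_on_add[OF z a, of 1 "-1"] by (simp add: a'_def)
    have "(\<integral>\<omega>. f \<omega> * ex a \<omega> \<partial>P) = (\<integral>\<omega>. cnj (ex a' \<omega>) * f \<omega> \<partial>P)"
    proof (rule integral_cong_AE)
      show "AE \<omega> in P. f \<omega> * ex a \<omega> = cnj (ex a' \<omega>) * f \<omega>"
        using ex_diff[OF bm_on_bm[OF z] bm_on_bm[OF a]] ex_zero by eventually_elim (simp add: a'_def)
    qed (use ex_measurable[OF bm_on_bm[OF a]] ex_measurable[OF bm_on_bm[OF a']] in measurable)
    also have "\<dots> = hinner L2P (e a') u" unfolding e_def f(2) by (rule inner_L2P[OF ex_LFQ[OF a'] f(1), symmetric])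
    also have "\<dots> = 0" using orth a' by (simp add: L2on_ops)
    finally show "(\<integral>\<omega>. f \<omega> * ex a \<omega> \<partial>P) = 0" .
  qed
  then have "AE \<omega> in Q A. f \<omega> = 0"
  proof (intro AE_zero_if_set_integrals_zero)
    show "integrable (Q A) f" by (rule integrable_in_subalg[OF subalg fm fi])
    fix F assume "F \<in> sets (Q A)"
    then have F[measurable]: "F \<in> sets (alg A)" by (simp add: sets_restr_to_subalg[OF subalg])
    note fm[measurable]
    have "(\<integral>\<omega>. indicator F \<omega> *\<^sub>R f \<omega> \<partial>Q A) = (\<integral>\<omega>. indicator F \<omega> *\<^sub>R f \<omega> \<partial>P)"
      by (rule integral_subalgebra2[OF subalg]) measurable
    moreover assume "\<And>F. F \<in> sets (alg A) \<Longrightarrow> (\<integral>\<omega>. indicator F \<omega> *\<^sub>R f \<omega> \<partial>P) = 0"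
    ultimately show "(\<integral>\<omega>. indicator F \<omega> *\<^sub>R f \<omega> \<partial>Q A) = 0" using F by simp
  qed
  then have "AE \<omega> in P. f \<omega> = 0" by (rule AE_restr_to_subalg[OF subalg])
  then have "cl f = cl (\<lambda>\<omega>. 0)" by (intro cl_eqI[OF f(1), of _ A]) (simp_all add: LFQ_iff)
  then show "u = hzero (L2on A)"
    unfolding L2on_ops L2P f(2) L2_space.L2_zero[OF L2_space_Q] by (simp add: complex_as_hilbert_def)
qed

text \<open>Inner products of exponentials depend on the difference of the two functions only, so
  their multiplicativity is that of the characteristic functional over disjoint supports.\<close>

lemma exp_system: "exp_system L2P M e"
proof -
  interpret complex_hilbert_space L2P by (rule hilbert_L2P)
  show ?thesis
  proof
    show "total_in L2P (e ` bm)" using e_total_on[of "space M"] by (simp add: L2on_space bm_on_space)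
    show "hinner L2P (e (\<lambda>x. 0)) (e (\<lambda>x. 0)) = 1" by (simp add: e_inner bm_const cf_zero)
    fix A a a' b b'
    assume A: "A \<in> sets M" and a: "a \<in> bm_on M A" "a' \<in> bm_on M A" and b: "b \<in> bm_on M (space M - A)" "b' \<in> bm_on M (space M - A)"
    have "(\<lambda>x. a x - a' x) \<in> bm_on M A" "(\<lambda>x. b x - b' x) \<in> bm_on M (space M - A)"
      using bm_on_add[OF a, of 1 "-1"] bm_on_add[OF b, of 1 "-1"] by simp_all
    from cf_add[OF this]
    have "cf (\<lambda>x. (a x + b x) - (a' x + b' x)) = cf (\<lambda>x. a x - a' x) * cf (\<lambda>x. b x - b' x)" by (simp add: algebra_simps)
    then show "hinner L2P (e (\<lambda>x. a' x + b' x)) (e (\<lambda>x. a x + b x)) = hinner L2P (e a') (e a) * hinner L2P (e b') (e b)"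
      using a b by (simp add: e_inner bm_plus bm_on_bm)
  qed (rule e_AE)
qed

section \<open>The tensor decomposition of the functionals of the process\<close>

definition tau :: "('w \<Rightarrow> complex) set \<Rightarrow> ('w \<Rightarrow> complex) set \<Rightarrow> ('w \<Rightarrow> complex) set" where
  "tau u v = L2_class (process_space M P \<eta>) complex_as_hilbert (\<lambda>\<omega>. rep u \<omega> * rep v \<omega>)"

lemma tau_commute: "tau u v = tau v u" by (simp add: tau_def mult.commute)

text \<open>In general a product of square integrable functions is merely integrable; here
  independence makes the integral of the product of the squares finite.\<close>

lemma tau_cl:
  assumes f: "f \<in> LFQ A" and g: "g \<in> LFQ (space M - A)"
  shows "tau (cl f) (cl g) = cl (\<lambda>\<omega>. f \<omega> * g \<omega>)" "(\<lambda>\<omega>. f \<omega> * g \<omega>) \<in> LFQ (space M)"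
proof -
  interpret S: L2_space CH "Q (space M)" by (rule L2_space_Q)
  show "tau (cl f) (cl g) = cl (\<lambda>\<omega>. f \<omega> * g \<omega>)" unfolding tau_def process_space_def
    using S.rep_cls(2)[OF LFQ_space[OF f]] S.rep_cls(2)[OF LFQ_space[OF g]]
    by (intro S.cls_eqI) (auto elim: eventually_elim2)
  have [measurable]: "f \<in> borel_measurable (alg (space M))" "g \<in> borel_measurable (alg (space M))"
    using LFQ_space[OF f] LFQ_space[OF g] by (auto simp: LFQ_iff)
  have "indep_var borel (\<lambda>\<omega>. (cmod (f \<omega>))^2) borel (\<lambda>\<omega>. (cmod (g \<omega>))^2)"
    using f g by (intro alg_indep_var[of _ A]) (auto simp: LFQ_iff)
  then have "integrable P (\<lambda>\<omega>. (cmod (f \<omega>))^2 * (cmod (g \<omega>))^2)"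
    using f g by (intro indep_var_integrable) (auto simp: LFQ_iff)
  then show "(\<lambda>\<omega>. f \<omega> * g \<omega>) \<in> LFQ (space M)" by (simp add: LFQ_iff norm_mult power_mult_distrib)
qed

lemma tau_e:
  assumes a: "a \<in> bm_on M A" and b: "b \<in> bm_on M (space M - A)"
  shows "tau (e a) (e b) = e (\<lambda>x. a x + b x)" unfolding e_def tau_cl(1)[OF ex_LFQ[OF a] ex_LFQ[OF b]]
proof (rule cl_eqI)
  show "(\<lambda>\<omega>. ex a \<omega> * ex b \<omega>) \<in> LFQ (space M)" by (rule tau_cl(2)[OF ex_LFQ[OF a] ex_LFQ[OF b]])
  show "ex (\<lambda>x. a x + b x) \<in> LFQ (space M)"
    using bm_plus[OF bm_on_bm[OF a] bm_on_bm[OF b]] by (intro ex_LFQ) (simp add: bm_on_space)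
  show "AE \<omega> in P. ex a \<omega> * ex b \<omega> = ex (\<lambda>x. a x + b x) \<omega>"
    using ex_add[OF bm_on_bm[OF a] bm_on_bm[OF b]] by eventually_elim simp
qed

text \<open>Independence makes the inner products multiplicative. Totality holds because every
  exponential is the product of the exponentials of the two parts of its function on
  \<open>A\<close> and off \<open>A\<close>.\<close>

lemma tensor_process:
  assumes A: "A \<in> sets M"
  shows "tensor_decomposition L2P (L2on A) (L2on (space M - A)) tau"
proof -
  interpret H: complex_hilbert_space L2P by (rule hilbert_L2P)
  interpret H1: complex_hilbert_space "L2on A" by (rule hilbert_L2on)
  interpret H2: complex_hilbert_space "L2on (space M - A)" by (rule hilbert_L2on)
  interpret E: exp_system L2P M e by (rule exp_system)
  have z: "(\<lambda>x. 0) \<in> bm_on M B" for B by (simp add: bm_on_def bm_const)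
  have ec: "e a \<in> hcarrier (L2on B)" if "a \<in> bm_on M B" for a B using e_total_on[of B] that by (auto simp: total_in_def)
  show ?thesis
  proof
    fix x y assume "x \<in> hcarrier (L2on A)" "y \<in> hcarrier (L2on (space M - A))"
    then obtain f g where fg: "f \<in> LFQ A" "g \<in> LFQ (space M - A)" "x = cl f" "y = cl g" by (auto simp: carrier_L2on)
    then show "tau x y \<in> hcarrier L2P" using tau_cl[of f A g] by (simp add: L2P L2_space.cls_carrier[OF L2_space_Q])
    fix x' y' assume "x' \<in> hcarrier (L2on A)" "y' \<in> hcarrier (L2on (space M - A))"
    then obtain f' g' where fg': "f' \<in> LFQ A" "g' \<in> LFQ (space M - A)" "x' = cl f'" "y' = cl g'" by (auto simp: carrier_L2on)
    have "hinner L2P (tau x y) (tau x' y') = (\<integral>\<omega>. cnj (f \<omega> * g \<omega>) * (f' \<omega> * g' \<omega>) \<partial>P)"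
      using fg fg' tau_cl[OF fg(1,2)] tau_cl[OF fg'(1,2)] inner_L2P by simp
    also have "\<dots> = (\<integral>\<omega>. (cnj (f \<omega>) * f' \<omega>) * (cnj (g \<omega>) * g' \<omega>) \<partial>P)" by (simp add: ac_simps)
    also have "\<dots> = (\<integral>\<omega>. cnj (f \<omega>) * f' \<omega> \<partial>P) * (\<integral>\<omega>. cnj (g \<omega>) * g' \<omega> \<partial>P)"
    proof (rule indep_var_lebesgue_integral)
      have [measurable]: "f \<in> borel_measurable (alg A)" "f' \<in> borel_measurable (alg A)"
        "g \<in> borel_measurable (alg (space M - A))" "g' \<in> borel_measurable (alg (space M - A))"
        using fg fg' by (auto simp: LFQ_iff)
      show "indep_var borel (\<lambda>\<omega>. cnj (f \<omega>) * f' \<omega>) borel (\<lambda>\<omega>. cnj (g \<omega>) * g' \<omega>)" by (rule alg_indep_var[of _ A]; measurable)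
    qed (use fg fg' LFQ_integrable_mult in auto)
    finally show "hinner L2P (tau x y) (tau x' y') = hinner (L2on A) x x' * hinner (L2on (space M - A)) y y'"
      using fg fg' by (simp add: L2on_ops inner_L2P)
  next
    fix w assume w: "w \<in> hcarrier L2P"
      and orth: "\<And>x y. \<lbrakk>x \<in> hcarrier (L2on A); y \<in> hcarrier (L2on (space M - A))\<rbrakk> \<Longrightarrow> hinner L2P (tau x y) w = 0"
    have "hinner L2P (e c) w = 0" if c: "c \<in> bm" for c
    proof -
      define a where "a = (\<lambda>x. if x \<in> A then c x else 0)"
      define b where "b = (\<lambda>x. if x \<in> A then 0 else c x)"
      have ab: "a \<in> bm_on M A" "b \<in> bm_on M (space M - A)" using bm_If[OF A c] by (auto simp: a_def b_def bm_on_def)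
      have "(\<lambda>x. a x + b x) = c" by (auto simp: a_def b_def)
      then show ?thesis using orth[OF ec[OF ab(1)] ec[OF ab(2)]] tau_e[OF ab] by simp
    qed
    then show "w = hzero L2P" using E.e_total w by (auto simp: total_in_def)
  next
    show "\<exists>x\<in>hcarrier (L2on A). hinner (L2on A) x x = 1" using ec[OF z] E.e_unit by (auto simp: L2on_ops)
    show "\<exists>x\<in>hcarrier (L2on (space M - A)). hinner (L2on (space M - A)) x x = 1"
      using ec[OF z] E.e_unit by (auto simp: L2on_ops)
  qed
qed

lemma process_factorization_tau:
  "process_factorization M P \<eta> A = amplification L2P (L2on A) (L2on (space M - A)) tau"
  by (simp add: process_factorization_def tau_def[abs_def])

text \<open>The criterion \<open>amplification_iff\<close> for the exponentials on both sides of
  \<open>A\<close>, with the exponential of the zero function, that is the constant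
  \<open>1\<close>, as unit vector.\<close>

lemma process_factorization_exp_alg:
  assumes A: "A \<in> sets M"
  shows "process_factorization M P \<eta> A = exp_alg M L2P e A"
proof -
  interpret T: tensor_decomposition L2P "L2on A" "L2on (space M - A)" tau by (rule tensor_process[OF A])
  interpret E: exp_system L2P M e by (rule exp_system)
  have z: "(\<lambda>x. 0) \<in> bm_on M (space M - A)" by (simp add: bm_on_def bm_const)
  show ?thesis
  proof (intro set_eqI)
    fix T
    have 0: "tau (e a) (e (\<lambda>x. 0)) = e a" if "a \<in> bm_on M A" for a using tau_e[OF that z] by simp
    have 1: "hinner (L2on (space M - A)) (e (\<lambda>x. 0)) (e (\<lambda>x. 0)) = 1" by (simp only: L2on_ops E.e_unit)
    show "T \<in> process_factorization M P \<eta> A \<longleftrightarrow> T \<in> exp_alg M L2P e A"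
      unfolding process_factorization_tau exp_alg_def mem_Collect_eq
        T.amplification_iff[where ?e1.0=e and ?e2.0=e and ?o2.0="\<lambda>x. 0", OF e_total_on e_total_on z 1]
      by (intro conj_cong ball_cong refl) (simp only: 0 tau_e L2on_ops)
  qed
qed

lemma process_factorization_compl:
  assumes A: "A \<in> sets M"
  shows "process_factorization M P \<eta> (space M - A) = commutant L2P (process_factorization M P \<eta> A)"
proof -
  interpret T: tensor_decomposition L2P "L2on A" "L2on (space M - A)" tau by (rule tensor_process[OF A])
  have "space M - (space M - A) = A" using sets.sets_into_space[OF A] by blast
  moreover have "(\<lambda>y x. tau x y) = tau" by (intro ext) (rule tau_commute)
  ultimately show ?thesis unfolding process_factorization_tau T.commutant_amplification by (simp only:)
qed

theorem hilbert_factorization_process: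
  "hilbert_factorization M L2P (process_factorization M P \<eta>)"
proof -
  interpret E: exp_system L2P M e by (rule exp_system)
  show ?thesis
  proof (rule E.hilbert_factorization_exp_alg)
    fix A assume A: "A \<in> sets M"
    interpret T: tensor_decomposition L2P "L2on A" "L2on (space M - A)" tau by (rule tensor_process[OF A])
    show "type_I_factor L2P (process_factorization M P \<eta> A)"
      unfolding process_factorization_tau by (rule T.type_I_factor_amplification)
    show "process_factorization M P \<eta> A = exp_alg M L2P e A" by (rule process_factorization_exp_alg[OF A])
    show "process_factorization M P \<eta> (space M - A) = commutant L2P (process_factorization M P \<eta> A)"
      by (rule process_factorization_compl[OF A])
  qed
qed

end

section \<open>The Hilbert space of a Levy characteristic\<close>

definition add_measure :: "'a measure \<Rightarrow> 'a measure \<Rightarrow> 'a measure" where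
  "add_measure M N = measure_of (space M) (sets M) (\<lambda>A. emeasure M A + emeasure N A)"

lemma sets_add_measure [simp, measurable_cong]: "sets (add_measure M N) = sets M" by (simp add: add_measure_def)

lemma space_add_measure [simp]: "space (add_measure M N) = space M" by (simp add: add_measure_def space_measure_of_conv)

lemma emeasure_add_measure:
  assumes "sets N = sets M" "A \<in> sets M"
  shows "emeasure (add_measure M N) A = emeasure M A + emeasure N A" using add_measure_def
proof (rule emeasure_measure_of)
  show "countably_additive (sets (add_measure M N)) (\<lambda>A. emeasure M A + emeasure N A)"
  proof (rule countably_additiveI)
    fix A :: "nat \<Rightarrow> _" assume A: "range A \<subseteq> sets (add_measure M N)" "disjoint_family A"
    have "(\<Sum>i. emeasure M (A i) + emeasure N (A i)) = (\<Sum>i. emeasure M (A i)) + (\<Sum>i. emeasure N (A i))"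
      by (rule suminf_add[symmetric]) auto
    then show "(\<Sum>i. emeasure M (A i) + emeasure N (A i)) = emeasure M (\<Union> (range A)) + emeasure N (\<Union> (range A))"
      using A assms by (simp add: suminf_emeasure)
  qed
qed (use assms sets.space_closed in \<open>auto simp: positive_def\<close>)

definition kern :: "real \<Rightarrow> real \<Rightarrow> complex" where
  "kern y t = (if t = 0 then \<i> * of_real y else (iexp (t * y) - 1) * of_real (sqrt (1 + t^2) / t))"

text \<open>The measure \<open>t^2 / (1 + t^2) d\<Lambda>\<close> with the Gaussian variance as mass at \<open>0\<close>. The compensating
  factor \<open>sqrt (1 + t^2) / t\<close> in \<open>kern\<close> extends \<open>exp (i t y) - 1\<close> to \<open>t = 0\<close>, where it gives \<open>i y\<close>.\<close>

definition wlevy :: "real measure \<Rightarrow> real measure" where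
  "wlevy \<Lambda> = density \<Lambda> (\<lambda>t. ennreal (t^2 / (1 + t^2)))"

definition levy_mu :: "real \<Rightarrow> real measure \<Rightarrow> real measure" where
  "levy_mu \<sigma> \<Lambda> = add_measure (wlevy \<Lambda>) (density (return borel 0) (\<lambda>_. ennreal (\<sigma>^2)))"

definition levy_int :: "real \<Rightarrow> real \<Rightarrow> complex" where
  "levy_int y t = iexp (t * y) - 1 - \<i> * of_real (t * y / (1 + t^2))"

lemma cmod_iexp_1: "cmod (iexp x - 1) \<le> \<bar>x\<bar>" using iexp_approx1[of x 0] by simp

lemma cmod_iexp_2: "cmod (iexp x - 1) \<le> 2" using norm_triangle_ineq4[of "iexp x" 1] by simp

text \<open>Write \<open>(1 + t^2) / t^2\<close> as \<open>1 + 1 / t^2\<close>. The first summand is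
  met with the bound \<open>2\<close> for \<open>iexp (t * y) - 1\<close>, which gives
  \<open>4\<close>, and the second with the bound \<open>\<bar>t * y\<bar>\<close>, which gives
  \<open>y^2\<close>.\<close>

lemma kern_bound: "(cmod (kern y t))^2 \<le> 4 + y^2"
proof (cases "t = 0")
  case True
  then show ?thesis by (simp add: kern_def norm_mult)
next
  case False
  define d where "d = cmod (iexp (t * y) - 1)"
  have d: "d^2 \<le> 4" "d^2 \<le> t^2 * y^2"
    using power_mono[OF cmod_iexp_2[of "t * y"], of 2] power_mono[OF cmod_iexp_1[of "t * y"], of 2]
    by (simp_all add: d_def power_mult_distrib)
  have "(cmod (kern y t))^2 = d^2 * ((1 + t^2) / t^2)"
    using False by (simp add: kern_def d_def norm_mult norm_divide power_mult_distrib power_divide)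
  also have "\<dots> = d^2 + d^2 / t^2" using False by (simp add: field_simps)
  also have "\<dots> \<le> 4 + y^2" using d False by (intro add_mono) (simp_all add: divide_le_eq mult.commute)
  finally show ?thesis .
qed

lemma kern_measurable [measurable]: "kern y \<in> borel_measurable borel" unfolding kern_def by measurable

lemma kern_measurable2: "(\<lambda>(y, t). kern y t) \<in> borel_measurable (borel \<Otimes>\<^sub>M borel)" unfolding kern_def by measurable

lemma kern_weight:
  "(t^2 / (1 + t^2)) *\<^sub>R (cnj (kern a t) * kern b t) = cnj (iexp (t * a) - 1) * (iexp (t * b) - 1)"
proof (cases "t = 0")
  case False
  define s where "s = complex_of_real (sqrt (1 + t^2) / t)"
  have "cnj s * s = complex_of_real ((1 + t^2) / t^2)" unfolding s_def complex_cnj_complex_of_real of_real_mult[symmetric]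
    by (rule arg_cong[of _ _ complex_of_real]) (simp add: power2_eq_square field_simps real_sqrt_mult_self)
  moreover have "(t^2 / (1 + t^2)) * ((1 + t^2) / t^2) = 1" using False by (simp add: add_nonneg_eq_0_iff)
  ultimately have "complex_of_real (t^2 / (1 + t^2)) * (cnj s * s) = 1" by (metis of_real_1 of_real_mult)
  moreover have "(t^2 / (1 + t^2)) *\<^sub>R (cnj (kern a t) * kern b t) =
      (complex_of_real (t^2 / (1 + t^2)) * (cnj s * s)) * (cnj (iexp (t * a) - 1) * (iexp (t * b) - 1))"
    using False by (simp add: kern_def s_def scaleR_conv_of_real del: of_real_mult of_real_divide of_real_add of_real_power)
  ultimately show ?thesis by simp
qed simp

text \<open>The cocycle identity of \<open>y \<mapsto> kern y\<close> for translations: increments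
  are the kernel multiplied by a character, including at \<open>t = 0\<close>, where the character
  is \<open>1\<close>.\<close>

lemma kern_diff: "kern (y + s) t - kern y t = iexp (t * y) * kern s t"
proof (cases "t = 0")
  case False
  have 1: "iexp (t * (y + s)) = iexp (t * y) * iexp (t * s)"
    by (simp add: distrib_left exp_add)
  have 2: "(E * F - 1) * r - (E - 1) * r = E * ((F - 1) * r)" for E F r :: complex by (simp add: algebra_simps)
  show ?thesis unfolding kern_def if_not_P[OF False] 1 2 ..
qed (simp add: kern_def distrib_left)

text \<open>For \<open>\<bar>t\<bar> \<le> 1\<close> the exponential is expanded to second order and
  \<open>t^2\<close> is at most twice the weight \<open>t^2 / (1 + t^2)\<close>. For large
  \<open>t\<close> the weight is at least \<open>1/2\<close> and the trivial bound
  \<open>2 + \<bar>y\<bar>\<close> suffices. The constant dominates those of both cases.\<close>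

lemma levy_int_bound: "cmod (levy_int y t) \<le> (y^2 + 4 + 2 * \<bar>y\<bar>) * (t^2 / (1 + t^2))"
proof (cases "\<bar>t\<bar> \<le> 1")
  case True
  then have t2: "t^2 \<le> 1" by (simp add: abs_square_le_1)
  \<comment> \<open>The compensator \<open>t * y / (1 + t^2)\<close> is replaced by the Taylor term
    \<open>t * y\<close>; their difference already carries the weight.\<close>
  have eq: "levy_int y t = (iexp (t * y) - (1 + \<i> * of_real (t * y))) + \<i> * of_real (t * y * (t^2 / (1 + t^2)))"
  proof -
    have "t * y - t * y / (1 + t^2) = t * y * (t^2 / (1 + t^2))" by (simp add: field_simps add_nonneg_eq_0_iff)
    then have eq: "\<i> * complex_of_real (t * y * (t^2 / (1 + t^2))) = \<i> * complex_of_real (t * y) - \<i> * complex_of_real (t * y / (1 + t^2))"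
      by (metis of_real_diff right_diff_distrib)
    show ?thesis unfolding levy_int_def eq by simp
  qed
  have 1: "cmod (iexp (t * y) - (1 + \<i> * of_real (t * y))) \<le> (t * y)^2 / 2"
    using iexp_approx1[of "t * y" 1] by (simp add: power2_eq_square numeral_2_eq_2)
  have 2: "cmod (\<i> * of_real (t * y * (t^2 / (1 + t^2)))) \<le> \<bar>y\<bar> * (t^2 / (1 + t^2))"
  proof -
    have "\<bar>t\<bar> * (\<bar>y\<bar> * (t^2 / (1 + t^2))) \<le> 1 * (\<bar>y\<bar> * (t^2 / (1 + t^2)))" by (rule mult_right_mono[OF True]) simp
    then show ?thesis unfolding norm_mult norm_ii norm_of_real by (simp add: abs_mult mult.assoc)
  qed
  have 3: "t^2 \<le> 2 * (t^2 / (1 + t^2))"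
  proof -
    have "t^2 * (1 + t^2) \<le> t^2 * 2" using t2 by (intro mult_left_mono) auto
    then have "t^2 \<le> t^2 * 2 / (1 + t^2)" by (subst pos_le_divide_eq) (auto intro: add_pos_nonneg)
    then show ?thesis by (simp add: mult.commute)
  qed
  have "cmod (levy_int y t) \<le> (t * y)^2 / 2 + \<bar>y\<bar> * (t^2 / (1 + t^2))"
    unfolding eq by (rule order_trans[OF norm_triangle_ineq add_mono[OF 1 2]])
  also have "(t * y)^2 / 2 \<le> y^2 * (t^2 / (1 + t^2))"
    using mult_left_mono[OF 3, of "y^2 / 2"] by (simp add: power_mult_distrib mult.commute)
  finally have "cmod (levy_int y t) \<le> (y^2 + \<bar>y\<bar>) * (t^2 / (1 + t^2))" by (simp only: distrib_right)
  also have "\<dots> \<le> (y^2 + 4 + 2 * \<bar>y\<bar>) * (t^2 / (1 + t^2))" by (intro mult_right_mono) auto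
  finally show ?thesis .
next
  case False
  then have t1: "\<bar>t\<bar> \<ge> 1" by simp
  then have t2: "t^2 \<ge> 1" by (metis abs_1 abs_le_square_iff one_power2)
  have w: "1 \<le> 2 * (t^2 / (1 + t^2))" using t2 by (simp add: field_simps add_pos_nonneg)
  have "cmod (\<i> * of_real (t * y / (1 + t^2))) \<le> \<bar>y\<bar>"
  proof -
    have "\<bar>t\<bar> \<le> t^2" using t1 by (metis abs_mult_self_eq mult_le_cancel_left1 abs_ge_zero power2_eq_square not_less)
    then have "\<bar>t\<bar> \<le> 1 + t^2" by simp
    then have "\<bar>t\<bar> * \<bar>y\<bar> \<le> (1 + t^2) * \<bar>y\<bar>" by (rule mult_right_mono) simp
    then show ?thesis unfolding norm_mult norm_ii norm_of_real by (simp add: abs_mult divide_le_eq add_pos_nonneg mult.commute)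
  qed
  from order_trans[OF norm_triangle_ineq4 add_mono[OF cmod_iexp_2 this]]
  have "cmod (levy_int y t) \<le> 2 + \<bar>y\<bar>" unfolding levy_int_def by blast
  also have "\<dots> \<le> (2 + \<bar>y\<bar>) * (2 * (t^2 / (1 + t^2)))" using mult_left_mono[OF w, of "2 + \<bar>y\<bar>"] by simp
  also have "\<dots> \<le> (y^2 + 4 + 2 * \<bar>y\<bar>) * (t^2 / (1 + t^2))"
  proof -
    have "(4 + 2 * \<bar>y\<bar>) * (t^2 / (1 + t^2)) \<le> (y^2 + 4 + 2 * \<bar>y\<bar>) * (t^2 / (1 + t^2))" by (intro mult_right_mono) auto
    then show ?thesis by (simp add: algebra_simps)
  qed
  finally show ?thesis .
qed

locale levy_data =
  fixes \<sigma> :: real and \<Lambda> :: "real measure"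
  assumes levy: "levy_measure \<Lambda>"
begin

abbreviation "\<mu> \<equiv> levy_mu \<sigma> \<Lambda>"
abbreviation "W \<equiv> wlevy \<Lambda>"

lemma sets_L [measurable_cong]: "sets \<Lambda> = sets borel" using levy by (simp add: levy_measure_def)

lemma integrable_weight: "integrable \<Lambda> (\<lambda>t. t^2 / (1 + t^2))" using levy by (simp add: levy_measure_def)

lemma space_L: "space \<Lambda> = UNIV" using sets_eq_imp_space_eq[OF sets_L] by simp

lemma sets_W [measurable_cong]: "sets W = sets borel" by (simp add: wlevy_def sets_L)

lemma sets_mu [measurable_cong]: "sets \<mu> = sets borel" by (simp add: levy_mu_def sets_W)

lemma space_mu: "space \<mu> = UNIV" using sets_eq_imp_space_eq[OF sets_mu] by simp

lemma emeasure_mu: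
  assumes "A \<in> sets borel"
  shows "emeasure \<mu> A = emeasure W A + ennreal (\<sigma>^2) * indicator A 0" unfolding levy_mu_def using assms
  by (subst emeasure_add_measure) (simp_all add: sets_W emeasure_density nn_integral_return nn_integral_cmult)

lemma finite_W: "finite_measure W"
proof (rule finite_measureI)
  have "emeasure W (space W) = (\<integral>\<^sup>+t. ennreal (t^2 / (1 + t^2)) \<partial>\<Lambda>)"
    unfolding wlevy_def by (subst emeasure_density) (auto simp: space_L intro!: nn_integral_cong)
  also have "\<dots> = ennreal (\<integral>t. t^2 / (1 + t^2) \<partial>\<Lambda>)" by (rule nn_integral_eq_integral[OF integrable_weight]) simp
  finally show "emeasure W (space W) \<noteq> \<infinity>" by simp
qed

lemma finite_mu: "finite_measure \<mu>"
proof (rule finite_measureI)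
  have "emeasure \<mu> UNIV = emeasure W UNIV + ennreal (\<sigma>^2) * indicator UNIV (0::real)" by (rule emeasure_mu) simp
  moreover have "emeasure W UNIV \<noteq> \<infinity>" by (simp add: finite_measure.emeasure_finite[OF finite_W])
  ultimately show "emeasure \<mu> (space \<mu>) \<noteq> \<infinity>" by (simp add: space_mu)
qed

text \<open>The density is positive off \<open>0\<close>, and \<open>{0}\<close> is a null set of
  \<Lambda>.\<close>

lemma null_W_iff:
  assumes [measurable]: "A \<in> sets borel"
  shows "emeasure W A = 0 \<longleftrightarrow> emeasure \<Lambda> A = 0"
proof -
  have 0: "{0::real} \<in> null_sets \<Lambda>" using levy by (auto simp: levy_measure_def null_sets_def)
  have "emeasure W A = 0 \<longleftrightarrow> (AE t in \<Lambda>. ennreal (t^2 / (1 + t^2)) * indicator A t = 0)"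
    unfolding wlevy_def by (subst emeasure_density) (auto simp: nn_integral_0_iff_AE)
  also have "\<dots> \<longleftrightarrow> (AE t in \<Lambda>. t = 0 \<or> t \<notin> A)"
  proof -
    have "(ennreal (t^2 / (1 + t^2)) * indicator A t = 0) = (t = 0 \<or> t \<notin> A)" for t
      using add_pos_nonneg[of 1 "t^2"] by (auto split: split_indicator simp: ennreal_eq_0_iff divide_le_0_iff)
    then show ?thesis by simp
  qed
  also have "\<dots> \<longleftrightarrow> (AE t in \<Lambda>. t \<notin> A)" using AE_not_in[OF 0] by (auto elim: eventually_elim2 eventually_mono)
  also have "\<dots> \<longleftrightarrow> emeasure \<Lambda> A = 0" by (subst AE_iff_measurable[of A]) (auto simp: space_L)
  finally show ?thesis .
qed

lemma W_0: "emeasure W {0} = 0" using null_W_iff[of "{0}"] levy by (simp add: levy_measure_def)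

lemma density_mu: "density \<mu> (indicator (- {0})) = W"
proof (rule measure_eqI)
  show "sets (density \<mu> (indicator (- {0}))) = sets W" by (simp add: sets_mu sets_W)
  fix A assume "A \<in> sets (density \<mu> (indicator (- {0})))"
  then have A[measurable]: "A \<in> sets borel" by (simp add: sets_mu)
  have "emeasure (density \<mu> (indicator (- {0}))) A = (\<integral>\<^sup>+t. indicator (- {0}) t * indicator A t \<partial>\<mu>)"
    by (rule emeasure_density) auto
  also have "\<dots> = (\<integral>\<^sup>+t. indicator (A - {0}) t \<partial>\<mu>)" by (intro nn_integral_cong) (auto split: split_indicator)
  also have "\<dots> = emeasure \<mu> (A - {0})" by simp
  also have "\<dots> = emeasure W (A - {0})" by (subst emeasure_mu) auto
  also have "\<dots> = emeasure W A" using W_0 by (intro emeasure_Diff_null_set) (auto simp: null_sets_def sets_W)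
  finally show "emeasure (density \<mu> (indicator (- {0}))) A = emeasure W A" .
qed

lemma integral_mu:
  fixes f :: "real \<Rightarrow> complex"
  assumes f: "integrable \<mu> f"
  shows "(\<integral>t. f t \<partial>\<mu>) = (\<integral>t. (t^2 / (1 + t^2)) *\<^sub>R f t \<partial>\<Lambda>) + of_real (\<sigma>^2) * f 0"
proof -
  have fm[measurable]: "f \<in> borel_measurable borel"
    using f borel_measurable_integrable measurable_cong_sets[OF sets_mu refl] by blast
  have i: "integrable \<mu> (\<lambda>t. indicator A t *\<^sub>R f t)" if "A \<in> sets borel" for A
    by (rule integrable_mult_indicator[OF _ f]) (use that in \<open>simp add: sets_mu\<close>)
  have "(\<integral>t. f t \<partial>\<mu>) = (\<integral>t. indicator {0} t *\<^sub>R f t + indicator (- {0}) t *\<^sub>R f t \<partial>\<mu>)"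
    by (intro Bochner_Integration.integral_cong refl) (auto split: split_indicator)
  also have "\<dots> = (\<integral>t. indicator {0} t *\<^sub>R f t \<partial>\<mu>) + (\<integral>t. indicator (- {0}) t *\<^sub>R f t \<partial>\<mu>)"
    by (rule Bochner_Integration.integral_add) (auto intro!: i)
  also have "(\<integral>t. indicator {0} t *\<^sub>R f t \<partial>\<mu>) = (\<integral>t. indicator {0} t *\<^sub>R f 0 \<partial>\<mu>)"
    by (intro Bochner_Integration.integral_cong refl) (auto split: split_indicator)
  also have "\<dots> = of_real (\<sigma>^2) * f 0"
  proof -
    have "emeasure \<mu> {0} = ennreal (\<sigma>^2)" using W_0 by (simp add: emeasure_mu)
    then have "measure \<mu> {0} = \<sigma>^2" by (simp add: measure_def)
    then show ?thesis using finite_measure.emeasure_finite[OF finite_mu, of "{0}"]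
      by (simp add: scaleR_conv_of_real space_mu sets_mu)
  qed
  also have "(\<integral>t. indicator (- {0}) t *\<^sub>R f t \<partial>\<mu>) = (\<integral>t. f t \<partial>density \<mu> (\<lambda>t. ennreal (indicator (- {0}) t)))"
    by (rule integral_density[symmetric]) auto
  also have "density \<mu> (\<lambda>t. ennreal (indicator (- {0}) t)) = W"
    using density_mu by (simp add: ennreal_indicator[abs_def] ennreal_indicator)
  also have "(\<integral>t. f t \<partial>W) = (\<integral>t. (t^2 / (1 + t^2)) *\<^sub>R f t \<partial>\<Lambda>)" unfolding wlevy_def by (rule integral_density) auto
  finally show ?thesis by simp
qed

lemma integrable_mu_bounded:
  fixes f :: "real \<Rightarrow> complex"
  assumes "f \<in> borel_measurable borel" "\<And>t. cmod (f t) \<le> C"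
  shows "integrable \<mu> f" by (rule finite_measure.integrable_const_bound[OF finite_mu, of _ C])
    (use assms in \<open>auto simp: measurable_cong_sets[OF sets_mu refl]\<close>)

definition \<kappa> :: "real \<Rightarrow> real \<Rightarrow> complex" where
  "\<kappa> a b = (\<integral>t. cnj (kern a t) * kern b t \<partial>\<mu>)"

lemma levy_int_integrable: "integrable \<Lambda> (levy_int y)"
proof (rule Bochner_Integration.integrable_bound)
  show "integrable \<Lambda> (\<lambda>t. (y^2 + 4 + 2 * \<bar>y\<bar>) * (t^2 / (1 + t^2)))" by (rule integrable_mult_right[OF integrable_weight])
  show "levy_int y \<in> borel_measurable \<Lambda>" unfolding levy_int_def by measurable
  show "AE t in \<Lambda>. norm (levy_int y t) \<le> norm ((y^2 + 4 + 2 * \<bar>y\<bar>) * (t^2 / (1 + t^2)))"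
    using levy_int_bound by (intro AE_I2) (auto intro: order_trans[OF _ abs_ge_self])
qed

lemma log_phi_eq: "log_phi c \<sigma> \<Lambda> y = \<i> * of_real (c * y) - of_real (\<sigma>^2 * y^2 / 2) + (\<integral>t. levy_int y t \<partial>\<Lambda>)"
  by (simp add: log_phi_def levy_int_def)

lemma kern_prod_bound: "cmod (cnj (kern a t) * kern b t) \<le> (4 + a^2) + (4 + b^2)"
proof -
  have "cmod (cnj (kern a t) * kern b t) \<le> (cmod (kern a t))^2 + (cmod (kern b t))^2"
    using sum_squares_bound[of "cmod (kern a t)" "cmod (kern b t)"]
      mult_nonneg_nonneg[OF norm_ge_zero[of "kern a t"] norm_ge_zero[of "kern b t"]]
    unfolding norm_mult complex_mod_cnj by linarith
  then show ?thesis using kern_bound[of a t] kern_bound[of b t] by linarith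
qed

lemma kern_prod_integrable: "integrable \<mu> (\<lambda>t. cnj (kern a t) * kern b t)"
  by (rule integrable_mu_bounded[OF _ kern_prod_bound]) measurable

text \<open>The product \<open>cnj (iexp (t * a) - 1) * (iexp (t * b) - 1)\<close> is a combination
  of three values of \<open>levy_int\<close>, since the compensators are linear in \<open>y\<close>
  and cancel. The drift terms cancel likewise, and the quadratic Gaussian term leaves
  \<open>\<sigma>^2 * a * b\<close>, the contribution of the mass of \<mu> at
  \<open>0\<close>.\<close>

lemma log_phi_diff: "log_phi c \<sigma> \<Lambda> (b - a) = log_phi c \<sigma> \<Lambda> b + cnj (log_phi c \<sigma> \<Lambda> a) + \<kappa> a b"
proof -
  have "\<kappa> a b = (\<integral>t. (t^2 / (1 + t^2)) *\<^sub>R (cnj (kern a t) * kern b t) \<partial>\<Lambda>) + of_real (\<sigma>^2) * (cnj (kern a 0) * kern b 0)"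
    unfolding \<kappa>_def by (rule integral_mu[OF kern_prod_integrable])
  also have "(\<integral>t. (t^2 / (1 + t^2)) *\<^sub>R (cnj (kern a t) * kern b t) \<partial>\<Lambda>) =
      (\<integral>t. levy_int (b - a) t - levy_int b t - cnj (levy_int a t) \<partial>\<Lambda>)" unfolding kern_weight
    by (intro Bochner_Integration.integral_cong refl)
      (simp add: levy_int_def exp_cnj algebra_simps exp_diff exp_minus diff_divide_distrib divide_inverse)
  also have "\<dots> = (\<integral>t. levy_int (b - a) t \<partial>\<Lambda>) - (\<integral>t. levy_int b t \<partial>\<Lambda>) - cnj (\<integral>t. levy_int a t \<partial>\<Lambda>)"
    using levy_int_integrable by simp
  finally have k: "\<kappa> a b = (\<integral>t. levy_int (b - a) t \<partial>\<Lambda>) - (\<integral>t. levy_int b t \<partial>\<Lambda>) - cnj (\<integral>t. levy_int a t \<partial>\<Lambda>) + of_real (\<sigma>^2 * a * b)"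
    by (simp add: kern_def complex_eq_iff)
  show ?thesis unfolding k log_phi_eq by (simp add: power2_eq_square field_simps)
qed

lemma log_phi_bound: "cmod (log_phi c \<sigma> \<Lambda> y) \<le> \<bar>c\<bar> * \<bar>y\<bar> + \<sigma>^2 * y^2 + (y^2 + 4 + 2 * \<bar>y\<bar>) * (\<integral>t. t^2 / (1 + t^2) \<partial>\<Lambda>)"
proof -
  have "cmod (\<integral>t. levy_int y t \<partial>\<Lambda>) \<le> (\<integral>t. (y^2 + 4 + 2 * \<bar>y\<bar>) * (t^2 / (1 + t^2)) \<partial>\<Lambda>)"
    by (rule Bochner_Integration.integral_norm_bound_integral[OF levy_int_integrable integrable_mult_right[OF integrable_weight] levy_int_bound])
  also have "\<dots> = (y^2 + 4 + 2 * \<bar>y\<bar>) * (\<integral>t. t^2 / (1 + t^2) \<partial>\<Lambda>)" by (rule integral_mult_right_zero)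
  finally have 1: "cmod (\<integral>t. levy_int y t \<partial>\<Lambda>) \<le> (y^2 + 4 + 2 * \<bar>y\<bar>) * (\<integral>t. t^2 / (1 + t^2) \<partial>\<Lambda>)" .
  have 2: "cmod (\<i> * of_real (c * y) - of_real (\<sigma>^2 * y^2 / 2)) \<le> \<bar>c\<bar> * \<bar>y\<bar> + \<sigma>^2 * y^2"
  proof (rule order_trans[OF norm_triangle_ineq4 add_mono])
    show "cmod (\<i> * of_real (c * y)) \<le> \<bar>c\<bar> * \<bar>y\<bar>" by (simp add: norm_mult)
    show "cmod (of_real (\<sigma>^2 * y^2 / 2)) \<le> \<sigma>^2 * y^2" unfolding norm_of_real by simp
  qed
  show ?thesis unfolding log_phi_eq by (rule order_trans[OF norm_triangle_ineq add_mono[OF 2 1]])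
qed

lemma log_phi_measurable [measurable]: "log_phi c \<sigma> \<Lambda> \<in> borel_measurable borel"
proof -
  define h where "h y t = (if t = 0 then 0 else levy_int y t * of_real ((1 + t^2) / t^2))" for y t
  have hm: "(\<lambda>(y, t). h y t) \<in> borel_measurable (borel \<Otimes>\<^sub>M borel)" unfolding h_def levy_int_def by measurable
  have eq: "(\<integral>t. levy_int y t \<partial>\<Lambda>) = (\<integral>t. h y t \<partial>W)" for y
  proof -
    have "(\<integral>t. h y t \<partial>W) = (\<integral>t. (t^2 / (1 + t^2)) *\<^sub>R h y t \<partial>\<Lambda>)" unfolding wlevy_def
    proof (rule integral_density)
      show "h y \<in> borel_measurable \<Lambda>" unfolding h_def levy_int_def by measurable
    qed auto
    also have "\<dots> = (\<integral>t. levy_int y t \<partial>\<Lambda>)"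
    proof (intro Bochner_Integration.integral_cong refl)
      fix t :: real
      have "1 + t^2 > 0" by (simp add: add_pos_nonneg)
      then have "t \<noteq> 0 \<Longrightarrow> (t^2 / (1 + t^2)) * ((1 + t^2) / t^2) = 1" by simp
      then have "t \<noteq> 0 \<Longrightarrow> complex_of_real (t^2 / (1 + t^2)) * complex_of_real ((1 + t^2) / t^2) = 1"
        by (metis of_real_1 of_real_mult)
      then show "(t^2 / (1 + t^2)) *\<^sub>R h y t = levy_int y t"
        unfolding h_def scaleR_conv_of_real by (cases "t = 0") (simp_all add: levy_int_def mult.left_commute del: of_real_divide of_real_add)
    qed
    finally show ?thesis by simp
  qed
  interpret W: finite_measure W by (rule finite_W)
  have "(\<lambda>(y, t). h y t) \<in> borel_measurable (borel \<Otimes>\<^sub>M W)" using hm by (simp cong: measurable_cong_sets add: sets_W)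
  then have "(\<lambda>y. \<integral>t. h y t \<partial>W) \<in> borel_measurable borel" by (rule W.borel_measurable_lebesgue_integral)
  then show ?thesis unfolding log_phi_eq[abs_def] eq by measurable
qed

subsection \<open>Square integrable functions of the jump size\<close>

abbreviation "CH \<equiv> complex_as_hilbert"
abbreviation "G \<equiv> L2 \<mu> CH"
abbreviation "LG \<equiv> L2_functions \<mu> CH"
abbreviation "clG \<equiv> L2_class \<mu> CH"

lemma L2_space_mu: "L2_space CH \<mu>"
proof -
  interpret separable_hilbert CH by (rule separable_complex)
  interpret finite_measure \<mu> by (rule finite_mu)
  show ?thesis by unfold_locales
qed

lemma LG_iff: "f \<in> LG \<longleftrightarrow> f \<in> borel_measurable borel \<and> integrable \<mu> (\<lambda>t. (cmod (f t))^2)"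
  unfolding L2_functions_complex by (simp add: measurable_cong_sets[OF sets_mu refl])

lemma inner_G: "f \<in> LG \<Longrightarrow> g \<in> LG \<Longrightarrow> hinner G (clG f) (clG g) = (\<integral>t. cnj (f t) * g t \<partial>\<mu>)"
  using L2_space.L2_inner[OF L2_space_mu, of f g] by (simp add: complex_as_hilbert_def)

lemma hilbert_G: "complex_hilbert_space G" by (rule L2_space.hilbert_L2[OF L2_space_mu])

lemma clG_carrier: "f \<in> LG \<Longrightarrow> clG f \<in> hcarrier G" by (rule L2_space.cls_carrier[OF L2_space_mu])

lemma carrier_G: "hcarrier G = clG ` LG" by (rule L2_space.carrier_L2[OF L2_space_mu])

lemma clG_zero: "AE t in \<mu>. f t = 0 \<Longrightarrow> clG f = hzero G" unfolding L2_space.L2_zero[OF L2_space_mu]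
  by (intro L2_space.cls_eqI[OF L2_space_mu]) (simp add: complex_as_hilbert_def)

lemma LG_bounded:
  assumes [measurable]: "f \<in> borel_measurable borel" and "\<And>t. (cmod (f t))^2 \<le> C"
  shows "f \<in> LG"
proof -
  have "integrable \<mu> (\<lambda>t. (cmod (f t))^2)" by (rule finite_measure.integrable_const_bound[OF finite_mu, of _ C])
      (use assms in \<open>auto simp: measurable_cong_sets[OF sets_mu refl]\<close>)
  then show ?thesis by (simp add: LG_iff)
qed

lemma LG_integrable: assumes f: "f \<in> LG" shows "integrable \<mu> f"
proof -
  have "(\<lambda>t. 1) \<in> LG" by (rule LG_bounded[of _ 1]) auto
  from L2_space.LF_integrable_inner[OF L2_space_mu this f] show ?thesis by (simp add: complex_as_hilbert_def)
qed

lemma kern_LG: "kern y \<in> LG" by (rule LG_bounded[OF _ kern_bound]) measurable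

definition kG :: "real \<Rightarrow> (real \<Rightarrow> complex) set" where
  "kG y = clG (kern y)"

lemma kG_inner: "hinner G (kG a) (kG b) = \<kappa> a b" by (simp add: kG_def inner_G kern_LG \<kappa>_def)

lemma kG_carrier: "kG y \<in> hcarrier G" by (simp add: kG_def clG_carrier kern_LG)

lemma kern_LG_integrable:
  assumes "f \<in> LG"
  shows "integrable \<mu> (\<lambda>t. cnj (kern y t) * f t)"
  using L2_space.LF_integrable_inner[OF L2_space_mu kern_LG[of y] assms] by (simp add: complex_as_hilbert_def)

text \<open>Dominated convergence: by \<open>kern_bound\<close> a bounded sequence of parameters
  gives uniformly bounded kernels. It carries the orthogonality in \<open>kG_total\<close> from
  rational to real parameters.\<close>

lemma kern_inner_continuous:
  assumes f: "f \<in> LG" and y: "y \<longlonglongrightarrow> y0"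
  shows "(\<lambda>n. \<integral>t. cnj (kern (y n) t) * f t \<partial>\<mu>) \<longlonglongrightarrow> (\<integral>t. cnj (kern y0 t) * f t \<partial>\<mu>)"
proof -
  obtain B where B: "\<And>n. \<bar>y n\<bar> \<le> B" using convergent_imp_Bseq[of y] y by (auto simp: convergent_def Bseq_def)
  have fm: "f \<in> borel_measurable borel" using f by (simp add: LG_iff)
  show ?thesis
  proof (rule integral_dominated_convergence[where w="\<lambda>t. sqrt (4 + B^2) * cmod (f t)"])
    show "(\<lambda>t. cnj (kern y0 t) * f t) \<in> borel_measurable \<mu>" "(\<lambda>t. cnj (kern (y n) t) * f t) \<in> borel_measurable \<mu>" for n
      using fm by (simp_all add: measurable_cong_sets[OF sets_mu refl])
    show "integrable \<mu> (\<lambda>t. sqrt (4 + B^2) * cmod (f t))" using LG_integrable[OF f] by simp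
    show "AE t in \<mu>. (\<lambda>n. cnj (kern (y n) t) * f t) \<longlonglongrightarrow> cnj (kern y0 t) * f t"
    proof (rule AE_I2)
      fix t
      have "(\<lambda>n. kern (y n) t) \<longlonglongrightarrow> kern y0 t" unfolding kern_def by (cases "t = 0") (auto intro!: tendsto_intros y)
      then show "(\<lambda>n. cnj (kern (y n) t) * f t) \<longlonglongrightarrow> cnj (kern y0 t) * f t" by (intro tendsto_intros)
    qed
    show "AE t in \<mu>. norm (cnj (kern (y n) t) * f t) \<le> sqrt (4 + B^2) * cmod (f t)" for n
    proof (rule AE_I2)
      fix t
      have "(y n)^2 \<le> B^2" using B[of n] by (metis abs_ge_zero power2_abs power_mono)
      then have "(cmod (kern (y n) t))^2 \<le> 4 + B^2" using kern_bound[of "y n" t] by linarith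
      then have "cmod (kern (y n) t) \<le> sqrt (4 + B^2)" by (rule real_le_rsqrt)
      then show "norm (cnj (kern (y n) t) * f t) \<le> sqrt (4 + B^2) * cmod (f t)" by (simp add: norm_mult mult_right_mono)
    qed
  qed
qed

text \<open>Differences of the kernel in \<open>y\<close> produce Fourier transforms, so that orthogonality to all
  \<open>kern y\<close> forces \<open>kern s t * f t = 0\<close> for every \<open>s\<close>; small \<open>s\<close> have no zero at a given \<open>t\<close>.\<close>

lemma kG_total: "total_in G (kG ` \<rat>)" unfolding total_in_def
proof (intro conjI ballI impI)
  show "kG ` \<rat> \<subseteq> hcarrier G" using kG_carrier by blast
  fix u assume "u \<in> hcarrier G" and orth: "\<forall>w\<in>kG ` \<rat>. hinner G w u = 0"
  then obtain f where f: "f \<in> LG" "u = clG f" by (auto simp: carrier_G)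
  have fm[measurable]: "f \<in> borel_measurable borel" using f by (simp add: LG_iff)
  have rat: "(\<integral>t. cnj (kern y t) * f t \<partial>\<mu>) = 0" if "y \<in> \<rat>" for y using orth that f by (simp add: kG_def inner_G kern_LG)
  have all: "(\<integral>t. cnj (kern y t) * f t \<partial>\<mu>) = 0" for y
  proof -
    have "\<exists>q\<in>\<rat>. y < q \<and> q < y + 1 / real (Suc n)" for n by (rule Rats_dense_in_real) simp
    then obtain r where r: "\<And>n::nat. r n \<in> \<rat>" "\<And>n. y < r n" "\<And>n. r n < y + 1 / real (Suc n)" by metis
    have "(\<lambda>n. y + 1 / real (Suc n)) \<longlonglongrightarrow> y"
      using tendsto_add[OF tendsto_const LIMSEQ_inverse_real_of_nat, of y] by (simp add: inverse_eq_divide)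
    then have "r \<longlonglongrightarrow> y"
      by (rule tendsto_sandwich[OF _ _ tendsto_const, rotated -1]) (use r in \<open>auto intro!: always_eventually less_imp_le\<close>)
    note r = r(1) this
    show ?thesis using kern_inner_continuous[OF f(1) r(2)] rat[OF r(1)] by (simp add: LIMSEQ_const_iff)
  qed
  have sz: "AE t in \<mu>. cnj (kern s t) * f t = 0" for s
  proof (rule AE_zero_if_set_integrals_zero[OF kern_LG_integrable[OF f(1)]])
    fix F assume "F \<in> sets \<mu>"
    then have F: "F \<in> sets borel" by (simp add: sets_mu)
    have "(\<integral>t. indicator F t *\<^sub>R (cnj (kern s t) * f t) \<partial>\<mu>) = 0"
    proof (rule fourier_zero[OF kern_LG_integrable[OF f(1)] _ _ F])
      show "(\<lambda>t. t) \<in> borel_measurable \<mu>" by (simp add: measurable_cong_sets[OF sets_mu refl])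
      fix y
      have "(\<integral>t. cnj (kern s t) * f t * iexp (y * t) \<partial>\<mu>) =
          (\<integral>t. cnj (kern (- y + s) t) * f t - cnj (kern (- y) t) * f t \<partial>\<mu>)"
      proof (intro Bochner_Integration.integral_cong refl)
        fix t
        have "cnj (kern (- y + s) t) - cnj (kern (- y) t) = cnj (iexp (t * (- y)) * kern s t)"
          unfolding kern_diff[symmetric] by simp
        also have "\<dots> = iexp (y * t) * cnj (kern s t)" by (simp add: exp_cnj mult.commute)
        finally have e: "cnj (kern (- y + s) t) - cnj (kern (- y) t) = iexp (y * t) * cnj (kern s t)" .
        show "cnj (kern s t) * f t * iexp (y * t) = cnj (kern (- y + s) t) * f t - cnj (kern (- y) t) * f t"
          unfolding left_diff_distrib[symmetric] e by (simp add: ac_simps)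
      qed
      also have "\<dots> = 0" using kern_LG_integrable[OF f(1)] all by simp
      finally show "(\<integral>t. cnj (kern s t) * f t * iexp (y * t) \<partial>\<mu>) = 0" .
    qed
    then show "(\<integral>t. indicator F t *\<^sub>R (cnj (kern s t) * f t) \<partial>\<mu>) = 0" .
  qed
  have "AE t in \<mu>. \<forall>n::nat. cnj (kern (1 / Suc n) t) * f t = 0" unfolding AE_all_countable using sz by blast
  then have "AE t in \<mu>. f t = 0"
  proof eventually_elim
    fix t assume *: "\<forall>n::nat. cnj (kern (1 / Suc n) t) * f t = 0"
    \<comment> \<open>Then \<open>t / Suc n\<close> has absolute value below \<open>1\<close>, hence
      below \<open>pi\<close>, and is no nonzero period of the exponential.\<close>
    obtain n :: nat where n: "\<bar>t\<bar> < real n" using reals_Archimedean2 by blast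
    have "kern (1 / Suc n) t \<noteq> 0"
    proof (cases "t = 0")
      case True
      then show ?thesis by (simp add: kern_def del: of_nat_Suc)
    next
      case False
      define x where "x = t * (1 / Suc n)"
      have x: "x \<noteq> 0" "\<bar>x\<bar> < 1" using False n by (auto simp: x_def abs_mult field_simps)
      have "iexp x \<noteq> 1"
      proof
        assume "iexp x = 1"
        then have "sin x = 0" by (metis Im_exp one_complex.sel(2) mult_eq_0_iff exp_not_eq_zero Im_complex_of_real Im_i_times Re_complex_of_real)
        moreover have "- pi < x" "x < pi" using x pi_gt3 by linarith+
        ultimately show False using sin_eq_0_pi x by blast
      qed
      then show ?thesis using False by (simp add: kern_def x_def add_nonneg_eq_0_iff)
    qed
    then show "f t = 0" using * by (metis complex_cnj_zero_iff mult_eq_0_iff)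
  qed
  then show "u = hzero G" unfolding f(2) by (rule clG_zero)
qed

subsection \<open>The dimension\<close>

text \<open>Open sets of positive measure are the same for \<mu> and \<Lambda>, except that a
  Gaussian part makes every neighbourhood of \<open>0\<close> positive. To test another point
  against \<Lambda>, the point \<open>0\<close> is removed from its neighbourhoods.\<close>

lemma support_mu: "measure_support \<mu> = levy_support \<sigma> \<Lambda>"
proof (intro set_eqI iffI)
  fix t
  have pos: "emeasure \<mu> U > 0 \<longleftrightarrow> emeasure \<Lambda> U > 0 \<or> (0 \<in> U \<and> \<sigma> \<noteq> 0)" if "open U" for U
  proof -
    have U: "U \<in> sets borel" using that by simp
    have "emeasure \<mu> U = 0 \<longleftrightarrow> emeasure \<Lambda> U = 0 \<and> ennreal (\<sigma>^2) * indicator U 0 = 0"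
      using null_W_iff[OF U] by (simp add: emeasure_mu[OF U] add_eq_0_iff_both_eq_0)
    moreover have "ennreal (\<sigma>^2) * indicator U 0 = 0 \<longleftrightarrow> \<not> (0 \<in> U \<and> \<sigma> \<noteq> 0)"
      by (auto split: split_indicator simp: ennreal_eq_0_iff)
    ultimately show ?thesis by (auto simp: zero_less_iff_neq_zero)
  qed
  {
    assume t: "t \<in> measure_support \<mu>"
    show "t \<in> levy_support \<sigma> \<Lambda>"
    proof (cases "t = 0 \<and> \<sigma> \<noteq> 0")
      case False
      have "emeasure \<Lambda> U > 0" if U: "open U" "t \<in> U" for U
      proof (cases "\<sigma> = 0")
        case True
        then show ?thesis using t U pos by (auto simp: measure_support_def)
      next
        case s: False
        then have "open (U - {0})" "t \<in> U - {0}" using False U by auto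
        then have "emeasure \<Lambda> (U - {0}) > 0" using t pos[of "U - {0}"] by (auto simp: measure_support_def)
        also have "emeasure \<Lambda> (U - {0}) \<le> emeasure \<Lambda> U" using U by (intro emeasure_mono) (auto simp: sets_L)
        finally show ?thesis .
      qed
      then show ?thesis by (auto simp: levy_support_def measure_support_def)
    qed (simp add: levy_support_def)
  }
  {
    assume "t \<in> levy_support \<sigma> \<Lambda>"
    then show "t \<in> measure_support \<mu>" using pos by (auto simp: levy_support_def measure_support_def split: if_splits)
  }
qed

text \<open>The complement is a union of open null sets, and by the Lindelof property countably many
  of them have the same union.\<close>

lemma null_compl_support: "- measure_support \<mu> \<in> null_sets \<mu>"
proof -
  define \<F> where "\<F> = {U. open U \<and> emeasure \<mu> U = 0}"
  have "\<Union>\<F> = - measure_support \<mu>" by (auto simp: \<F>_def measure_support_def zero_less_iff_neq_zero)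
  moreover obtain \<F>' where F': "\<F>' \<subseteq> \<F>" "countable \<F>'" "\<Union>\<F>' = \<Union>\<F>" using Lindelof[of \<F>] by (auto simp: \<F>_def)
  moreover have "(\<Union>U\<in>\<F>'. U) \<in> null_sets \<mu>"
    by (rule null_sets_UN'[OF F'(2)]) (use F'(1) in \<open>auto simp: \<F>_def null_sets_def sets_mu\<close>)
  ultimately show ?thesis using F'(3) by simp
qed

definition nvec :: "real set \<Rightarrow> (real \<Rightarrow> complex) set" where
  "nvec A = clG (\<lambda>t. of_real (indicator A t / sqrt (measure \<mu> A)))"

lemma nvec_LG: "A \<in> sets borel \<Longrightarrow> (\<lambda>t. complex_of_real (indicator A t / sqrt (measure \<mu> A))) \<in> LG"
  by (rule LG_bounded[of _ "1 / measure \<mu> A"]) (auto split: split_indicator simp: norm_divide power_divide)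

lemma nvec_inner:
  assumes A: "A \<in> sets borel" and B: "B \<in> sets borel"
  shows "hinner G (nvec A) (nvec B) = of_real (measure \<mu> (A \<inter> B) / (sqrt (measure \<mu> A) * sqrt (measure \<mu> B)))"
proof -
  have "hinner G (nvec A) (nvec B) = (\<integral>t. of_real (indicator (A \<inter> B) t / (sqrt (measure \<mu> A) * sqrt (measure \<mu> B))) \<partial>\<mu>)"
    unfolding nvec_def inner_G[OF nvec_LG[OF A] nvec_LG[OF B]]
    by (intro Bochner_Integration.integral_cong refl) (auto split: split_indicator)
  also have "\<dots> = of_real (\<integral>t. indicator (A \<inter> B) t / (sqrt (measure \<mu> A) * sqrt (measure \<mu> B)) \<partial>\<mu>)"
    by (rule integral_complex_of_real)
  finally show ?thesis using A B by (simp add: space_mu)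
qed

lemma nvec_carrier: "A \<in> sets borel \<Longrightarrow> nvec A \<in> hcarrier G" unfolding nvec_def by (rule clG_carrier[OF nvec_LG])

lemma nvec_unit: "A \<in> sets borel \<Longrightarrow> 0 < measure \<mu> A \<Longrightarrow> hinner G (nvec A) (nvec A) = 1"
  by (simp add: nvec_inner flip: of_real_mult)

lemma nvec_disjoint: "A \<in> sets borel \<Longrightarrow> B \<in> sets borel \<Longrightarrow> A \<inter> B = {} \<Longrightarrow> hinner G (nvec A) (nvec B) = 0"
  by (simp add: nvec_inner)

lemma onb_dimension:
  "\<exists>B. orthonormal_basis G B \<and> countable B \<and> num_points B = num_points (levy_support \<sigma> \<Lambda>)"
proof -
  interpret G: complex_hilbert_space G by (rule hilbert_G)
  define S where "S = measure_support \<mu>"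
  have Spos: "measure \<mu> U > 0" if "open U" "U \<inter> S \<noteq> {}" for U
    using that finite_measure.emeasure_eq_measure[OF finite_mu] by (auto simp: S_def measure_support_def)
  show ?thesis
  proof (cases "finite S")
    case True
    have atom: "measure \<mu> {s} > 0" if s: "s \<in> S" for s
    proof -
      \<comment> \<open>An open neighbourhood of \<open>s\<close> that meets the support only in
        \<open>s\<close>. Its measure is positive and, the complement of the support being null,
        equal to that of \<open>{s}\<close>.\<close>
      have o: "open (- (S - {s}))" using True by (intro open_Compl finite_imp_closed) auto
      have "0 < measure \<mu> (- (S - {s}))" by (rule Spos[OF o]) (use s in auto)
      also have "- (S - {s}) = {s} \<union> - S" using s by auto
      also have "measure \<mu> ({s} \<union> - S) = measure \<mu> {s}"
        using null_compl_support by (intro measure_Un_null_set) (auto simp: sets_mu S_def)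
      finally show ?thesis .
    qed
    define B where "B = (\<lambda>s. nvec {s}) ` S"
    have inn: "hinner G (nvec {s}) (nvec {s'}) = (if s = s' then 1 else 0)" if "s \<in> S" "s' \<in> S" for s s'
      using atom[OF that(1)] by (cases "s = s'") (auto simp: nvec_unit nvec_disjoint)
    have inj: "inj_on (\<lambda>s. nvec {s}) S"
    proof (rule inj_onI)
      fix s s' assume "s \<in> S" "s' \<in> S" "nvec {s} = nvec {s'}"
      then show "s = s'" using inn[of s s] inn[of s s'] by (auto split: if_splits)
    qed
    have "orthonormal_basis G B" unfolding orthonormal_basis_def
    proof (intro conjI ballI impI)
      show "B \<subseteq> hcarrier G" by (auto simp: B_def intro!: nvec_carrier)
      show "hinner G b b' = (if b = b' then 1 else 0)" if bb: "b \<in> B" "b' \<in> B" for b b'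
      proof -
        obtain s s' where "s \<in> S" "s' \<in> S" "b = nvec {s}" "b' = nvec {s'}" using bb by (auto simp: B_def)
        then show ?thesis using inn[of s s'] inj_on_eq_iff[OF inj, of s s'] by simp
      qed
      fix u assume "u \<in> hcarrier G" and orth: "\<forall>b\<in>B. hinner G b u = 0"
      then obtain f where f: "f \<in> LG" "u = clG f" by (auto simp: carrier_G)
      have fz: "f s = 0" if s: "s \<in> S" for s
      proof -
        have "0 = hinner G (nvec {s}) u" using orth s by (simp add: B_def)
        also have "\<dots> = (\<integral>t. indicator {s} t *\<^sub>R (f s / of_real (sqrt (measure \<mu> {s}))) \<partial>\<mu>)"
        proof -
          have b: "{s} \<in> sets borel" by simp
          show ?thesis unfolding nvec_def f(2) inner_G[OF nvec_LG[OF b] f(1)]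
            by (intro Bochner_Integration.integral_cong refl) (auto split: split_indicator)
        qed
        also have "\<dots> = measure \<mu> {s} *\<^sub>R (f s / of_real (sqrt (measure \<mu> {s})))"
        proof -
          have "integrable \<mu> (indicat_real {s})" by (rule finite_measure.integrable_const_bound[OF finite_mu, of _ 1])
              (auto simp: measurable_cong_sets[OF sets_mu refl] split: split_indicator)
          then show ?thesis by (subst integral_scaleR_left) (auto simp: space_mu)
        qed
        finally show ?thesis using atom[OF s] by simp
      qed
      have "AE t in \<mu>. f t = 0" using AE_not_in[OF null_compl_support] by eventually_elim (simp add: fz S_def)
      then show "u = hzero G" unfolding f(2) by (rule clG_zero)
    qed
    moreover have "num_points B = num_points S" using True card_image[OF inj] by (simp add: num_points_def B_def)
    ultimately show ?thesis using True countable_finite[of B] by (intro exI[of _ B]) (auto simp: B_def S_def support_mu)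
  next
    case False
    obtain B where B: "orthonormal_basis G B" using G.orthonormal_basis_exists by blast
    then have on: "G.orthonormal B" by (auto simp: G.orthonormal_def orthonormal_basis_def)
    have "countable (kG ` \<rat>)" by (simp add: countable_rat)
    then have "countable B" by (rule G.orthonormal_countable[OF on _ kG_total])
    moreover have "infinite B"
    proof
      assume fin: "finite B"
      obtain F where F: "F \<subseteq> S" "finite F" "card F = Suc (card B)" using infinite_arbitrarily_large[OF False] by metis
      \<comment> \<open>The Voronoi cells of the chosen points: open, disjoint, each around its own
        point.\<close>
      define U where "U s = (\<Inter>s'\<in>F - {s}. {t. \<bar>t - s\<bar> < \<bar>t - s'\<bar>})" for s
      have Uo: "open (U s)" for s
        unfolding U_def using F(2) by (intro open_INT) (auto intro!: open_Collect_less continuous_intros)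
      have Us: "s \<in> U s" if "s \<in> F" for s using that by (auto simp: U_def)
      have Ud: "U s \<inter> U s' = {}" if "s \<in> F" "s' \<in> F" "s \<noteq> s'" for s s'
      proof -
        have "\<bar>t - s\<bar> < \<bar>t - s'\<bar> \<and> \<bar>t - s'\<bar> < \<bar>t - s\<bar>" if "t \<in> U s" "t \<in> U s'" for t
          using that \<open>s \<in> F\<close> \<open>s' \<in> F\<close> \<open>s \<noteq> s'\<close> unfolding U_def by blast
        then show ?thesis by fastforce
      qed
      have Up: "measure \<mu> (U s) > 0" if "s \<in> F" for s using Spos[OF Uo] Us[OF that] F(1) that by blast
      have Ub: "U s \<in> sets borel" for s using Uo by simp
      have inn: "hinner G (nvec (U s)) (nvec (U s')) = (if s = s' then 1 else 0)" if "s \<in> F" "s' \<in> F" for s s'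
        using Up[OF that(1)] Ud[OF that] by (cases "s = s'") (auto simp: nvec_unit nvec_disjoint Ub)
      have vc: "nvec (U s) \<in> hcarrier G" for s by (rule nvec_carrier[OF Ub])
      have inj: "inj_on (\<lambda>s. nvec (U s)) F"
      proof (rule inj_onI)
        fix s s' assume "s \<in> F" "s' \<in> F" "nvec (U s) = nvec (U s')"
        then show "s = s'" using inn[of s s] inn[of s s'] by (auto split: if_splits)
      qed
      define V where "V = (\<lambda>s. nvec (U s)) ` F"
      have onV: "G.orthonormal V" unfolding G.orthonormal_def
      proof (intro conjI ballI)
        show "V \<subseteq> hcarrier G" using vc by (auto simp: V_def)
        fix b b' assume "b \<in> V" "b' \<in> V"
        then obtain s s' where "s \<in> F" "s' \<in> F" "b = nvec (U s)" "b' = nvec (U s')" by (auto simp: V_def)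
        then show "hinner G b b' = (if b = b' then 1 else 0)" using inn[of s s'] inj_on_eq_iff[OF inj, of s s'] by simp
      qed
      have BH: "b \<in> hcarrier G" if "b \<in> B" for b using B that by (auto simp: orthonormal_basis_def)
      have one: "(\<Sum>b\<in>B. (cmod (hinner G b v))^2) = 1" if "v \<in> V" for v
      proof -
        have v: "v \<in> hcarrier G" "hinner G v v = 1" using onV that by (auto simp: G.orthonormal_def)
        have "(hnorm G v)^2 = 1" using G.hnorm_sq[OF v(1)] v(2) by simp
        then show ?thesis using G.parseval_norm[OF B v(1)] fin by (simp add: has_sum_finite_iff)
      qed
      \<comment> \<open>Double counting of the square coefficients: summed over the basis they give
        \<open>1\<close> for each member of \<open>V\<close> by Parseval, and summed over
        \<open>V\<close> at most \<open>1\<close> for each basis vector by Bessel.\<close>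
      have "real (card V) = (\<Sum>v\<in>V. \<Sum>b\<in>B. (cmod (hinner G b v))^2)" by (simp add: one)
      also have "\<dots> = (\<Sum>b\<in>B. \<Sum>v\<in>V. (cmod (hinner G v b))^2)"
      proof (subst sum.swap, intro sum.cong refl)
        fix b v assume "b \<in> B" "v \<in> V"
        then show "(cmod (hinner G b v))^2 = (cmod (hinner G v b))^2"
          using G.inner_commute[of b v] BH vc by (auto simp: V_def)
      qed
      also have "\<dots> \<le> (\<Sum>b\<in>B. 1)"
      proof (rule sum_mono)
        fix b assume b: "b \<in> B"
        have "(\<Sum>v\<in>V. (cmod (hinner G v b))^2) \<le> (hnorm G b)^2"
          by (rule G.bessel[OF onV _ order_refl BH[OF b]]) (use F(2) in \<open>simp add: V_def\<close>)
        also have "(hnorm G b)^2 = 1" using B b G.hnorm_sq[OF BH[OF b]] by (simp add: orthonormal_basis_def)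
        finally show "(\<Sum>v\<in>V. (cmod (hinner G v b))^2) \<le> 1" .
      qed
      finally have "card V \<le> card B" by simp
      moreover have "card V = Suc (card B)" using card_image[OF inj] F(3) by (simp add: V_def)
      ultimately show False by simp
    qed
    ultimately show ?thesis using B False by (intro exI[of _ B]) (simp add: num_points_def S_def flip: support_mu)
  qed
qed

end

text \<open>What the Fock side needs to know of the one-particle space. Totality is asked of the
  rational parameters so that exceptional null sets can be united, and \<open>k_zero\<close> makes a
  function vanish wherever its exponent does.\<close>

locale levy_kernel = separable_hilbert H for H :: "'h hilbert" +
  fixes k :: "real \<Rightarrow> 'h" and \<kappa> :: "real \<Rightarrow> real \<Rightarrow> complex" and C :: real
  assumes k_carrier: "k y \<in> hcarrier H"
    and k_inner: "hinner H (k a) (k b) = \<kappa> a b"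
    and k_measurable: "h \<in> hcarrier H \<Longrightarrow> (\<lambda>y. hinner H h (k y)) \<in> borel_measurable borel"
    and k_total: "total_in H (k ` \<rat>)"
    and k_zero: "k 0 = hzero H"
    and k_bound: "(hnorm H (k y))^2 \<le> C * (4 + y^2)"

context levy_data
begin

theorem levy_kernel_exists:
  "\<exists>(H :: (nat \<Rightarrow> complex) hilbert) k C. levy_kernel H k \<kappa> C \<and>
     hilbert_dim H (num_points (levy_support \<sigma> \<Lambda>))"
proof -
  interpret G: complex_hilbert_space G by (rule hilbert_G)
  obtain B where B: "orthonormal_basis G B" "countable B" "num_points B = num_points (levy_support \<sigma> \<Lambda>)"
    using onb_dimension by blast
  have BH: "b \<in> hcarrier G" if "b \<in> B" for b using B that by (auto simp: orthonormal_basis_def)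
  define \<phi> where "\<phi> u = (\<lambda>j. if j \<in> to_nat_on B ` B then hinner G (from_nat_into B j) u else 0)" for u
  have \<phi>b: "\<phi> u (to_nat_on B b) = hinner G b u" if "b \<in> B" for u b using that B(2) by (simp add: \<phi>_def)
  have inj: "inj_on \<phi> (hcarrier G)"
  proof (rule inj_onI)
    fix u v assume uv: "u \<in> hcarrier G" "v \<in> hcarrier G" "\<phi> u = \<phi> v"
    show "u = v" by (rule G.total_eqI[OF G.onb_total[OF B(1)] uv(1,2)]) (use uv(3) \<phi>b in metis)
  qed
  define H where "H = transport_hilbert G \<phi>"
  define k where "k y = \<phi> (kG y)" for y
  note tr = transport_hilbert[OF hilbert_G inj, folded H_def]
  have Hc: "hcarrier H = \<phi> ` hcarrier G" "hzero H = \<phi> (hzero G)" by (simp_all add: H_def transport_hilbert_def Let_def)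
  have onb: "orthonormal_basis H (\<phi> ` B)" by (rule tr(3)[OF B(1)])
  interpret H: complex_hilbert_space H by (rule tr(1))
  have kin: "hinner H (k a) (k b) = \<kappa> a b" for a b unfolding k_def by (simp add: tr(2) kG_carrier kG_inner)
  have kc: "k y \<in> hcarrier H" for y by (simp add: k_def Hc kG_carrier)
  have "levy_kernel H k \<kappa> (measure \<mu> UNIV)"
  proof
    show "\<exists>B. orthonormal_basis H B \<and> countable B" using onb B(2) by blast
    show "k y \<in> hcarrier H" for y by (rule kc)
    show "hinner H (k a) (k b) = \<kappa> a b" for a b by (rule kin)
    show "(\<lambda>y. hinner H h (k y)) \<in> borel_measurable borel" if "h \<in> hcarrier H" for h
    proof -
      obtain f where f: "f \<in> LG" "h = \<phi> (clG f)" using \<open>h \<in> _\<close> by (auto simp: Hc carrier_G)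
      have eq: "hinner H h (k y) = (\<integral>t. cnj (f t) * kern y t \<partial>\<mu>)" for y
        unfolding f(2) k_def tr(2)[OF clG_carrier[OF f(1)] kG_carrier] by (simp add: kG_def inner_G f(1) kern_LG)
      interpret mu: finite_measure \<mu> by (rule finite_mu)
      have fm[measurable]: "f \<in> borel_measurable borel" using f by (simp add: LG_iff)
      note kern_measurable2[measurable]
      have "(\<lambda>(y, t). cnj (f t) * kern y t) \<in> borel_measurable (borel \<Otimes>\<^sub>M borel)"
        using kern_measurable2 by (auto simp: case_prod_unfold intro!: borel_measurable_times)
      then have "(\<lambda>(y, t). cnj (f t) * kern y t) \<in> borel_measurable (borel \<Otimes>\<^sub>M \<mu>)"
        by (simp cong: measurable_cong_sets add: sets_mu)
      then show ?thesis unfolding eq by (rule mu.borel_measurable_lebesgue_integral)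
    qed
    show "total_in H (k ` \<rat>)" unfolding total_in_def
    proof (intro conjI ballI impI)
      show "k ` \<rat> \<subseteq> hcarrier H" using kc by blast
      fix x assume "x \<in> hcarrier H" "\<forall>w\<in>k ` \<rat>. hinner H w x = 0"
      then show "x = hzero H" using kG_total by (auto simp: Hc total_in_def k_def tr(2) kG_carrier)
    qed
    show "k 0 = hzero H"
    proof (rule H.inner_definite[OF kc])
      have "kern 0 = (\<lambda>t. 0)" by (auto simp: kern_def)
      then show "hinner H (k 0) (k 0) = 0" by (simp add: kin \<kappa>_def)
    qed
    show "(hnorm H (k y))^2 \<le> measure \<mu> UNIV * (4 + y^2)" for y
    proof -
      have "(hnorm H (k y))^2 = (hnorm G (kG y))^2" using kc by (simp add: H.hnorm_sq G.hnorm_sq kG_carrier kin kG_inner)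
      also have "\<dots> = (\<integral>t. (hnorm CH (kern y t))^2 \<partial>\<mu>)"
        unfolding kG_def by (rule L2_space.L2_norm_sq(1)[OF L2_space_mu kern_LG])
      also have "\<dots> \<le> (\<integral>t. 4 + y^2 \<partial>\<mu>)"
      proof (rule integral_mono)
        show "integrable \<mu> (\<lambda>t. (hnorm CH (kern y t))^2)" by (rule L2_space.LF_integrable_norm[OF L2_space_mu kern_LG])
        show "integrable \<mu> (\<lambda>t. 4 + y^2)" using finite_mu by (simp add: finite_measure.integrable_const)
        show "(hnorm CH (kern y t))^2 \<le> 4 + y^2" for t
        proof -
          have "hnorm CH z = cmod z" for z by (simp add: hnorm_def complex_as_hilbert_def cmod_def power2_eq_square)
          then show ?thesis by (simp add: kern_bound)
        qed
      qed
      also have "\<dots> = measure \<mu> UNIV * (4 + y^2)" by (simp add: space_mu)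
      finally show ?thesis .
    qed
  qed
  moreover have "hilbert_dim H (num_points (levy_support \<sigma> \<Lambda>))"
  proof -
    have "inj_on \<phi> B" using inj BH by (auto intro: inj_on_subset)
    then have "num_points (\<phi> ` B) = num_points B" by (auto simp: num_points_def card_image finite_image_iff)
    then show ?thesis using onb B by (auto simp: hilbert_dim_def intro!: exI[of _ "\<phi> ` B"])
  qed
  ultimately show ?thesis by blast
qed

end

section \<open>Totality of the exponential vectors of a process\<close>

lemma exp_taylor_1:
  fixes z :: complex
  shows "cmod (exp z - 1 - z) \<le> exp (cmod z) * (cmod z)^2"
proof -
  have "cmod (exp z - (\<Sum>i\<le>1. z ^ i / fact i)) \<le> exp \<bar>Re z\<bar> * (cmod z) ^ Suc 1 / fact 1" by (rule Taylor_exp)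
  also have "\<dots> \<le> exp (cmod z) * (cmod z)^2" by (auto intro!: mult_right_mono abs_Re_le_cmod simp: power2_eq_square)
  finally show ?thesis by (simp add: diff_diff_eq)
qed

text \<open>Weights with sum \<open>1\<close> reproduce the constant term \<open>1\<close> exactly
  and the linear term by definition, so the error consists of the second order remainders
  alone.\<close>

lemma affine_exp_sum:
  fixes \<alpha> v :: "'i \<Rightarrow> complex"
  assumes I: "finite I" and one: "(\<Sum>i\<in>I. \<alpha> i) = 1" and \<alpha>: "(\<Sum>i\<in>I. cmod (\<alpha> i)) \<le> A"
    and v: "\<And>i. i \<in> I \<Longrightarrow> cmod (v i) \<le> L" and s: "0 \<le> s" "s \<le> 1" and L: "0 \<le> L"
  shows "cmod ((\<Sum>i\<in>I. \<alpha> i * exp (of_real s * v i)) - 1 - of_real s * (\<Sum>i\<in>I. \<alpha> i * v i)) \<le> A * (exp L * L^2) * s^2"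
proof -
  have "(\<Sum>i\<in>I. \<alpha> i * exp (of_real s * v i)) - 1 - of_real s * (\<Sum>i\<in>I. \<alpha> i * v i) =
      (\<Sum>i\<in>I. \<alpha> i * (exp (of_real s * v i) - 1 - of_real s * v i))"
    using one by (simp add: sum_distrib_left sum_subtractf right_diff_distrib ac_simps)
  also have "cmod \<dots> \<le> (\<Sum>i\<in>I. cmod (\<alpha> i) * ((exp L * L^2) * s^2))"
  proof (rule sum_norm_le)
    fix i assume i: "i \<in> I"
    have n: "cmod (of_real s * v i) \<le> s * L" using v[OF i] s by (simp add: norm_mult mult_left_mono)
    also have "\<dots> \<le> L" using s L by (simp add: mult_left_le_one_le)
    finally have n': "cmod (of_real s * v i) \<le> L" .
    have "cmod (exp (of_real s * v i) - 1 - of_real s * v i) \<le> exp (cmod (of_real s * v i)) * (cmod (of_real s * v i))^2"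
      by (rule exp_taylor_1)
    also have "\<dots> \<le> exp L * (s * L)^2" using n n' by (intro mult_mono power_mono) auto
    also have "\<dots> = (exp L * L^2) * s^2" by (simp add: power_mult_distrib)
    finally show "cmod (\<alpha> i * (exp (of_real s * v i) - 1 - of_real s * v i)) \<le> cmod (\<alpha> i) * ((exp L * L^2) * s^2)"
      unfolding norm_mult by (rule mult_left_mono) simp
  qed
  also have "\<dots> = (\<Sum>i\<in>I. cmod (\<alpha> i)) * ((exp L * L^2) * s^2)" by (rule sum_distrib_right[symmetric])
  also have "\<dots> \<le> A * ((exp L * L^2) * s^2)" by (rule mult_right_mono[OF \<alpha>]) simp
  finally show ?thesis by (simp add: mult.assoc)
qed

text \<open>Errors of order \<open>s^2\<close> in the single factors add up in the product, provided
  that the partial products stay bounded. The prefactor is the price of this boundedness and depends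
  only on the sum of the \<open>s r\<close>.\<close>

lemma prod_exp_approx:
  fixes g w :: "'r \<Rightarrow> complex" and s :: "'r \<Rightarrow> real"
  assumes R: "finite R" and s: "\<And>r. r \<in> R \<Longrightarrow> 0 \<le> s r \<and> s r \<le> 1"
    and g: "\<And>r. r \<in> R \<Longrightarrow> cmod (g r - 1 - of_real (s r) * w r) \<le> B * (s r)^2"
    and e: "\<And>r. r \<in> R \<Longrightarrow> cmod (exp (of_real (s r) * w r) - 1 - of_real (s r) * w r) \<le> B * (s r)^2"
    and w: "\<And>r. r \<in> R \<Longrightarrow> cmod (w r) \<le> D" and B: "0 \<le> B"
  shows "cmod ((\<Prod>r\<in>R. g r) - (\<Prod>r\<in>R. exp (of_real (s r) * w r))) \<le>
    exp ((D + B) * (\<Sum>r\<in>R. s r)) * (\<Sum>r\<in>R. 2 * B * (s r)^2)"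
proof -
  define c where "c = D + B"
  \<comment> \<open>The telescoping estimate \<open>norm_prod_diff\<close> asks for factors of norm
    at most \<open>1\<close>. Both kinds of factors are at most
    \<open>1 + c * s r \<le> exp (c * s r)\<close>, so they are damped by \<open>q r\<close>, and
    the damping is undone at the end by \<open>E\<close>.\<close>
  define q where "q r = complex_of_real (exp (- (c * s r)))" for r
  have bound: "cmod (z * q r) \<le> 1" if r: "r \<in> R" and z: "cmod (z - 1 - of_real (s r) * w r) \<le> B * (s r)^2" for r z
  proof -
    have "cmod z \<le> cmod (z - 1 - of_real (s r) * w r) + cmod (1 + of_real (s r) * w r)"
      using norm_triangle_ineq[of "z - 1 - of_real (s r) * w r" "1 + of_real (s r) * w r"] by simp
    also have "cmod (1 + of_real (s r) * w r) \<le> 1 + s r * D"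
      using norm_triangle_ineq[of 1 "of_real (s r) * w r"] s[OF r] mult_left_mono[OF w[OF r], of "s r"] by (simp add: norm_mult)
    also have "cmod (z - 1 - of_real (s r) * w r) \<le> B * s r"
    proof -
      have "(s r)^2 \<le> s r" using s[OF r] by (simp add: power2_eq_square mult_left_le)
      then show ?thesis using z mult_left_mono[OF _ B, of "(s r)^2" "s r"] by linarith
    qed
    finally have "cmod z \<le> 1 + c * s r" by (simp add: c_def algebra_simps)
    also have "\<dots> \<le> exp (c * s r)" by (rule exp_ge_add_one_self)
    finally have "cmod z * exp (- (c * s r)) \<le> exp (c * s r) * exp (- (c * s r))" by (rule mult_right_mono) simp
    then show ?thesis by (simp add: q_def norm_mult flip: exp_add)
  qed
  have qn: "cmod (q r) \<le> 1" if r: "r \<in> R" for r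
  proof -
    have "0 \<le> D" using w[OF r] norm_ge_zero order_trans by blast
    then show ?thesis using B s[OF r] by (simp add: q_def c_def)
  qed
  have "cmod ((\<Prod>r\<in>R. g r * q r) - (\<Prod>r\<in>R. exp (of_real (s r) * w r) * q r)) \<le>
      (\<Sum>r\<in>R. cmod (g r * q r - exp (of_real (s r) * w r) * q r))" by (rule norm_prod_diff) (use bound g e in auto)
  also have "\<dots> \<le> (\<Sum>r\<in>R. 2 * B * (s r)^2)"
  proof (rule sum_mono)
    fix r assume r: "r \<in> R"
    have "cmod (g r * q r - exp (of_real (s r) * w r) * q r) = cmod (g r - exp (of_real (s r) * w r)) * cmod (q r)"
      by (simp flip: norm_mult left_diff_distrib)
    also have "\<dots> \<le> cmod (g r - exp (of_real (s r) * w r))" using qn[OF r] by (simp add: mult_left_le)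
    also have "\<dots> \<le> cmod (g r - 1 - of_real (s r) * w r) + cmod (exp (of_real (s r) * w r) - 1 - of_real (s r) * w r)"
      using norm_triangle_ineq4[of "g r - 1 - of_real (s r) * w r" "exp (of_real (s r) * w r) - 1 - of_real (s r) * w r"]
      by (simp add: algebra_simps)
    also have "\<dots> \<le> 2 * B * (s r)^2" using g[OF r] e[OF r] by simp
    finally show "cmod (g r * q r - exp (of_real (s r) * w r) * q r) \<le> 2 * B * (s r)^2" .
  qed
  finally have 1: "cmod ((\<Prod>r\<in>R. g r * q r) - (\<Prod>r\<in>R. exp (of_real (s r) * w r) * q r)) \<le> (\<Sum>r\<in>R. 2 * B * (s r)^2)" .
  define E where "E = exp (c * (\<Sum>r\<in>R. s r))"
  have "(\<Prod>r\<in>R. q r) = complex_of_real (\<Prod>r\<in>R. exp (- (c * s r)))" by (simp add: q_def)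
  also have "(\<Prod>r\<in>R. exp (- (c * s r))) = exp (- (c * (\<Sum>r\<in>R. s r)))"
    using R by (simp add: exp_sum sum_distrib_left flip: sum_negf)
  finally have q: "of_real E * (\<Prod>r\<in>R. q r) = 1" by (simp add: E_def flip: of_real_mult exp_add)
  have "cmod ((\<Prod>r\<in>R. g r) - (\<Prod>r\<in>R. exp (of_real (s r) * w r))) =
      cmod (of_real E * ((\<Prod>r\<in>R. g r * q r) - (\<Prod>r\<in>R. exp (of_real (s r) * w r) * q r)))"
  proof -
    have "of_real E * ((\<Prod>r\<in>R. g r * q r) - (\<Prod>r\<in>R. exp (of_real (s r) * w r) * q r)) =
        (of_real E * (\<Prod>r\<in>R. q r)) * ((\<Prod>r\<in>R. g r) - (\<Prod>r\<in>R. exp (of_real (s r) * w r)))"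
      by (simp add: prod.distrib algebra_simps)
    then show ?thesis by (simp add: q)
  qed
  also have "\<dots> \<le> E * (\<Sum>r\<in>R. 2 * B * (s r)^2)" using mult_left_mono[OF 1, of E] by (simp add: norm_mult E_def)
  finally show ?thesis by (simp add: E_def c_def)
qed

lemma double_prod_sum:
  fixes X :: "'r \<Rightarrow> 'i \<Rightarrow> 'i \<Rightarrow> complex"
  assumes "finite R" "finite I"
  shows "(\<Sum>f\<in>PiE R (\<lambda>_. I). \<Sum>g\<in>PiE R (\<lambda>_. I). \<Prod>r\<in>R. X r (f r) (g r)) = (\<Prod>r\<in>R. \<Sum>i\<in>I. \<Sum>j\<in>I. X r i j)"
  using assms by (simp add: prod_sum_PiE)

text \<open>The form in which the absence of atoms is used. It passes at once to restrictions to
  measurable sets, which the tensor decomposition requires.\<close>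

definition small_partitions :: "'x measure \<Rightarrow> bool" where
  "small_partitions M \<longleftrightarrow> (\<forall>\<delta>>0. \<exists>(N::nat) E. (\<forall>i<N. E i \<in> sets M \<and> measure M (E i) < \<delta>) \<and>
     disjoint_family_on E {..<N} \<and> (\<Union>i<N. E i) = space M)"

lemma small_partitions_restrict:
  assumes "finite_measure M" "small_partitions M" "A \<in> sets M"
  shows "small_partitions (restrict_space M A)" unfolding small_partitions_def
proof (intro allI impI)
  interpret finite_measure M by fact
  fix \<delta> :: real assume "0 < \<delta>"
  then obtain N :: nat and E where E: "\<forall>i<N. E i \<in> sets M \<and> measure M (E i) < \<delta>" "disjoint_family_on E {..<N}" "(\<Union>i<N. E i) = space M"
    using assms(2) unfolding small_partitions_def by blast
  have A: "A \<subseteq> space M" using sets.sets_into_space[OF assms(3)] .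
  have "measure (restrict_space M A) (E i \<inter> A) < \<delta>" if "i < N" for i
  proof -
    have "measure (restrict_space M A) (E i \<inter> A) = measure M (E i \<inter> A)"
      using assms(3) A by (intro measure_restrict_space) auto
    also have "\<dots> \<le> measure M (E i)" using E(1) that assms(3) by (intro finite_measure_mono) auto
    finally show ?thesis using E(1) that by fastforce
  qed
  moreover have "E i \<inter> A \<in> sets (restrict_space M A)" if "i < N" for i using E(1) that by (auto simp: sets_restrict_space)
  moreover have "disjoint_family_on (\<lambda>i. E i \<inter> A) {..<N}" using E(2) by (auto simp: disjoint_family_on_def)
  moreover have "(\<Union>i<N. E i \<inter> A) = space (restrict_space M A)" using E(3) A by (auto simp: space_restrict_space)
  ultimately show "\<exists>(N::nat) E. (\<forall>i<N. E i \<in> sets (restrict_space M A) \<and> measure (restrict_space M A) (E i) < \<delta>) \<and>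
      disjoint_family_on E {..<N} \<and> (\<Union>i<N. E i) = space (restrict_space M A)"
    by (intro exI[of _ N] exI[of _ "\<lambda>i. E i \<inter> A"]) simp
qed

text \<open>Every point has a neighbourhood of small measure, and countably many of these cover the space.\<close>

lemma small_partitions_standard_borel:
  assumes sb: "standard_borel_space M" and fin: "finite_measure M" and cont: "\<forall>x\<in>space M. emeasure M {x} = 0"
  shows "small_partitions M" unfolding small_partitions_def
proof (intro allI impI)
  interpret finite_measure M by fact
  fix \<delta> :: real assume \<delta>: "0 < \<delta>"
  obtain X where X: "topspace X = space M" "completely_metrizable_space X" "second_countable X"
    "sets M = sigma_sets (space M) {U. openin X U}" using sb by (auto simp: standard_borel_space_def)
  have op: "U \<in> sets M" if "openin X U" for U using that X(4) by (auto intro: sigma_sets.Basic)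
  obtain S d where Sd: "Metric_space S d" "X = Metric_space.mtopology S d"
    using X(2) by (auto simp: completely_metrizable_space_def)
  interpret Metric_space S d by (rule Sd(1))
  have S: "S = space M" using X(1) Sd(2) by simp
  have "\<exists>U. openin X U \<and> x \<in> U \<and> measure M U < \<delta>" if x: "x \<in> space M" for x
  proof -
    define U where "U n = mball x (1 / real (Suc n))" for n
    have Uo: "openin X (U n)" for n unfolding U_def Sd(2) by (rule openin_mball)
    have dec: "decseq U" unfolding decseq_def U_def by (auto intro!: mball_subset_concentric divide_left_mono)
    have "(\<Inter>n. U n) = {x}"
    proof (intro set_eqI iffI)
      fix z assume z: "z \<in> (\<Inter>n. U n)"
      then have "d x z < 1 / real (Suc n)" "z \<in> S" for n by (auto simp: U_def in_mball)
      then have "d x z \<le> 0" by (metis linorder_not_le nat_approx_posE not_less_iff_gr_or_eq)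
      then show "z \<in> {x}" using \<open>\<And>n. z \<in> S\<close> x S by (metis insertI1 mdist_pos_less not_le)
    next
      fix z assume "z \<in> {x}"
      then show "z \<in> (\<Inter>n. U n)" using x unfolding S[symmetric] by (auto simp: U_def in_mball add_pos_nonneg)
    qed
    then have "(\<lambda>n. measure M (U n)) \<longlonglongrightarrow> measure M {x}" using finite_Lim_measure_decseq[of U] op[OF Uo] dec by auto
    then have "(\<lambda>n. measure M (U n)) \<longlonglongrightarrow> 0" using cont x by (simp add: measure_def)
    then obtain n where "measure M (U n) < \<delta>"
      using eventually_happens'[OF sequentially_bot order_tendstoD(2)[OF _ \<delta>]] by blast
    moreover have "x \<in> U n" using x unfolding U_def S[symmetric] by (simp add: add_pos_nonneg)
    ultimately show ?thesis using Uo by blast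
  qed
  then obtain U where U: "\<And>x. x \<in> space M \<Longrightarrow> openin X (U x) \<and> x \<in> U x \<and> measure M (U x) < \<delta>" by metis
  have "Lindelof_space X" by (rule second_countable_imp_Lindelof_space[OF X(3)])
  then obtain \<V> where V: "countable \<V>" "\<V> \<subseteq> U ` space M" "\<Union>\<V> = topspace X"
    using U X(1) openin_subset unfolding Lindelof_space_def
    by (smt (verit) Sup_le_iff UN_iff image_iff subsetI subset_antisym)
  show "\<exists>(N::nat) E. (\<forall>i<N. E i \<in> sets M \<and> measure M (E i) < \<delta>) \<and> disjoint_family_on E {..<N} \<and> (\<Union>i<N. E i) = space M"
  proof (cases "\<V> = {}")
    case True
    then show ?thesis using V(3) X(1) by (intro exI[of _ 0] exI[of _ "\<lambda>_. {}"]) (auto simp: disjoint_family_on_def)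
  next
    case False
    define V where "V = from_nat_into \<V>"
    have Vr: "range V = \<V>" unfolding V_def using False V(1) by (rule range_from_nat_into)
    have Vs: "V i \<in> sets M" "measure M (V i) < \<delta>" for i
    proof -
      have "V i \<in> U ` space M" using Vr V(2) by blast
      then show "V i \<in> sets M" "measure M (V i) < \<delta>" using U op by auto
    qed
    have Vu: "(\<Union>i. V i) = space M" using Vr V(3) X(1) by simp
    define D where "D = disjointed V"
    have Ds: "D i \<in> sets M" for i unfolding D_def disjointed_def using Vs(1) by auto
    have Dm: "measure M (D i) < \<delta>" for i
      by (rule le_less_trans[OF finite_measure_mono Vs(2)]) (use disjointed_subset[of V i] Vs(1) in \<open>auto simp: D_def\<close>)
    have "(\<lambda>n. measure M (space M - (\<Union>i<n. V i))) \<longlonglongrightarrow> measure M (\<Inter>n. space M - (\<Union>i<n. V i))" using Vs(1)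
    proof (intro finite_Lim_measure_decseq)
      show "decseq (\<lambda>n. space M - (\<Union>i<n. V i))" unfolding decseq_def by (intro allI impI Diff_mono UN_mono subset_refl) simp
    qed auto
    moreover have "(\<Inter>n. space M - (\<Union>i<n. V i)) = {}" unfolding Vu[symmetric] by auto
    ultimately have "(\<lambda>n. measure M (space M - (\<Union>i<n. V i))) \<longlonglongrightarrow> 0" by (simp only: measure_empty)
    then obtain n where n: "measure M (space M - (\<Union>i<n. V i)) < \<delta>"
      using eventually_happens'[OF sequentially_bot order_tendstoD(2)[OF _ \<delta>]] by blast
    \<comment> \<open>After finitely many disjointed sets the uncovered remainder has measure below
      \<delta> and serves as one last piece, with index \<open>n\<close>.\<close>
    define E where "E i = (if i < n then D i else space M - (\<Union>i<n. V i))" for i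
    have uD: "(\<Union>i<n. D i) = (\<Union>i<n. V i)" using finite_UN_disjointed_eq[of V n] by (simp add: D_def atLeast0LessThan)
    have "\<forall>i<Suc n. E i \<in> sets M \<and> measure M (E i) < \<delta>" using Ds Dm n Vs(1) by (auto simp: E_def)
    moreover have "disjoint_family_on E {..<Suc n}"
    proof -
      have dj: "D i \<inter> D j = {}" if "i \<noteq> j" for i j
        using disjoint_family_disjointed[of V] that by (auto simp: D_def disjoint_family_on_def)
      have dn: "D i \<inter> (space M - (\<Union>i<n. V i)) = {}" if "i < n" for i using that uD by blast
      show ?thesis unfolding disjoint_family_on_def E_def using dj dn by (auto simp: less_Suc_eq)
    qed
    moreover have "(\<Union>i<Suc n. E i) = space M"
    proof -
      have "(\<Union>i<Suc n. E i) = (\<Union>i<n. D i) \<union> (space M - (\<Union>i<n. V i))" by (auto simp: E_def less_Suc_eq lessThan_Suc)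
      then show ?thesis using uD Vu by auto
    qed
    ultimately show ?thesis by blast
  qed
qed

section \<open>Step functions and the approximation of exponential vectors\<close>

locale levy_fock = levy_kernel H k \<kappa> C + finite_measure M for H :: "'h hilbert" and k \<kappa> C and M :: "'x measure" +
  assumes partitions: "small_partitions M"

sublocale levy_fock \<subseteq> L2_space H M by unfold_locales

context levy_fock
begin

abbreviation "K \<equiv> L2 M H"
abbreviation "bm \<equiv> bounded_measurable M"

sublocale K: complex_hilbert_space K by (rule hilbert_L2)
sublocale F: complex_hilbert_space "EXP K" by (rule K.hilbert_fock)

definition ka :: "('x \<Rightarrow> real) \<Rightarrow> ('x \<Rightarrow> 'h) set" where
  "ka a = cls (\<lambda>x. k (a x))"

lemma k_LF:
  assumes a: "a \<in> bm"
  shows "(\<lambda>x. k (a x)) \<in> LF"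
proof -
  obtain B where B: "\<And>x. x \<in> space M \<Longrightarrow> \<bar>a x\<bar> \<le> B" using a by (auto simp: bounded_measurable_def)
  show ?thesis
  proof (rule LF_bounded[where g="\<lambda>_. \<bar>C\<bar> * (4 + B^2)"])
    show "(\<lambda>x. ip h (k (a x))) \<in> borel_measurable M" if "h \<in> V" for h
      using measurable_compose[OF _ k_measurable[OF that], of a M] a by (simp add: bounded_measurable_def)
    fix x assume x: "x \<in> space M"
    have "(a x)^2 \<le> B^2" using B[OF x] by (metis abs_ge_zero power2_abs power_mono)
    then have "\<bar>C\<bar> * (4 + (a x)^2) \<le> \<bar>C\<bar> * (4 + B^2)" by (intro mult_left_mono) auto
    moreover have "C * (4 + (a x)^2) \<le> \<bar>C\<bar> * (4 + (a x)^2)" by (intro mult_right_mono) auto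
    ultimately show "(nm (k (a x)))^2 \<le> \<bar>C\<bar> * (4 + B^2)" using k_bound[of "a x"] by linarith
  qed (simp_all add: k_carrier)
qed

lemma ka_carrier: "a \<in> bm \<Longrightarrow> ka a \<in> K.V" by (simp add: ka_def cls_carrier k_LF)

lemma ka_inner: "a \<in> bm \<Longrightarrow> b \<in> bm \<Longrightarrow> K.ip (ka a) (ka b) = (\<integral>x. \<kappa> (a x) (b x) \<partial>M)" by (simp add: ka_def L2_inner k_LF k_inner)

lemma expv_carrier: "h \<in> K.V \<Longrightarrow> K.expv h \<in> F.V" using K.expv_closed by (simp add: fock_space_def)

text \<open>Because of \<open>k 0 = 0\<close> this is the class of the function with value
  \<open>k y\<close> on \<open>A\<close> and zero elsewhere.\<close>

definition kstep :: "'x set \<Rightarrow> real \<Rightarrow> ('x \<Rightarrow> 'h) set" where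
  "kstep A y = ka (\<lambda>x. if x \<in> A then y else 0)"

lemma step_bm: "A \<in> sets M \<Longrightarrow> (\<lambda>x. if x \<in> A then y else 0) \<in> bm" using bm_If(1)[of A M "\<lambda>_. y"] bm_const by blast

text \<open>Letting \<open>A\<close> vary shows that \<open>\<langle>k y, f x\<rangle>\<close> is
  zero for almost every \<open>x\<close>, with an exceptional set depending on \<open>y\<close>.
  Rational \<open>y\<close> are total in \<open>H\<close>, so countably many exceptional sets
  suffice.\<close>

lemma kstep_total: "total_in K {kstep A y | A y. A \<in> sets M}" unfolding total_in_def
proof (intro conjI ballI impI)
  show "{kstep A y | A y. A \<in> sets M} \<subseteq> K.V" using ka_carrier[OF step_bm] by (auto simp: kstep_def)
  fix u assume "u \<in> K.V" and orth: "\<forall>w\<in>{kstep A y | A y. A \<in> sets M}. K.ip w u = 0"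
  then obtain f where f: "f \<in> LF" "u = cls f" by (auto elim: carrierE)
  have "AE x in M. ip (k y) (f x) = 0" for y
  proof (rule AE_zero_if_set_integrals_zero)
    show "integrable M (\<lambda>x. ip (k y) (f x))" using LF_integrable_inner[OF k_LF[OF bm_const[of y]] f(1)] by simp
    fix A assume A: "A \<in> sets M"
    have "0 = K.ip (kstep A y) u" using orth A by (metis (mono_tags, lifting) mem_Collect_eq)
    also have "\<dots> = (\<integral>x. ip (k (if x \<in> A then y else 0)) (f x) \<partial>M)"
      unfolding kstep_def ka_def f(2) by (rule L2_inner[OF k_LF[OF step_bm[OF A]] f(1)])
    also have "\<dots> = (\<integral>x. indicator A x *\<^sub>R ip (k y) (f x) \<partial>M)"
      by (intro Bochner_Integration.integral_cong refl) (simp add: k_zero inner_zero_left LF_closed[OF f(1)])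
    finally show "(\<integral>x. indicator A x *\<^sub>R ip (k y) (f x) \<partial>M) = 0" by simp
  qed
  then have "AE x in M. \<forall>y\<in>\<rat>. ip (k y) (f x) = 0" by (subst AE_ball_countable) (auto simp: countable_rat)
  then have "AE x in M. f x = hzero H"
    using AE_space by eventually_elim (use k_total LF_closed[OF f(1)] in \<open>auto simp: total_in_def\<close>)
  then show "u = hzero K" unfolding f(2) L2_zero by (rule cls_eqI)
qed

lemma cell_integral:
  fixes F :: "'x \<Rightarrow> complex"
  assumes R: "finite R" and E: "\<And>r. r \<in> R \<Longrightarrow> E r \<in> sets M" "disjoint_family_on E R" "(\<Union>r\<in>R. E r) = space M"
    and F: "\<And>r x. r \<in> R \<Longrightarrow> x \<in> E r \<Longrightarrow> F x = v r"
  shows "(\<integral>x. F x \<partial>M) = (\<Sum>r\<in>R. of_real (measure M (E r)) * v r)"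
proof -
  have "F x = (\<Sum>r\<in>R. indicator (E r) x *\<^sub>R v r)" if x: "x \<in> space M" for x
  proof -
    obtain r where r: "r \<in> R" "x \<in> E r" using E(3) x by auto
    have "(\<Sum>r\<in>R. indicator (E r) x *\<^sub>R v r) = (\<Sum>r'\<in>R. if r' = r then v r else 0)"
      using r E(2) by (intro sum.cong refl) (auto simp: disjoint_family_on_def split: split_indicator)
    also have "\<dots> = F x" using R r F[OF r] by simp
    finally show ?thesis by simp
  qed
  then have "(\<integral>x. F x \<partial>M) = (\<integral>x. (\<Sum>r\<in>R. indicator (E r) x *\<^sub>R v r) \<partial>M)" by (intro Bochner_Integration.integral_cong refl)
  also have "\<dots> = (\<Sum>r\<in>R. \<integral>x. indicator (E r) x *\<^sub>R v r \<partial>M)"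
    using E(1) by (intro Bochner_Integration.integral_sum integrable_mult_indicator) auto
  also have "\<dots> = (\<Sum>r\<in>R. of_real (measure M (E r)) * v r)"
  proof (intro sum.cong refl)
    fix r assume r: "r \<in> R"
    have "integrable M (indicat_real (E r))"
      by (rule integrable_const_bound[of _ 1]) (use E(1)[OF r] in \<open>auto split: split_indicator\<close>)
    then show "(\<integral>x. indicator (E r) x *\<^sub>R v r \<partial>M) = of_real (measure M (E r)) * v r"
      using sets.sets_into_space[OF E(1)[OF r]] by (subst integral_scaleR_left) (auto simp: scaleR_conv_of_real Int_absorb2)
  qed
  finally show ?thesis .
qed

text \<open>On a piece of small measure \<open>s\<close> on which \<open>h = \<Sum>i. \<gamma> i * k (y i)\<close> with \<open>\<Sum>i. \<gamma> i = 1\<close>, the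
  combination \<open>\<Sum>i. \<gamma> i * exp (k (y i))\<close> agrees with \<open>exp h\<close> up to an error of order \<open>s^2\<close>; the product
  over all pieces is again a combination of exponential vectors of the process.\<close>

lemma expv_step_approx:
  fixes c :: "nat \<Rightarrow> complex" and A :: "nat \<Rightarrow> 'x set" and y :: "nat \<Rightarrow> real"
  assumes A: "\<And>i. i < n \<Longrightarrow> A i \<in> sets M" and e: "0 < \<epsilon>"
  defines "h \<equiv> hsum K (\<lambda>i. hscale K (c i) (kstep (A i) (y i))) {..<n}"
  shows "\<exists>u\<in>hspan (EXP K) ((\<lambda>a. K.expv (ka a)) ` bm). hdist (EXP K) u (K.expv h) < \<epsilon>"
proof -
  \<comment> \<open>The additional index \<open>n\<close> carries the value \<open>0\<close>, at
    which \<open>k\<close> vanishes.\<close>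
  define y' where "y' i = (if i < n then y i else 0)" for i
  \<comment> \<open>\<open>T\<close> is the set of those \<open>i\<close> whose \<open>A i\<close>
    contains the cell. The index \<open>n\<close> receives the weight missing from \<open>1\<close>;
    this leaves the combination of the vectors \<open>k (y' i)\<close> unchanged.\<close>
  define \<gamma> where "\<gamma> T i = (if i < n then (if i \<in> T then c i else 0) else 1 - (\<Sum>i<n. if i \<in> T then c i else 0))" for T i
  have \<kappa>0: "\<kappa> a 0 = 0" "\<kappa> 0 a = 0" for a
    using k_inner[of a 0] k_inner[of 0 a] by (simp_all add: k_zero inner_zero_right inner_zero_left k_carrier)
  have \<gamma>1: "(\<Sum>i\<le>n. \<gamma> T i) = 1" for T by (simp add: lessThan_Suc_atMost[symmetric] \<gamma>_def)
  \<comment> \<open>The weights with index below \<open>n\<close> contribute one sum of the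
    \<open>cmod (c i)\<close>, and the weight at \<open>n\<close> contributes \<open>1\<close> and
    another such sum.\<close>
  define \<Gamma> where "\<Gamma> = 1 + 2 * (\<Sum>i<n. cmod (c i))"
  have \<Gamma>: "\<Gamma> \<ge> 1" by (simp add: \<Gamma>_def sum_nonneg)
  have \<gamma>b: "(\<Sum>i\<le>n. cmod (\<gamma> T i)) \<le> \<Gamma>" for T
  proof -
    have 1: "(\<Sum>i<n. cmod (\<gamma> T i)) \<le> (\<Sum>i<n. cmod (c i))" by (rule sum_mono) (simp add: \<gamma>_def)
    have "cmod (\<Sum>i<n. if i \<in> T then c i else 0) \<le> (\<Sum>i<n. cmod (c i))" by (rule sum_norm_le) simp
    then have "cmod (\<gamma> T n) \<le> 1 + (\<Sum>i<n. cmod (c i))"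
      using norm_triangle_ineq4[of 1 "\<Sum>i<n. if i \<in> T then c i else 0"] by (simp add: \<gamma>_def)
    then show ?thesis using 1 by (simp add: lessThan_Suc_atMost[symmetric] \<Gamma>_def)
  qed
  define L0 where "L0 = (\<Sum>i\<le>n. \<Sum>j\<le>n. cmod (\<kappa> (y' i) (y' j)))"
  have L0: "cmod (\<kappa> (y' i) (y' j)) \<le> L0" if "i \<le> n" "j \<le> n" for i j
  proof -
    have "cmod (\<kappa> (y' i) (y' j)) \<le> (\<Sum>j\<le>n. cmod (\<kappa> (y' i) (y' j)))" using that by (intro member_le_sum) auto
    also have "\<dots> \<le> L0" unfolding L0_def using that by (intro member_le_sum sum_nonneg) auto
    finally show ?thesis .
  qed
  have L00: "L0 \<ge> 0" by (simp add: L0_def sum_nonneg)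
  define L where "L = \<Gamma> * \<Gamma> * L0"
  have \<Gamma>2: "\<Gamma> \<le> \<Gamma> * \<Gamma>" "1 \<le> \<Gamma> * \<Gamma>" using \<Gamma> mult_mono[of 1 \<Gamma> 1 \<Gamma>] by (simp_all add: mult_left_mono[of 1 \<Gamma> \<Gamma>])
  have LL: "L0 \<le> L" "\<Gamma> * L0 \<le> L" "L \<ge> 0"
    using L00 \<Gamma>2 mult_right_mono[of 1 "\<Gamma> * \<Gamma>" L0] mult_right_mono[of \<Gamma> "\<Gamma> * \<Gamma>" L0] by (simp_all add: L_def)
  \<comment> \<open>A common bound for the three uses of \<open>affine_exp_sum\<close>, where the
    pair of weight bound and exponent bound is \<open>(\<Gamma>, \<Gamma> * L0)\<close>,
    \<open>(1, L)\<close> and \<open>(\<Gamma> * \<Gamma>, L0)\<close>.\<close>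
  define B where "B = \<Gamma> * \<Gamma> * (exp L * L^2)"
  have B: "B \<ge> 0" using \<Gamma>2 by (simp add: B_def)
  define m where "m = measure M (space M)"
  \<comment> \<open>The minimum with \<open>1\<close> is for the condition
    \<open>s r \<le> 1\<close>. The quotient makes the final error, three times \<open>bd\<close>,
    smaller than \<open>\<epsilon>^2\<close>; the added \<open>1\<close> makes this strict and
    avoids division by zero.\<close>
  define \<delta> where "\<delta> = min 1 (\<epsilon>^2 / (3 * (exp ((L + B) * m) * (2 * B * m)) + 1))"
  have m: "m \<ge> 0" by (simp add: m_def)
  have den: "0 \<le> 3 * (exp ((L + B) * m) * (2 * B * m))" using B m by simp
  then have \<delta>: "0 < \<delta>" unfolding \<delta>_def using e by (auto intro!: divide_pos_pos add_nonneg_pos simp del: mult_numeral_left)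
  obtain N :: nat and E0 where E0: "\<And>i. i < N \<Longrightarrow> E0 i \<in> sets M \<and> measure M (E0 i) < \<delta>"
    "disjoint_family_on E0 {..<N}" "(\<Union>i<N. E0 i) = space M" using partitions \<delta> unfolding small_partitions_def by blast
  \<comment> \<open>A cell is given by a small piece together with the set of those \<open>i\<close>
    for which it lies in \<open>A i\<close>, so all the step functions are constant on
    cells.\<close>
  define R where "R = {..<N} \<times> Pow {..<n}"
  define E where "E r = {x \<in> E0 (fst r). \<forall>i<n. x \<in> A i \<longleftrightarrow> i \<in> snd r}" for r
  have R: "finite R" by (simp add: R_def)
  have Es: "E r \<in> sets M" if "r \<in> R" for r
  proof -
    have "E r = E0 (fst r) \<inter> {x \<in> space M. \<forall>i\<in>{..<n}. x \<in> A i \<longleftrightarrow> i \<in> snd r}" using E0(3) that by (auto simp: E_def R_def)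
    also have "\<dots> \<in> sets M"
    proof (intro sets.Int)
      show "E0 (fst r) \<in> sets M" using E0(1) that by (auto simp: R_def)
      have "{x \<in> space M. (x \<in> A i) = (i \<in> snd r)} \<in> sets M" if "i \<in> {..<n}" for i
      proof -
        have [measurable]: "A i \<in> sets M" using A that by simp
        show ?thesis by measurable
      qed
      then show "{x \<in> space M. \<forall>i\<in>{..<n}. (x \<in> A i) = (i \<in> snd r)} \<in> sets M"
        by (rule sets.sets_Collect_finite_All[OF _ finite_lessThan])
    qed
    finally show ?thesis .
  qed
  have Ed: "disjoint_family_on E R" unfolding disjoint_family_on_def
  proof (intro ballI impI)
    fix r r' assume r: "r \<in> R" "r' \<in> R" "r \<noteq> r'"
    show "E r \<inter> E r' = {}"
    proof (cases "fst r = fst r'")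
      case False
      then have "E0 (fst r) \<inter> E0 (fst r') = {}"  using r by (intro disjoint_family_onD[OF E0(2)]) (auto simp: R_def)
      then show ?thesis by (auto simp: E_def)
    next
      case True
      then have "snd r \<noteq> snd r'" "snd r \<subseteq> {..<n}" "snd r' \<subseteq> {..<n}" using r by (auto simp: R_def prod_eq_iff)
      then show ?thesis by (auto simp: E_def)
    qed
  qed
  have Eu: "(\<Union>r\<in>R. E r) = space M"
  proof (intro set_eqI iffI)
    fix x assume "x \<in> space M"
    then obtain i where "i < N" "x \<in> E0 i" using E0(3) by auto
    then show "x \<in> (\<Union>r\<in>R. E r)" by (intro UN_I[of "(i, {j. j < n \<and> x \<in> A j})"]) (auto simp: R_def E_def)
  next
    fix x assume "x \<in> (\<Union>r\<in>R. E r)"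
    then show "x \<in> space M" using Es sets.sets_into_space by blast
  qed
  define s where "s r = measure M (E r)" for r
  have s0: "0 \<le> s r" for r by (simp add: s_def)
  have s\<delta>: "s r \<le> \<delta>" if "r \<in> R" for r
  proof -
    have "s r \<le> measure M (E0 (fst r))"
      unfolding s_def using E0(1) that by (intro finite_measure_mono) (auto simp: E_def R_def)
    then show ?thesis using E0(1)[of "fst r"] that by (auto simp: R_def)
  qed
  have sm: "(\<Sum>r\<in>R. s r) = m"
    unfolding s_def m_def Eu[symmetric] using R Es Ed by (intro finite_measure_finite_Union[symmetric]) auto
  note cell = cell_integral[OF R Es Ed Eu, folded s_def]
  \<comment> \<open>\<open>f\<close> chooses an index for each cell, and \<open>a f\<close> is the
    step function with the chosen values.\<close>
  define a where "a f x = y' (f (THE r. r \<in> R \<and> x \<in> E r))" for f :: "nat \<times> nat set \<Rightarrow> nat" and x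
  have the: "(THE r. r \<in> R \<and> x \<in> E r) = r" if "r \<in> R" "x \<in> E r" for r x
    using that Ed by (intro the_equality) (auto simp: disjoint_family_on_def)
  have av: "a f x = y' (f r)" if "r \<in> R" "x \<in> E r" for f r x by (simp add: a_def the[OF that])
  have abm: "a f \<in> bm" for f
  proof -
    have eq: "a f x = (\<Sum>r\<in>R. indicator (E r) x * y' (f r))" if x: "x \<in> space M" for x
    proof -
      obtain r where r: "r \<in> R" "x \<in> E r" using x unfolding Eu[symmetric] by (elim UN_E)
      have "(\<Sum>r\<in>R. indicator (E r) x * y' (f r)) = (\<Sum>r'\<in>R. if r' = r then y' (f r) else 0)"
        using r Ed by (intro sum.cong refl) (auto simp: disjoint_family_on_def split: split_indicator)
      then show ?thesis using R r av[OF r] by simp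
    qed
    have "(\<lambda>x. \<Sum>r\<in>R. indicator (E r) x * y' (f r)) \<in> borel_measurable M"
      using Es by (intro borel_measurable_sum borel_measurable_times borel_measurable_indicator) auto
    then have "a f \<in> borel_measurable M" using eq by (simp cong: measurable_cong)
    moreover have "\<bar>a f x\<bar> \<le> (\<Sum>r\<in>R. \<bar>y' (f r)\<bar>)" if x: "x \<in> space M" for x
    proof -
      obtain r where r: "r \<in> R" "x \<in> E r" using x unfolding Eu[symmetric] by (elim UN_E)
      show ?thesis unfolding av[OF r] using R r by (intro member_le_sum) auto
    qed
    ultimately show ?thesis by (auto simp: bounded_measurable_def)
  qed
  have h: "h \<in> K.V" unfolding h_def using A ka_carrier[OF step_bm] by (intro K.hsum_closed) (auto simp: kstep_def K.closed)
  have sum_n: "(\<Sum>i<n. (if i \<in> T then c i else 0) * f (y i)) = (\<Sum>i\<le>n. \<gamma> T i * f (y' i))"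
    if "f 0 = 0" for T and f :: "real \<Rightarrow> complex"
  proof -
    have "(\<Sum>i<n. \<gamma> T i * f (y' i)) = (\<Sum>i<n. (if i \<in> T then c i else 0) * f (y i))"
      by (intro sum.cong refl) (simp add: \<gamma>_def y'_def)
    then show ?thesis using that by (simp add: lessThan_Suc_atMost[symmetric] y'_def)
  qed
  have inner_h: "K.ip (ka b) h = (\<Sum>r\<in>R. of_real (s r) * (\<Sum>j\<le>n. \<gamma> (snd r) j * \<kappa> (v r) (y' j)))"
    if b: "b \<in> bm" and v: "\<And>r x. r \<in> R \<Longrightarrow> x \<in> E r \<Longrightarrow> b x = v r" for b v
  proof -
    have "K.ip (ka b) h = (\<Sum>i<n. c i * K.ip (ka b) (kstep (A i) (y i)))"
      unfolding h_def using A ka_carrier[OF step_bm] ka_carrier[OF b]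
      by (subst K.inner_hsum) (auto simp: kstep_def K.closed K.inner_simps)
    also have "\<dots> = (\<Sum>i<n. c i * (\<Sum>r\<in>R. of_real (s r) * (if i \<in> snd r then \<kappa> (v r) (y i) else 0)))"
    proof (intro sum.cong refl arg_cong2[of _ _ _ _ "(*)"])
      fix i assume i: "i \<in> {..<n}"
      have "K.ip (ka b) (kstep (A i) (y i)) = (\<integral>x. \<kappa> (b x) (if x \<in> A i then y i else 0) \<partial>M)"
        unfolding kstep_def using A i by (intro ka_inner b step_bm) auto
      also have "\<dots> = (\<Sum>r\<in>R. of_real (s r) * (if i \<in> snd r then \<kappa> (v r) (y i) else 0))"
        by (rule cell) (use i v in \<open>auto simp: E_def \<kappa>0\<close>)
      finally show "K.ip (ka b) (kstep (A i) (y i)) = (\<Sum>r\<in>R. of_real (s r) * (if i \<in> snd r then \<kappa> (v r) (y i) else 0))" .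
    qed
    also have "\<dots> = (\<Sum>i<n. \<Sum>r\<in>R. of_real (s r) * ((if i \<in> snd r then c i else 0) * \<kappa> (v r) (y i)))"
      by (simp add: sum_distrib_left mult.left_commute if_distrib[of "(*) _"] cong: if_cong)
        (intro sum.cong refl, simp)
    also have "\<dots> = (\<Sum>r\<in>R. of_real (s r) * (\<Sum>i<n. (if i \<in> snd r then c i else 0) * \<kappa> (v r) (y i)))"
      by (subst sum.swap) (simp only: sum_distrib_left)
    also have "\<dots> = (\<Sum>r\<in>R. of_real (s r) * (\<Sum>j\<le>n. \<gamma> (snd r) j * \<kappa> (v r) (y' j)))"
      by (intro sum.cong refl arg_cong2[of _ _ _ _ "(*)"] sum_n) (rule \<kappa>0)
    finally show ?thesis .
  qed
  \<comment> \<open>The square length of the value of \<open>h\<close> on the cell \<open>r\<close>,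
    written with the affine weights.\<close>
  define w where "w r = (\<Sum>i\<le>n. cnj (\<gamma> (snd r) i) * (\<Sum>j\<le>n. \<gamma> (snd r) j * \<kappa> (y' i) (y' j)))" for r :: "nat \<times> nat set"
  have hh: "K.ip h h = (\<Sum>r\<in>R. of_real (s r) * w r)"
  proof -
    have "K.ip h h = (\<Sum>i<n. cnj (c i) * K.ip (kstep (A i) (y i)) h)"
      by (subst (1) h_def, subst K.inner_hsum_left) (use A ka_carrier[OF step_bm] h in \<open>auto simp: kstep_def K.closed K.inner_simps\<close>)
    also have "\<dots> = (\<Sum>i<n. cnj (c i) * (\<Sum>r\<in>R. of_real (s r) * (\<Sum>j\<le>n. \<gamma> (snd r) j * \<kappa> (if i \<in> snd r then y i else 0) (y' j))))"
    proof (intro sum.cong refl arg_cong2[of _ _ _ _ "(*)"])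
      fix i assume i: "i \<in> {..<n}"
      show "K.ip (kstep (A i) (y i)) h = (\<Sum>r\<in>R. of_real (s r) * (\<Sum>j\<le>n. \<gamma> (snd r) j * \<kappa> (if i \<in> snd r then y i else 0) (y' j)))"
        unfolding kstep_def by (rule inner_h) (use A i in \<open>auto simp: E_def intro!: step_bm\<close>)
    qed
    also have "\<dots> = (\<Sum>i<n. \<Sum>r\<in>R. of_real (s r) * cnj ((if i \<in> snd r then c i else 0) * cnj (\<Sum>j\<le>n. \<gamma> (snd r) j * \<kappa> (y i) (y' j))))"
      unfolding sum_distrib_left[of "cnj _"] by (intro sum.cong refl) (auto simp: \<kappa>0)
    also have "\<dots> = (\<Sum>r\<in>R. of_real (s r) * cnj (\<Sum>i<n. (if i \<in> snd r then c i else 0) * cnj (\<Sum>j\<le>n. \<gamma> (snd r) j * \<kappa> (y i) (y' j))))"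
      by (subst sum.swap) (simp only: sum_distrib_left cnj_sum)
    also have "\<dots> = (\<Sum>r\<in>R. of_real (s r) * w r)" unfolding w_def
    proof (intro sum.cong refl arg_cong2[of _ _ _ _ "(*)"])
      fix r
      show "cnj (\<Sum>i<n. (if i \<in> snd r then c i else 0) * cnj (\<Sum>j\<le>n. \<gamma> (snd r) j * \<kappa> (y i) (y' j))) =
          (\<Sum>i\<le>n. cnj (\<gamma> (snd r) i) * (\<Sum>j\<le>n. \<gamma> (snd r) j * \<kappa> (y' i) (y' j)))"
        by (subst sum_n[where f="\<lambda>z. cnj (\<Sum>j\<le>n. \<gamma> (snd r) j * \<kappa> z (y' j))"]) (simp_all add: \<kappa>0 del: cnj_sum, simp)
    qed
    finally show ?thesis .
  qed
  define PI where "PI = PiE R (\<lambda>_. {..n})"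
  have PI: "finite PI" unfolding PI_def using R by (intro finite_PiE) auto
  have aa: "K.ip (ka (a f)) (ka (a g)) = (\<Sum>r\<in>R. of_real (s r) * \<kappa> (y' (f r)) (y' (g r)))" for f g
    unfolding ka_inner[OF abm abm]
  proof (rule cell)
    fix r x assume r: "r \<in> R" "x \<in> E r"
    show "\<kappa> (a f x) (a g x) = \<kappa> (y' (f r)) (y' (g r))" by (simp add: av[OF r])
  qed
  have ah: "K.ip (ka (a f)) h = (\<Sum>r\<in>R. of_real (s r) * (\<Sum>j\<le>n. \<gamma> (snd r) j * \<kappa> (y' (f r)) (y' j)))" for f
    by (rule inner_h[OF abm]) (erule (1) av)
  \<comment> \<open>The tensor product over the cells of the affine combinations of exponentials,
    multiplied out over all choice functions. Each term is an exponential vector of a bounded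
    function, which puts \<open>u\<close> into the span.\<close>
  define u where "u = hsum (EXP K) (\<lambda>f. hscale (EXP K) (\<Prod>r\<in>R. \<gamma> (snd r) (f r)) (K.expv (ka (a f)))) PI"
  have ec: "K.expv (ka (a f)) \<in> F.V" for f by (rule expv_carrier[OF ka_carrier[OF abm]])
  have ecl: "\<forall>f\<in>PI. hscale (EXP K) (\<Prod>r\<in>R. \<gamma> (snd r) (f r)) (K.expv (ka (a f))) \<in> F.V" using ec by (simp add: F.closed)
  have u: "u \<in> F.V" unfolding u_def by (rule F.hsum_closed[OF PI ecl])
  have bsub: "(\<lambda>a. K.expv (ka a)) ` bm \<subseteq> F.V" using expv_carrier ka_carrier by blast
  have uspan: "u \<in> hspan (EXP K) ((\<lambda>a. K.expv (ka a)) ` bm)" unfolding u_def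
  proof (rule F.hsum_in_subspace[OF F.hspan_subspace[OF bsub] PI])
    fix f
    have "K.expv (ka (a f)) \<in> hspan (EXP K) ((\<lambda>a. K.expv (ka a)) ` bm)" by (rule F.hspan_base[OF bsub]) (use abm in blast)
    then show "hscale (EXP K) (\<Prod>r\<in>R. \<gamma> (snd r) (f r)) (K.expv (ka (a f))) \<in> hspan (EXP K) ((\<lambda>a. K.expv (ka a)) ` bm)"
      using F.hspan_subspace[OF bsub] by (simp add: hsubspace_def)
  qed
  have ue: "F.ip u z = (\<Sum>f\<in>PI. cnj (\<Prod>r\<in>R. \<gamma> (snd r) (f r)) * F.ip (K.expv (ka (a f))) z)" if "z \<in> F.V" for z
    unfolding u_def using that ec by (subst F.inner_hsum_left[OF PI ecl]) (auto simp: F.inner_simps)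
  have eh: "K.expv h \<in> F.V" by (rule expv_carrier[OF h])
  define P where "P = (\<Prod>r\<in>R. exp (of_real (s r) * w r))"
  have PP: "F.ip (K.expv h) (K.expv h) = P" using R by (simp add: K.expv_inner[OF h h] hh P_def exp_sum)
  define g2 where "g2 r = (\<Sum>i\<le>n. cnj (\<gamma> (snd r) i) * exp (of_real (s r) * (\<Sum>j\<le>n. \<gamma> (snd r) j * \<kappa> (y' i) (y' j))))" for r :: "nat \<times> nat set"
  have I2: "F.ip u (K.expv h) = (\<Prod>r\<in>R. g2 r)"
  proof -
    have "F.ip u (K.expv h) = (\<Sum>f\<in>PI. \<Prod>r\<in>R. cnj (\<gamma> (snd r) (f r)) * exp (of_real (s r) * (\<Sum>j\<le>n. \<gamma> (snd r) j * \<kappa> (y' (f r)) (y' j))))"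
      unfolding ue[OF eh] using R by (simp add: K.expv_inner[OF ka_carrier[OF abm] h] ah exp_sum prod.distrib cnj_prod)
    also have "\<dots> = (\<Prod>r\<in>R. g2 r)" unfolding PI_def g2_def using R by (subst prod_sum_PiE) auto
    finally show ?thesis .
  qed
  define g1 where "g1 r = (\<Sum>i\<le>n. \<Sum>j\<le>n. cnj (\<gamma> (snd r) i) * \<gamma> (snd r) j * exp (of_real (s r) * \<kappa> (y' i) (y' j)))" for r :: "nat \<times> nat set"
  have I1: "F.ip u u = (\<Prod>r\<in>R. g1 r)"
  proof -
    have "F.ip (K.expv (ka (a f))) u = (\<Sum>g\<in>PI. (\<Prod>r\<in>R. \<gamma> (snd r) (g r)) * exp (\<Sum>r\<in>R. of_real (s r) * \<kappa> (y' (f r)) (y' (g r))))" for f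
      unfolding u_def using ec by (subst F.inner_hsum[OF PI ecl]) (auto simp: F.inner_simps K.expv_inner[OF ka_carrier[OF abm] ka_carrier[OF abm]] aa)
    then have "F.ip u u = (\<Sum>f\<in>PI. cnj (\<Prod>r\<in>R. \<gamma> (snd r) (f r)) * (\<Sum>g\<in>PI. (\<Prod>r\<in>R. \<gamma> (snd r) (g r)) * exp (\<Sum>r\<in>R. of_real (s r) * \<kappa> (y' (f r)) (y' (g r)))))"
      by (simp add: ue[OF u])
    also have "\<dots> = (\<Sum>f\<in>PI. \<Sum>g\<in>PI. \<Prod>r\<in>R. cnj (\<gamma> (snd r) (f r)) * \<gamma> (snd r) (g r) * exp (of_real (s r) * \<kappa> (y' (f r)) (y' (g r))))"
      using R by (simp add: sum_distrib_left prod.distrib exp_sum cnj_prod mult.assoc)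
    also have "\<dots> = (\<Prod>r\<in>R. g1 r)"
      unfolding PI_def g1_def by (rule double_prod_sum[OF R, where X="\<lambda>r i j. cnj (\<gamma> (snd r) i) * \<gamma> (snd r) j * exp (of_real (s r) * \<kappa> (y' i) (y' j))"]) simp
    finally show ?thesis .
  qed
  have s1: "0 \<le> s r \<and> s r \<le> 1" if "r \<in> R" for r using s0 s\<delta>[OF that] by (simp add: \<delta>_def)
  have mono: "A * (exp l * l^2) * t \<le> B * t" if "0 \<le> A" "A \<le> \<Gamma> * \<Gamma>" "0 \<le> l" "l \<le> L" "0 \<le> t" for A l t
    unfolding B_def using that by (intro mult_right_mono mult_mono power_mono) auto
  have cn: "(\<Sum>i\<le>n. cmod (cnj (\<gamma> (snd r) i))) \<le> \<Gamma>" for r using \<gamma>b by simp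
  have inn_b: "cmod (\<Sum>j\<le>n. \<gamma> (snd r) j * \<kappa> (y' i) (y' j)) \<le> \<Gamma> * L0" if "i \<le> n" for r i
  proof -
    have "cmod (\<Sum>j\<le>n. \<gamma> (snd r) j * \<kappa> (y' i) (y' j)) \<le> (\<Sum>j\<le>n. cmod (\<gamma> (snd r) j) * L0)"
      by (rule sum_norm_le) (use L0 that in \<open>auto simp: norm_mult intro!: mult_left_mono\<close>)
    also have "\<dots> \<le> \<Gamma> * L0" unfolding sum_distrib_right[symmetric] by (rule mult_right_mono[OF \<gamma>b L00])
    finally show ?thesis .
  qed
  have wb: "cmod (w r) \<le> L" for r
  proof -
    have "cmod (w r) \<le> (\<Sum>i\<le>n. cmod (\<gamma> (snd r) i) * (\<Gamma> * L0))"
      unfolding w_def by (rule sum_norm_le) (use inn_b in \<open>auto simp: norm_mult intro!: mult_left_mono\<close>)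
    also have "\<dots> \<le> \<Gamma> * (\<Gamma> * L0)" unfolding sum_distrib_right[symmetric] using \<Gamma> L00 by (intro mult_right_mono \<gamma>b) auto
    finally show ?thesis by (simp add: L_def mult.assoc)
  qed
  have G2: "cmod (g2 r - 1 - of_real (s r) * w r) \<le> B * (s r)^2" if r: "r \<in> R" for r
  proof -
    have "cmod (g2 r - 1 - of_real (s r) * w r) \<le> \<Gamma> * (exp (\<Gamma> * L0) * (\<Gamma> * L0)^2) * (s r)^2" unfolding g2_def w_def
    proof (rule affine_exp_sum)
      show "(\<Sum>i\<le>n. cnj (\<gamma> (snd r) i)) = 1" using \<gamma>1[of "snd r"] by (metis cnj_sum complex_cnj_one)
    qed (use cn inn_b s1[OF r] \<Gamma> L00 in auto)
    also have "\<dots> \<le> B * (s r)^2" using \<Gamma> \<Gamma>2 LL L00 by (intro mono) auto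
    finally show ?thesis .
  qed
  have G3: "cmod (exp (of_real (s r) * w r) - 1 - of_real (s r) * w r) \<le> B * (s r)^2" if r: "r \<in> R" for r
  proof -
    \<comment> \<open>An index set with one element and weight \<open>1\<close> turns
      \<open>affine_exp_sum\<close> into the Taylor estimate for
      \<open>exp (of_real (s r) * w r)\<close>.\<close>
    have "cmod ((\<Sum>i\<in>{()}. 1 * exp (of_real (s r) * w r)) - 1 - of_real (s r) * (\<Sum>i\<in>{()}. 1 * w r)) \<le> 1 * (exp L * L^2) * (s r)^2"
      by (rule affine_exp_sum) (use wb s1[OF r] LL in auto)
    also have "\<dots> \<le> B * (s r)^2" using \<Gamma>2 LL by (intro mono) auto
    finally show ?thesis by simp
  qed
  have G1: "cmod (g1 r - 1 - of_real (s r) * w r) \<le> B * (s r)^2" if r: "r \<in> R" for r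
  proof -
    \<comment> \<open>Both arguments of \<open>F.ip u u\<close> are combinations, so the weights are
      products over pairs of indices; they again sum to \<open>1\<close>.\<close>
    let ?\<alpha> = "\<lambda>(i, j). cnj (\<gamma> (snd r) i) * \<gamma> (snd r) j" and ?v = "\<lambda>(i, j). \<kappa> (y' i) (y' j)"
    have 1: "g1 r = (\<Sum>p\<in>{..n} \<times> {..n}. ?\<alpha> p * exp (of_real (s r) * ?v p))"
      unfolding g1_def sum.cartesian_product by (intro sum.cong refl) auto
    have 2: "w r = (\<Sum>p\<in>{..n} \<times> {..n}. ?\<alpha> p * ?v p)"
      unfolding w_def sum_distrib_left sum.cartesian_product by (intro sum.cong refl) auto
    have 3: "(\<Sum>p\<in>{..n} \<times> {..n}. ?\<alpha> p) = (\<Sum>i\<le>n. cnj (\<gamma> (snd r) i)) * (\<Sum>j\<le>n. \<gamma> (snd r) j)"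
      unfolding sum_product sum.cartesian_product by (rule refl)
    have 4: "(\<Sum>p\<in>{..n} \<times> {..n}. cmod (?\<alpha> p)) = (\<Sum>i\<le>n. cmod (\<gamma> (snd r) i)) * (\<Sum>j\<le>n. cmod (\<gamma> (snd r) j))"
      unfolding sum_product sum.cartesian_product by (intro sum.cong refl) (auto simp: norm_mult)
    have "cmod (g1 r - 1 - of_real (s r) * w r) \<le> (\<Gamma> * \<Gamma>) * (exp L0 * L0^2) * (s r)^2" unfolding 1 2
    proof (rule affine_exp_sum)
      show "(\<Sum>p\<in>{..n} \<times> {..n}. ?\<alpha> p) = 1" unfolding 3 \<gamma>1 using \<gamma>1[of "snd r"] by (metis cnj_sum complex_cnj_one mult_1_right)
      show "(\<Sum>p\<in>{..n} \<times> {..n}. cmod (?\<alpha> p)) \<le> \<Gamma> * \<Gamma>" unfolding 4 using \<gamma>b \<Gamma> by (intro mult_mono sum_nonneg) auto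
    qed (use L0 s1[OF r] L00 in auto)
    also have "\<dots> \<le> B * (s r)^2" using \<Gamma>2 LL L00 by (intro mono) auto
    finally show ?thesis .
  qed
  define bd where "bd = exp ((L + B) * m) * (2 * B * m * \<delta>)"
  have bd: "exp ((L + B) * (\<Sum>r\<in>R. s r)) * (\<Sum>r\<in>R. 2 * B * (s r)^2) \<le> bd"
  proof -
    have "(\<Sum>r\<in>R. 2 * B * (s r)^2) \<le> (\<Sum>r\<in>R. 2 * B * (s r * \<delta>))"
      using B s0 s\<delta> by (intro sum_mono mult_left_mono) (auto simp: power2_eq_square intro!: mult_left_mono)
    also have "\<dots> = 2 * B * (m * \<delta>)" by (simp add: sum_distrib_left[symmetric] sum_distrib_right[symmetric] sm)
    finally show ?thesis unfolding bd_def sm by (intro mult_left_mono) (simp_all add: mult.assoc)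
  qed
  have D1: "cmod (F.ip u u - P) \<le> bd" unfolding I1 P_def by (rule order_trans[OF prod_exp_approx[OF R s1 G1 G3 wb B] bd])
  have D2: "cmod (F.ip u (K.expv h) - P) \<le> bd"
    unfolding I2 P_def by (rule order_trans[OF prod_exp_approx[OF R s1 G2 G3 wb B] bd])
  \<comment> \<open>All three inner products in the expansion of the distance are compared with
    \<open>P\<close>, the exact value of the last one, so only the two deviations remain.\<close>
  have "(hdist (EXP K) u (K.expv h))^2 = Re (F.ip u u - P) - 2 * Re (F.ip u (K.expv h) - P)"
    using F.hdist_sq[OF u eh] by (simp add: F.hnorm_sq u eh PP)
  also have "\<dots> \<le> bd + 2 * bd"
    using D1 D2 abs_Re_le_cmod[of "F.ip u u - P"] abs_Re_le_cmod[of "F.ip u (K.expv h) - P"] by linarith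
  also have "\<dots> = 3 * (exp ((L + B) * m) * (2 * B * m)) * \<delta>" by (simp add: bd_def)
  also have "\<dots> < \<epsilon>^2"
  proof -
    define q where "q = 3 * (exp ((L + B) * m) * (2 * B * m))"
    have q: "q \<ge> 0" using den by (simp add: q_def)
    have "q * \<delta> \<le> q * (\<epsilon>^2 / (q + 1))" unfolding \<delta>_def q_def[symmetric] using q by (intro mult_left_mono) auto
    also have "\<dots> < \<epsilon>^2" using q e by (simp add: field_simps)
    finally show ?thesis by (simp add: q_def)
  qed
  finally have "hdist (EXP K) u (K.expv h) < \<epsilon>" using e by (simp add: power2_less_imp_less)
  then show ?thesis using uspan by blast
qed

text \<open>Orthogonality spreads in three steps: from the exponentials of \<open>ka a\<close> to
  those of all combinations of step functions by \<open>expv_step_approx\<close>, from there to all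
  exponential vectors by density and \<open>expv_tendsto\<close>, and then \<open>expv_total\<close>
  applies.\<close>

theorem expv_ka_total: "total_in (EXP K) ((\<lambda>a. K.expv (ka a)) ` bm)" unfolding total_in_def
proof (intro conjI ballI impI)
  show bsub: "(\<lambda>a. K.expv (ka a)) ` bm \<subseteq> F.V" using expv_carrier ka_carrier by blast
  fix \<Phi> assume \<Phi>: "\<Phi> \<in> F.V"
    and orth: "\<forall>w\<in>(\<lambda>a. K.expv (ka a)) ` bm. F.ip w \<Phi> = 0"
  have sp: "F.ip u \<Phi> = 0" if "u \<in> hspan (EXP K) ((\<lambda>a. K.expv (ka a)) ` bm)" for u using that
  proof induction
    case zero
    show ?case using \<Phi> by (rule F.inner_zero_left)
  next
    case (step x w c)
    then show ?case using F.hspan_closed[OF bsub step(1)] bsub \<Phi> orth by (auto simp: F.inner_simps)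
  qed
  have step: "F.ip (K.expv h) \<Phi> = 0" if h: "h \<in> hspan K {kstep A y | A y. A \<in> sets M}" for h
  proof -
    have sub: "{kstep A y | A y. A \<in> sets M} \<subseteq> K.V" using kstep_total by (simp add: total_in_def)
    obtain n :: nat and c d where d: "\<And>i. i < n \<Longrightarrow> d i \<in> {kstep A y | A y. A \<in> sets M}"
      "h = hsum K (\<lambda>i. hscale K (c i) (d i)) {..<n}"
      by (rule K.hspan_finite[OF sub h]) (rule that[rotated], assumption, blast)
    have "\<forall>i. \<exists>A y. i < n \<longrightarrow> A \<in> sets M \<and> d i = kstep A y" using d(1) by blast
    then obtain A y where Ay: "\<And>i. i < n \<Longrightarrow> A i \<in> sets M" "\<And>i. i < n \<Longrightarrow> d i = kstep (A i) (y i)" by metis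
    have hK: "h \<in> K.V" by (rule K.hspan_closed[OF sub h])
    have heq: "h = hsum K (\<lambda>i. hscale K (c i) (kstep (A i) (y i))) {..<n}" unfolding d(2) hsum_def using Ay(2) by simp
    have "cmod (F.ip (K.expv h) \<Phi>) \<le> \<epsilon> * F.nm \<Phi>" if e: "0 < \<epsilon>" for \<epsilon>
    proof -
      obtain u where u: "u \<in> hspan (EXP K) ((\<lambda>a. K.expv (ka a)) ` bm)" "hdist (EXP K) u (K.expv h) < \<epsilon>"
      proof -
        have "\<exists>u\<in>hspan (EXP K) ((\<lambda>a. K.expv (ka a)) ` bm). hdist (EXP K) u (K.expv h) < \<epsilon>"
          unfolding heq by (rule expv_step_approx) (use Ay(1) e in auto)
        then show thesis using that by (elim bexE)
      qed
      have uc: "u \<in> F.V" by (rule F.hspan_closed[OF bsub u(1)])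
      have "cmod (F.ip u \<Phi> - F.ip (K.expv h) \<Phi>) \<le>
          hdist (EXP K) u (K.expv h) * F.nm \<Phi> + F.nm (K.expv h) * hdist (EXP K) \<Phi> \<Phi>"
        by (rule F.inner_diff_le[OF uc expv_carrier[OF hK] \<Phi> \<Phi>])
      also have "\<dots> \<le> \<epsilon> * F.nm \<Phi>" using u(2) F.hnorm_nonneg[OF \<Phi>] by (simp add: F.hdist_zero[OF \<Phi>] mult_right_mono)
      finally show ?thesis by (simp add: sp[OF u(1)])
    qed
    note le = this
    have "cmod (F.ip (K.expv h) \<Phi>) \<le> 0 + t" if t: "0 < t" for t
    proof -
      have nn: "F.nm \<Phi> \<ge> 0" by (rule F.hnorm_nonneg[OF \<Phi>])
      have "cmod (F.ip (K.expv h) \<Phi>) \<le> t / (F.nm \<Phi> + 1) * F.nm \<Phi>" using t nn by (intro le) auto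
      also have "\<dots> \<le> t" using t nn by (simp add: field_simps)
      finally show ?thesis by simp
    qed
    then have "cmod (F.ip (K.expv h) \<Phi>) \<le> 0" by (rule field_le_epsilon)
    then show ?thesis by simp
  qed
  have "F.ip (K.expv h) \<Phi> = 0" if h: "h \<in> K.V" for h
  proof -
    obtain u where u: "\<And>n::nat. u n \<in> hspan K {kstep A y | A y. A \<in> sets M}" "\<And>n. u n \<in> K.V" "hconv K u h"
      using K.total_dense[OF kstep_total h] by blast
    have "(\<lambda>n. F.ip (K.expv (u n)) \<Phi>) \<longlonglongrightarrow> F.ip (K.expv h) \<Phi>" by (rule F.inner_tendsto[OF _ _ K.expv_tendsto[OF u(2) h u(3)]])
        (use expv_carrier u(2) h \<Phi> in \<open>auto simp: F.hdist_zero\<close>)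
    then show ?thesis using step[OF u(1)] by (simp add: LIMSEQ_const_iff)
  qed
  then show "\<Phi> = hzero (EXP K)" using K.expv_total \<Phi> by (auto simp: total_in_def)
qed

end

section \<open>The homogeneous Fock factorization\<close>

lemma prod_list_nths:
  fixes g :: "'a \<Rightarrow> 'b::comm_monoid_mult"
  assumes "J \<subseteq> {..<length l}"
  shows "prod_list (map g (nths l J)) = (\<Prod>i\<in>J. g (l ! i))"
proof -
  have "prod_list (map g (nths l J)) = (\<Prod>i<length l. if i \<in> J then g (l ! i) else 1)"
  proof (induction l rule: rev_induct)
    case (snoc x xs)
    have "(\<Prod>i<length xs. if i \<in> J then g ((xs @ [x]) ! i) else 1) = (\<Prod>i<length xs. if i \<in> J then g (xs ! i) else 1)"
      by (intro prod.cong refl) (auto simp: nth_append)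
    then show ?case by (simp add: snoc nths_append)
  qed simp
  also have "\<dots> = (\<Prod>i\<in>{..<length l} \<inter> J. g (l ! i))" by (simp add: prod.inter_restrict)
  finally show ?thesis using assms by (simp add: Int_absorb1)
qed

context complex_hilbert_space
begin

lemma fv_pointwise:
  assumes u: "\<And>n. u n \<in> fock_vectors H" and \<Phi>: "\<Phi> \<in> fock_vectors H" and c: "hconv (EXP H) u \<Phi>"
  shows "(\<lambda>n. u n l) \<longlonglongrightarrow> \<Phi> l"
proof (cases "l \<in> LH")
  case True
  have "(\<lambda>n. u n l - \<Phi> l) \<longlonglongrightarrow> 0"
  proof (rule Lim_null_comparison)
    have "cmod (u n l - \<Phi> l) \<le> prod_list (map (nm) l) * hdist (EXP H) (u n) \<Phi>" for n
      using fv_eval[OF fock_dist(3)[OF u \<Phi>] True, of n] fock_dist(2)[OF u \<Phi>, of n]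
      by (simp add: fock_dist(1)[OF u \<Phi>, symmetric])
    then show "\<forall>\<^sub>F n in sequentially. cmod (u n l - \<Phi> l) \<le> prod_list (map (nm) l) * hdist (EXP H) (u n) \<Phi>"
      by (intro always_eventually allI)
    show "(\<lambda>n. prod_list (map (nm) l) * hdist (EXP H) (u n) \<Phi>) \<longlonglongrightarrow> 0" using tendsto_mult_right_zero[OF c] .
  qed
  then show ?thesis by (rule LIM_zero_cancel)
next
  case False
  then show ?thesis using u \<Phi> by (simp add: fv_outside)
qed

text \<open>The formula for \<open>fock_tensor\<close> makes sense for arbitrary functionals, but
  that it yields Fock vectors with the right inner products is known only on exponential vectors.
  Linearity and pointwise continuity in one argument extend both facts from a total set to the whole
  space. The index \<open>i\<close> stands for the other argument, and pairs of indices are needed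
  for inner products; the lemma is applied once for each argument.\<close>

lemma fock_extension:
  fixes H1 :: "'a hilbert" and f :: "'i \<Rightarrow> 'a \<Rightarrow> 'v list \<Rightarrow> complex"
  assumes H1: "complex_hilbert_space H1" and D: "total_in H1 D"
    and zero: "\<And>i. i \<in> I \<Longrightarrow> f i (hzero H1) = (\<lambda>l. 0)"
    and lin: "\<And>i x y c. \<lbrakk>i \<in> I; x \<in> hcarrier H1; y \<in> hcarrier H1\<rbrakk> \<Longrightarrow>
      f i (hadd H1 x (hscale H1 c y)) = (\<lambda>l. f i x l + c * f i y l)"
    and base: "\<And>i x. \<lbrakk>i \<in> I; x \<in> D\<rbrakk> \<Longrightarrow> f i x \<in> fock_vectors H"
    and inner: "\<And>i j x y. \<lbrakk>i \<in> I; j \<in> I; x \<in> D; y \<in> D\<rbrakk> \<Longrightarrow>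
      hinner (EXP H) (f i x) (f j y) = g i j * hinner H1 x y"
    and cont: "\<And>i u x l. \<lbrakk>i \<in> I; \<And>n. u n \<in> hcarrier H1; x \<in> hcarrier H1; hconv H1 u x\<rbrakk> \<Longrightarrow>
      (\<lambda>n. f i (u n) l) \<longlonglongrightarrow> f i x l"
  shows "\<lbrakk>i \<in> I; x \<in> hcarrier H1\<rbrakk> \<Longrightarrow> f i x \<in> fock_vectors H"
    and "\<lbrakk>i \<in> I; j \<in> I; x \<in> hcarrier H1; y \<in> hcarrier H1\<rbrakk> \<Longrightarrow>
      hinner (EXP H) (f i x) (f j y) = g i j * hinner H1 x y"
proof -
  interpret H1: complex_hilbert_space H1 by (rule H1)
  interpret F: complex_hilbert_space "EXP H" by (rule hilbert_fock)
  have Dc: "D \<subseteq> hcarrier H1" using D by (simp add: total_in_def)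
  have car: "hcarrier (EXP H) = fock_vectors H" by (simp add: fock_space_def)
  have z: "f i (hzero H1) = hzero (EXP H)" if "i \<in> I" for i using zero[OF that] by (simp add: fock_space_def)
  have l: "f i (hadd H1 x (hscale H1 c y)) = hadd (EXP H) (f i x) (hscale (EXP H) c (f i y))"
    if "i \<in> I" "x \<in> hcarrier H1" "y \<in> hcarrier H1" for i x y c using lin[OF that] by (simp add: fock_space_def)
  note sc = H1.hspan_closed[OF Dc]
  have s: "f i x \<in> hcarrier (EXP H)" if "i \<in> I" "x \<in> hspan H1 D" for i x using that(2)
  proof induction
    case zero
    show ?case using z[OF that(1)] F.zero_closed by simp
  next
    case (step x w c)
    then show ?case using l[OF that(1) sc[OF step(1)]] Dc base[OF that(1)] by (auto simp: F.closed car[symmetric])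
  qed
  have b: "f i w \<in> hcarrier (EXP H)" if "i \<in> I" "w \<in> D" for i w using base[OF that] by (simp add: car)
  have i1: "hinner (EXP H) (f i x) (f j y) = g i j * hinner H1 x y" if "i \<in> I" "j \<in> I" "x \<in> D" "y \<in> hspan H1 D" for i j x y
    using that(4)
  proof induction
    case zero
    show ?case using z[OF that(2)] b[OF that(1,3)] Dc that(3) by (auto simp: F.inner_simps H1.inner_simps)
  next
    case (step y w c)
    have w: "w \<in> hcarrier H1" using step(2) Dc by blast
    have x: "x \<in> hcarrier H1" using that(3) Dc by blast
    show ?case
      using b[OF that(1,3)] s[OF that(2) step(1)] b[OF that(2) step(2)] step sc[OF step(1)] w x inner[OF that(1-3) step(2)]
      by (simp add: l[OF that(2) sc[OF step(1)] w] F.inner_simps H1.inner_simps algebra_simps)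
  qed
  have i2: "hinner (EXP H) (f i x) (f j y) = g i j * hinner H1 x y"
    if "i \<in> I" "j \<in> I" "x \<in> hspan H1 D" "y \<in> hspan H1 D" for i j x y using that(3)
  proof induction
    case zero
    show ?case using z[OF that(1)] s[OF that(2,4)] sc[OF that(4)] by (auto simp: F.inner_simps H1.inner_simps)
  next
    case (step x w c)
    have w: "w \<in> hcarrier H1" using step(2) Dc by blast
    show ?case
      using b[OF that(1) step(2)] s[OF that(1) step(1)] s[OF that(2,4)] step sc[OF step(1)] sc[OF that(4)] w i1[OF that(1,2) step(2) that(4)]
      by (simp add: l[OF that(1) sc[OF step(1)] w] F.inner_simps H1.inner_simps algebra_simps)
  qed
  have d: "(hdist (EXP H) (f i x) (f i y))^2 = Re (g i i * of_real ((hdist H1 x y)^2))"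
    if "i \<in> I" "x \<in> hspan H1 D" "y \<in> hspan H1 D" for i x y
  proof -
    define v where "v = hsub H1 x y"
    have v: "v \<in> hspan H1 D" using H1.hspan_subspace[OF Dc] that(2,3) by (simp add: v_def hsubspace_def)
    have e: "f i v = hsub (EXP H) (f i x) (f i y)" unfolding v_def by (rule l[OF that(1) sc[OF that(2)] sc[OF that(3)]])
    have "(hdist (EXP H) (f i x) (f i y))^2 = Re (hinner (EXP H) (f i v) (f i v))"
      unfolding hdist_def e[symmetric] by (rule F.hnorm_sq[OF s[OF that(1) v]])
    also have "\<dots> = Re (g i i * hinner H1 v v)" by (simp only: i2[OF that(1,1) v v])
    also have "hinner H1 v v = of_real ((hdist H1 x y)^2)"
      using H1.hnorm_sq[OF sc[OF v]] H1.inner_commute[OF sc[OF v] sc[OF v]]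
      by (auto simp: hdist_def v_def[symmetric] complex_eq_iff)
    finally show ?thesis .
  qed
  have ex: "\<exists>u. (\<forall>n. u n \<in> hspan H1 D) \<and> hconv H1 u x" if x: "x \<in> hcarrier H1" for x by (rule H1.total_dense[OF D x]) blast
  have lim: "f i x \<in> hcarrier (EXP H) \<and> hconv (EXP H) (\<lambda>n. f i (u n)) (f i x)"
    if i: "i \<in> I" and u: "\<And>n. u n \<in> hspan H1 D" and x: "x \<in> hcarrier H1" and c: "hconv H1 u x" for i u x
  proof -
    \<comment> \<open>Any number that is at least \<open>1\<close> and at least
      \<open>Re (g i i)\<close> would do: it gives \<open>Re (g i i) * h^2 \<le> (t * h)^2\<close>
      whatever the sign of \<open>Re (g i i)\<close>.\<close>
    define t where "t = \<bar>Re (g i i)\<bar> + 1"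
    have t: "t > 0" and t1: "1 \<le> t" by (simp_all add: t_def add_nonneg_pos)
    have "\<exists>N. \<forall>m\<ge>N. \<forall>n\<ge>N. hdist (EXP H) (f i (u m)) (f i (u n)) < \<epsilon>" if e: "0 < \<epsilon>" for \<epsilon>
    proof -
      have "0 < \<epsilon> / t" using e t by simp
      then obtain N where N: "\<And>m n. m \<ge> N \<Longrightarrow> n \<ge> N \<Longrightarrow> hdist H1 (u m) (u n) < \<epsilon> / t"
        using H1.hconv_imp_Cauchy[OF sc[OF u] x c] by blast
      have "hdist (EXP H) (f i (u m)) (f i (u n)) < \<epsilon>" if mn: "m \<ge> N" "n \<ge> N" for m n
      proof (rule power2_less_imp_less)
        let ?h = "hdist H1 (u m) (u n)"
        have h: "0 \<le> ?h" by (rule H1.hdist_nonneg[OF sc[OF u] sc[OF u]])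
        have "(hdist (EXP H) (f i (u m)) (f i (u n)))^2 = Re (g i i) * ?h^2" by (simp add: d[OF i u u])
        also have "\<dots> \<le> t * ?h^2" by (rule mult_right_mono) (simp_all add: t_def)
        also have "\<dots> \<le> t^2 * ?h^2" by (rule mult_right_mono[OF self_le_power[OF t1]]) simp_all
        also have "\<dots> = (t * ?h)^2" by (simp add: power_mult_distrib)
        also have "\<dots> < \<epsilon>^2" using N[OF mn] t h by (intro power_strict_mono) (auto simp: field_simps)
        finally show "(hdist (EXP H) (f i (u m)) (f i (u n)))^2 < \<epsilon>^2" .
      qed (use e in simp)
      then show ?thesis by blast
    qed
    from F.complete[OF s[OF i u] this] obtain Z where Z: "Z \<in> hcarrier (EXP H)" "hconv (EXP H) (\<lambda>n. f i (u n)) Z" by blast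
    \<comment> \<open>The norm limit is also a pointwise limit, and by \<open>cont\<close> the
      pointwise limit is the value of the formula at \<open>x\<close>. This is what shows that
      \<open>f i x\<close> is a Fock vector.\<close>
    have "f i x = Z"
    proof
      fix l
      have "(\<lambda>n. f i (u n) l) \<longlonglongrightarrow> Z l" by (rule fv_pointwise[OF _ _ Z(2)]) (use s[OF i u] Z(1) in \<open>simp_all add: car\<close>)
      with cont[OF i sc[OF u] x c, of l] show "f i x l = Z l" by (rule LIMSEQ_unique)
    qed
    then show ?thesis using Z by simp
  qed
  show "f i x \<in> fock_vectors H" if "i \<in> I" "x \<in> hcarrier H1"
    using ex[OF that(2)] lim[OF that(1) _ that(2)] by (auto simp: car)
  show "hinner (EXP H) (f i x) (f j y) = g i j * hinner H1 x y"
    if i: "i \<in> I" and j: "j \<in> I" and x: "x \<in> hcarrier H1" and y: "y \<in> hcarrier H1"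
  proof -
    obtain u v where u: "\<And>n. u n \<in> hspan H1 D" "hconv H1 u x" and v: "\<And>n. v n \<in> hspan H1 D" "hconv H1 v y"
      using ex[OF x] ex[OF y] by blast
    have "(\<lambda>n. hinner (EXP H) (f i (u n)) (f j (v n))) \<longlonglongrightarrow> hinner (EXP H) (f i x) (f j y)"
      by (rule F.inner_tendsto) (use lim[OF i u(1) x u(2)] lim[OF j v(1) y v(2)] s[OF i u(1)] s[OF j v(1)] in blast)+
    moreover have "(\<lambda>n. g i j * hinner H1 (u n) (v n)) \<longlonglongrightarrow> g i j * hinner H1 x y"
      by (intro tendsto_mult_left H1.inner_tendsto sc u v x y)
    ultimately show ?thesis unfolding i2[OF i j u(1) v(1)] by (rule LIMSEQ_unique)
  qed
qed

end

section \<open>Cutting the base space in two\<close>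

lemma bm_restrict: "a \<in> bounded_measurable M \<Longrightarrow> a \<in> bounded_measurable (restrict_space M A)"
  by (auto simp: bounded_measurable_def space_restrict_space intro: measurable_restrict_space1)

lemma bm_extend:
  assumes A: "A \<in> sets M" and a: "a \<in> bounded_measurable (restrict_space M A)"
  shows "(\<lambda>x. if x \<in> A then a x else 0) \<in> bm_on M A"
proof -
  have AS: "A \<inter> space M = A" using sets.sets_into_space[OF A] by blast
  obtain C where C: "\<And>x. x \<in> A \<Longrightarrow> \<bar>a x\<bar> \<le> C"
    using a sets.sets_into_space[OF A] by (auto simp: bounded_measurable_def space_restrict_space)
  have "(\<lambda>x. if x \<in> A then a x else 0) \<in> borel_measurable M"
  proof -
    have "(\<lambda>x. indicator A x *\<^sub>R a x) \<in> borel_measurable M"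
      using a A AS borel_measurable_restrict_space_iff[of A M a] by (simp add: bounded_measurable_def)
    also have "(\<lambda>x. indicator A x *\<^sub>R a x) = (\<lambda>x. if x \<in> A then a x else 0)" by auto
    finally show ?thesis .
  qed
  moreover have "\<bar>if x \<in> A then a x else 0\<bar> \<le> \<bar>C\<bar>" for x using C[of x] by auto
  ultimately have "(\<lambda>x. if x \<in> A then a x else 0) \<in> bounded_measurable M" unfolding bounded_measurable_def by blast
  then show ?thesis by (simp add: bm_on_def)
qed

locale levy_fock_cut = levy_fock H k \<kappa> C M for H :: "'h hilbert" and k \<kappa> C and M :: "'x measure" +
  fixes A :: "'x set"
  assumes A: "A \<in> sets M"

lemma (in levy_fock) levy_fock_restrict:
  assumes "A \<in> sets M"
  shows "levy_fock H k \<kappa> C (restrict_space M A)"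
proof -
  have "finite_measure (restrict_space M A)"
    by (rule finite_measure_restrict_space) (use assms in \<open>auto intro: finite_measure_axioms\<close>)
  moreover have "small_partitions (restrict_space M A)"
    by (rule small_partitions_restrict[OF _ partitions assms]) unfold_locales
  ultimately show ?thesis by (intro levy_fock.intro levy_fock_axioms.intro levy_kernel_axioms)
qed

sublocale levy_fock_cut \<subseteq> R: levy_fock H k \<kappa> C "restrict_space M A" by (rule levy_fock_restrict[OF A])

sublocale levy_fock_cut \<subseteq> S: levy_fock H k \<kappa> C "restrict_space M (space M - A)"
  by (rule levy_fock_restrict[OF sets.compl_sets[OF A]])

context levy_fock
begin

lemma LF_restrict:
  assumes f: "f \<in> LF" and A: "A \<in> sets M"
  shows "f \<in> L2_functions (restrict_space M A) H"
  using f A sets.sets_into_space[OF A] integrable_mult_indicator[of A M "\<lambda>x. (nm (f x))^2"] unfolding L2_functions_def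
  by (auto simp: space_restrict_space integrable_restrict_space intro!: measurable_restrict_space1)

lemma restrict_carrier: "u \<in> K.V \<Longrightarrow> A \<in> sets M \<Longrightarrow> L2_restrict M H A u \<in> hcarrier (L2 (restrict_space M A) H)"
  using LF_restrict[OF rep_carrier(1)] by (simp add: L2_restrict_def L2_def)

end

context levy_fock_cut
begin

lemma inner_split:
  assumes u: "u \<in> K.V" and a: "a \<in> bm_on M A" and b: "b \<in> bm_on M (space M - A)"
  shows "R.K.ip (L2_restrict M H A u) (R.ka a) + S.K.ip (L2_restrict M H (space M - A) u) (S.ka b) =
    K.ip u (ka (\<lambda>x. a x + b x))"
proof -
  have am: "a \<in> bm" and bm: "b \<in> bm" using a b by (simp_all add: bm_on_def)
  have r: "rep u \<in> LF" "cls (rep u) = u" using rep_carrier[OF u] by auto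
  have AS: "A \<subseteq> space M" by (rule sets.sets_into_space[OF A])
  have A': "space M - A \<in> sets M" using A by blast
  let ?p = "\<lambda>x. ip (rep u x) (k (a x))" and ?q = "\<lambda>x. ip (rep u x) (k (b x))"
  have 1: "R.K.ip (L2_restrict M H A u) (R.ka a) = (\<integral>x. indicator A x *\<^sub>R ?p x \<partial>M)"
  proof -
    have "R.K.ip (L2_restrict M H A u) (R.ka a) = (\<integral>x. ?p x \<partial>restrict_space M A)" unfolding L2_restrict_def R.ka_def
      by (rule R.L2_inner[OF LF_restrict[OF r(1) A] R.k_LF[OF bm_restrict[OF am]]])
    then show ?thesis using A AS by (simp add: integral_restrict_space Int_absorb2)
  qed
  have 2: "S.K.ip (L2_restrict M H (space M - A) u) (S.ka b) = (\<integral>x. indicator (space M - A) x *\<^sub>R ?q x \<partial>M)"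
  proof -
    have "S.K.ip (L2_restrict M H (space M - A) u) (S.ka b) = (\<integral>x. ?q x \<partial>restrict_space M (space M - A))"
      unfolding L2_restrict_def S.ka_def by (rule S.L2_inner[OF LF_restrict[OF r(1) A'] S.k_LF[OF bm_restrict[OF bm]]])
    then show ?thesis using A' by (simp add: integral_restrict_space Int_absorb2)
  qed
  have i: "integrable M (\<lambda>x. indicator A x *\<^sub>R ?p x)" "integrable M (\<lambda>x. indicator (space M - A) x *\<^sub>R ?q x)"
    using A A' by (auto intro!: integrable_mult_indicator LF_integrable_inner r k_LF am bm)
  have "K.ip u (ka (\<lambda>x. a x + b x)) = (\<integral>x. ip (rep u x) (k (a x + b x)) \<partial>M)"
    unfolding ka_def using L2_inner[OF r(1) k_LF[OF bm_plus[OF am bm]]] by (simp only: r(2))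
  also have "\<dots> = (\<integral>x. indicator A x *\<^sub>R ?p x + indicator (space M - A) x *\<^sub>R ?q x \<partial>M)"
    using a b by (intro Bochner_Integration.integral_cong refl) (auto simp: bm_on_def split: split_indicator)
  finally show ?thesis unfolding 1 2 by (simp add: Bochner_Integration.integral_add[OF i])
qed

text \<open>The sum over \<open>J\<close> is the expansion of the product of the
  \<open>\<alpha> + \<beta>\<close>, where the two terms are the inner products over
  \<open>A\<close> and over its complement. The square root in \<open>fock_tensor\<close> cancels
  the normalizations \<open>sqrt (fact (card J))\<close> and \<open>sqrt (fact (n - card J))\<close>
  of the two exponential vectors and leaves \<open>1 / sqrt (fact n)\<close>.\<close>

lemma fock_tensor_expv:
  assumes a: "a \<in> bm_on M A" and b: "b \<in> bm_on M (space M - A)"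
  shows "fock_tensor M H A (R.K.expv (R.ka a)) (S.K.expv (S.ka b)) = K.expv (ka (\<lambda>x. a x + b x))"
proof
  fix l
  show "fock_tensor M H A (R.K.expv (R.ka a)) (S.K.expv (S.ka b)) l = K.expv (ka (\<lambda>x. a x + b x)) l"
  proof (cases "l \<in> lists (K.V)")
    case True
    define n where "n = length l"
    have ln: "set l \<subseteq> K.V" using True by auto
    have nc: "set (nths l J) \<subseteq> K.V" for J by (rule order_trans[OF set_nths_subset ln])
    have A': "space M - A \<in> sets M" using A by blast
    define \<alpha> where "\<alpha> u = R.K.ip (L2_restrict M H A u) (R.ka a)" for u
    define \<beta> where "\<beta> u = S.K.ip (L2_restrict M H (space M - A) u) (S.ka b)" for u
    have 1: "R.K.expv (R.ka a) (map (L2_restrict M H A) (nths l J)) = (\<Prod>i\<in>J. \<alpha> (l ! i)) / sqrt (fact (card J))"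
      if J: "J \<subseteq> {..<n}" for J
    proof -
      have c: "card {i. i < n \<and> i \<in> J} = card J" using J by (intro arg_cong[where f=card]) auto
      have "map (L2_restrict M H A) (nths l J) \<in> lists (R.K.V)" by (auto intro!: restrict_carrier[OF subsetD[OF nc[of J]] A])
      then show ?thesis using prod_list_nths[of J l \<alpha>] J unfolding R.K.expv_def
        by (simp add: length_nths c comp_def \<alpha>_def[symmetric] n_def[symmetric])
    qed
    have 2: "S.K.expv (S.ka b) (map (L2_restrict M H (space M - A)) (nths l J)) = (\<Prod>i\<in>J. \<beta> (l ! i)) / sqrt (fact (card J))"
      if J: "J \<subseteq> {..<n}" for J
    proof -
      have c: "card {i. i < n \<and> i \<in> J} = card J" using J by (intro arg_cong[where f=card]) auto
      have "map (L2_restrict M H (space M - A)) (nths l J) \<in> lists (S.K.V)"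
        by (auto intro!: restrict_carrier[OF subsetD[OF nc[of J]] A'])
      then show ?thesis using prod_list_nths[of J l \<beta>] J unfolding S.K.expv_def
        by (simp add: length_nths c comp_def \<beta>_def[symmetric] n_def[symmetric])
    qed
    have "fock_tensor M H A (R.K.expv (R.ka a)) (S.K.expv (S.ka b)) l =
        (\<Sum>J\<in>Pow {..<n}. (\<Prod>i\<in>J. \<alpha> (l ! i)) * (\<Prod>i\<in>{..<n} - J. \<beta> (l ! i)) / sqrt (fact n))"
      unfolding fock_tensor_def if_P[OF True] n_def[symmetric]
    proof (intro sum.cong refl)
      fix J assume "J \<in> Pow {..<n}"
      then have J: "J \<subseteq> {..<n}" by blast
      have cj: "card ({..<n} - J) = n - card J" using J by (simp add: card_Diff_subset finite_subset)
      show "of_real (sqrt (fact (card J) * fact (n - card J) / fact n)) * R.K.expv (R.ka a) (map (L2_restrict M H A) (nths l J)) *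
          S.K.expv (S.ka b) (map (L2_restrict M H (space M - A)) (nths l ({..<n} - J))) =
          (\<Prod>i\<in>J. \<alpha> (l ! i)) * (\<Prod>i\<in>{..<n} - J. \<beta> (l ! i)) / sqrt (fact n)"
        unfolding 1[OF J] 2[OF Diff_subset] cj by (simp add: real_sqrt_mult real_sqrt_divide)
    qed
    also have "\<dots> = (\<Prod>i<n. \<alpha> (l ! i) + \<beta> (l ! i)) / sqrt (fact n)" by (simp add: prod_add sum_divide_distrib)
    also have "(\<Prod>i<n. \<alpha> (l ! i) + \<beta> (l ! i)) = (\<Prod>i<n. K.ip (l ! i) (ka (\<lambda>x. a x + b x)))"
      unfolding \<alpha>_def \<beta>_def using ln by (intro prod.cong refl inner_split[OF _ a b]) (auto simp: n_def)
    also have "\<dots> = prod_list (map (\<lambda>u. K.ip u (ka (\<lambda>x. a x + b x))) l)"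
      using prod_list_nths[of "{..<n}" l "\<lambda>u. K.ip u (ka (\<lambda>x. a x + b x))"] by (simp add: n_def)
    finally show ?thesis using True by (simp add: K.expv_def n_def)
  qed (simp add: fock_tensor_def K.expv_def)
qed

lemma restrict_ka:
  assumes a: "a \<in> bm_on M A" and b: "b \<in> bm_on M (space M - A)"
  shows "L2_restrict M H A (ka (\<lambda>x. a x + b x)) = R.ka a"
proof -
  have "(\<lambda>x. a x + b x) \<in> bm" using a b by (simp add: bm_on_def bm_plus)
  then have "AE x in M. k (a x + b x) = rep (ka (\<lambda>x. a x + b x)) x" using rep_cls[OF k_LF] unfolding ka_def by blast
  then have "AE x in M. x \<in> A \<longrightarrow> rep (ka (\<lambda>x. a x + b x)) x = k (a x)"
    using AE_space by eventually_elim (use b sets.sets_into_space[OF A] in \<open>auto simp: bm_on_def\<close>)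
  then have "AE x in restrict_space M A. rep (ka (\<lambda>x. a x + b x)) x = k (a x)" using A by (simp add: AE_restrict_space_iff)
  then show ?thesis unfolding L2_restrict_def R.ka_def by (rule R.cls_eqI)
qed

text \<open>Functions on the restricted space are extended by zero; the extension has the same class
  over \<open>A\<close>.\<close>

lemma expv_restrict_total: "total_in (EXP R.K) ((\<lambda>a. R.K.expv (R.ka a)) ` bm_on M A)"
proof -
  have "(\<lambda>a. R.K.expv (R.ka a)) ` bm_on M A = (\<lambda>a. R.K.expv (R.ka a)) ` bounded_measurable (restrict_space M A)"
  proof (intro subset_antisym image_subsetI)
    fix a assume a: "a \<in> bm_on M A"
    then have "a \<in> bounded_measurable (restrict_space M A)" by (simp add: bm_on_def bm_restrict)
    then show "R.K.expv (R.ka a) \<in> (\<lambda>a. R.K.expv (R.ka a)) ` bounded_measurable (restrict_space M A)" by (rule imageI)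
  next
    fix a assume a: "a \<in> bounded_measurable (restrict_space M A)"
    have "R.ka a = R.ka (\<lambda>x. if x \<in> A then a x else 0)"
      unfolding R.ka_def by (intro R.cls_eqI AE_I2) (simp add: space_restrict_space)
    then show "R.K.expv (R.ka a) \<in> (\<lambda>a. R.K.expv (R.ka a)) ` bm_on M A" using bm_extend[OF A a] by auto
  qed
  then show ?thesis using R.expv_ka_total by simp
qed

end

lemma fock_tensor_linear:
  "fock_tensor M H A (hadd (EXP X) \<Phi> (hscale (EXP X) c \<Phi>')) \<Psi> =
     (\<lambda>l. fock_tensor M H A \<Phi> \<Psi> l + c * fock_tensor M H A \<Phi>' \<Psi> l)"
  "fock_tensor M H A \<Phi> (hadd (EXP X) \<Psi> (hscale (EXP X) c \<Psi>')) =
     (\<lambda>l. fock_tensor M H A \<Phi> \<Psi> l + c * fock_tensor M H A \<Phi> \<Psi>' l)"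
  "fock_tensor M H A (hzero (EXP X)) \<Psi> = (\<lambda>l. 0)"
  "fock_tensor M H A \<Phi> (hzero (EXP X)) = (\<lambda>l. 0)"
  by (auto simp: fun_eq_iff fock_tensor_def fock_space_def algebra_simps sum_distrib_left sum.distrib)

context levy_fock_cut
begin

lemma ka_inner_split:
  assumes a: "a \<in> bm_on M A" "a' \<in> bm_on M A" and b: "b \<in> bm_on M (space M - A)" "b' \<in> bm_on M (space M - A)"
  shows "R.K.ip (R.ka a) (R.ka a') + S.K.ip (S.ka b) (S.ka b') =
    K.ip (ka (\<lambda>x. a x + b x)) (ka (\<lambda>x. a' x + b' x))"
proof -
  interpret X: levy_fock_cut H k \<kappa> C M "space M - A" by unfold_locales (use A in blast)
  have AA: "space M - (space M - A) = A" using sets.sets_into_space[OF A] by blast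
  have ab: "(\<lambda>x. a x + b x) \<in> bm" using a b by (simp add: bm_on_def bm_plus)
  have "L2_restrict M H (space M - A) (ka (\<lambda>x. b x + a x)) = S.ka b" by (rule X.restrict_ka[OF b(1)]) (simp only: AA a(1))
  then show ?thesis using inner_split[OF ka_carrier[OF ab] a(2) b(2)] by (simp add: restrict_ka[OF a(1) b(1)] add.commute)
qed

text \<open>On exponential vectors the tensor map and its inner products are explicit. They extend
  by \<open>fock_extension\<close> to all first arguments with exponential second ones, and then to
  all second arguments. Totality holds since every exponential vector of a function on the whole
  space is such a tensor.\<close>

lemma tensor_fock: "tensor_decomposition (EXP K) (EXP R.K) (EXP S.K) (fock_tensor M H A)"
proof -
  let ?\<tau> = "fock_tensor M H A"
  interpret X: levy_fock_cut H k \<kappa> C M "space M - A" by unfold_locales (use A in blast)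
  define D1 where "D1 = (\<lambda>a. R.K.expv (R.ka a)) ` bm_on M A"
  define D2 where "D2 = (\<lambda>b. S.K.expv (S.ka b)) ` bm_on M (space M - A)"
  have t1: "total_in (EXP R.K) D1" unfolding D1_def by (rule expv_restrict_total)
  have t2: "total_in (EXP S.K) D2" unfolding D2_def by (rule X.expv_restrict_total)

  have ab: "(\<lambda>x. a x + b x) \<in> bm" if "a \<in> bm_on M A" "b \<in> bm_on M (space M - A)" for a b
    using that by (simp add: bm_on_def bm_plus)
  have ra: "R.ka a \<in> R.K.V" if "a \<in> bm_on M A" for a using that by (intro R.ka_carrier bm_restrict) (simp add: bm_on_def)
  have sb: "S.ka b \<in> S.K.V" if "b \<in> bm_on M (space M - A)" for b
    using that by (intro S.ka_carrier bm_restrict) (simp add: bm_on_def)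
  have cR: "R.F.V = fock_vectors R.K" and cS: "S.F.V = fock_vectors S.K"
    and cK: "F.V = fock_vectors K" by (simp_all add: fock_space_def)
  have c1: "(\<lambda>n. ?\<tau> (u n) y l) \<longlonglongrightarrow> ?\<tau> x y l" if "\<And>n. u n \<in> R.F.V" "x \<in> R.F.V" "hconv (EXP R.K) u x" for u x y l
    unfolding fock_tensor_def using R.K.fv_pointwise[OF that[unfolded cR]]
    by (cases "l \<in> lists (K.V)") (auto intro!: tendsto_intros)
  have c2: "(\<lambda>n. ?\<tau> x (u n) l) \<longlonglongrightarrow> ?\<tau> x y l" if "\<And>n. u n \<in> S.F.V" "y \<in> S.F.V" "hconv (EXP S.K) u y" for u x y l
    unfolding fock_tensor_def using S.K.fv_pointwise[OF that[unfolded cS]]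
    by (cases "l \<in> lists (K.V)") (auto intro!: tendsto_intros)
  have base: "?\<tau> x y \<in> fock_vectors K" if "y \<in> D2" "x \<in> D1" for x y
    using that unfolding D1_def D2_def by (auto simp: fock_tensor_expv intro!: K.expv_closed ka_carrier ab)
  have inner: "F.ip (?\<tau> x y) (?\<tau> x' y') = S.F.ip y y' * R.F.ip x x'" if "y \<in> D2" "y' \<in> D2" "x \<in> D1" "x' \<in> D1" for x y x' y'
  proof -
    obtain a a' b b' where *: "a \<in> bm_on M A" "x = R.K.expv (R.ka a)" "a' \<in> bm_on M A" "x' = R.K.expv (R.ka a')"
      "b \<in> bm_on M (space M - A)" "y = S.K.expv (S.ka b)" "b' \<in> bm_on M (space M - A)" "y' = S.K.expv (S.ka b')"
      using \<open>y \<in> D2\<close> \<open>y' \<in> D2\<close> \<open>x \<in> D1\<close> \<open>x' \<in> D1\<close> unfolding D1_def D2_def by (elim imageE)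
    have "F.ip (?\<tau> x y) (?\<tau> x' y') =
        exp (R.K.ip (R.ka a) (R.ka a') + S.K.ip (S.ka b) (S.ka b'))"
      unfolding *(2,4,6,8) fock_tensor_expv[OF *(1,5)] fock_tensor_expv[OF *(3,7)]
        K.expv_inner[OF ka_carrier[OF ab[OF *(1,5)]] ka_carrier[OF ab[OF *(3,7)]]] ka_inner_split[OF *(1,3,5,7)] ..
    then show ?thesis unfolding *(2,4,6,8) by (simp add: exp_add R.K.expv_inner[OF ra ra] S.K.expv_inner[OF sb sb] *)
  qed
  note ext1 = K.fock_extension[where I=D2 and D=D1 and f="\<lambda>y x. ?\<tau> x y" and g="S.F.ip",
      OF R.K.hilbert_fock t1 fock_tensor_linear(3) fock_tensor_linear(1) base inner c1]
  have base': "?\<tau> x y \<in> fock_vectors K" if "x \<in> R.F.V" "y \<in> D2" for x y by (rule ext1(1)) (use that in simp_all)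
  have inner': "F.ip (?\<tau> x y) (?\<tau> x' y') = R.F.ip x x' * S.F.ip y y'"
    if "x \<in> R.F.V" "x' \<in> R.F.V" "y \<in> D2" "y' \<in> D2" for x y x' y'
  proof -
    have "F.ip (?\<tau> x y) (?\<tau> x' y') = S.F.ip y y' * R.F.ip x x'" by (rule ext1(2)) (use that in simp_all)
    then show ?thesis by simp
  qed
  note ext2 = K.fock_extension[where I="R.F.V" and D=D2 and f="?\<tau>" and g="R.F.ip",
      OF S.K.hilbert_fock t2 fock_tensor_linear(4) fock_tensor_linear(2) base' inner' c2]
  have cl: "?\<tau> x y \<in> F.V" if "x \<in> R.F.V" "y \<in> S.F.V" for x y unfolding cK by (rule ext2(1)) (use that in simp_all)
  show ?thesis
  proof (intro tensor_decomposition.intro tensor_decomposition_axioms.intro F.complex_hilbert_space_axioms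
      R.K.hilbert_fock S.K.hilbert_fock cl)
    show "F.ip (?\<tau> x y) (?\<tau> x' y') = R.F.ip x x' * S.F.ip y y'" if "x \<in> R.F.V" "y \<in> S.F.V"
        "x' \<in> R.F.V" "y' \<in> S.F.V" for x y x' y' by (rule ext2(2)) (use that in simp_all)
    show "z = hzero (EXP K)" if z: "z \<in> F.V"
        "\<And>x y. \<lbrakk>x \<in> R.F.V; y \<in> S.F.V\<rbrakk> \<Longrightarrow> F.ip (?\<tau> x y) z = 0" for z
    proof -
      have "F.ip (K.expv (ka a)) z = 0" if a: "a \<in> bm" for a
      proof -
        let ?a = "\<lambda>x. if x \<in> A then a x else 0" and ?b = "\<lambda>x. if x \<in> A then 0 else a x"
        have a1: "?a \<in> bm_on M A" and b1: "?b \<in> bm_on M (space M - A)" using bm_If[OF A a] by (simp_all add: bm_on_def)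
        have "(\<lambda>x. ?a x + ?b x) = a" by auto
        then have "K.expv (ka a) = ?\<tau> (R.K.expv (R.ka ?a)) (S.K.expv (S.ka ?b))" by (simp only: fock_tensor_expv[OF a1 b1])
        then show ?thesis using z(2)[OF R.expv_carrier[OF ra[OF a1]] S.expv_carrier[OF sb[OF b1]]] by simp
      qed
      then show ?thesis using expv_ka_total z(1) by (auto simp: total_in_def)
    qed
    have z1: "(\<lambda>x. 0) \<in> bm_on M A" "(\<lambda>x. 0) \<in> bm_on M (space M - A)" by (simp_all add: bm_on_def bm_const)
    have k0: "\<kappa> 0 0 = 0" using k_inner[of 0 0] by (simp add: k_zero inner_zero_left zero_closed)
    show "\<exists>x\<in>R.F.V. R.F.ip x x = 1" by (rule bexI[OF _ R.expv_carrier[OF ra[OF z1(1)]]])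
        (simp add: R.K.expv_inner[OF ra ra] z1 R.ka_inner bm_const k0)
    show "\<exists>x\<in>S.F.V. S.F.ip x x = 1" by (rule bexI[OF _ S.expv_carrier[OF sb[OF z1(2)]]])
        (simp add: S.K.expv_inner[OF sb sb] z1 S.ka_inner bm_const k0)
  qed
qed

text \<open>The same use of \<open>amplification_iff\<close> as for the process, the unit vector now
  being the exponential of zero, that is the vacuum. Inner products over the complement of
  \<open>A\<close> coincide with those over the whole space for functions supported there.\<close>

lemma fock_factorization_exp_alg:
  "homogeneous_fock_factorization M H A = exp_alg M (EXP K) (\<lambda>a. K.expv (ka a)) A"
proof -
  interpret T: tensor_decomposition "EXP K" "EXP R.K" "EXP S.K" "fock_tensor M H A" by (rule tensor_fock)
  interpret X: levy_fock_cut H k \<kappa> C M "space M - A" by unfold_locales (use A in blast)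
  have z: "(\<lambda>x. 0) \<in> bm_on M (space M - A)" by (simp add: bm_on_def bm_const)
  have zA: "(\<lambda>x. 0) \<in> bm_on M A" by (simp add: bm_on_def bm_const)
  have k0: "\<kappa> 0 0 = 0" using k_inner[of 0 0] by (simp add: k_zero inner_zero_left zero_closed)
  have sb: "S.ka b \<in> S.K.V" if "b \<in> bm_on M (space M - A)" for b
    using that by (intro S.ka_carrier bm_restrict) (simp add: bm_on_def)
  have 1: "S.F.ip (S.K.expv (S.ka (\<lambda>x. 0))) (S.K.expv (S.ka (\<lambda>x. 0))) = 1"
    by (simp add: S.K.expv_inner[OF sb sb] z S.ka_inner bm_const k0)
  have 0: "fock_tensor M H A (R.K.expv (R.ka a)) (S.K.expv (S.ka (\<lambda>x. 0))) = K.expv (ka a)" if "a \<in> bm_on M A" for a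
    using fock_tensor_expv[OF that z] by simp
  have 2: "S.F.ip (S.K.expv (S.ka b')) (S.K.expv (S.ka b)) =
      F.ip (K.expv (ka b')) (K.expv (ka b))" if b: "b \<in> bm_on M (space M - A)" "b' \<in> bm_on M (space M - A)" for b b'
  proof -
    have "R.K.ip (R.ka (\<lambda>x. 0)) (R.ka (\<lambda>x. 0)) = 0" by (simp add: R.ka_inner bm_const k0)
    moreover have "b \<in> bm" "b' \<in> bm" using b by (simp_all add: bm_on_def)
    ultimately show ?thesis
      using ka_inner_split[OF zA zA b(2,1)] by (simp add: S.K.expv_inner[OF sb sb] K.expv_inner[OF ka_carrier ka_carrier] b)
  qed
  show ?thesis
  proof (intro set_eqI)
    fix T
    show "T \<in> homogeneous_fock_factorization M H A \<longleftrightarrow> T \<in> exp_alg M (EXP K) (\<lambda>a. K.expv (ka a)) A"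
      unfolding homogeneous_fock_factorization_def homogeneous_fock_space_def exp_alg_def mem_Collect_eq
        T.amplification_iff[where ?e1.0="\<lambda>a. R.K.expv (R.ka a)" and ?e2.0="\<lambda>b. S.K.expv (S.ka b)" and ?o2.0="\<lambda>x. 0",
          OF expv_restrict_total X.expv_restrict_total z 1]
      by (intro conj_cong ball_cong refl) (simp only: 0 2 fock_tensor_expv)
  qed
qed

end

text \<open>By multiplicativity of \<phi> both sides of the defining equation acquire the same
  nonzero factor.\<close>

lemma exp_alg_scale:
  assumes H: "complex_hilbert_space H" and e: "\<And>a. a \<in> bounded_measurable M \<Longrightarrow> e a \<in> hcarrier H"
    and nz: "\<And>a. \<phi> a \<noteq> 0"
    and mult: "\<And>a b. \<lbrakk>a \<in> bm_on M A; b \<in> bm_on M (space M - A)\<rbrakk> \<Longrightarrow> \<phi> (\<lambda>x. a x + b x) = \<phi> a * \<phi> b"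
  shows "exp_alg M H (\<lambda>a. hscale H (\<phi> a) (e a)) A = exp_alg M H e A"
proof -
  interpret complex_hilbert_space H by (rule H)
  have "hinner H (hscale H (\<phi> (\<lambda>x. a' x + b' x)) (e (\<lambda>x. a' x + b' x))) (T (hscale H (\<phi> (\<lambda>x. a x + b x)) (e (\<lambda>x. a x + b x)))) =
      hinner H (hscale H (\<phi> a') (e a')) (T (hscale H (\<phi> a) (e a))) * hinner H (hscale H (\<phi> b') (e b')) (hscale H (\<phi> b) (e b)) \<longleftrightarrow>
      hinner H (e (\<lambda>x. a' x + b' x)) (T (e (\<lambda>x. a x + b x))) = hinner H (e a') (T (e a)) * hinner H (e b') (e b)"
    if T: "T \<in> bounded_ops H" and a: "a \<in> bm_on M A" "a' \<in> bm_on M A"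
      and b: "b \<in> bm_on M (space M - A)" "b' \<in> bm_on M (space M - A)" for T a a' b b'
  proof -
    have ec: "e a \<in> hcarrier H" "e a' \<in> hcarrier H" "e b \<in> hcarrier H" "e b' \<in> hcarrier H"
      "e (\<lambda>x. a x + b x) \<in> hcarrier H" "e (\<lambda>x. a' x + b' x) \<in> hcarrier H"
      using a b by (auto intro!: e bm_plus simp: bm_on_def)
    have Tc: "T x \<in> hcarrier H" and Ts: "T (hscale H c x) = hscale H c (T x)" if "x \<in> hcarrier H" for x c
      using T that by (auto simp: bounded_ops_def)
    show ?thesis by (simp add: ec Tc Ts inner_simps mult[OF a(1) b(1)] mult[OF a(2) b(2)] nz ac_simps)
  qed
  then show ?thesis unfolding exp_alg_def by (auto; blast)
qed

section \<open>The measure algebra and the final isomorphism\<close>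

lemma mod0_iff: "(A, B) \<in> mod0 M \<longleftrightarrow> A \<in> sets M \<and> B \<in> sets M \<and> sym_diff A B \<in> null_sets M"
  by (auto simp: mod0_def null_sets_def)

lemma equiv_mod0: "equiv (sets M) (mod0 M)"
proof (rule equivI)
  show "mod0 M \<subseteq> sets M \<times> sets M" by (auto simp: mod0_def)
  show "refl_on (sets M) (mod0 M)" by (auto simp: refl_on_def mod0_def)
  show "sym (mod0 M)" by (auto simp: sym_def mod0_def Un_commute)
  show "trans (mod0 M)"
  proof (rule transI)
    fix A B D assume AB: "(A, B) \<in> mod0 M" and BD: "(B, D) \<in> mod0 M"
    then have "sym_diff A B \<union> sym_diff B D \<in> null_sets M" by (auto simp: mod0_iff)
    moreover have "sym_diff A D \<subseteq> sym_diff A B \<union> sym_diff B D" by blast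
    ultimately have "sym_diff A D \<in> null_sets M" using AB BD by (auto intro: null_sets_subset simp: mod0_iff)
    then show "(A, D) \<in> mod0 M" using AB BD by (simp add: mod0_iff)
  qed
qed

lemma measure_algebra_iso_id: "measure_algebra_iso M M (\<lambda>X. X)" unfolding measure_algebra_iso_def
proof (intro conjI ballI)
  show "bij_betw (\<lambda>X. X) (sets M // mod0 M) (sets M // mod0 M)" by (simp add: bij_betw_def)
next
  fix A B A' B' assume AB: "A \<in> sets M" "B \<in> sets M" and "A' \<in> mod0_class M A" "B' \<in> mod0_class M B"
  then have *: "(A, A') \<in> mod0 M" "(B, B') \<in> mod0 M" by (simp_all add: mod0_class_def)
  then have "sym_diff A A' \<union> sym_diff B B' \<in> null_sets M" by (auto simp: mod0_iff)
  moreover have "sym_diff (A \<inter> B) (A' \<inter> B') \<subseteq> sym_diff A A' \<union> sym_diff B B'" by blast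
  ultimately have "sym_diff (A \<inter> B) (A' \<inter> B') \<in> null_sets M" using * by (auto intro: null_sets_subset simp: mod0_iff)
  then have "(A \<inter> B, A' \<inter> B') \<in> mod0 M" using * by (auto simp: mod0_iff)
  then show "mod0_class M (A \<inter> B) = mod0_class M (A' \<inter> B')" unfolding mod0_class_def by (rule equiv_class_eq[OF equiv_mod0])
next
  fix A A' assume A: "A \<in> sets M" and "A' \<in> mod0_class M A"
  then have *: "(A, A') \<in> mod0 M" by (simp add: mod0_class_def)
  moreover have "sym_diff (space M - A) (space M - A') = sym_diff A A'"
    using * sets.sets_into_space[of A M] sets.sets_into_space[of A' M] by (auto simp: mod0_iff)
  ultimately have "(space M - A, space M - A') \<in> mod0 M" by (auto simp: mod0_iff)
  then show "mod0_class M (space M - A) = mod0_class M (space M - A')"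
    unfolding mod0_class_def by (rule equiv_class_eq[OF equiv_mod0])
qed

lemma (in levy_data) log_phi_integrable:
  assumes "finite_measure M" and a: "a \<in> bounded_measurable M"
  shows "integrable M (\<lambda>x. log_phi c \<sigma> \<Lambda> (a x))"
proof -
  interpret finite_measure M by fact
  obtain B where B: "\<And>x. x \<in> space M \<Longrightarrow> \<bar>a x\<bar> \<le> B" using a by (auto simp: bounded_measurable_def)
  define J where "J = (\<integral>t. t^2 / (1 + t^2) \<partial>\<Lambda>)"
  have J: "0 \<le> J" by (simp add: J_def)
  have "cmod (log_phi c \<sigma> \<Lambda> (a x)) \<le> \<bar>c\<bar> * B + \<sigma>^2 * B^2 + (B^2 + 4 + 2 * B) * J" if x: "x \<in> space M" for x
  proof -
    have "(a x)^2 \<le> B^2" using B[OF x] by (metis abs_ge_zero power2_abs power_mono)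
    then have "\<bar>c\<bar> * \<bar>a x\<bar> + \<sigma>^2 * (a x)^2 + ((a x)^2 + 4 + 2 * \<bar>a x\<bar>) * J \<le> \<bar>c\<bar> * B + \<sigma>^2 * B^2 + (B^2 + 4 + 2 * B) * J"
      using B[OF x] J by (intro add_mono mult_left_mono mult_right_mono) auto
    then show ?thesis using log_phi_bound[of c "a x"] by (simp add: J_def)
  qed
  moreover have "(\<lambda>x. log_phi c \<sigma> \<Lambda> (a x)) \<in> borel_measurable M"
    by (rule measurable_compose[OF _ log_phi_measurable]) (use a in \<open>simp add: bounded_measurable_def\<close>)
  ultimately show ?thesis by (intro integrable_const_bound[where B="\<bar>c\<bar> * B + \<sigma>^2 * B^2 + (B^2 + 4 + 2 * B) * J"] AE_I2)
qed

theorem theorem7: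
  fixes \<nu> :: "'x measure" and P :: "'w measure"
    and \<eta> :: "('x \<Rightarrow> real) \<Rightarrow> 'w \<Rightarrow> real"
    and c \<sigma> :: real and \<Lambda> :: "real measure"
  assumes "standard_borel_space \<nu>"
    and "finite_measure \<nu>"
    and "\<forall>x\<in>space \<nu>. emeasure \<nu> {x} = 0"
    and "levy_process \<nu> P \<eta>"
    and "homogeneous_process \<nu> P \<eta>"
    and "levy_characteristics \<nu> P \<eta> c \<sigma> \<Lambda>"
  shows "hilbert_factorization \<nu> (L2_process \<nu> P \<eta>) (process_factorization \<nu> P \<eta>) \<and>
         is_homogeneous_fock_of_dim \<nu> (L2_process \<nu> P \<eta>) (process_factorization \<nu> P \<eta>)
           (num_points (levy_support \<sigma> \<Lambda>))"
proof
  have "prob_space P" using assms(4) by (simp add: levy_process_def generalized_random_process_def)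
  then interpret V: independent_values P \<nu> \<eta> by (intro independent_values.intro independent_values_axioms.intro assms(4))
  interpret D: levy_data \<sigma> \<Lambda> by unfold_locales (use assms(6) in \<open>simp add: levy_characteristics_def\<close>)
  show "hilbert_factorization \<nu> V.L2P (process_factorization \<nu> P \<eta>)" by (rule V.hilbert_factorization_process)
  obtain H :: "(nat \<Rightarrow> complex) hilbert" and k C where H: "levy_kernel H k D.\<kappa> C"
    and dim: "hilbert_dim H (num_points (levy_support \<sigma> \<Lambda>))" using D.levy_kernel_exists by blast
  interpret F: levy_fock H k D.\<kappa> C \<nu>
    by (intro levy_fock.intro H assms(2) levy_fock_axioms.intro small_partitions_standard_borel assms(1,3))
  have cf: "V.cf a = exp (\<integral>x. log_phi c \<sigma> \<Lambda> (a x) \<partial>\<nu>)" if "a \<in> F.bm" for a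
    using assms(6) that by (simp add: levy_characteristics_def V.cf_def V.ex_def)
  \<comment> \<open>\<open>exp_alg_scale\<close> asks for a nonzero factor at every function, hence
    the value \<open>1\<close> outside the bounded measurable ones.\<close>
  define \<phi> where "\<phi> a = (if a \<in> F.bm then V.cf a else 1)" for a
  have nz: "\<phi> a \<noteq> 0" for a by (simp add: \<phi>_def cf)
  define f where "f a = hscale (EXP F.K) (\<phi> a) (F.K.expv (F.ka a))" for a
  have ec: "F.K.expv (F.ka a) \<in> F.F.V" if "a \<in> F.bm" for a by (rule F.expv_carrier[OF F.ka_carrier[OF that]])
  \<comment> \<open>Integrating \<open>log_phi_diff\<close> and taking the exponential gives
    \<open>cnj (\<phi> a) * \<phi> b * exp \<langle>ka a, ka b\<rangle>\<close>, which is the inner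
    product of the scaled exponential vectors.\<close>
  have gram: "hinner V.L2P (V.e a) (V.e b) = F.F.ip (f a) (f b)" if a: "a \<in> F.bm" and b: "b \<in> F.bm" for a b
  proof -
    have ba: "(\<lambda>x. b x - a x) \<in> F.bm" using bm_add[OF b a, of 1 "-1"] by simp
    have i: "integrable \<nu> (\<lambda>x. log_phi c \<sigma> \<Lambda> (a x))" if "a \<in> F.bm" for a by (rule D.log_phi_integrable[OF assms(2) that])
    have i\<kappa>: "integrable \<nu> (\<lambda>x. D.\<kappa> (a x) (b x))"
      using F.LF_integrable_inner[OF F.k_LF[OF a] F.k_LF[OF b]] by (simp add: F.k_inner)
    have "(\<integral>x. log_phi c \<sigma> \<Lambda> (b x - a x) \<partial>\<nu>) =
        (\<integral>x. log_phi c \<sigma> \<Lambda> (b x) \<partial>\<nu>) + cnj (\<integral>x. log_phi c \<sigma> \<Lambda> (a x) \<partial>\<nu>) + (\<integral>x. D.\<kappa> (a x) (b x) \<partial>\<nu>)"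
      using i[OF a] i[OF b] i\<kappa> by (simp add: D.log_phi_diff)
    then show ?thesis
      using a b ec by (simp add: V.e_inner cf[OF ba] f_def \<phi>_def cf F.F.inner_simps F.K.expv_inner F.ka_carrier F.ka_inner exp_add exp_cnj)
  qed
  have f_total: "total_in (EXP F.K) (f ` F.bm)" unfolding total_in_def
  proof (intro conjI ballI impI)
    show "f ` F.bm \<subseteq> F.F.V" using ec by (auto simp: f_def F.F.closed)
    fix z assume z: "z \<in> F.F.V" and o: "\<forall>w\<in>f ` F.bm. F.F.ip w z = 0"
    have "F.F.ip (F.K.expv (F.ka a)) z = 0" if a: "a \<in> F.bm" for a
    proof -
      have "F.F.ip (f a) z = 0" using o a by blast
      then show ?thesis using ec[OF a] z nz[of a] by (simp add: f_def F.F.inner_simps)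
    qed
    then show "z = hzero (EXP F.K)" using F.expv_ka_total z by (auto simp: total_in_def)
  qed
  interpret E: exp_system V.L2P \<nu> V.e by (rule V.exp_system)
  interpret G: equal_gram V.L2P "EXP F.K" F.bm V.e f by unfold_locales (rule E.e_total f_total gram; assumption?)+
  obtain T where T: "hilbert_iso V.L2P (EXP F.K) T" "\<And>a. a \<in> F.bm \<Longrightarrow> T (V.e a) = f a" by (rule G.unitary_exists) blast
  \<comment> \<open>The isomorphism of measure algebras is the identity on classes, so
    \<open>B\<close> is an arbitrary representative of the class of \<open>A\<close>; the change
    from \<open>A\<close> to \<open>B\<close> is made on the side of the process.\<close>
  have conj: "conjugate_op V.L2P (EXP F.K) T ` process_factorization \<nu> P \<eta> A = homogeneous_fock_factorization \<nu> H B"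
    if A: "A \<in> sets \<nu>" and "B \<in> mod0_class \<nu> A" for A B
  proof -
    have m: "(A, B) \<in> mod0 \<nu>" using that(2) by (simp add: mod0_class_def)
    then have B: "B \<in> sets \<nu>" by (simp add: mod0_iff)
    interpret X: levy_fock_cut H k D.\<kappa> C \<nu> B by unfold_locales (rule B)
    have "conjugate_op V.L2P (EXP F.K) T ` process_factorization \<nu> P \<eta> A =
        conjugate_op V.L2P (EXP F.K) T ` exp_alg \<nu> V.L2P V.e B"
      by (simp only: V.process_factorization_exp_alg[OF A] E.exp_alg_mod0[OF m])
    also have "\<dots> = exp_alg \<nu> (EXP F.K) f B"
      by (rule conjugate_exp_alg[OF V.hilbert_L2P F.K.hilbert_fock T(1) E.e_closed T(2)])
    also have "\<dots> = exp_alg \<nu> (EXP F.K) (\<lambda>a. F.K.expv (F.ka a)) B" unfolding f_def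
    proof (rule exp_alg_scale[OF F.K.hilbert_fock ec nz])
      fix a b assume ab: "a \<in> bm_on \<nu> B" "b \<in> bm_on \<nu> (space \<nu> - B)"
      then show "\<phi> (\<lambda>x. a x + b x) = \<phi> a * \<phi> b" using V.cf_add[OF ab] by (simp add: \<phi>_def bm_on_def bm_plus)
    qed
    also have "\<dots> = homogeneous_fock_factorization \<nu> H B" by (rule X.fock_factorization_exp_alg[symmetric])
    finally show ?thesis .
  qed
  show "is_homogeneous_fock_of_dim \<nu> V.L2P (process_factorization \<nu> P \<eta>) (num_points (levy_support \<sigma> \<Lambda>))"
    unfolding is_homogeneous_fock_of_dim_def isomorphic_factorizations_def homogeneous_fock_space_def
    by (intro exI[of _ H] exI[of _ "\<lambda>X. X"] exI[of _ T] conjI F.complex_hilbert_space_axioms dim measure_algebra_iso_id T(1) ballI conj)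
qed

end
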